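(* Let $P$ be an $A$-submodule of $A^k$, let $\ell$ be the minimum number of generators of $P$, and let $P(D)$ be any $\ell\times k$ matrix with entries in $A$ whose $\ell$ rows generate $P$. Suppose that the cancellation ideal $\mathfrak{i}_\ell(P)$ is nonzero (so that in particular $\ell\leq k$). Then $A^k/P$ is torsion free if and only if $P(x)$ has full row rank for all $x$ in the complement of an algebraic variety in $\mathbb{C}^n$ of dimension $\leq n-2$ (in other words, if and only if the Krull dimension of the ring $A/\mathfrak{i}_\ell(P)$ is less than or equal to $n-2$). Thus, for an $A$-submodule $\mathcal{F}\subset\mathcal{D}'$ satisfying the cutoff assumption (stated in the context): (i) if $\mathcal{F}$ is an injective $A$-module, then $\mathrm{Ker}_{\mathcal{F}}(P)$ is controllable if the dimension of the cancellation variety $\mathcal{V}(\mathfrak{i}_\ell(P))$ is less than or equal to $n-2$; (ii) if $\mathcal{F}$ is an injective cogenerator, then $\dim \mathcal{V}(\mathfrak{i}_\ell(P))\leq n-2$ is also necessary for $\mathrm{Ker}_{\mathcal{F}}(P)$ to be controllable.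
   Context: $A=\mathbb{C}[D_1,\ldots,D_n]$, $D_j=\frac{1}{\imath}\partial_j$, is the ring of constant coefficient partial differential operators on $\mathbb{R}^n$, acting by differentiation on the space $\mathcal{D}'$ of distributions on $\mathbb{R}^n$. A matrix $P(D)$ over $A$ is identified with a polynomial matrix $P(x)$, $x\in\mathbb{C}^n$, via $D_j\leftrightarrow x_j$. The cancellation ideal $\mathfrak{i}_\ell(P)$ is the ideal generated by all $\ell\times\ell$ minors of $P(x)$, where the rows of $P(D)$ are a minimum set ($\ell$ in number) of generators of $P$; it is independent of the choice of such $P(D)$ (it is $0$ if $\ell>k$, and $(1)$ if $\ell=0$). The empty variety (and the zero ring) is regarded as having dimension $\leq n-2$ for every $n\ge 1$. $\mathrm{Ker}_{\mathcal{F}}(P)=\{f\in\mathcal{F}^k : \sum_j p_j(D)f_j=0 \text{ for all } (p_1,\ldots,p_k)\in P\}$. An injective $A$-module $\mathcal{F}$ is a cogenerator if $\mathrm{Hom}_A(M,\mathcal{F})\neq 0$ for every nonzero $A$-module $M$. A disjoint pair $U_1,U_2\subset\mathbb{R}^n$ with non-intersecting closures is admissible with respect to $\mathcal{F}$ if for any $f_1,f_2\in\mathcal{F}$ there is $f\in\mathcal{F}$ with $f=f_1$ on some neighbourhood of $U_1$ and $f=f_2$ on some neighbourhood of $U_2$. $\mathrm{Ker}_{\mathcal{F}}(P)$ is controllable if for every admissible pair $U_1,U_2$ and any $f_1,f_2\in\mathrm{Ker}_{\mathcal{F}}(P)$ there is $f\in\mathrm{Ker}_{\mathcal{F}}(P)$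 with $f=f_1$ on some neighbourhood of $U_1$ and $f=f_2$ on some neighbourhood of $U_2$. Cutoff assumption on $\mathcal{F}$: for every bounded $V\subset\mathbb{R}^n$ with nonempty interior there is a nonempty subset $U$ whose closure is contained in the interior of $V$ such that the pair $U,\ \mathbb{R}^n\setminus V$ is admissible with respect to $\mathcal{F}$ (equivalently every $f\in\mathcal{F}$ has some $f_c\in\mathcal{F}$ equal to $f$ near $U$ and to $0$ near $\mathbb{R}^n\setminus V$). *)

theory Defs
  imports
    "HOL-Analysis.Analysis"
    "HOL-Library.Poly_Mapping"
    "HOL-Algebra.QuotRing"
    "Jordan_Normal_Form.DL_Rank"
    "Jordan_Normal_Form.DL_Submatrix"
begin

unbundle no vec_syntax

section \<open>Commutative algebra\<close>

subsection \<open>Modules\<close>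

definition quotient_module ::
    "('a, 'r) ring_scheme \<Rightarrow> ('a, 'b, 'm) module_scheme \<Rightarrow> 'b set \<Rightarrow> ('a, 'b set) module" where
  "quotient_module R M N =
    \<lparr>carrier = a_rcosets\<^bsub>M\<^esub> N, mult = undefined, one = undefined, zero = N, add = set_add M,
     smult = (\<lambda>a X. \<Union>x\<in>X. N +>\<^bsub>M\<^esub> (a \<odot>\<^bsub>M\<^esub> x))\<rparr>"

definition torsion_free :: "('a, 'r) ring_scheme \<Rightarrow> ('a, 'b, 'm) module_scheme \<Rightarrow> bool" where
  "torsion_free R M \<longleftrightarrow>
    (\<forall>a\<in>carrier R. \<forall>x\<in>carrier M. a \<odot>\<^bsub>M\<^esub> x = \<zero>\<^bsub>M\<^esub> \<longrightarrow> a = \<zero>\<^bsub>R\<^esub> \<or> x = \<zero>\<^bsub>M\<^esub>)"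

definition min_generators ::
    "('a, 'r) ring_scheme \<Rightarrow> ('a, 'b, 'm) module_scheme \<Rightarrow> 'b set \<Rightarrow> nat" where
  "min_generators R M N =
    (LEAST m. \<exists>S \<subseteq> carrier M. finite S \<and> card S = m \<and> LinearCombinations.module.span R M S = N)"

text \<open>
  A HOL formula cannot quantify over the modules on all types. In the following two definitions
  the test modules are those whose carrier lies in the type of the scalars. Nothing is lost:
  \<open>injective_module_extend\<close> and \<open>injective_cogenerator_hom\<close> below derive the same properties
  for test modules on arbitrary types.
\<close>

definition injective_module :: "('a, 'r) ring_scheme \<Rightarrow> ('a, 'b, 'm) module_scheme \<Rightarrow> bool" where
  "injective_module R I \<longleftrightarrow> Module.module R I \<and>
    (\<forall>(X :: ('a, 'a) module) (Y :: ('a, 'a) module). \<forall>f g.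
      Module.module R X \<and> Module.module R Y \<and>
      f \<in> module_hom R X Y \<and> inj_on f (carrier X) \<and> g \<in> module_hom R X I \<longrightarrow>
      (\<exists>h\<in>module_hom R Y I. \<forall>x\<in>carrier X. h (f x) = g x))"

definition injective_cogenerator :: "('a, 'r) ring_scheme \<Rightarrow> ('a, 'b, 'm) module_scheme \<Rightarrow> bool" where
  "injective_cogenerator R I \<longleftrightarrow> injective_module R I \<and>
    (\<forall>X :: ('a, 'a) module. Module.module R X \<and> carrier X \<noteq> {\<zero>\<^bsub>X\<^esub>} \<longrightarrow>
      (\<exists>f\<in>module_hom R X I. \<exists>x\<in>carrier X. f x \<noteq> \<zero>\<^bsub>I\<^esub>))"


lemma module_homI:
  assumes "\<And>x. x \<in> carrier M \<Longrightarrow> f x \<in> carrier N"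
    and "\<And>x y. x \<in> carrier M \<Longrightarrow> y \<in> carrier M \<Longrightarrow> f (x \<oplus>\<^bsub>M\<^esub> y) = f x \<oplus>\<^bsub>N\<^esub> f y"
    and "\<And>r x. r \<in> carrier R \<Longrightarrow> x \<in> carrier M \<Longrightarrow> f (r \<odot>\<^bsub>M\<^esub> x) = r \<odot>\<^bsub>N\<^esub> f x"
  shows "f \<in> module_hom R M N"
  using assms unfolding module_hom_def by auto

lemma module_homD:
  assumes "f \<in> module_hom R M N"
  shows "x \<in> carrier M \<Longrightarrow> f x \<in> carrier N"
    and "x \<in> carrier M \<Longrightarrow> y \<in> carrier M \<Longrightarrow> f (x \<oplus>\<^bsub>M\<^esub> y) = f x \<oplus>\<^bsub>N\<^esub> f y"
    and "r \<in> carrier R \<Longrightarrow> x \<in> carrier M \<Longrightarrow> f (r \<odot>\<^bsub>M\<^esub> x) = r \<odot>\<^bsub>N\<^esub> f x"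
  using assms unfolding module_hom_def by auto

lemma (in cring) ideal_as_module:
  assumes "ideal J R"
  shows "Module.module R \<lparr>carrier = J, mult = (\<otimes>), one = \<one>, zero = \<zero>, add = (\<oplus>), smult = (\<otimes>)\<rparr>"
    (is "Module.module R ?J")
proof -
  interpret J: ideal J R by fact
  have JR: "\<And>x. x \<in> J \<Longrightarrow> x \<in> carrier R" using J.a_subset by blast
  have "abelian_group ?J"
  proof (rule abelian_groupI)
    fix x assume "x \<in> carrier ?J"
    then have "x \<in> J" by simp
    then show "\<exists>y\<in>carrier ?J. y \<oplus>\<^bsub>?J\<^esub> x = \<zero>\<^bsub>?J\<^esub>"
      using JR[of x] by (auto intro!: bexI[of _ "\<ominus> x"] simp: l_neg)
  qed (use JR in \<open>auto simp: a_ac\<close>)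
  then show ?thesis
    by (intro moduleI is_cring) (use JR in \<open>auto simp: l_distr r_distr m_assoc J.I_l_closed\<close>)
qed

lemma injective_module_extend:
  fixes R :: "('a, 'r) ring_scheme" and I :: "('a, 'b, 'm) module_scheme"
    and X :: "('a, 'x, 'p) module_scheme" and Y :: "('a, 'y, 'q) module_scheme"
  assumes inj: "injective_module R I"
    and X: "Module.module R X" and Y: "Module.module R Y"
    and f: "f \<in> module_hom R X Y" and f_inj: "inj_on f (carrier X)" and g: "g \<in> module_hom R X I"
  shows "\<exists>h\<in>module_hom R Y I. \<forall>x\<in>carrier X. h (f x) = g x"
proof -
  interpret X: Module.module R X by fact
  interpret Y: Module.module R Y by fact
  interpret I: Module.module R I using inj by (simp add: injective_module_def)
  interpret f: mod_hom R X Y f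
    using X Y f by (simp add: mod_hom_def mod_hom_axioms_def)
  interpret g: mod_hom R X I g
    using X I.module_axioms g by (simp add: mod_hom_def mod_hom_axioms_def)
  \<comment> \<open>graphs of partial homomorphisms that extend \<open>g\<close>\<close>
  define good where "good G \<longleftrightarrow> G \<subseteq> carrier Y \<times> carrier I \<and>
    (\<forall>x\<in>carrier X. (f x, g x) \<in> G) \<and>
    (\<forall>y z y' z'. (y, z) \<in> G \<and> (y', z') \<in> G \<longrightarrow> (y \<oplus>\<^bsub>Y\<^esub> y', z \<oplus>\<^bsub>I\<^esub> z') \<in> G) \<and>
    (\<forall>r\<in>carrier R. \<forall>y z. (y, z) \<in> G \<longrightarrow> (r \<odot>\<^bsub>Y\<^esub> y, r \<odot>\<^bsub>I\<^esub> z) \<in> G) \<and>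
    (\<forall>z. (\<zero>\<^bsub>Y\<^esub>, z) \<in> G \<longrightarrow> z = \<zero>\<^bsub>I\<^esub>)" for G
  define G0 where "G0 = (\<lambda>x. (f x, g x)) ` carrier X"
  have G0: "good G0"
    unfolding good_def
  proof (intro conjI allI impI ballI)
    show "G0 \<subseteq> carrier Y \<times> carrier I" by (auto simp: G0_def)
    show "(f x, g x) \<in> G0" if "x \<in> carrier X" for x using that by (auto simp: G0_def)
    show "(y \<oplus>\<^bsub>Y\<^esub> y', z \<oplus>\<^bsub>I\<^esub> z') \<in> G0" if "(y, z) \<in> G0 \<and> (y', z') \<in> G0" for y z y' z'
    proof -
      obtain a b where "a \<in> carrier X" "b \<in> carrier X" "y = f a" "z = g a" "y' = f b" "z' = g b"
        using \<open>(y, z) \<in> G0 \<and> (y', z') \<in> G0\<close> by (auto simp: G0_def)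
      then show ?thesis unfolding G0_def by (intro image_eqI[of _ _ "a \<oplus>\<^bsub>X\<^esub> b"]) auto
    qed
    show "(r \<odot>\<^bsub>Y\<^esub> y, r \<odot>\<^bsub>I\<^esub> z) \<in> G0" if r: "r \<in> carrier R" and "(y, z) \<in> G0" for r y z
    proof -
      obtain a where "a \<in> carrier X" "y = f a" "z = g a"
        using \<open>(y, z) \<in> G0\<close> by (auto simp: G0_def)
      then show ?thesis using r unfolding G0_def by (intro image_eqI[of _ _ "r \<odot>\<^bsub>X\<^esub> a"]) auto
    qed
    show "z = \<zero>\<^bsub>I\<^esub>" if "(\<zero>\<^bsub>Y\<^esub>, z) \<in> G0" for z
    proof -
      have "\<exists>a\<in>carrier X. f a = \<zero>\<^bsub>Y\<^esub> \<and> z = g a"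
        using that unfolding G0_def image_iff prod.inject by metis
      then obtain a where a: "a \<in> carrier X" "f a = \<zero>\<^bsub>Y\<^esub>" "z = g a" by blast
      have "a = \<zero>\<^bsub>X\<^esub>" using f_inj a f.f0_is_0 by (metis X.M.zero_closed inj_on_contraD)
      then show ?thesis using a by simp
    qed
  qed
  have "\<exists>G\<in>{G. good G}. \<forall>G'\<in>{G. good G}. G \<subseteq> G' \<longrightarrow> G' = G"
  proof (rule subset_Zorn_nonempty)
    show "{G. good G} \<noteq> {}" using G0 by auto
    fix C assume "C \<noteq> {}" and chain: "subset.chain {G. good G} C"
    have gd: "good G" if "G \<in> C" for G using chain that by (auto simp: subset.chain_def)
    have lin: "G \<subseteq> H \<or> H \<subseteq> G" if "G \<in> C" "H \<in> C" for G H
      using chain that by (auto simp: subset_chain_def)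
    have "good (\<Union>C)"
      unfolding good_def
    proof (intro conjI allI impI ballI)
      show "\<Union>C \<subseteq> carrier Y \<times> carrier I" using gd unfolding good_def by blast
      show "(f x, g x) \<in> \<Union>C" if "x \<in> carrier X" for x
        using gd \<open>C \<noteq> {}\<close> that unfolding good_def by blast
      show "(y \<oplus>\<^bsub>Y\<^esub> y', z \<oplus>\<^bsub>I\<^esub> z') \<in> \<Union>C" if asm: "(y, z) \<in> \<Union>C \<and> (y', z') \<in> \<Union>C" for y z y' z'
      proof -
        obtain G H where GH: "G \<in> C" "H \<in> C" "(y, z) \<in> G" "(y', z') \<in> H" using asm by blast
        then obtain K where "K \<in> C" "(y, z) \<in> K" "(y', z') \<in> K" using lin[of G H] by blast
        then show ?thesis using gd[of K] unfolding good_def by blast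
      qed
      show "(r \<odot>\<^bsub>Y\<^esub> y, r \<odot>\<^bsub>I\<^esub> z) \<in> \<Union>C" if "r \<in> carrier R" and "(y, z) \<in> \<Union>C" for r y z
        using gd that unfolding good_def by blast
      show "z = \<zero>\<^bsub>I\<^esub>" if "(\<zero>\<^bsub>Y\<^esub>, z) \<in> \<Union>C" for z
        using gd that unfolding good_def by blast
    qed
    then show "\<Union>C \<in> {G. good G}" by simp
  qed
  then obtain G where G: "good G" and G_max: "\<And>G'. good G' \<Longrightarrow> G \<subseteq> G' \<Longrightarrow> G' = G" by auto
  have G_sub: "y \<in> carrier Y" "z \<in> carrier I" if "(y, z) \<in> G" for y z
    using G that unfolding good_def by auto
  have G_fg: "(f x, g x) \<in> G" if "x \<in> carrier X" for x
    using G that unfolding good_def by auto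
  have G_add: "(y \<oplus>\<^bsub>Y\<^esub> y', z \<oplus>\<^bsub>I\<^esub> z') \<in> G" if "(y, z) \<in> G" "(y', z') \<in> G" for y z y' z'
    using G that unfolding good_def by auto
  have G_smult: "(r \<odot>\<^bsub>Y\<^esub> y, r \<odot>\<^bsub>I\<^esub> z) \<in> G" if "r \<in> carrier R" "(y, z) \<in> G" for r y z
    using G that unfolding good_def by auto
  have G_zero: "z = \<zero>\<^bsub>I\<^esub>" if "(\<zero>\<^bsub>Y\<^esub>, z) \<in> G" for z
    using G that unfolding good_def by auto
  have G_00: "(\<zero>\<^bsub>Y\<^esub>, \<zero>\<^bsub>I\<^esub>) \<in> G" using G_fg[of "\<zero>\<^bsub>X\<^esub>"] by simp
  have G_neg: "(\<ominus>\<^bsub>Y\<^esub> y, \<ominus>\<^bsub>I\<^esub> z) \<in> G" if "(y, z) \<in> G" for y z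
  proof -
    have "(\<ominus>\<^bsub>R\<^esub> \<one>\<^bsub>R\<^esub>) \<odot>\<^bsub>Y\<^esub> y = \<ominus>\<^bsub>Y\<^esub> y" "(\<ominus>\<^bsub>R\<^esub> \<one>\<^bsub>R\<^esub>) \<odot>\<^bsub>I\<^esub> z = \<ominus>\<^bsub>I\<^esub> z"
      using G_sub[OF that] by (simp_all add: Y.smult_l_minus I.smult_l_minus)
    then show ?thesis using G_smult[OF _ that, of "\<ominus>\<^bsub>R\<^esub> \<one>\<^bsub>R\<^esub>"] by simp
  qed
  have G_fun: "z = z'" if "(y, z) \<in> G" "(y, z') \<in> G" for y z z'
  proof -
    have "(y \<oplus>\<^bsub>Y\<^esub> \<ominus>\<^bsub>Y\<^esub> y, z \<oplus>\<^bsub>I\<^esub> \<ominus>\<^bsub>I\<^esub> z') \<in> G" using G_add[OF that(1) G_neg[OF that(2)]] .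
    then have "z \<oplus>\<^bsub>I\<^esub> \<ominus>\<^bsub>I\<^esub> z' = \<zero>\<^bsub>I\<^esub>"
      using G_zero G_sub[OF that(1)] by (simp add: Y.M.r_neg)
    then show ?thesis using G_sub[OF that(1)] G_sub[OF that(2)]
      by (metis I.M.add.inv_closed I.M.minus_equality I.M.minus_minus)
  qed
  have dom: "\<exists>z. (y, z) \<in> G" if y: "y \<in> carrier Y" for y
  proof -
    define J where "J = {r \<in> carrier R. \<exists>z. (r \<odot>\<^bsub>Y\<^esub> y, z) \<in> G}"
    have J_ideal: "ideal J R"
    proof (rule idealI)
      show "ring R" by (rule X.R.ring_axioms)
      show "subgroup J (add_monoid R)"
      proof (rule group.subgroupI)
        show "group (add_monoid R)" by (rule X.R.add.is_group)
        show "J \<subseteq> carrier (add_monoid R)" by (auto simp: J_def)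
        have "\<zero>\<^bsub>R\<^esub> \<in> J" using G_00 y by (auto simp: J_def Y.lmult_0)
        then show "J \<noteq> {}" by auto
        fix a assume "a \<in> J"
        then obtain z where a: "a \<in> carrier R" "(a \<odot>\<^bsub>Y\<^esub> y, z) \<in> G" by (auto simp: J_def)
        have "((\<ominus>\<^bsub>R\<^esub> a) \<odot>\<^bsub>Y\<^esub> y, \<ominus>\<^bsub>I\<^esub> z) \<in> G"
          using G_neg[OF a(2)] a y by (simp add: Y.smult_l_minus)
        then show "inv\<^bsub>add_monoid R\<^esub> a \<in> J"
          using a unfolding J_def a_inv_def[symmetric] by auto
        fix b assume "b \<in> J"
        then obtain z' where b: "b \<in> carrier R" "(b \<odot>\<^bsub>Y\<^esub> y, z') \<in> G" by (auto simp: J_def)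
        have "((a \<oplus>\<^bsub>R\<^esub> b) \<odot>\<^bsub>Y\<^esub> y, z \<oplus>\<^bsub>I\<^esub> z') \<in> G"
          using G_add[OF a(2) b(2)] a b y by (simp add: Y.smult_l_distr)
        then show "a \<otimes>\<^bsub>add_monoid R\<^esub> b \<in> J" using a b by (auto simp: J_def)
      qed
      fix a x assume "a \<in> J" and x: "x \<in> carrier R"
      then obtain z where a: "a \<in> carrier R" "(a \<odot>\<^bsub>Y\<^esub> y, z) \<in> G" by (auto simp: J_def)
      have "((x \<otimes>\<^bsub>R\<^esub> a) \<odot>\<^bsub>Y\<^esub> y, x \<odot>\<^bsub>I\<^esub> z) \<in> G"
        using G_smult[OF x a(2)] a x y by (simp add: Y.smult_assoc1)
      then show "x \<otimes>\<^bsub>R\<^esub> a \<in> J" using a x by (auto simp: J_def)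
      then show "a \<otimes>\<^bsub>R\<^esub> x \<in> J" using a x by (simp add: X.R.m_comm)
    qed
    let ?M = "\<lambda>J. \<lparr>carrier = J, mult = (\<otimes>\<^bsub>R\<^esub>), one = \<one>\<^bsub>R\<^esub>, zero = \<zero>\<^bsub>R\<^esub>, add = (\<oplus>\<^bsub>R\<^esub>),
      smult = (\<otimes>\<^bsub>R\<^esub>)\<rparr>"
    have J_mod: "Module.module R (?M J)" by (rule X.R.ideal_as_module[OF J_ideal])
    have R_mod: "Module.module R (?M (carrier R))"
      by (rule X.R.ideal_as_module[OF X.R.oneideal])
    define \<phi> where "\<phi> r = (THE z. (r \<odot>\<^bsub>Y\<^esub> y, z) \<in> G)" for r
    have \<phi>_eq: "\<phi> r = z" if "(r \<odot>\<^bsub>Y\<^esub> y, z) \<in> G" for r z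
      unfolding \<phi>_def using that G_fun by (intro the_equality) auto
    have \<phi>: "(r \<odot>\<^bsub>Y\<^esub> y, \<phi> r) \<in> G" if "r \<in> J" for r
      using that \<phi>_eq by (auto simp: J_def)
    have J_carr: "r \<in> carrier R" if "r \<in> J" for r using that by (simp add: J_def)
    have \<phi>_hom: "\<phi> \<in> module_hom R (?M J) I"
    proof (rule module_homI)
      show "\<phi> x \<in> carrier I" if "x \<in> carrier (?M J)" for x
        using that \<phi> G_sub by (metis partial_object.select_convs(1))
      show "\<phi> (a \<oplus>\<^bsub>?M J\<^esub> b) = \<phi> a \<oplus>\<^bsub>I\<^esub> \<phi> b" if "a \<in> carrier (?M J)" "b \<in> carrier (?M J)" for a b
        using that G_add[OF \<phi> \<phi>, of a b] J_carr y by (auto intro!: \<phi>_eq simp: Y.smult_l_distr)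
      show "\<phi> (r \<odot>\<^bsub>?M J\<^esub> a) = r \<odot>\<^bsub>I\<^esub> \<phi> a" if "r \<in> carrier R" "a \<in> carrier (?M J)" for r a
        using that G_smult[OF _ \<phi>, of r a] J_carr y by (auto intro!: \<phi>_eq simp: Y.smult_assoc1)
    qed
    have "id \<in> module_hom R (?M J) (?M (carrier R))" "inj_on id (carrier (?M J))"
      using J_carr by (auto intro!: module_homI)
    then obtain h where h: "h \<in> module_hom R (?M (carrier R)) I"
      and h_ext: "\<And>r. r \<in> J \<Longrightarrow> h r = \<phi> r"
      using inj J_mod R_mod \<phi>_hom unfolding injective_module_def by fastforce
    define v where "v = h \<one>\<^bsub>R\<^esub>"
    have v: "v \<in> carrier I" using module_homD(1)[OF h, of "\<one>\<^bsub>R\<^esub>"] by (simp add: v_def)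
    have h_v: "h r = r \<odot>\<^bsub>I\<^esub> v" if "r \<in> carrier R" for r
      using module_homD(3)[OF h that, of "\<one>\<^bsub>R\<^esub>"] that by (simp add: v_def)
    define G' where "G' = {(d \<oplus>\<^bsub>Y\<^esub> r \<odot>\<^bsub>Y\<^esub> y, w \<oplus>\<^bsub>I\<^esub> r \<odot>\<^bsub>I\<^esub> v) | d w r. (d, w) \<in> G \<and> r \<in> carrier R}"
    have "G \<subseteq> G'"
    proof (rule subrelI)
      fix d w assume dw: "(d, w) \<in> G"
      have "d = d \<oplus>\<^bsub>Y\<^esub> \<zero>\<^bsub>R\<^esub> \<odot>\<^bsub>Y\<^esub> y" "w = w \<oplus>\<^bsub>I\<^esub> \<zero>\<^bsub>R\<^esub> \<odot>\<^bsub>I\<^esub> v"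
        using G_sub[OF dw] y v by (simp_all add: Y.lmult_0 I.lmult_0)
      then show "(d, w) \<in> G'" using dw unfolding G'_def by blast
    qed
    moreover have "good G'"
      unfolding good_def
    proof (intro conjI allI impI ballI)
      show "G' \<subseteq> carrier Y \<times> carrier I" using G_sub y v by (auto simp: G'_def)
      show "(f x, g x) \<in> G'" if "x \<in> carrier X" for x using G_fg[OF that] \<open>G \<subseteq> G'\<close> by auto
      show "(a \<oplus>\<^bsub>Y\<^esub> a', z \<oplus>\<^bsub>I\<^esub> z') \<in> G'" if asm: "(a, z) \<in> G' \<and> (a', z') \<in> G'" for a z a' z'
      proof -
        from asm obtain d w r d' w' r' where 1: "a = d \<oplus>\<^bsub>Y\<^esub> r \<odot>\<^bsub>Y\<^esub> y" "z = w \<oplus>\<^bsub>I\<^esub> r \<odot>\<^bsub>I\<^esub> v"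
          "(d, w) \<in> G" "r \<in> carrier R" and 2: "a' = d' \<oplus>\<^bsub>Y\<^esub> r' \<odot>\<^bsub>Y\<^esub> y" "z' = w' \<oplus>\<^bsub>I\<^esub> r' \<odot>\<^bsub>I\<^esub> v"
          "(d', w') \<in> G" "r' \<in> carrier R" unfolding G'_def by blast
        note c = G_sub[OF 1(3)] G_sub[OF 2(3)] 1(4) 2(4) y v
        have "a \<oplus>\<^bsub>Y\<^esub> a' = (d \<oplus>\<^bsub>Y\<^esub> d') \<oplus>\<^bsub>Y\<^esub> (r \<oplus>\<^bsub>R\<^esub> r') \<odot>\<^bsub>Y\<^esub> y"
          using c by (simp add: 1 2 Y.smult_l_distr Y.M.a_ac)
        moreover have "z \<oplus>\<^bsub>I\<^esub> z' = (w \<oplus>\<^bsub>I\<^esub> w') \<oplus>\<^bsub>I\<^esub> (r \<oplus>\<^bsub>R\<^esub> r') \<odot>\<^bsub>I\<^esub> v"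
          using c by (simp add: 1 2 I.smult_l_distr I.M.a_ac)
        ultimately show ?thesis using G_add[OF 1(3) 2(3)] c unfolding G'_def by blast
      qed
      show "(s \<odot>\<^bsub>Y\<^esub> a, s \<odot>\<^bsub>I\<^esub> z) \<in> G'" if s: "s \<in> carrier R" and asm: "(a, z) \<in> G'" for s a z
      proof -
        from asm obtain d w r where 1: "a = d \<oplus>\<^bsub>Y\<^esub> r \<odot>\<^bsub>Y\<^esub> y" "z = w \<oplus>\<^bsub>I\<^esub> r \<odot>\<^bsub>I\<^esub> v"
          "(d, w) \<in> G" "r \<in> carrier R" unfolding G'_def by blast
        note c = G_sub[OF 1(3)] 1(4) y v s
        have "s \<odot>\<^bsub>Y\<^esub> a = s \<odot>\<^bsub>Y\<^esub> d \<oplus>\<^bsub>Y\<^esub> (s \<otimes>\<^bsub>R\<^esub> r) \<odot>\<^bsub>Y\<^esub> y"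
          using c by (simp add: 1 Y.smult_r_distr Y.smult_assoc1)
        moreover have "s \<odot>\<^bsub>I\<^esub> z = s \<odot>\<^bsub>I\<^esub> w \<oplus>\<^bsub>I\<^esub> (s \<otimes>\<^bsub>R\<^esub> r) \<odot>\<^bsub>I\<^esub> v"
          using c by (simp add: 1 I.smult_r_distr I.smult_assoc1)
        ultimately show ?thesis using G_smult[OF s 1(3)] c unfolding G'_def by blast
      qed
      show "z = \<zero>\<^bsub>I\<^esub>" if asm: "(\<zero>\<^bsub>Y\<^esub>, z) \<in> G'" for z
      proof -
        from asm obtain d w r where 1: "\<zero>\<^bsub>Y\<^esub> = d \<oplus>\<^bsub>Y\<^esub> r \<odot>\<^bsub>Y\<^esub> y" "z = w \<oplus>\<^bsub>I\<^esub> r \<odot>\<^bsub>I\<^esub> v"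
          "(d, w) \<in> G" "r \<in> carrier R" unfolding G'_def by blast
        note c = G_sub[OF 1(3)] 1(4) y v
        have "\<ominus>\<^bsub>Y\<^esub> d = r \<odot>\<^bsub>Y\<^esub> y"
          using c 1(1) by (metis Y.M.minus_equality Y.M.a_comm Y.smult_closed)
        then have ry: "(r \<odot>\<^bsub>Y\<^esub> y, \<ominus>\<^bsub>I\<^esub> w) \<in> G" using G_neg[OF 1(3)] by simp
        then have "r \<in> J" using c by (auto simp: J_def)
        then have "r \<odot>\<^bsub>I\<^esub> v = \<ominus>\<^bsub>I\<^esub> w" using h_ext[of r] h_v[of r] \<phi>_eq[OF ry] c(3) by metis
        then show ?thesis using c by (simp add: 1(2) I.M.r_neg)
      qed
    qed
    ultimately have "G' = G" using G_max by blast
    moreover have "(y, v) \<in> G'"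
      using G_00 y v unfolding G'_def by (auto intro!: exI[of _ "\<zero>\<^bsub>Y\<^esub>"] exI[of _ "\<zero>\<^bsub>I\<^esub>"] exI[of _ "\<one>\<^bsub>R\<^esub>"])
    ultimately show ?thesis by auto
  qed
  define h where "h y = (THE z. (y, z) \<in> G)" for y
  have h_eq: "h y = z" if "(y, z) \<in> G" for y z
    unfolding h_def using that G_fun by (intro the_equality) auto
  have h: "(y, h y) \<in> G" if "y \<in> carrier Y" for y
    using dom[OF that] h_eq by auto
  have "h \<in> module_hom R Y I"
  proof (rule module_homI)
    show "h x \<in> carrier I" if "x \<in> carrier Y" for x using G_sub(2)[OF h[OF that]] .
    show "h (x \<oplus>\<^bsub>Y\<^esub> y) = h x \<oplus>\<^bsub>I\<^esub> h y" if "x \<in> carrier Y" "y \<in> carrier Y" for x y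
      using h_eq[OF G_add[OF h[OF that(1)] h[OF that(2)]]] .
    show "h (r \<odot>\<^bsub>Y\<^esub> x) = r \<odot>\<^bsub>I\<^esub> h x" if "r \<in> carrier R" "x \<in> carrier Y" for r x
      using h_eq[OF G_smult[OF that(1) h[OF that(2)]]] .
  qed
  moreover have "\<forall>x\<in>carrier X. h (f x) = g x" using G_fg h_eq by blast
  ultimately show ?thesis by blast
qed

lemma injective_cogenerator_hom:
  fixes R :: "('a, 'r) ring_scheme" and I :: "('a, 'b, 'm) module_scheme"
    and X :: "('a, 'x, 'p) module_scheme"
  assumes cogen: "injective_cogenerator R I"
    and X: "Module.module R X" and nonzero: "carrier X \<noteq> {\<zero>\<^bsub>X\<^esub>}"
  shows "\<exists>f\<in>module_hom R X I. \<exists>x\<in>carrier X. f x \<noteq> \<zero>\<^bsub>I\<^esub>"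
proof -
  interpret X: Module.module R X by fact
  obtain x where x: "x \<in> carrier X" "x \<noteq> \<zero>\<^bsub>X\<^esub>" using nonzero by blast
  \<comment> \<open>a copy of the cyclic submodule generated by \<open>x\<close>, carried by representatives in \<open>R\<close>\<close>
  define d where "d r = r \<odot>\<^bsub>X\<^esub> x" for r
  define e where "e z = (SOME r. r \<in> carrier R \<and> d r = z)" for z
  have e: "e (d r) \<in> carrier R" "d (e (d r)) = d r" if "r \<in> carrier R" for r
    unfolding e_def using someI[of "\<lambda>s. s \<in> carrier R \<and> d s = d r" r] that by auto
  have d: "d r \<in> carrier X" if "r \<in> carrier R" for r using that x by (simp add: d_def)
  have d_add: "d (r \<oplus>\<^bsub>R\<^esub> s) = d r \<oplus>\<^bsub>X\<^esub> d s" if "r \<in> carrier R" "s \<in> carrier R" for r s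
    using that x by (simp add: d_def X.smult_l_distr)
  have d_mult: "d (r \<otimes>\<^bsub>R\<^esub> s) = r \<odot>\<^bsub>X\<^esub> d s" if "r \<in> carrier R" "s \<in> carrier R" for r s
    using that x by (simp add: d_def X.smult_assoc1)
  define c where "c r = e (d r)" for r
  have c: "c r \<in> carrier R" "d (c r) = d r" if "r \<in> carrier R" for r
    using e[OF that] by (auto simp: c_def)
  have c_cong: "c r = c s" if "d r = d s" for r s using that by (simp add: c_def)
  have cc: "c (c r) = c r" if "r \<in> carrier R" for r using c(2)[OF that] by (rule c_cong)
  define N where "N = \<lparr>carrier = c ` carrier R, mult = (\<otimes>\<^bsub>R\<^esub>), one = \<one>\<^bsub>R\<^esub>, zero = c \<zero>\<^bsub>R\<^esub>,
    add = (\<lambda>r s. c (r \<oplus>\<^bsub>R\<^esub> s)), smult = (\<lambda>r s. c (r \<otimes>\<^bsub>R\<^esub> s))\<rparr>"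
  have N_simps [simp]: "carrier N = c ` carrier R" "\<zero>\<^bsub>N\<^esub> = c \<zero>\<^bsub>R\<^esub>"
    "r \<oplus>\<^bsub>N\<^esub> s = c (r \<oplus>\<^bsub>R\<^esub> s)" "r \<odot>\<^bsub>N\<^esub> s = c (r \<otimes>\<^bsub>R\<^esub> s)" for r s
    by (simp_all add: N_def)
  note c_simps = c d d_add d_mult X.smult_l_distr X.smult_r_distr X.smult_assoc1
  have "abelian_group N"
  proof (rule abelian_groupI)
    fix u assume "u \<in> carrier N"
    then obtain r where r: "u = c r" "r \<in> carrier R" by auto
    have "c (\<ominus>\<^bsub>R\<^esub> r) \<oplus>\<^bsub>N\<^esub> u = \<zero>\<^bsub>N\<^esub>"
      using r d_add[of "\<ominus>\<^bsub>R\<^esub> r" r] by (auto intro!: c_cong simp: c_simps X.R.l_neg)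
    then show "\<exists>w\<in>carrier N. w \<oplus>\<^bsub>N\<^esub> u = \<zero>\<^bsub>N\<^esub>" using r by auto
  next
    fix u assume "u \<in> carrier N"
    then obtain r where r: "u = c r" "r \<in> carrier R" by auto
    have "d (c \<zero>\<^bsub>R\<^esub> \<oplus>\<^bsub>R\<^esub> c r) = d r"
      using r d_add[of "\<zero>\<^bsub>R\<^esub>" r] by (simp add: c_simps)
    then show "\<zero>\<^bsub>N\<^esub> \<oplus>\<^bsub>N\<^esub> u = u" using r by (auto intro!: c_cong)
  qed (auto intro!: c_cong imageI simp: c_simps X.M.a_ac)
  then have N: "Module.module R N"
  proof (rule moduleI[OF X.R.is_cring])
    fix u assume "u \<in> carrier N"
    then obtain r where r: "u = c r" "r \<in> carrier R" by auto
    then show "\<one>\<^bsub>R\<^esub> \<odot>\<^bsub>N\<^esub> u = u" by (simp add: c cc)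
  qed (auto intro!: c_cong imageI simp: c_simps)
  have "carrier N \<noteq> {\<zero>\<^bsub>N\<^esub>}"
  proof
    assume "carrier N = {\<zero>\<^bsub>N\<^esub>}"
    then have "c \<one>\<^bsub>R\<^esub> = c \<zero>\<^bsub>R\<^esub>" by auto
    then have "d \<one>\<^bsub>R\<^esub> = d \<zero>\<^bsub>R\<^esub>" by (metis X.R.one_closed X.R.zero_closed c(2))
    then show False using x by (simp add: d_def X.lmult_0)
  qed
  then obtain f u where f: "f \<in> module_hom R N I" and u: "u \<in> carrier N" "f u \<noteq> \<zero>\<^bsub>I\<^esub>"
    using cogen N unfolding injective_cogenerator_def by blast
  have "d \<in> module_hom R N X"
    by (rule module_homI) (auto simp: c_simps)
  moreover have "inj_on d (carrier N)"
    by (rule inj_onI) (auto simp: c intro: c_cong)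
  moreover have "injective_module R I" using cogen by (simp add: injective_cogenerator_def)
  ultimately obtain h where "h \<in> module_hom R X I" "\<forall>r\<in>carrier N. h (d r) = f r"
    using injective_module_extend[OF _ N X _ _ f] by blast
  then show ?thesis using u d c by (auto intro!: bexI[of _ h] bexI[of _ "d u"])
qed


subsection \<open>Krull dimension\<close>

text \<open>The zero ring has no prime ideals, hence dimension \<open>Sup {} = - \<infinity>\<close>.\<close>

definition krull_dim :: "('a, 'r) ring_scheme \<Rightarrow> ereal" where
  "krull_dim R = Sup {ereal (real m) | m. \<exists>p :: nat \<Rightarrow> 'a set.
    (\<forall>i\<le>m. primeideal (p i) R) \<and> (\<forall>i<m. p i \<subset> p (Suc i))}"


section \<open>Polynomials and varieties\<close>

text \<open>Polynomials over the complex numbers with one indeterminate for each element of \<open>'n\<close>, so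
  \<open>CARD('n)\<close> indeterminates; the same type is used for the operators \<open>p(D)\<close>.\<close>

type_synonym 'n mpoly = "('n \<Rightarrow>\<^sub>0 nat) \<Rightarrow>\<^sub>0 complex"

definition peval :: "'n::finite mpoly \<Rightarrow> complex ^ 'n \<Rightarrow> complex" where
  "peval p x = (\<Sum>m\<in>Poly_Mapping.keys p.
    Poly_Mapping.lookup p m * (\<Prod>j\<in>UNIV. vec_nth x j ^ Poly_Mapping.lookup m j))"

definition zero_set :: "'n::finite mpoly set \<Rightarrow> (complex ^ 'n) set" where
  "zero_set S = {x. \<forall>p\<in>S. peval p x = 0}"

definition algebraic_variety :: "(complex ^ 'n::finite) set \<Rightarrow> bool" where
  "algebraic_variety V \<longleftrightarrow> (\<exists>S. V = zero_set S)"

definition irreducible_variety :: "(complex ^ 'n::finite) set \<Rightarrow> bool" where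
  "irreducible_variety V \<longleftrightarrow> algebraic_variety V \<and> V \<noteq> {} \<and>
    (\<forall>V1 V2. algebraic_variety V1 \<and> algebraic_variety V2 \<and> V = V1 \<union> V2 \<longrightarrow> V = V1 \<or> V = V2)"

text \<open>The empty variety has dimension \<open>- \<infinity>\<close>.\<close>

definition variety_dim :: "(complex ^ 'n::finite) set \<Rightarrow> ereal" where
  "variety_dim V = Sup {ereal (real m) | m. \<exists>W :: nat \<Rightarrow> (complex ^ 'n) set.
    (\<forall>i\<le>m. irreducible_variety (W i) \<and> W i \<subseteq> V) \<and> (\<forall>i<m. W i \<subset> W (Suc i))}"

text \<open>For \<open>M\<close> with more rows than columns there are no maximal minors and the ideal is \<open>0\<close>;
  for \<open>M\<close> without rows the only minor is the empty determinant \<open>1\<close>.\<close>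

definition cancellation_ideal :: "'a::comm_ring_1 mat \<Rightarrow> 'a set" where
  "cancellation_ideal M = Idl\<^bsub>class_ring\<^esub>
    {det (submatrix M UNIV J) | J. J \<subseteq> {..<dim_col M} \<and> card J = dim_row M}"

definition full_row_rank :: "'a::field mat \<Rightarrow> bool" where
  "full_row_rank B \<longleftrightarrow> vec_space.rank (dim_row B) B = dim_row B"


section \<open>Distributions on Euclidean space\<close>

definition partial :: "'n::finite \<Rightarrow> (real ^ 'n \<Rightarrow> complex) \<Rightarrow> real ^ 'n \<Rightarrow> complex" where
  "partial j \<phi> x = frechet_derivative \<phi> (at x) (axis j 1)"

definition smooth :: "(real ^ 'n::finite \<Rightarrow> complex) \<Rightarrow> bool" where
  "smooth \<phi> \<longleftrightarrow> (\<forall>js x. fold partial js \<phi> differentiable (at x))"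

definition supp :: "(real ^ 'n::finite \<Rightarrow> complex) \<Rightarrow> (real ^ 'n) set" where
  "supp \<phi> = closure {x. \<phi> x \<noteq> 0}"

definition test_functions :: "(real ^ 'n::finite \<Rightarrow> complex) set" where
  "test_functions = {\<phi>. smooth \<phi> \<and> compact (supp \<phi>)}"

text \<open>Distributions are functionals on the test functions, given the value \<open>0\<close> on all other
  functions. Continuity is expressed by the usual estimates on each compact set.\<close>

type_synonym 'n functional = "(real ^ 'n \<Rightarrow> complex) \<Rightarrow> complex"

definition distributions :: "'n::finite functional set" where
  "distributions = {T.
    (\<forall>\<phi>\<in>test_functions. \<forall>\<psi>\<in>test_functions. T (\<lambda>x. \<phi> x + \<psi> x) = T \<phi> + T \<psi>) \<and>
    (\<forall>c. \<forall>\<phi>\<in>test_functions. T (\<lambda>x. c * \<phi> x) = c * T \<phi>) \<and>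
    (\<forall>K. compact K \<longrightarrow> (\<exists>N C. \<forall>\<phi>\<in>test_functions. supp \<phi> \<subseteq> K \<longrightarrow>
      norm (T \<phi>) \<le> C * (\<Sum>js | length js \<le> N. SUP x. norm (fold partial js \<phi> x)))) \<and>
    (\<forall>\<phi>. \<phi> \<notin> test_functions \<longrightarrow> T \<phi> = 0)}"

text \<open>\<open>D\<^sub>j = (1 / \<i>) \<partial>\<^sub>j\<close> with \<open>(\<partial>\<^sub>j T) \<phi> = - T (\<partial>\<^sub>j \<phi>)\<close>.\<close>

definition dist_D :: "'n::finite \<Rightarrow> 'n functional \<Rightarrow> 'n functional" where
  "dist_D j T = (\<lambda>\<phi>. if \<phi> \<in> test_functions then (1 / \<i>) * (- T (partial j \<phi>)) else 0)"

text \<open>The operators \<open>D\<^sub>j\<close> commute on distributions, so the enumeration of the indices chosen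
  here does not matter.\<close>

definition dist_D_monomial :: "('n::finite \<Rightarrow>\<^sub>0 nat) \<Rightarrow> 'n functional \<Rightarrow> 'n functional" where
  "dist_D_monomial m =
    fold (\<lambda>j. dist_D j ^^ Poly_Mapping.lookup m j) (SOME js. distinct js \<and> set js = UNIV)"

definition dist_apply :: "'n::finite mpoly \<Rightarrow> 'n functional \<Rightarrow> 'n functional" where
  "dist_apply p T =
    (\<lambda>\<phi>. \<Sum>m\<in>Poly_Mapping.keys p. Poly_Mapping.lookup p m * dist_D_monomial m T \<phi>)"

definition dist_module :: "('n::finite mpoly, 'n functional) module" where
  "dist_module =
    \<lparr>carrier = distributions, mult = undefined, one = undefined,
     zero = (\<lambda>\<phi>. 0), add = (\<lambda>S T \<phi>. S \<phi> + T \<phi>), smult = dist_apply\<rparr>"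

definition Ker ::
    "'n::finite functional set \<Rightarrow> nat \<Rightarrow> 'n mpoly Matrix.vec set \<Rightarrow> 'n functional Matrix.vec set" where
  "Ker F k P = {f \<in> carrier_vec k. (\<forall>j<k. vec_index f j \<in> F) \<and>
    (\<forall>p\<in>P. (\<Oplus>\<^bsub>dist_module\<^esub> j\<in>{..<k}. vec_index p j \<odot>\<^bsub>dist_module\<^esub> vec_index f j)
            = \<zero>\<^bsub>dist_module\<^esub>)}"

definition eq_near :: "(real ^ 'n::finite) set \<Rightarrow> 'n functional \<Rightarrow> 'n functional \<Rightarrow> bool" where
  "eq_near U S T \<longleftrightarrow>
    (\<exists>W. open W \<and> U \<subseteq> W \<and> (\<forall>\<phi>\<in>test_functions. supp \<phi> \<subseteq> W \<longrightarrow> S \<phi> = T \<phi>))"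

definition eq_near_vec ::
    "(real ^ 'n::finite) set \<Rightarrow> 'n functional Matrix.vec \<Rightarrow> 'n functional Matrix.vec \<Rightarrow> bool" where
  "eq_near_vec U f g \<longleftrightarrow>
    (\<exists>W. open W \<and> U \<subseteq> W \<and> dim_vec f = dim_vec g \<and>
      (\<forall>j<dim_vec f. \<forall>\<phi>\<in>test_functions. supp \<phi> \<subseteq> W \<longrightarrow> vec_index f j \<phi> = vec_index g j \<phi>))"

definition admissible ::
    "'n::finite functional set \<Rightarrow> (real ^ 'n) set \<Rightarrow> (real ^ 'n) set \<Rightarrow> bool" where
  "admissible F U1 U2 \<longleftrightarrow> U1 \<inter> U2 = {} \<and> closure U1 \<inter> closure U2 = {} \<and>
    (\<forall>f1\<in>F. \<forall>f2\<in>F. \<exists>f\<in>F. eq_near U1 f f1 \<and> eq_near U2 f f2)"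

definition controllable :: "'n::finite functional set \<Rightarrow> nat \<Rightarrow> 'n mpoly Matrix.vec set \<Rightarrow> bool" where
  "controllable F k P \<longleftrightarrow> (\<forall>U1 U2. admissible F U1 U2 \<longrightarrow>
    (\<forall>f1\<in>Ker F k P. \<forall>f2\<in>Ker F k P.
      \<exists>f\<in>Ker F k P. eq_near_vec U1 f f1 \<and> eq_near_vec U2 f f2))"

definition cutoff_assumption :: "'n::finite functional set \<Rightarrow> bool" where
  "cutoff_assumption F \<longleftrightarrow> (\<forall>V. bounded V \<and> interior V \<noteq> {} \<longrightarrow>
    (\<exists>U. U \<noteq> {} \<and> closure U \<subseteq> interior V \<and> admissible F U (- V)))"

end

theory Submission
  imports
    Defs
    "Jordan_Normal_Form.DL_Rank_Submatrix"
    "Jordan_Normal_Form.Char_Poly"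
begin

text \<open>
  The quotient is torsion free iff the row module of \<open>P(D)\<close> is saturated, and the dimension is at least
  \<open>n - 1\<close> iff some chain of \<open>n\<close> primes contains the maximal minors. If \<open>a v\<close> is a combination of the
  rows with coefficients \<open>c\<^sub>i\<close> and \<open>a\<close> does not divide \<open>c\<^sub>i\<close>, then Cramer's rule puts the minors into the
  colon ideal \<open>(a) : c\<^sub>i\<close>. After Nagata's change of variables \<open>a\<close> is monic in one variable, so that this
  ideal meets the ring in the other \<open>n - 1\<close> variables trivially, and lying over gives the chain.
  Conversely, the least prime \<open>q\<close> of a chain has height one; a left kernel vector of \<open>P(x)\<close> modulo \<open>q\<close>,
  multiplied by an element representing the socle of the local ring at \<open>q\<close> modulo a minor, yields an
  unsaturated element.

  A saturated module is the kernel of a matrix \<open>R\<close>, so over an injective module of distributions the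
  behaviour is the image of the transpose of \<open>R(D)\<close>, and trajectories are patched by patching preimages.
  If instead \<open>a v \<in> P\<close> with \<open>a \<noteq> 0\<close> and \<open>v \<notin> P\<close>, then by the Nullstellensatz and the cogenerator property
  some trajectory \<open>f\<close> has \<open>v(D) f = u\<close> with \<open>u \<noteq> 0\<close> exponential. If \<open>f\<close> could be cut off, the same
  combination \<open>w\<close> of the result would be a compactly supported solution of \<open>a(D) w = 0\<close> that agrees with
  \<open>u\<close> on a nonempty open set. But \<open>w = 0\<close>, because \<open>a\<close> acts on the generating series of the moments of
  \<open>w\<close> by multiplication, and an exponential distribution that vanishes on a nonempty open set is zero.
\<close>

text \<open>Only chains of primes enter: dimension at least \<open>n - 1\<close>, of the variety or
  of the quotient ring, is the existence of \<open>n\<close> strictly increasing primes above the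
  minors. The one upper bound needed, that a chain has at most \<open>n + 1\<close> primes, comes
  from counting monomials with bounded exponents; it leaves no room for a prime strictly between
  zero and the least of the \<open>n\<close> primes. Counting of the same kind, together with the
  uncountability of the reals, gives the Nullstellensatz.

  In the analytic half the set on which a cut-off keeps a trajectory is not under control: it is
  merely some nonempty set inside the ball. The torsion output must therefore be visible near every
  point, which is why it is chosen exponential. The Fourier transform of the compactly supported
  output is replaced by its Taylor coefficients, the moments, where multiplication by a nonzero
  polynomial is visibly injective. That the moments determine the distribution follows from
  approximating test functions by polynomials together with all derivatives up to a given
  order.\<close>

section \<open>Ideals and prime ideals as bare sets\<close>

definition cideal :: "'a::comm_ring_1 set \<Rightarrow> bool" where
  "cideal J \<longleftrightarrow> 0 \<in> J \<and> (\<forall>a\<in>J. \<forall>b\<in>J. a + b \<in> J) \<and> (\<forall>a\<in>J. \<forall>r. r * a \<in> J)"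

definition cprime :: "'a::comm_ring_1 set \<Rightarrow> bool" where
  "cprime J \<longleftrightarrow> cideal J \<and> 1 \<notin> J \<and> (\<forall>a b. a * b \<in> J \<longrightarrow> a \<in> J \<or> b \<in> J)"

lemma cidealI:
  assumes "0 \<in> J" "\<And>a b. a \<in> J \<Longrightarrow> b \<in> J \<Longrightarrow> a + b \<in> J" "\<And>r a. a \<in> J \<Longrightarrow> r * a \<in> J"
  shows "cideal J"
  using assms by (auto simp: cideal_def)

lemma cidealD:
  assumes "cideal J"
  shows cideal_zero: "0 \<in> J"
    and cideal_add: "a \<in> J \<Longrightarrow> b \<in> J \<Longrightarrow> a + b \<in> J"
    and cideal_mult: "a \<in> J \<Longrightarrow> r * a \<in> J"
    and cideal_mult_right: "a \<in> J \<Longrightarrow> a * r \<in> J"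
  using assms by (auto simp: cideal_def mult.commute)

lemma cideal_uminus: "cideal J \<Longrightarrow> a \<in> J \<Longrightarrow> - a \<in> J"
  using cideal_mult[of J a "-1"] by simp

lemma cideal_diff: "cideal J \<Longrightarrow> a \<in> J \<Longrightarrow> b \<in> J \<Longrightarrow> a - b \<in> J"
  using cideal_add[of J a "- b"] cideal_uminus[of J b] by simp

lemma cideal_sum: "cideal J \<Longrightarrow> (\<And>i. i \<in> S \<Longrightarrow> f i \<in> J) \<Longrightarrow> sum f S \<in> J"
  by (induction S rule: infinite_finite_induct) (auto simp: cidealD)

lemma cprimeD:
  assumes "cprime J"
  shows cprime_ideal: "cideal J" and cprime_one: "1 \<notin> J"
    and cprime_mult: "a * b \<in> J \<Longrightarrow> a \<in> J \<or> b \<in> J"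
  using assms by (auto simp: cprime_def)

lemma cprime_power: "cprime J \<Longrightarrow> a ^ k \<in> J \<Longrightarrow> a \<in> J"
  using cprime_one[of J] cprime_mult[of J] by (induction k) auto

lemma cprime_prod:
  assumes "cprime J" "finite S" "prod f S \<in> J"
  shows "\<exists>i\<in>S. f i \<in> J"
  using assms(2,3) cprime_one[OF assms(1)] cprime_mult[OF assms(1)]
  by (induction S rule: finite_induct) auto

lemma cideal_insert:
  assumes "cideal J"
  shows "cideal {j + r * x |j r. j \<in> J}"
proof (rule cidealI)
  show "0 \<in> {j + r * x |j r. j \<in> J}" using cideal_zero[OF assms] by (auto intro!: exI[of _ 0])
  fix a b assume "a \<in> {j + r * x |j r. j \<in> J}" "b \<in> {j + r * x |j r. j \<in> J}"
  then obtain j r j' r' where "a = j + r * x" "b = j' + r' * x" "j \<in> J" "j' \<in> J" by auto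
  then show "a + b \<in> {j + r * x |j r. j \<in> J}" using cideal_add[OF assms]
    by (intro CollectI exI[of _ "j + j'"] exI[of _ "r + r'"]) (simp add: algebra_simps)
next
  fix s a assume "a \<in> {j + r * x |j r. j \<in> J}"
  then obtain j r where "a = j + r * x" "j \<in> J" by auto
  then show "s * a \<in> {j + r * x |j r. j \<in> J}" using cideal_mult[OF assms]
    by (intro CollectI exI[of _ "s * j"] exI[of _ "s * r"]) (simp add: algebra_simps)
qed

text \<open>Adjoining \<open>a\<close> or \<open>b\<close> to \<open>Q\<close> reaches
  \<open>S\<close>, and the product of the two witnesses lies in \<open>Q\<close> as soon as
  \<open>a * b\<close> does. The maximality stays in the conclusion because the Nullstellensatz
  reads off inverses from it.\<close>

theorem krull_maximal_avoiding:
  fixes J :: "'a::comm_ring_1 set"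
  assumes J: "cideal J" and S: "1 \<in> S" "\<And>a b. a \<in> S \<Longrightarrow> b \<in> S \<Longrightarrow> a * b \<in> S" and disj: "J \<inter> S = {}"
  obtains Q where "cprime Q" "J \<subseteq> Q" "Q \<inter> S = {}"
    "\<And>K. cideal K \<Longrightarrow> Q \<subseteq> K \<Longrightarrow> K \<inter> S = {} \<Longrightarrow> K = Q"
proof -
  let ?A = "{K. cideal K \<and> J \<subseteq> K \<and> K \<inter> S = {}}"
  have "\<exists>M\<in>?A. \<forall>K\<in>?A. M \<subseteq> K \<longrightarrow> K = M"
  proof (rule subset_Zorn_nonempty)
    show "?A \<noteq> {}" using J disj by blast
    fix C assume C: "C \<noteq> {}" "subset.chain ?A C"
    have CA: "K \<in> ?A" if "K \<in> C" for K using C that by (auto simp: subset.chain_def)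
    have lin: "K \<subseteq> L \<or> L \<subseteq> K" if "K \<in> C" "L \<in> C" for K L
      using C that by (auto simp: subset_chain_def)
    have "cideal (\<Union>C)"
    proof (rule cidealI)
      show "0 \<in> \<Union>C"
      proof -
        obtain K where "K \<in> C" using C(1) by blast
        then show ?thesis using CA[of K] cideal_zero[of K] by blast
      qed
      fix a b assume "a \<in> \<Union>C" "b \<in> \<Union>C"
      then obtain K L where KL: "K \<in> C" "L \<in> C" "a \<in> K" "b \<in> L" by blast
      have "\<exists>M\<in>C. a \<in> M \<and> b \<in> M" using lin[OF KL(1,2)] KL by blast
      then obtain M where M: "M \<in> C" "a \<in> M" "b \<in> M" by blast
      then show "a + b \<in> \<Union>C" using CA[OF M(1)] cideal_add[of M a b] by blast
    next
      fix r a assume "a \<in> \<Union>C"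
      then obtain K where "K \<in> C" "a \<in> K" by blast
      then show "r * a \<in> \<Union>C" using CA[of K] cideal_mult[of K a r] by blast
    qed
    then show "\<Union>C \<in> ?A" using C(1) CA by blast
  qed
  then obtain Q where QA: "Q \<in> ?A" and maxA: "\<forall>K\<in>?A. Q \<subseteq> K \<longrightarrow> K = Q" by (rule bexE)
  from QA have Q: "cideal Q" "J \<subseteq> Q" "Q \<inter> S = {}" by simp_all
  have max: "K = Q" if "cideal K" "J \<subseteq> K" "K \<inter> S = {}" "Q \<subseteq> K" for K
    using maxA that by simp
  have ext: "\<exists>j\<in>Q. \<exists>r. j + r * a \<in> S" if a: "a \<notin> Q" for a
  proof (rule ccontr)
    assume *: "\<not> ?thesis"
    let ?K = "{j + r * a |j r. j \<in> Q}"
    have "?K \<inter> S = {}" using * by blast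
    moreover have sub: "Q \<subseteq> ?K"
    proof
      fix x assume "x \<in> Q"
      then show "x \<in> ?K" by (intro CollectI exI[of _ x] exI[of _ 0]) simp
    qed
    ultimately have "?K = Q" using max[OF cideal_insert[OF Q(1)] subset_trans[OF Q(2) sub]] by simp
    moreover have "a \<in> ?K"
      using cideal_zero[OF Q(1)] by (intro CollectI exI[of _ 0] exI[of _ 1]) simp
    ultimately show False using a by blast
  qed
  have "cprime Q"
    unfolding cprime_def
  proof (intro conjI allI impI Q(1))
    show "1 \<notin> Q" using Q S by blast
    fix a b assume ab: "a * b \<in> Q"
    show "a \<in> Q \<or> b \<in> Q"
    proof (rule ccontr)
      assume "\<not> (a \<in> Q \<or> b \<in> Q)"
      then obtain j r j' r' where 1: "j \<in> Q" "j + r * a \<in> S" "j' \<in> Q" "j' + r' * b \<in> S"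
        using ext[of a] ext[of b] by blast
      have "(j + r * a) * (j' + r' * b) = j * (j' + r' * b) + (r * a) * j' + (r * r') * (a * b)"
        by (simp add: algebra_simps)
      also have "\<dots> \<in> Q"
        by (intro cideal_add[OF Q(1)] cideal_mult[OF Q(1)] cideal_mult_right[OF Q(1)] 1 ab)
      finally show False using S(2)[OF 1(2) 1(4)] Q(3) by blast
    qed
  qed
  then show ?thesis using that[of Q] Q max[OF _ subset_trans[OF Q(2)]] by simp
qed

subsection \<open>Polynomials\<close>

abbreviation lkp where "lkp \<equiv> Poly_Mapping.lookup"
abbreviation pkeys where "pkeys \<equiv> Poly_Mapping.keys"

definition PC :: "complex \<Rightarrow> 'n mpoly" where "PC c = Poly_Mapping.single 0 c"
definition PX :: "'n \<Rightarrow> 'n mpoly" where "PX j = Poly_Mapping.single (Poly_Mapping.single j 1) 1"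

lemma poly_mapping_sum_single: "p = (\<Sum>m\<in>pkeys p. Poly_Mapping.single m (lkp p m))"
proof (rule poly_mapping_eqI)
  fix k
  show "lkp p k = lkp (\<Sum>m\<in>pkeys p. Poly_Mapping.single m (lkp p m)) k"
    by (cases "k \<in> pkeys p") (auto simp: lookup_sum lookup_single when_def in_keys_iff sum.delta')
qed

lemma single_PC: "Poly_Mapping.single m c = PC c * Poly_Mapping.single m 1"
  by (simp add: PC_def mult_single)

lemma PX_power: "PX j ^ k = Poly_Mapping.single (Poly_Mapping.single j k) 1"
proof (induction k)
  case (Suc k)
  have "PX j ^ Suc k = Poly_Mapping.single (Poly_Mapping.single j 1) 1 * Poly_Mapping.single (Poly_Mapping.single j k) 1"
    using Suc by (simp add: PX_def)
  then show ?case by (simp add: mult_single single_add[symmetric])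
qed (simp flip: single_one)

lemma prod_single: "(\<Prod>j\<in>S. Poly_Mapping.single (f j) (1::complex)) = Poly_Mapping.single (sum f S) 1"
  by (induction S rule: infinite_finite_induct) (simp_all add: mult_single flip: single_one)

lemma single_monomial: "Poly_Mapping.single (m :: 'n::finite \<Rightarrow>\<^sub>0 nat) (1::complex) = (\<Prod>j\<in>UNIV. PX j ^ lkp m j)"
proof -
  have "m = (\<Sum>j\<in>UNIV. Poly_Mapping.single j (lkp m j))"
    by (rule poly_mapping_eqI) (simp add: lookup_sum lookup_single when_def)
  then show ?thesis by (simp add: PX_power prod_single)
qed

lemma PC_hom [simp]: "PC 0 = 0" "PC 1 = 1" "PC (a + b) = PC a + PC b" "PC (a * b) = PC a * PC b" "PC (- a) = - PC a" "PC (a - b) = PC a - PC b"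
  by (simp_all add: PC_def single_add mult_single single_uminus single_diff)

lemma mpoly_induct [case_names const var add mult]:
  fixes p :: "'n::finite mpoly"
  assumes "\<And>c. Q (PC c)" "\<And>j. Q (PX j)" and add: "\<And>p q. Q p \<Longrightarrow> Q q \<Longrightarrow> Q (p + q)"
    and mult: "\<And>p q. Q p \<Longrightarrow> Q q \<Longrightarrow> Q (p * q)"
  shows "Q p"
proof -
  have pow: "Q (x ^ k)" if "Q x" for x k
    using that assms(1)[of 1] by (induction k) (auto intro: mult)
  have prod: "Q (prod f S)" if "\<And>j. Q (f j)" for f :: "'n \<Rightarrow> _" and S
    using that assms(1)[of 1] by (induction S rule: infinite_finite_induct) (auto intro: mult)
  have mono: "Q (Poly_Mapping.single m c)" for m c
    by (subst single_PC, subst single_monomial) (intro mult assms(1) prod pow assms(2))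
  have "Q (\<Sum>m\<in>S. Poly_Mapping.single m (lkp p m))" for S
    using assms(1)[of 0] by (induction S rule: infinite_finite_induct) (auto intro: add mono)
  then have "Q (\<Sum>m\<in>pkeys p. Poly_Mapping.single m (lkp p m))" .
  then show ?thesis by (simp only: poly_mapping_sum_single[symmetric])
qed

text \<open>Coefficient map and values live in an arbitrary commutative ring, so that one evaluation
  serves points of affine space, substitutions of polynomials for variables and the passage to
  polynomials in one variable.\<close>

definition meval :: "(complex \<Rightarrow> 'r::comm_ring_1) \<Rightarrow> ('n::finite \<Rightarrow> 'r) \<Rightarrow> 'n mpoly \<Rightarrow> 'r" where
  "meval h x p = (\<Sum>m\<in>pkeys p. h (lkp p m) * (\<Prod>j\<in>UNIV. x j ^ lkp m j))"

lemma meval_superset: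
  assumes "h 0 = 0" "finite K" "pkeys p \<subseteq> K"
  shows "meval h x p = (\<Sum>m\<in>K. h (lkp p m) * (\<Prod>j\<in>UNIV. x j ^ lkp m j))"
  unfolding meval_def using assms by (intro sum.mono_neutral_left) (auto simp: in_keys_iff)

locale mpoly_eval = h: comm_ring_hom h for h :: "complex \<Rightarrow> 'r::comm_ring_1" +
  fixes x :: "'n::finite \<Rightarrow> 'r"
begin

abbreviation "ev \<equiv> meval h x"

lemma ev_add: "ev (p + q) = ev p + ev q"
proof -
  let ?K = "pkeys p \<union> pkeys q"
  have "pkeys (p + q) \<subseteq> ?K" by (rule keys_add)
  then show ?thesis
    by (subst (1 2 3) meval_superset[where K = ?K])
      (simp_all add: lookup_add h.hom_add distrib_right sum.distrib)
qed

lemma ev_single: "ev (Poly_Mapping.single m c) = h c * (\<Prod>j\<in>UNIV. x j ^ lkp m j)"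
  by (subst meval_superset[where K = "{m}"]) (auto simp: keys_single)

lemma ev_PC [simp]: "ev (PC c) = h c"
  by (simp add: PC_def ev_single)

lemma ev_PX [simp]: "ev (PX j) = x j"
proof -
  have "(\<Prod>i\<in>UNIV. x i ^ lkp (Poly_Mapping.single j 1) i) = (\<Prod>i\<in>UNIV. if i = j then x i else 1)"
    by (intro prod.cong) (auto simp: lookup_single when_def)
  then show ?thesis by (simp add: PX_def ev_single)
qed

lemma ev_zero: "ev 0 = 0" by (simp add: meval_def)

lemma ev_sum: "ev (sum f S) = (\<Sum>i\<in>S. ev (f i))"
  by (induction S rule: infinite_finite_induct) (simp_all add: ev_zero ev_add)

lemma ev_mult: "ev (p * q) = ev p * ev q"
proof -
  have 1: "ev (Poly_Mapping.single m c * Poly_Mapping.single m' c') =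
    ev (Poly_Mapping.single m c) * ev (Poly_Mapping.single m' c')" for m c m' c'
    by (simp add: mult_single ev_single h.hom_mult lookup_add power_add prod.distrib mult_ac)
  have "ev (p * q) = ev ((\<Sum>m\<in>pkeys p. Poly_Mapping.single m (lkp p m)) * (\<Sum>m\<in>pkeys q. Poly_Mapping.single m (lkp q m)))"
    by (simp only: poly_mapping_sum_single[symmetric])
  also have "\<dots> = ev (\<Sum>m\<in>pkeys p. Poly_Mapping.single m (lkp p m)) * ev (\<Sum>m\<in>pkeys q. Poly_Mapping.single m (lkp q m))"
    by (simp add: sum_product ev_sum 1)
  also have "\<dots> = ev p * ev q"
    by (simp only: poly_mapping_sum_single[symmetric])
  finally show ?thesis .
qed

sublocale comm_ring_hom ev
proof
  show "ev 1 = 1" using ev_PC[of 1] by simp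
qed (simp_all add: ev_zero ev_add ev_mult)

lemma axioms_ev: "comm_ring_hom ev" by unfold_locales

end

lemma mpoly_hom_eqI:
  assumes "comm_ring_hom (f :: 'n::finite mpoly \<Rightarrow> _)" "comm_ring_hom g" "\<And>c. f (PC c) = g (PC c)" "\<And>j. f (PX j) = g (PX j)"
  shows "f p = g p"
proof -
  interpret f: comm_ring_hom f by fact
  interpret g: comm_ring_hom g by fact
  show ?thesis
    by (induction p rule: mpoly_induct) (simp_all add: assms f.hom_add g.hom_add f.hom_mult g.hom_mult)
qed

lemma comm_ring_hom_comp: "comm_ring_hom f \<Longrightarrow> comm_ring_hom g \<Longrightarrow> comm_ring_hom (\<lambda>p. g (f p))"
proof -
  assume "comm_ring_hom f" "comm_ring_hom g"
  then interpret f: comm_ring_hom f + g: comm_ring_hom g .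
  show ?thesis by unfold_locales (simp_all add: f.hom_add f.hom_mult g.hom_add g.hom_mult)
qed

lemma comm_ring_hom_PC: "comm_ring_hom (PC :: complex \<Rightarrow> 'n mpoly)"
  by unfold_locales simp_all

lemma comm_ring_hom_meval: "comm_ring_hom h \<Longrightarrow> comm_ring_hom (meval h x)"
  by (rule mpoly_eval.axioms_ev) (simp add: mpoly_eval_def)

lemma meval_PC: "comm_ring_hom h \<Longrightarrow> meval h x (PC c) = h c"
  and meval_PX: "comm_ring_hom h \<Longrightarrow> meval h x (PX j) = x j"
  by (simp_all add: mpoly_eval.ev_PC mpoly_eval.ev_PX mpoly_eval_def)

lemma comm_ring_hom_ident: "comm_ring_hom (\<lambda>x. x)" by unfold_locales simp_all

lemma peval_eq_meval: "peval p x = meval (\<lambda>c. c) (vec_nth x) p"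
  by (simp add: peval_def meval_def)

interpretation peval: comm_ring_hom "\<lambda>p :: 'n::finite mpoly. peval p x"
  unfolding peval_eq_meval by (rule comm_ring_hom_meval[OF comm_ring_hom_ident])

lemma peval_PC [simp]: "peval (PC c) x = c" and peval_PX [simp]: "peval (PX j) x = vec_nth x j"
  by (simp_all add: peval_eq_meval meval_PC meval_PX comm_ring_hom_ident)

section \<open>Weights that separate monomials\<close>

lemma base_digits_unique:
  fixes a b :: "nat \<Rightarrow> nat"
  assumes "(\<Sum>i<n. a i * K ^ i) = (\<Sum>i<n. b i * K ^ i)" "\<And>i. i < n \<Longrightarrow> a i < K" "\<And>i. i < n \<Longrightarrow> b i < K" "i < n"
  shows "a i = b i"
  using assms
proof (induction n arbitrary: a b i)
  case (Suc n)
  have s: "(\<Sum>i<Suc n. f i * K ^ i) = f 0 + K * (\<Sum>i<n. f (Suc i) * K ^ i)" for f :: "nat \<Rightarrow> nat"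
    by (simp add: sum.lessThan_Suc_shift sum_distrib_left mult_ac del: sum.lessThan_Suc)
  have eq: "a 0 + K * (\<Sum>i<n. a (Suc i) * K ^ i) = b 0 + K * (\<Sum>i<n. b (Suc i) * K ^ i)"
    using Suc.prems(1) by (simp only: s)
  have lt: "a 0 < K" "b 0 < K" using Suc.prems by auto
  have 0: "a 0 = b 0" using arg_cong[OF eq, of "\<lambda>x. x mod K"] lt by simp
  then have eq': "(\<Sum>i<n. a (Suc i) * K ^ i) = (\<Sum>i<n. b (Suc i) * K ^ i)" using eq lt by simp
  have "a (Suc i) = b (Suc i)" if "i < n" for i
    by (rule Suc.IH[OF eq' _ _ that]) (use Suc.prems(2,3) in auto)
  then show ?case using 0 Suc.prems(4) by (cases i) auto
qed simp

definition weight :: "('n \<Rightarrow> nat) \<Rightarrow> ('n::finite \<Rightarrow>\<^sub>0 nat) \<Rightarrow> nat" where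
  "weight w m = (\<Sum>j\<in>UNIV. w j * lkp m j)"

lemma weight_add: "weight w (m + m') = weight w m + weight w m'"
  by (simp add: weight_def lookup_add algebra_simps sum.distrib)

lemma ex_enum_from:
  obtains e :: "'n::finite \<Rightarrow> nat" where "bij_betw e UNIV {..<CARD('n)}" "e v = 0"
proof -
  obtain e0 :: "'n \<Rightarrow> nat" where e0: "bij_betw e0 UNIV {0..<CARD('n)}"
    using ex_bij_betw_finite_nat[of "UNIV :: 'n set"] by auto
  have "0 \<in> e0 ` UNIV" using e0 by (simp add: bij_betw_def)
  then obtain u where u: "e0 u = 0" by auto
  have "bij_betw (e0 \<circ> Transposition.transpose u v) UNIV {0..<CARD('n)}"
    using e0 by (intro bij_betw_trans[of _ UNIV UNIV]) auto
  then show ?thesis using that[of "e0 \<circ> Transposition.transpose u v"] u by (simp add: atLeast0LessThan)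
qed

text \<open>The weights are powers of a base \<open>K\<close> exceeding all exponents in
  \<open>S\<close>, so the weight of a monomial has its exponents as digits. The enumeration starts
  at \<open>v\<close>, which thereby gets \<open>K ^ 0 = 1\<close>; Nagata's change of variables
  needs this to keep \<open>x_v\<close> itself as the distinguished variable.\<close>

lemma ex_weight:
  fixes S :: "('n::finite \<Rightarrow>\<^sub>0 nat) set" and v :: 'n
  assumes "finite S"
  obtains w where "inj_on (weight w) S" "\<And>j. w j \<ge> 1" "w v = 1"
proof -
  obtain e :: "'n \<Rightarrow> nat" where e: "bij_betw e UNIV {..<CARD('n)}" "e v = 0" by (rule ex_enum_from)
  define K where "K = Suc (\<Sum>m\<in>S. \<Sum>j\<in>UNIV. lkp m j)"
  have K: "lkp m j < K" if "m \<in> S" for m j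
  proof -
    have "lkp m j \<le> (\<Sum>j\<in>UNIV. lkp m j)" by (intro member_le_sum) auto
    also have "\<dots> \<le> (\<Sum>m\<in>S. \<Sum>j\<in>UNIV. lkp m j)"
      by (rule member_le_sum[OF that, of "\<lambda>m. \<Sum>j\<in>UNIV. lkp m j"]) (use assms in auto)
    finally show ?thesis by (simp add: K_def)
  qed
  define w where "w j = K ^ e j" for j
  let ?d = "inv_into UNIV e"
  have ed: "e (?d i) = i" if "i < CARD('n)" for i
    using that bij_betw_inv_into_right[OF e(1)] by simp
  have de: "?d (e j) = j" for j using bij_betw_inv_into_left[OF e(1)] by simp
  have wt: "weight w m = (\<Sum>i<CARD('n). lkp m (?d i) * K ^ i)" for m
    unfolding weight_def w_def
    by (subst sum.reindex_bij_betw[OF e(1), symmetric]) (simp add: de mult.commute)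
  have "inj_on (weight w) S"
  proof (rule inj_onI, rule poly_mapping_eqI)
    fix m m' j assume m: "m \<in> S" "m' \<in> S" "weight w m = weight w m'"
    have "lkp m (?d (e j)) = lkp m' (?d (e j))"
      using m e(1) by (intro base_digits_unique[of "\<lambda>i. lkp m (?d i)" K "CARD('n)" "\<lambda>i. lkp m' (?d i)"])
        (auto simp: wt K bij_betw_def)
    then show "lkp m j = lkp m' j" by (simp add: de)
  qed
  moreover have "w j \<ge> 1" for j by (simp add: w_def K_def)
  ultimately show ?thesis using that[of w] e(2) by (simp add: w_def)
qed

lemma lookup_mult_unique:
  fixes p q :: "'n mpoly"
  assumes "k \<in> pkeys p" "m \<in> pkeys q"
    and "\<And>k' m'. k' \<in> pkeys p \<Longrightarrow> m' \<in> pkeys q \<Longrightarrow> k' + m' = k + m \<Longrightarrow> k' = k \<and> m' = m"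
  shows "lkp (p * q) (k + m) = lkp p k * lkp q m"
proof -
  have "p * q = (\<Sum>k'\<in>pkeys p. \<Sum>m'\<in>pkeys q. Poly_Mapping.single (k' + m') (lkp p k' * lkp q m'))"
    by (subst (1) poly_mapping_sum_single[of p], subst (1) poly_mapping_sum_single[of q]) (simp add: sum_product mult_single)
  then have "lkp (p * q) (k + m) = (\<Sum>k'\<in>pkeys p. \<Sum>m'\<in>pkeys q. if k' = k \<and> m' = m then lkp p k' * lkp q m' else 0)"
    using assms(3) by (auto simp: lookup_sum lookup_single when_def intro!: sum.cong)
  also have "\<dots> = (\<Sum>k'\<in>pkeys p. if k' = k then \<Sum>m'\<in>pkeys q. if m' = m then lkp p k' * lkp q m' else 0 else 0)"
    by (intro sum.cong) auto
  also have "\<dots> = lkp p k * lkp q m" using assms(1,2) by (simp add: sum.delta)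
  finally show ?thesis .
qed

text \<open>The lightest monomials of the two factors combine to a monomial that no other pair of
  keys produces, because the weight is injective on the keys.\<close>

lemma mpoly_no_zero_divisors:
  fixes p q :: "'n::finite mpoly"
  assumes "p * q = 0"
  shows "p = 0 \<or> q = 0"
proof (rule ccontr)
  assume "\<not> (p = 0 \<or> q = 0)"
  then have ne: "pkeys p \<noteq> {}" "pkeys q \<noteq> {}" by auto
  obtain w where w: "inj_on (weight w) (pkeys p \<union> pkeys q)"
    by (rule ex_weight[of "pkeys p \<union> pkeys q" undefined]) auto
  obtain k where k: "k \<in> pkeys p" "\<And>k'. k' \<in> pkeys p \<Longrightarrow> weight w k \<le> weight w k'"
    using ne ex_has_least_nat[of "\<lambda>k. k \<in> pkeys p" _ "weight w"] by blast
  obtain m where m: "m \<in> pkeys q" "\<And>k'. k' \<in> pkeys q \<Longrightarrow> weight w m \<le> weight w k'"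
    using ne ex_has_least_nat[of "\<lambda>k. k \<in> pkeys q" _ "weight w"] by blast
  have "lkp (p * q) (k + m) = lkp p k * lkp q m"
  proof (rule lookup_mult_unique[OF k(1) m(1)])
    fix k' m' assume *: "k' \<in> pkeys p" "m' \<in> pkeys q" "k' + m' = k + m"
    have "weight w k' + weight w m' = weight w k + weight w m" using * by (simp flip: weight_add)
    then have "weight w k' = weight w k" "weight w m' = weight w m"
      using k(2)[OF *(1)] m(2)[OF *(2)] by linarith+
    then show "k' = k \<and> m' = m" using w * k(1) m(1) by (auto dest: inj_onD)
  qed
  then show False using k(1) m(1) assms by (simp add: in_keys_iff)
qed

lemma cprime_zero: "cprime {0 :: 'n::finite mpoly}"
  by (auto simp: cprime_def cideal_def dest: mpoly_no_zero_divisors)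

lemma mpoly_power_eq_0D: "p ^ k = (0 :: 'n::finite mpoly) \<Longrightarrow> p = 0"
  using cprime_power[OF cprime_zero] by auto

subsection \<open>Polynomials with bounded exponents\<close>

text \<open>Each exponent is bounded separately instead of the total degree: the monomials then fill
  a box with at most \<open>(D + 1) ^ n\<close> members, and bounds add under products.\<close>

definition bounded_exps :: "'n mpoly \<Rightarrow> nat \<Rightarrow> bool" where
  "bounded_exps p D \<longleftrightarrow> (\<forall>m\<in>pkeys p. \<forall>j. lkp m j \<le> D)"

lemma bounded_exps_mult: "bounded_exps p D \<Longrightarrow> bounded_exps q E \<Longrightarrow> bounded_exps (p * q) (D + E)"
  unfolding bounded_exps_def using keys_mult[of p q] by (force simp: lookup_add intro!: add_mono)

lemma bounded_exps_mono: "bounded_exps p D \<Longrightarrow> D \<le> E \<Longrightarrow> bounded_exps p E"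
  unfolding bounded_exps_def using order_trans by blast

lemma bounded_exps_one: "bounded_exps 1 D"
  by (simp add: bounded_exps_def)

lemma bounded_exps_power: "bounded_exps p D \<Longrightarrow> bounded_exps (p ^ k) (k * D)"
  by (induction k) (auto simp: bounded_exps_one intro: bounded_exps_mult)

lemma bounded_exps_prod: "(\<And>i. i \<in> S \<Longrightarrow> bounded_exps (f i) (d i)) \<Longrightarrow> bounded_exps (prod f S) (sum d S)"
  by (induction S rule: infinite_finite_induct) (auto simp: bounded_exps_one intro: bounded_exps_mult)

lemma ex_bounded_exps: "\<exists>D. bounded_exps (p :: 'n::finite mpoly) D"
proof (intro exI)
  show "bounded_exps p (\<Sum>m\<in>pkeys p. \<Sum>j\<in>UNIV. lkp m j)"
    unfolding bounded_exps_def
  proof (intro ballI allI)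
    fix m j assume m: "m \<in> pkeys p"
    have "lkp m j \<le> (\<Sum>j\<in>UNIV. lkp m j)" by (intro member_le_sum) auto
    also have "\<dots> \<le> (\<Sum>m\<in>pkeys p. \<Sum>j\<in>UNIV. lkp m j)"
      by (rule member_le_sum[OF m, of "\<lambda>m. \<Sum>j\<in>UNIV. lkp m j"]) auto
    finally show "lkp m j \<le> (\<Sum>m\<in>pkeys p. \<Sum>j\<in>UNIV. lkp m j)" .
  qed
qed

interpretation mpvs: vector_space "\<lambda>c (p :: 'n mpoly). PC c * p"
  by unfold_locales (simp_all add: algebra_simps)

lemma finite_monomials: "finite {m :: 'n::finite \<Rightarrow>\<^sub>0 nat. \<forall>j. lkp m j \<le> D}" (is "finite ?M")
  and card_monomials: "card {m :: 'n::finite \<Rightarrow>\<^sub>0 nat. \<forall>j. lkp m j \<le> D} \<le> (D + 1) ^ CARD('n)"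
proof -
  have inj: "inj_on lkp ?M" by (rule inj_onI) (simp add: poly_mapping_eqI)
  have sub: "lkp ` ?M \<subseteq> (UNIV :: 'n set) \<rightarrow>\<^sub>E {..D}" by auto
  have fin: "finite ((UNIV :: 'n set) \<rightarrow>\<^sub>E {..D})" by (intro finite_PiE) auto
  show "finite ?M" using finite_imageD[OF finite_subset[OF sub fin] inj] .
  have "card ?M = card (lkp ` ?M)" by (rule card_image[OF inj, symmetric])
  also have "\<dots> \<le> card ((UNIV :: 'n set) \<rightarrow>\<^sub>E {..D})" by (rule card_mono[OF fin sub])
  also have "\<dots> = (D + 1) ^ CARD('n)" by (simp add: card_PiE)
  finally show "card ?M \<le> (D + 1) ^ CARD('n)" .
qed

text \<open>There are more polynomials than monomials in the box. A repeated value is treated apart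
  because \<open>dependent\<close> speaks of the set of values, which forgets repetitions.\<close>

lemma bounded_exps_dependent:
  fixes g :: "'a \<Rightarrow> 'n::finite mpoly"
  assumes S: "finite S" "card S > (D + 1) ^ CARD('n)" and g: "\<And>s. s \<in> S \<Longrightarrow> bounded_exps (g s) D"
  obtains c where "(\<Sum>s\<in>S. PC (c s) * g s) = 0" "\<exists>s\<in>S. c s \<noteq> 0"
proof (cases "inj_on g S")
  case False
  then obtain s t where st: "s \<in> S" "t \<in> S" "s \<noteq> t" "g s = g t" by (auto simp: inj_on_def)
  define c where "c u = (if u = s then 1 else if u = t then - 1 else 0 :: complex)" for u
  have "(\<Sum>u\<in>S. PC (c u) * g u) = (\<Sum>u\<in>{s, t}. PC (c u) * g u)"
    using st S by (intro sum.mono_neutral_right) (auto simp: c_def)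
  also have "\<dots> = 0" using st by (simp add: c_def)
  finally show ?thesis using that[of c] st(1) by (force simp: c_def)
next
  case True
  let ?M = "(\<lambda>m. Poly_Mapping.single m (1::complex)) ` {m :: 'n \<Rightarrow>\<^sub>0 nat. \<forall>j. lkp m j \<le> D}"
  have M: "finite ?M" "card ?M \<le> (D + 1) ^ CARD('n)"
    using finite_monomials[of D] card_image_le[OF finite_monomials[of D]] card_monomials[of D, where 'n='n] by (auto intro: order_trans)
  have "g ` S \<subseteq> mpvs.span ?M"
  proof
    fix p assume "p \<in> g ` S"
    then have p: "bounded_exps p D" using g by auto
    have "(\<Sum>m\<in>pkeys p. PC (lkp p m) * Poly_Mapping.single m 1) \<in> mpvs.span ?M"
      using p by (intro mpvs.span_sum mpvs.span_scale mpvs.span_base) (auto simp: bounded_exps_def)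
    then show "p \<in> mpvs.span ?M"
      by (simp only: single_PC[symmetric] poly_mapping_sum_single[symmetric])
  qed
  moreover have "\<not> card (g ` S) \<le> card ?M" using S M card_image[OF True] by simp
  ultimately have "mpvs.dependent (g ` S)" using mpvs.independent_span_bound[OF M(1)] by blast
  then obtain u where u: "\<exists>p\<in>g ` S. u p \<noteq> 0" "(\<Sum>p\<in>g ` S. PC (u p) * p) = 0"
    using mpvs.dependent_finite[of "g ` S"] S by auto
  then show ?thesis using that[of "u \<circ> g"] by (auto simp: sum.reindex[OF True])
qed

text \<open>Downward induction: after division by the least power of \<open>f i\<close>, which lies
  outside the prime \<open>P i\<close>, all terms that still contain \<open>f i\<close> vanish
  modulo \<open>P (Suc i)\<close>, and the induction hypothesis applies to the rest. So the
  \<open>f j\<close> are algebraically independent over the constants.\<close>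

lemma monomials_independent_mod_chain:
  fixes P :: "nat \<Rightarrow> 'n::finite mpoly set"
  assumes P: "\<And>i. i \<le> m \<Longrightarrow> cprime (P i)" "\<And>i. i < m \<Longrightarrow> P i \<subseteq> P (Suc i)"
    and f: "\<And>i. i < m \<Longrightarrow> f i \<in> P (Suc i)" "\<And>i. i < m \<Longrightarrow> f i \<notin> P i"
    and i: "i \<le> m" and S: "finite S" "S \<noteq> {}" "\<And>\<alpha> \<beta>. \<alpha> \<in> S \<Longrightarrow> \<beta> \<in> S \<Longrightarrow> (\<forall>j\<in>{i..<m}. \<alpha> j = \<beta> j) \<Longrightarrow> \<alpha> = \<beta>"
    and c: "\<And>\<alpha>. \<alpha> \<in> S \<Longrightarrow> c \<alpha> \<noteq> 0"
  shows "(\<Sum>\<alpha>\<in>S. PC (c \<alpha>) * (\<Prod>j\<in>{i..<m}. f j ^ \<alpha> j)) \<notin> P i"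
  using i S c
proof (induction i arbitrary: S rule: inc_induct)
  case base
  then obtain \<alpha> where \<alpha>: "\<alpha> \<in> S" by blast
  have "\<beta> = \<alpha>" if "\<beta> \<in> S" for \<beta>
    by (rule base(3)[OF that \<alpha>]) simp
  then have S: "S = {\<alpha>}" using \<alpha> by blast
  have "PC (inverse (c \<alpha>)) * PC (c \<alpha>) = (1 :: 'n mpoly)"
    using base(4)[of \<alpha>] S by (simp flip: PC_hom(4))
  then have "PC (c \<alpha>) \<notin> P m"
    using cideal_mult[OF cprime_ideal[OF P(1)[OF order_refl]], of "PC (c \<alpha>)" "PC (inverse (c \<alpha>))"] cprime_one[OF P(1)[OF order_refl]] by auto
  then show ?case using S by simp
next
  case (step i)
  have i: "i < m" by (rule step.hyps)
  note Pi = P(1)[of i] and Psi = P(1)[of "Suc i"]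
  obtain a where a: "a \<in> (\<lambda>\<alpha>. \<alpha> i) ` S" "\<And>b. b \<in> (\<lambda>\<alpha>. \<alpha> i) ` S \<Longrightarrow> a \<le> b"
  proof
    show "Min ((\<lambda>\<alpha>. \<alpha> i) ` S) \<in> (\<lambda>\<alpha>. \<alpha> i) ` S" using step.prems(1,2) by (intro Min_in) auto
    show "Min ((\<lambda>\<alpha>. \<alpha> i) ` S) \<le> b" if "b \<in> (\<lambda>\<alpha>. \<alpha> i) ` S" for b
      using step.prems(1) that by (intro Min_le) auto
  qed
  define T where "T = {\<alpha>\<in>S. \<alpha> i = a}"
  let ?t = "\<lambda>\<alpha>. PC (c \<alpha>) * (\<Prod>j\<in>{Suc i..<m}. f j ^ \<alpha> j)"
  let ?r = "\<Sum>\<alpha>\<in>S. f i ^ (\<alpha> i - a) * ?t \<alpha>"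
  have "(\<Sum>\<alpha>\<in>S. PC (c \<alpha>) * (\<Prod>j\<in>{i..<m}. f j ^ \<alpha> j)) = f i ^ a * ?r"
    unfolding sum_distrib_left
  proof (rule sum.cong[OF refl])
    fix \<alpha> assume "\<alpha> \<in> S"
    then have "a \<le> \<alpha> i" using a by auto
    then have "f i ^ \<alpha> i = f i ^ a * f i ^ (\<alpha> i - a)" by (simp flip: power_add)
    then show "PC (c \<alpha>) * (\<Prod>j\<in>{i..<m}. f j ^ \<alpha> j) = f i ^ a * (f i ^ (\<alpha> i - a) * ?t \<alpha>)"
      using i by (simp add: prod.atLeast_Suc_lessThan mult_ac)
  qed
  moreover have "?r \<notin> P i"
  proof
    assume "?r \<in> P i"
    then have r: "?r \<in> P (Suc i)" using P(2)[OF i] by blast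
    have "?r = (\<Sum>\<alpha>\<in>T. f i ^ (\<alpha> i - a) * ?t \<alpha>) + (\<Sum>\<alpha>\<in>S - T. f i ^ (\<alpha> i - a) * ?t \<alpha>)"
      using step.prems(1) by (subst sum.subset_diff[of T S]) (auto simp: T_def)
    moreover have "(\<Sum>\<alpha>\<in>S - T. f i ^ (\<alpha> i - a) * ?t \<alpha>) \<in> P (Suc i)"
    proof (intro cideal_sum cideal_mult_right cprime_ideal Psi)
      fix \<alpha> assume "\<alpha> \<in> S - T"
      then have "\<alpha> i - a = Suc (\<alpha> i - a - 1)" using a by (force simp: T_def)
      then have "f i ^ (\<alpha> i - a) = f i ^ (\<alpha> i - a - 1) * f i" by (metis power_Suc2)
      then show "f i ^ (\<alpha> i - a) \<in> P (Suc i)"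
        using cideal_mult[OF cprime_ideal[OF Psi] f(1)[OF i]] i by simp
    qed (use i in auto)
    ultimately have "(\<Sum>\<alpha>\<in>T. f i ^ (\<alpha> i - a) * ?t \<alpha>) \<in> P (Suc i)"
      using cideal_diff[OF cprime_ideal[OF Psi] r] i by fastforce
    moreover have "(\<Sum>\<alpha>\<in>T. f i ^ (\<alpha> i - a) * ?t \<alpha>) = (\<Sum>\<alpha>\<in>T. ?t \<alpha>)"
      by (intro sum.cong) (auto simp: T_def)
    moreover have "(\<Sum>\<alpha>\<in>T. ?t \<alpha>) \<notin> P (Suc i)"
    proof (rule step.IH)
      show "finite T" "T \<noteq> {}" using step.prems a by (auto simp: T_def)
      fix \<alpha> \<beta> assume ab: "\<alpha> \<in> T" "\<beta> \<in> T" "\<forall>j\<in>{Suc i..<m}. \<alpha> j = \<beta> j"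
      then have "\<forall>j\<in>{i..<m}. \<alpha> j = \<beta> j" by (auto simp: T_def) (metis Suc_leI atLeastLessThan_iff le_neq_implies_less)
      then show "\<alpha> = \<beta>" using step.prems(3) ab by (auto simp: T_def)
    qed (use step.prems in \<open>auto simp: T_def\<close>)
    ultimately show False by simp
  qed
  moreover have "f i ^ a \<notin> P i" using cprime_power[OF Pi] f(2)[OF i] i by force
  ultimately show ?case
    using cprime_mult[OF Pi, of "f i ^ a" ?r] i by auto
qed

theorem prime_chain_le_card:
  fixes P :: "nat \<Rightarrow> 'n::finite mpoly set"
  assumes P: "\<And>i. i \<le> m \<Longrightarrow> cprime (P i)" "\<And>i. i < m \<Longrightarrow> P i \<subset> P (Suc i)"
  shows "m \<le> CARD('n)"
proof (rule ccontr)
  assume m: "\<not> m \<le> CARD('n)"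
  have "\<forall>i<m. \<exists>x. x \<in> P (Suc i) \<and> x \<notin> P i" using P(2) by blast
  then obtain f where f: "\<And>i. i < m \<Longrightarrow> f i \<in> P (Suc i)" "\<And>i. i < m \<Longrightarrow> f i \<notin> P i" by metis
  have "\<forall>i. \<exists>D. bounded_exps (f i) D" using ex_bounded_exps by blast
  then obtain d where d: "\<And>i. bounded_exps (f i) (d i)" by metis
  \<comment> \<open>\<open>N * (E - 1)\<close> bounds every exponent in a product of the
    \<open>f j\<close> with powers up to \<open>N\<close>. With \<open>N = E ^ n\<close> the
    \<open>(N + 1) ^ m\<close> products outnumber the at most \<open>((N + 1) * E) ^ n\<close>
    monomials as soon as \<open>m > n\<close>.\<close>
  define E where "E = Suc (\<Sum>i<m. d i)"
  define N where "N = E ^ CARD('n)"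
  define S where "S = ({..<m} \<rightarrow>\<^sub>E {..N} :: (nat \<Rightarrow> nat) set)"
  let ?g = "\<lambda>\<alpha>. \<Prod>j\<in>{0..<m}. f j ^ \<alpha> j"
  have cardS: "card S = (N + 1) ^ m" by (simp add: S_def card_PiE)
  have finS: "finite S" by (auto simp: S_def intro!: finite_PiE)
  have bd: "bounded_exps (?g \<alpha>) (N * (E - 1))" if "\<alpha> \<in> S" for \<alpha>
  proof (rule bounded_exps_mono[OF bounded_exps_prod])
    show "bounded_exps (f j ^ \<alpha> j) (\<alpha> j * d j)" for j by (rule bounded_exps_power[OF d])
    have "(\<Sum>j\<in>{0..<m}. \<alpha> j * d j) \<le> (\<Sum>j\<in>{0..<m}. N * d j)"
      using that by (intro sum_mono mult_right_mono) (auto simp: S_def)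
    then show "(\<Sum>j\<in>{0..<m}. \<alpha> j * d j) \<le> N * (E - 1)"
      by (simp add: E_def sum_distrib_left atLeast0LessThan)
  qed
  have "N * (E - 1) + 1 \<le> (N + 1) * E"
    by (cases E) (auto simp: E_def)
  then have "(N * (E - 1) + 1) ^ CARD('n) \<le> ((N + 1) * E) ^ CARD('n)" by (rule power_mono) simp
  also have "\<dots> = (N + 1) ^ CARD('n) * N" by (simp only: power_mult_distrib N_def)
  also have "\<dots> < (N + 1) ^ CARD('n) * (N + 1)" by simp
  also have "\<dots> = (N + 1) ^ Suc (CARD('n))" by simp
  also have "\<dots> \<le> (N + 1) ^ m" using m by (intro power_increasing) auto
  finally have big: "card S > (N * (E - 1) + 1) ^ CARD('n)" using cardS by simp
  obtain c where c: "(\<Sum>\<alpha>\<in>S. PC (c \<alpha>) * ?g \<alpha>) = 0" "\<exists>\<alpha>\<in>S. c \<alpha> \<noteq> 0"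
    by (rule bounded_exps_dependent[where g = ?g, OF finS big bd])
  define T where "T = {\<alpha>\<in>S. c \<alpha> \<noteq> 0}"
  have "(\<Sum>\<alpha>\<in>T. PC (c \<alpha>) * ?g \<alpha>) \<notin> P 0"
  proof (rule monomials_independent_mod_chain[of m P f 0 T c])
    fix \<alpha> \<beta> assume "\<alpha> \<in> T" "\<beta> \<in> T" "\<forall>j\<in>{0..<m}. \<alpha> j = \<beta> j"
    then show "\<alpha> = \<beta>" by (auto simp: T_def S_def intro!: PiE_ext[of \<alpha> "{..<m}" "\<lambda>_. {..N}" \<beta>])
  qed (use P f c finS in \<open>auto simp: T_def\<close>)
  moreover have "(\<Sum>\<alpha>\<in>T. PC (c \<alpha>) * ?g \<alpha>) = (\<Sum>\<alpha>\<in>S. PC (c \<alpha>) * ?g \<alpha>)"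
    using finS by (intro sum.mono_neutral_left) (auto simp: T_def)
  ultimately show False using c(1) cideal_zero[OF cprime_ideal[OF P(1)]] by auto
qed

subsection \<open>Nullstellensatz\<close>

lemma PC_mem_ideal:
  assumes "cideal J" "(1 :: 'n mpoly) \<notin> J" "PC c \<in> J"
  shows "c = 0"
proof (rule ccontr)
  assume "c \<noteq> 0"
  then have "PC (inverse c) * PC c = (1 :: 'n mpoly)" by (simp flip: PC_hom(4))
  then show False using cideal_mult[OF assms(1,3), of "PC (inverse c)"] assms(2) by simp
qed

text \<open>Complex roots are split off one linear factor at a time. The prime contains one of the
  factors, and a nonzero constant cannot be the one because it is invertible.\<close>

lemma cprime_root:
  fixes J :: "'n::finite mpoly set" and h :: "complex poly"
  assumes J: "cprime J" and "h \<noteq> 0" "poly (map_poly PC h) (PX i) \<in> J"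
  shows "\<exists>c. PX i - PC c \<in> J"
  using assms(2,3)
proof (induction "degree h" arbitrary: h rule: less_induct)
  case less
  interpret PC: map_poly_comm_ring_hom "PC :: complex \<Rightarrow> 'n mpoly"
    by (intro map_poly_comm_ring_hom.intro comm_ring_hom_PC)
  show ?case
  proof (cases "degree h = 0")
    case True
    then obtain a where "h = [:a:]" by (elim degree_eq_zeroE)
    then show ?thesis
      using less.prems PC_mem_ideal[OF cprime_ideal[OF J] cprime_one[OF J], of a] by simp
  next
    case False
    then obtain r where "poly h r = 0"
      using fundamental_theorem_of_algebra[of h] constant_degree[of h] by auto
    then obtain g where g: "h = [:- r, 1:] * g" by (auto simp: poly_eq_0_iff_dvd dvd_def)
    then have "g \<noteq> 0" using less.prems by auto
    then have "degree h = degree [:- r, 1:] + degree g" unfolding g by (intro degree_mult_eq) auto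
    then have "degree g < degree h" by simp
    moreover have "poly (map_poly PC h) (PX i) = (PX i - PC r) * poly (map_poly PC g) (PX i)"
      unfolding g PC.hom_mult by (simp add: left_diff_distrib)
    ultimately show ?thesis using less.hyps[of g] less.prems(2) \<open>g \<noteq> 0\<close> cprime_mult[OF J] by metis
  qed
qed

text \<open>\<open>J\<close> becomes a maximal ideal once \<open>f\<close> is inverted. If no
  \<open>x_i - c\<close> were in \<open>J\<close>, each would be invertible there; uncountably many
  inverses in a space of countable dimension satisfy a linear relation, and cleared of denominators
  it is a nonzero polynomial in \<open>x_i\<close> alone, one of whose linear factors lies in
  \<open>J\<close>. Hence all variables are constant modulo \<open>J\<close>, and these constants
  are the coordinates of \<open>z\<close>.\<close>

theorem nullstellensatz:
  fixes Q :: "'n::finite mpoly set"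
  assumes Q: "cprime Q" and f: "f \<notin> Q"
  obtains z where "\<And>p. p \<in> Q \<Longrightarrow> peval p z = 0" "peval f z \<noteq> 0"
proof -
  let ?S = "range (\<lambda>k. f ^ k)"
  have "1 \<in> ?S" by (rule range_eqI[of _ _ 0]) simp
  moreover have "a * b \<in> ?S" if "a \<in> ?S" "b \<in> ?S" for a b
    using that by (auto simp flip: power_add)
  moreover have "Q \<inter> ?S = {}" using cprime_power[OF Q] f by auto
  ultimately obtain J where J: "cprime J" "Q \<subseteq> J" "J \<inter> ?S = {}"
    and max: "\<And>K. cideal K \<Longrightarrow> J \<subseteq> K \<Longrightarrow> K \<inter> ?S = {} \<Longrightarrow> K = J"
    using krull_maximal_avoiding[OF cprime_ideal[OF Q], of ?S] by metis
  note Ji = cprime_ideal[OF J(1)]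
  have fJ: "f ^ k \<notin> J" for k using J(3) by blast
  \<comment> \<open>By maximality, \<open>J\<close> together with \<open>g\<close> reaches a power
    of \<open>f\<close>: modulo \<open>J\<close>, every \<open>g\<close> outside is invertible once
    \<open>f\<close> is.\<close>
  have inv: "\<exists>a k. f ^ k - a * g \<in> J" if g: "g \<notin> J" for g
  proof (rule ccontr)
    assume *: "\<not> ?thesis"
    let ?K = "{j + r * g |j r. j \<in> J}"
    have "?K \<inter> ?S = {}"
    proof (rule ccontr)
      assume "?K \<inter> ?S \<noteq> {}"
      then obtain k j r where "f ^ k = j + r * g" "j \<in> J" by auto
      then have "f ^ k - r * g \<in> J" by simp
      then show False using * by blast
    qed
    moreover have "J \<subseteq> ?K"
    proof
      fix x assume "x \<in> J"
      then show "x \<in> ?K" by (intro CollectI exI[of _ x] exI[of _ 0]) simp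
    qed
    ultimately have "?K = J" by (intro max cideal_insert Ji)
    moreover have "g \<in> ?K" using cideal_zero[OF Ji] by (intro CollectI exI[of _ 0] exI[of _ 1]) simp
    ultimately show False using g by simp
  qed
  have var: "\<exists>c. PX i - PC c \<in> J" for i
  proof (rule ccontr)
    assume *: "\<not> ?thesis"
    have "\<exists>a k. f ^ k - a * (PX i - PC (complex_of_real c)) \<in> J" for c
      using inv * by blast
    then obtain a k where ak: "\<And>c. f ^ k c - a c * (PX i - PC (complex_of_real c)) \<in> J" by metis
    have "\<forall>c. \<exists>D. bounded_exps (a c) D" using ex_bounded_exps by blast
    then obtain d where d: "\<And>c. bounded_exps (a c) (d c)" by metis
    \<comment> \<open>There are countably many pairs of a power of \<open>f\<close> and an exponent
      bound, but uncountably many real \<open>c\<close>, so infinitely many \<open>c\<close> share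
      one pair.\<close>
    let ?F = "\<lambda>(l, D). {c. k c = l \<and> d c = D}"
    have "\<exists>y. infinite (?F y)"
    proof (rule ccontr)
      assume "\<nexists>y. infinite (?F y)"
      then have "countable (\<Union>y. ?F y)" by (intro countable_UN) (auto intro: countable_finite)
      moreover have "(\<Union>y. ?F y) = UNIV" by auto
      ultimately show False using uncountable_UNIV_real by simp
    qed
    then obtain l D where "infinite {c. k c = l \<and> d c = D}" by auto
    then obtain S where S: "finite S" "card S = Suc ((D + 1) ^ CARD('n))" "S \<subseteq> {c. k c = l \<and> d c = D}"
      using infinite_arbitrarily_large by blast
    have bd: "bounded_exps (a c) D" if "c \<in> S" for c using d[of c] S(3) that by auto
    obtain \<mu> where \<mu>: "(\<Sum>c\<in>S. PC (\<mu> c) * a c) = 0" "\<exists>c\<in>S. \<mu> c \<noteq> 0"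
      by (rule bounded_exps_dependent[where g = a, OF S(1) _ bd]) (use S(2) in auto)
    let ?x = "\<lambda>c. PX i - PC (complex_of_real c) :: 'n mpoly"
    \<comment> \<open>The relation between the \<open>a c\<close>, which stand for
      \<open>f ^ l / (x_i - c)\<close>, with its denominators cleared. At \<open>c0\<close> only the
      summand of \<open>c0\<close> survives, so \<open>h\<close> is not zero.\<close>
    define h where "h = (\<Sum>c\<in>S. Polynomial.smult (\<mu> c) (\<Prod>b\<in>S - {c}. [:- complex_of_real b, 1:]))"
    interpret PC: map_poly_comm_ring_hom "PC :: complex \<Rightarrow> 'n mpoly"
      by (intro map_poly_comm_ring_hom.intro comm_ring_hom_PC)
    have h_eval: "poly (map_poly PC h) (PX i) = (\<Sum>c\<in>S. PC (\<mu> c) * (\<Prod>b\<in>S - {c}. ?x b))"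
      by (simp add: h_def PC.hom_sum PC.hom_prod poly_sum poly_prod PC.base.map_poly_hom_smult algebra_simps)
    obtain c0 where c0: "c0 \<in> S" "\<mu> c0 \<noteq> 0" using \<mu>(2) by blast
    have "poly h (complex_of_real c0) = (\<Sum>c\<in>S. \<mu> c * (\<Prod>b\<in>S - {c}. complex_of_real c0 - complex_of_real b))"
      by (simp add: h_def poly_sum poly_prod)
    also have "\<dots> = (\<Sum>c\<in>S. if c = c0 then \<mu> c * (\<Prod>b\<in>S - {c}. complex_of_real c0 - complex_of_real b) else 0)"
      using S(1) c0 by (intro sum.cong) auto
    also have "\<dots> \<noteq> 0" using S(1) c0 by (auto simp: sum.delta)
    finally have "h \<noteq> 0" by auto
    have 1: "(\<Prod>b\<in>S. ?x b) = ?x c * (\<Prod>b\<in>S - {c}. ?x b)" if "c \<in> S" for c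
      using S(1) that by (rule prod.remove)
    have "(\<Sum>c\<in>S. PC (\<mu> c) * (f ^ l - a c * ?x c) * (\<Prod>b\<in>S - {c}. ?x b)) \<in> J"
    proof (intro cideal_sum[OF Ji])
      fix c assume "c \<in> S"
      then have "f ^ l - a c * ?x c \<in> J" using ak[of c] S(3) by auto
      then show "PC (\<mu> c) * (f ^ l - a c * ?x c) * (\<Prod>b\<in>S - {c}. ?x b) \<in> J"
        by (intro cideal_mult_right[OF Ji] cideal_mult[OF Ji])
    qed
    also have "(\<Sum>c\<in>S. PC (\<mu> c) * (f ^ l - a c * ?x c) * (\<Prod>b\<in>S - {c}. ?x b)) =
      f ^ l * (\<Sum>c\<in>S. PC (\<mu> c) * (\<Prod>b\<in>S - {c}. ?x b)) - (\<Sum>c\<in>S. PC (\<mu> c) * a c) * (\<Prod>b\<in>S. ?x b)"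
    proof -
      let ?R = "\<lambda>c. \<Prod>b\<in>S - {c}. ?x b"
      have "PC (\<mu> c) * (f ^ l - a c * ?x c) * ?R c = f ^ l * (PC (\<mu> c) * ?R c) - PC (\<mu> c) * a c * (\<Prod>b\<in>S. ?x b)"
        if c: "c \<in> S" for c
      proof -
        have ring: "p * (q - r * s) * t = q * (p * t) - p * r * (s * t)" for p q r s t :: "'n mpoly"
          by (simp add: algebra_simps)
        show ?thesis by (subst 1[OF c]) (rule ring)
      qed
      then have "(\<Sum>c\<in>S. PC (\<mu> c) * (f ^ l - a c * ?x c) * ?R c) =
        (\<Sum>c\<in>S. f ^ l * (PC (\<mu> c) * ?R c) - PC (\<mu> c) * a c * (\<Prod>b\<in>S. ?x b))"
        by (intro sum.cong) auto
      then show ?thesis by (simp only: sum_subtractf sum_distrib_left sum_distrib_right)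
    qed
    finally have "f ^ l * poly (map_poly PC h) (PX i) \<in> J" using \<mu>(1) by (simp add: h_eval)
    then have "poly (map_poly PC h) (PX i) \<in> J" using cprime_mult[OF J(1)] fJ by blast
    then show False using cprime_root[OF J(1) \<open>h \<noteq> 0\<close>] * by blast
  qed
  then obtain \<zeta> where \<zeta>: "\<And>i. PX i - PC (\<zeta> i) \<in> J" by metis
  define z where "z = vec_lambda \<zeta>"
  have cong: "p - PC (peval p z) \<in> J" for p
  proof (induction p rule: mpoly_induct)
    case (const c)
    then show ?case using cideal_zero[OF Ji] by simp
  next
    case (var j)
    then show ?case using \<zeta>[of j] by (simp add: z_def)
  next
    case (add p q)
    have "p + q - PC (peval (p + q) z) = (p - PC (peval p z)) + (q - PC (peval q z))"
      by (simp add: peval.hom_add)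
    then show ?case using cideal_add[OF Ji add] by (simp only:)
  next
    case (mult p q)
    have "p * q - PC (peval (p * q) z) = p * (q - PC (peval q z)) + (p - PC (peval p z)) * PC (peval q z)"
      by (simp add: peval.hom_mult algebra_simps)
    then show ?case
      using cideal_add[OF Ji cideal_mult[OF Ji mult(2)] cideal_mult_right[OF Ji mult(1)]] by (simp only:)
  qed
  show ?thesis
  proof (rule that[of z])
    fix p assume "p \<in> Q"
    then have "p \<in> J" using J(2) by blast
    then have "PC (peval p z) \<in> J" using cideal_diff[OF Ji _ cong[of p]] by fastforce
    then show "peval p z = 0" by (rule PC_mem_ideal[OF Ji cprime_one[OF J(1)]])
  next
    show "peval f z \<noteq> 0" using cong[of f] fJ[of 1] by auto
  qed
qed

subsection \<open>Chains of primes and dimension\<close>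

definition vanishing :: "(complex ^ 'n::finite) set \<Rightarrow> 'n mpoly set" where
  "vanishing W = {p. \<forall>x\<in>W. peval p x = 0}"

lemma zero_set_vanishing: "algebraic_variety W \<Longrightarrow> zero_set (vanishing W) = W"
  by (auto simp: algebraic_variety_def zero_set_def vanishing_def)

lemma cideal_vanishing: "cideal (vanishing W)"
  by (auto simp: cideal_def vanishing_def peval.hom_add peval.hom_mult)

lemma cprime_vanishing:
  assumes "irreducible_variety W"
  shows "cprime (vanishing W)"
  unfolding cprime_def
proof (intro conjI allI impI cideal_vanishing)
  show "1 \<notin> vanishing W" using assms by (auto simp: irreducible_variety_def vanishing_def)
  fix p q assume pq: "p * q \<in> vanishing W"
  from assms obtain S where S: "W = zero_set S" by (auto simp: irreducible_variety_def algebraic_variety_def)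
  have "W = zero_set (insert p S) \<union> zero_set (insert q S)"
    using pq S by (auto simp: zero_set_def vanishing_def peval.hom_mult)
  moreover have "algebraic_variety (zero_set T)" for T :: "'a mpoly set" by (auto simp: algebraic_variety_def)
  ultimately have "W = zero_set (insert p S) \<or> W = zero_set (insert q S)"
    using assms unfolding irreducible_variety_def by metis
  then show "p \<in> vanishing W \<or> q \<in> vanishing W" by (auto simp: zero_set_def vanishing_def)
qed

lemma vanishing_zero_set: "cprime Q \<Longrightarrow> vanishing (zero_set Q) = Q"
  by (auto simp: vanishing_def zero_set_def) (metis nullstellensatz)

lemma irreducible_zero_set:
  assumes Q: "cprime Q"
  shows "irreducible_variety (zero_set Q)"
  unfolding irreducible_variety_def
proof (intro conjI allI impI)
  show "algebraic_variety (zero_set Q)" by (auto simp: algebraic_variety_def)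
  show "zero_set Q \<noteq> {}"
    by (rule nullstellensatz[OF Q cprime_one[OF Q]]) (auto simp: zero_set_def)
  fix V1 V2 assume *: "algebraic_variety V1 \<and> algebraic_variety V2 \<and> zero_set Q = V1 \<union> V2"
  then obtain S1 S2 where S: "V1 = zero_set S1" "V2 = zero_set S2" by (auto simp: algebraic_variety_def)
  show "zero_set Q = V1 \<or> zero_set Q = V2"
  proof (rule ccontr)
    assume "\<not> ?thesis"
    then have "\<not> zero_set Q \<subseteq> V1" "\<not> zero_set Q \<subseteq> V2" using * by auto
    then obtain f g where fg: "f \<in> S1" "g \<in> S2" "f \<notin> vanishing (zero_set Q)" "g \<notin> vanishing (zero_set Q)"
      by (auto simp: S zero_set_def vanishing_def)
    have "f * g \<in> vanishing (zero_set Q)"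
      using * fg(1,2) by (auto simp: vanishing_def peval.hom_mult) (auto simp: S zero_set_def)
    then show False using fg(3,4) cprime_mult[OF Q, of f g] by (simp add: vanishing_zero_set[OF Q])
  qed
qed

text \<open>\<open>n\<close> primes form a chain of length \<open>n - 1\<close>, so this is the
  negation of dimension at most \<open>n - 2\<close>, for the variety as well as for the quotient
  ring. No prime contains the unit ideal, in agreement with its dimension minus infinity.\<close>

definition has_long_chain :: "'n::finite mpoly set \<Rightarrow> bool" where
  "has_long_chain I \<longleftrightarrow> (\<exists>Q. (\<forall>i<CARD('n). cprime (Q i) \<and> I \<subseteq> Q i) \<and> (\<forall>i. Suc i < CARD('n) \<longrightarrow> Q i \<subset> Q (Suc i)))"

text \<open>The lengths that occur are closed downwards, so it suffices to test
  \<open>n - 1\<close>. The bound is formed in the reals: for \<open>n = 1\<close> it is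
  \<open>-1\<close>, met only by the supremum of the empty set.\<close>

lemma Sup_ereal_nat_le_iff:
  assumes "\<And>m m'. P m \<Longrightarrow> m' \<le> m \<Longrightarrow> P m'" "n > 0"
  shows "Sup {ereal (real m) | m. P m} \<le> ereal (real n - 2) \<longleftrightarrow> \<not> P (n - 1)"
proof
  assume le: "Sup {ereal (real m) | m. P m} \<le> ereal (real n - 2)"
  show "\<not> P (n - 1)"
  proof
    assume "P (n - 1)"
    then have "ereal (real (n - 1)) \<le> Sup {ereal (real m) | m. P m}" by (intro Sup_upper) auto
    then show False using le assms(2) by (auto dest: order_trans simp: of_nat_diff)
  qed
next
  assume n: "\<not> P (n - 1)"
  show "Sup {ereal (real m) | m. P m} \<le> ereal (real n - 2)"
  proof (rule Sup_least)
    fix x assume "x \<in> {ereal (real m) | m. P m}"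
    then obtain m where m: "x = ereal (real m)" "P m" by auto
    then have "\<not> n - 1 \<le> m" using n assms(1) by blast
    then show "x \<le> ereal (real n - 2)" using m by simp
  qed
qed

text \<open>Vanishing ideals and zero sets are mutually inverse between irreducible varieties and
  primes and reverse inclusions; the index \<open>CARD('n) - 1 - i\<close> turns the chain
  around.\<close>

lemma variety_dim_le_iff:
  fixes I :: "'n::finite mpoly set"
  shows "variety_dim (zero_set I) \<le> ereal (real CARD('n) - 2) \<longleftrightarrow> \<not> has_long_chain I"
proof -
  let ?P = "\<lambda>m. \<exists>W :: nat \<Rightarrow> (complex ^ 'n) set.
    (\<forall>i\<le>m. irreducible_variety (W i) \<and> W i \<subseteq> zero_set I) \<and> (\<forall>i<m. W i \<subset> W (Suc i))"
  have pos: "CARD('n) > 0" by simp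
  have "?P (CARD('n) - 1) \<longleftrightarrow> has_long_chain I"
  proof
    assume "?P (CARD('n) - 1)"
    then obtain W where W: "\<And>i. i \<le> CARD('n) - 1 \<Longrightarrow> irreducible_variety (W i)"
      "\<And>i. i \<le> CARD('n) - 1 \<Longrightarrow> W i \<subseteq> zero_set I" "\<And>i. i < CARD('n) - 1 \<Longrightarrow> W i \<subset> W (Suc i)" by blast
    let ?Q = "\<lambda>i. vanishing (W (CARD('n) - 1 - i))"
    have "cprime (?Q i) \<and> I \<subseteq> ?Q i" for i
    proof -
      have le: "CARD('n) - 1 - i \<le> CARD('n) - 1" by simp
      show ?thesis using cprime_vanishing[OF W(1)[OF le]] W(2)[OF le]
        by (auto simp: vanishing_def zero_set_def)
    qed
    moreover have "?Q i \<subset> ?Q (Suc i)" if "Suc i < CARD('n)" for i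
    proof -
      have eq: "CARD('n) - 1 - i = Suc (CARD('n) - 1 - Suc i)" using that by simp
      have lt: "W (CARD('n) - 1 - Suc i) \<subset> W (CARD('n) - 1 - i)"
        using W(3)[of "CARD('n) - 1 - Suc i"] that eq by simp
      have alg: "algebraic_variety (W j)" if "j \<le> CARD('n) - 1" for j
        using W(1)[OF that] by (simp add: irreducible_variety_def)
      have "?Q i \<noteq> ?Q (Suc i)"
      proof
        assume "?Q i = ?Q (Suc i)"
        then have "zero_set (?Q i) = zero_set (?Q (Suc i))" by simp
        then show False using lt zero_set_vanishing[OF alg] by auto
      qed
      then show ?thesis using lt by (auto simp: vanishing_def)
    qed
    ultimately show "has_long_chain I" unfolding has_long_chain_def by (intro exI[of _ ?Q]) blast
  next
    assume "has_long_chain I"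
    then obtain Q where Q: "\<And>i. i < CARD('n) \<Longrightarrow> cprime (Q i)" "\<And>i. i < CARD('n) \<Longrightarrow> I \<subseteq> Q i"
      "\<And>i. Suc i < CARD('n) \<Longrightarrow> Q i \<subset> Q (Suc i)" unfolding has_long_chain_def by blast
    let ?W = "\<lambda>i. zero_set (Q (CARD('n) - 1 - i))"
    have "irreducible_variety (?W i) \<and> ?W i \<subseteq> zero_set I" for i
      using irreducible_zero_set[OF Q(1)[of "CARD('n) - 1 - i"]] Q(2)[of "CARD('n) - 1 - i"] pos
      by (auto simp: zero_set_def)
    moreover have "?W i \<subset> ?W (Suc i)" if "i < CARD('n) - 1" for i
    proof -
      have eq: "CARD('n) - 1 - i = Suc (CARD('n) - 1 - Suc i)" using that by simp
      have lt: "Q (CARD('n) - 1 - Suc i) \<subset> Q (CARD('n) - 1 - i)"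
        using Q(3)[of "CARD('n) - 1 - Suc i"] that eq by simp
      have "?W i \<noteq> ?W (Suc i)"
      proof
        assume "?W i = ?W (Suc i)"
        then have "vanishing (?W i) = vanishing (?W (Suc i))" by simp
        then show False using lt that by (simp add: vanishing_zero_set Q(1))
      qed
      then show ?thesis using lt by (auto simp: zero_set_def)
    qed
    ultimately show "?P (CARD('n) - 1)" by (intro exI[of _ ?W]) blast
  qed
  moreover have "?P m'" if P: "?P m" and le: "m' \<le> m" for m m'
  proof -
    from P obtain W where W: "\<forall>i\<le>m. irreducible_variety (W i) \<and> W i \<subseteq> zero_set I" "\<forall>i<m. W i \<subset> W (Suc i)"
      by (elim exE conjE)
    show ?thesis by (rule exI[of _ W]) (use W le in simp)
  qed
  ultimately show ?thesis
    using Sup_ereal_nat_le_iff[where P = ?P, OF _ pos] unfolding variety_dim_def by presburger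
qed

lemma variety_dim_mono: "V \<subseteq> W \<Longrightarrow> variety_dim V \<le> variety_dim W"
  unfolding variety_dim_def by (intro Sup_subset_mono) blast

section \<open>Prime ideals in the locale sense, and the Krull dimension of a quotient\<close>

lemma cideal_iff_ideal: "ideal J class_ring \<longleftrightarrow> cideal (J :: 'a::comm_ring_1 set)"
proof
  assume "ideal J class_ring"
  then interpret J: ideal J "class_ring :: 'a ring" .
  show "cideal J"
  proof (rule cidealI)
    show "0 \<in> J" using J.zero_closed by (simp add: class_ring_simps)
    show "a + b \<in> J" if "a \<in> J" "b \<in> J" for a b
      using J.a_closed[OF that] by (simp add: class_ring_simps)
    show "r * a \<in> J" if "a \<in> J" for r a
      using J.I_l_closed[OF that, of r] by (simp add: class_ring_simps)
  qed
next
  assume J: "cideal J"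
  show "ideal J class_ring"
  proof (rule idealI)
    show "ring (class_ring :: 'a ring)" by (rule class_ring.ring_axioms)
    show "subgroup J (add_monoid class_ring)"
    proof (rule group.subgroupI)
      show "Group.group (add_monoid (class_ring :: 'a ring))"
        by (rule abelian_group.a_group) (rule class_ring.abelian_group_axioms)
      have "\<ominus>\<^bsub>class_ring\<^esub> a = - a" for a :: 'a by (simp add: class_ring_simps)
      then show "inv\<^bsub>add_monoid class_ring\<^esub> a \<in> J" if "a \<in> J" for a
        using cideal_uminus[OF J that] by (simp only: a_inv_def)
    qed (use cideal_add[OF J] cideal_zero[OF J] in \<open>auto simp: class_ring_simps\<close>)
  qed (use cideal_mult[OF J] cideal_mult_right[OF J] in \<open>auto simp: class_ring_simps\<close>)
qed

lemma cprime_iff_primeideal: "primeideal J class_ring \<longleftrightarrow> cprime (J :: 'a::comm_ring_1 set)"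
proof
  assume "primeideal J class_ring"
  then interpret J: primeideal J "class_ring :: 'a ring" .
  have J: "cideal J" using J.is_ideal by (simp add: cideal_iff_ideal)
  have "1 \<notin> J"
  proof
    assume "1 \<in> J"
    then have "a \<in> J" for a using cideal_mult[OF J, of 1 a] by simp
    then show False using J.I_notcarr by (auto simp: class_ring_simps)
  qed
  then show "cprime J"
    using J J.I_prime by (auto simp: cprime_def class_ring_simps)
next
  assume J: "cprime J"
  show "primeideal J class_ring"
  proof (rule primeidealI)
    show "ideal J class_ring" using cprime_ideal[OF J] by (simp add: cideal_iff_ideal)
    show "cring (class_ring :: 'a ring)" by (rule class_cring.cring_axioms)
  qed (use cprime_one[OF J] cprime_mult[OF J] in \<open>auto simp: class_ring_simps\<close>)
qed

text \<open>Primes of the quotient are pulled back along the coset map, and primes above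
  \<open>I\<close> are pushed forward along it.\<close>

lemma krull_dim_le_iff:
  fixes I :: "'n::finite mpoly set"
  assumes I: "cideal I"
  shows "krull_dim (class_ring Quot I) \<le> ereal (real CARD('n) - 2) \<longleftrightarrow> \<not> has_long_chain I"
proof -
  let ?R = "class_ring :: 'n mpoly ring"
  interpret I: ideal I ?R using I by (simp add: cideal_iff_ideal)
  let ?h = "\<lambda>a. I +>\<^bsub>?R\<^esub> a"
  interpret h: ring_hom_ring ?R "?R Quot I" ?h by (rule I.rcos_ring_hom_ring)
  have crQ: "cring (?R Quot I)" by (rule I.quotient_is_cring[OF class_cring.cring_axioms])
  have surj: "carrier (?R Quot I) = ?h ` UNIV"
    by (auto simp: FactRing_def A_RCOSETS_def' class_ring_simps)
  have h_eq: "?h a = ?h b \<longleftrightarrow> a - b \<in> I" for a b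
    using ring.quotient_eq_iff_same_a_r_cos[OF class_ring.ring_axioms I.is_ideal, of a b]
    by (simp add: class_ring_simps a_minus_def)
  let ?P = "\<lambda>m. \<exists>p :: nat \<Rightarrow> 'n mpoly set set.
    (\<forall>i\<le>m. primeideal (p i) (?R Quot I)) \<and> (\<forall>i<m. p i \<subset> p (Suc i))"
  have pos: "CARD('n) > 0" by simp
  have "?P (CARD('n) - 1) \<longleftrightarrow> has_long_chain I"
  proof
    assume "?P (CARD('n) - 1)"
    then obtain p where p: "\<And>i. i \<le> CARD('n) - 1 \<Longrightarrow> primeideal (p i) (?R Quot I)"
      "\<And>i. i < CARD('n) - 1 \<Longrightarrow> p i \<subset> p (Suc i)" by blast
    let ?Q = "\<lambda>i. {r. ?h r \<in> p i}"
    have sub: "p i \<subseteq> ?h ` UNIV" if "i \<le> CARD('n) - 1" for i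
      using ideal.Icarr[OF primeideal.axioms(1)[OF p(1)[OF that]]] surj by blast
    have "cprime (?Q i) \<and> I \<subseteq> ?Q i" if "i < CARD('n)" for i
    proof
      have pi: "primeideal (p i) (?R Quot I)" using p(1) that by simp
      have "primeideal {r \<in> carrier ?R. ?h r \<in> p i} ?R"
        by (rule h.primeideal_vimage[OF class_cring.cring_axioms pi])
      then show "cprime (?Q i)" by (simp add: cprime_iff_primeideal class_ring_simps)
      show "I \<subseteq> ?Q i"
      proof
        fix r assume "r \<in> I"
        then have "?h r = \<zero>\<^bsub>?R Quot I\<^esub>" using I.a_rcos_const[of r] by (simp add: FactRing_def)
        then show "r \<in> ?Q i"
          using additive_subgroup.zero_closed[OF ideal.axioms(1)[OF primeideal.axioms(1)[OF pi]]] by simp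
      qed
    qed
    moreover have "?Q i \<subset> ?Q (Suc i)" if i: "Suc i < CARD('n)" for i
    proof -
      have lt: "p i \<subset> p (Suc i)" using p(2)[of i] i by simp
      have "p (Suc i) \<subseteq> ?h ` UNIV" using sub[of "Suc i"] i by simp
      then show ?thesis using lt by blast
    qed
    ultimately show "has_long_chain I" unfolding has_long_chain_def by (intro exI[of _ ?Q]) blast
  next
    assume "has_long_chain I"
    then obtain Q where Q: "\<And>i. i < CARD('n) \<Longrightarrow> cprime (Q i)" "\<And>i. i < CARD('n) \<Longrightarrow> I \<subseteq> Q i"
      "\<And>i. Suc i < CARD('n) \<Longrightarrow> Q i \<subset> Q (Suc i)" unfolding has_long_chain_def by blast
    let ?p = "\<lambda>i. ?h ` Q i"
    \<comment> \<open>\<open>Q i\<close> contains \<open>I\<close> and is thus a union of its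
      cosets, so its image determines it.\<close>
    have mem: "?h a \<in> ?p i \<longleftrightarrow> a \<in> Q i" if "i < CARD('n)" for a i
    proof
      assume "?h a \<in> ?p i"
      then obtain b where b: "b \<in> Q i" "?h a = ?h b" by auto
      then have "a - b \<in> Q i" using h_eq Q(2)[OF that] by blast
      then show "a \<in> Q i" using cideal_add[OF cprime_ideal[OF Q(1)[OF that]] _ b(1), of "a - b"] by simp
    qed auto
    have h_simps: "?h a \<otimes>\<^bsub>?R Quot I\<^esub> ?h b = ?h (a * b)" "?h a \<oplus>\<^bsub>?R Quot I\<^esub> ?h b = ?h (a + b)" for a b
      using h.hom_mult[of a b] h.hom_add[of a b] by (simp_all add: class_ring_simps)
    have "primeideal (?p i) (?R Quot I)" if i: "i < CARD('n)" for i
    proof (rule primeidealI)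
      note Qi = Q(1)[OF i]
      show "ideal (?p i) (?R Quot I)"
      proof (rule idealI)
        show "ring (?R Quot I)" by (rule I.quotient_is_ring)
        show "subgroup (?p i) (add_monoid (?R Quot I))"
        proof (rule group.subgroupI)
          show "group (add_monoid (?R Quot I))" by (rule abelian_group.a_group) (rule ring.is_abelian_group[OF I.quotient_is_ring])
          show "?p i \<subseteq> carrier (add_monoid (?R Quot I))" using surj by auto
          show "?p i \<noteq> {}" using cideal_zero[OF cprime_ideal[OF Qi]] by auto
          fix a assume "a \<in> ?p i"
          then obtain x where x: "x \<in> Q i" "a = ?h x" by auto
          have "\<ominus>\<^bsub>?R Quot I\<^esub> a = ?h (- x)" using x h.hom_a_inv[of x] by (simp add: class_ring_simps)
          then show "inv\<^bsub>add_monoid (?R Quot I)\<^esub> a \<in> ?p i"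
            using cideal_uminus[OF cprime_ideal[OF Qi] x(1)] by (simp add: a_inv_def)
          fix b assume "b \<in> ?p i"
          then obtain y where y: "y \<in> Q i" "b = ?h y" by auto
          show "a \<otimes>\<^bsub>add_monoid (?R Quot I)\<^esub> b \<in> ?p i"
            using cideal_add[OF cprime_ideal[OF Qi] x(1) y(1)] x y by (simp add: h_simps)
        qed
        fix a x assume "a \<in> ?p i" "x \<in> carrier (?R Quot I)"
        then obtain r s where "a = ?h r" "r \<in> Q i" "x = ?h s" using surj by auto
        then show "x \<otimes>\<^bsub>?R Quot I\<^esub> a \<in> ?p i" "a \<otimes>\<^bsub>?R Quot I\<^esub> x \<in> ?p i"
          using cidealD[OF cprime_ideal[OF Qi]] by (auto simp: h_simps)
      qed
      show "carrier (?R Quot I) \<noteq> ?p i"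
      proof
        assume "carrier (?R Quot I) = ?p i"
        then have "?h 1 \<in> ?p i" using surj by blast
        then show False using mem[OF i, of 1] cprime_one[OF Qi] by blast
      qed
      fix a b assume "a \<in> carrier (?R Quot I)" "b \<in> carrier (?R Quot I)" and ab: "a \<otimes>\<^bsub>?R Quot I\<^esub> b \<in> ?p i"
      then obtain r s where "a = ?h r" "b = ?h s" using surj by auto
      then show "a \<in> ?p i \<or> b \<in> ?p i"
        using ab cprime_mult[OF Qi, of r s] by (simp add: h_simps mem[OF i])
    qed (rule crQ)
    moreover have "?p i \<subset> ?p (Suc i)" if i: "Suc i < CARD('n)" for i
    proof -
      obtain x where "x \<in> Q (Suc i)" "x \<notin> Q i" using Q(3)[OF i] by blast
      then have "?h x \<in> ?p (Suc i)" "?h x \<notin> ?p i" using mem[of i x] i by auto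
      then show ?thesis using Q(3)[OF i] by blast
    qed
    moreover have "i < CARD('n)" if "i \<le> CARD('n) - 1" for i using that pos by linarith
    ultimately show "?P (CARD('n) - 1)" by (intro exI[of _ ?p]) auto
  qed
  moreover have "?P m'" if P: "?P m" and le: "m' \<le> m" for m m'
  proof -
    from P obtain p where p: "\<forall>i\<le>m. primeideal (p i) (?R Quot I)" "\<forall>i<m. p i \<subset> p (Suc i)"
      by (elim exE conjE)
    show ?thesis by (rule exI[of _ p]) (use p le in simp)
  qed
  ultimately show ?thesis
    using Sup_ereal_nat_le_iff[where P = ?P, OF _ pos] unfolding krull_dim_def by presburger
qed

subsection \<open>Polynomials that are monic in one variable\<close>

text \<open>A degree bound with coefficient \<open>1\<close> at \<open>d\<close> passes to products
  over any commutative ring by looking at coefficients, where degrees of general products need not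
  add.\<close>

definition monic_upto :: "'r::comm_ring_1 poly \<Rightarrow> nat \<Rightarrow> bool" where
  "monic_upto p d \<longleftrightarrow> degree p \<le> d \<and> poly.coeff p d = 1"

lemma monic_upto_mult:
  assumes "monic_upto p d" "monic_upto q e"
  shows "monic_upto (p * q) (d + e)"
proof -
  have "poly.coeff (p * q) (d + e) = (\<Sum>i\<le>d + e. if i = d then 1 else 0)"
    unfolding coeff_mult
  proof (rule sum.cong[OF refl])
    fix i assume "i \<in> {..d + e}"
    have "poly.coeff p i = 0" if "i > d" using that assms(1) by (intro coeff_eq_0) (auto simp: monic_upto_def)
    moreover have "poly.coeff q (d + e - i) = 0" if "i < d" using that assms(2) by (intro coeff_eq_0) (auto simp: monic_upto_def)
    ultimately show "poly.coeff p i * poly.coeff q (d + e - i) = (if i = d then 1 else 0)"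
      using assms by (cases i d rule: linorder_cases) (auto simp: monic_upto_def)
  qed
  moreover have "degree (p * q) \<le> d + e"
    using degree_mult_le[of p q] assms by (auto simp: monic_upto_def)
  ultimately show ?thesis by (simp add: monic_upto_def)
qed

lemma monic_upto_one: "monic_upto 1 0"
  by (simp add: monic_upto_def)

lemma monic_upto_power: "monic_upto p d \<Longrightarrow> monic_upto (p ^ k) (d * k)"
  by (induction k) (auto simp: monic_upto_one intro: monic_upto_mult)

lemma monic_upto_prod: "(\<And>i. i \<in> S \<Longrightarrow> monic_upto (f i) (d i)) \<Longrightarrow> monic_upto (prod f S) (sum d S)"
  by (induction S rule: infinite_finite_induct) (auto simp: monic_upto_one intro: monic_upto_mult)

text \<open>A monic factor keeps the leading coefficient of \<open>h\<close> alive, so a product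
  with nonzero \<open>h\<close> has degree at least \<open>d\<close>.\<close>

lemma monic_upto_mult_eq_0:
  fixes P :: "'r::comm_ring_1 poly"
  assumes P: "monic_upto P d" and lt: "P * h = r" "r = 0 \<or> degree r < d"
  shows "h = 0"
proof (rule ccontr)
  assume h: "h \<noteq> 0"
  have "poly.coeff (P * h) (d + degree h) = (\<Sum>i\<le>d + degree h. if i = d then lead_coeff h else 0)"
    unfolding coeff_mult
  proof (rule sum.cong[OF refl])
    fix i assume "i \<in> {..d + degree h}"
    have "poly.coeff P i = 0" if "i > d" using that P by (intro coeff_eq_0) (auto simp: monic_upto_def)
    moreover have "poly.coeff h (d + degree h - i) = 0" if "i < d" using that by (intro coeff_eq_0) auto
    ultimately show "poly.coeff P i * poly.coeff h (d + degree h - i) = (if i = d then lead_coeff h else 0)"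
      using P by (cases i d rule: linorder_cases) (auto simp: monic_upto_def)
  qed
  then have "poly.coeff (P * h) (d + degree h) \<noteq> 0" using h by simp
  then show False using lt by (auto dest: le_degree)
qed

lemma monic_upto_division:
  fixes P F :: "'r::comm_ring_1 poly"
  assumes P: "monic_upto P d"
  shows "\<exists>q r. F = P * q + r \<and> (r = 0 \<or> degree r < d)"
proof (induction "degree F" arbitrary: F rule: less_induct)
  case less
  show ?case
  proof (cases "degree F < d \<or> F = 0")
    case True
    then show ?thesis by (intro exI[of _ 0] exI[of _ F]) auto
  next
    case False
    let ?m = "Polynomial.monom (lead_coeff F) (degree F - d)"
    define G where "G = F - P * ?m"
    have "poly.coeff (P * ?m) (degree F) = lead_coeff F"
      using False P by (simp add: mult.commute[of P] coeff_monom_mult monic_upto_def)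
    then have c0: "poly.coeff G (degree F) = 0" by (simp add: G_def)
    have "degree (P * ?m) \<le> degree F"
      using degree_mult_le[of P ?m] degree_monom_le[of "lead_coeff F" "degree F - d"] False P by (auto simp: monic_upto_def)
    then have le: "degree G \<le> degree F" unfolding G_def by (intro degree_diff_le) auto
    show ?thesis
    proof (cases "G = 0")
      case True
      then show ?thesis by (intro exI[of _ ?m] exI[of _ 0]) (simp add: G_def)
    next
      case G: False
      then have "degree G < degree F" using le c0 by (metis le_neq_implies_less leading_coeff_0_iff)
      from less[OF this] obtain q r where "G = P * q + r" "r = 0 \<or> degree r < d" by blast
      then show ?thesis by (intro exI[of _ "q + ?m"] exI[of _ r]) (simp add: G_def algebra_simps)
    qed
  qed
qed

subsection \<open>Annihilators of torsion elements\<close>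

text \<open>Nagata's change of variables: the subalgebra generated by the \<open>x\<^sub>j - x\<^sub>v ^ w\<^sub>j\<close> is the range of
  \<open>sub_y\<close>, over it every polynomial becomes a polynomial in \<open>x\<^sub>v\<close> via \<open>to_poly\<close>, and \<open>from_poly\<close> undoes this.
  \<open>kill S\<close> sets \<open>x\<^sub>v\<close> and the variables in \<open>S\<close> to zero.\<close>

locale nagata =
  fixes v :: "'n::finite" and w :: "'n \<Rightarrow> nat"
  assumes w_pos: "w j \<ge> 1" and w_v: "w v = 1"
begin

definition kill :: "'n set \<Rightarrow> 'n mpoly \<Rightarrow> 'n mpoly" where
  "kill S = meval PC (\<lambda>j. if j \<in> S \<or> j = v then 0 else PX j)"

definition sub_y :: "'n mpoly \<Rightarrow> 'n mpoly" where
  "sub_y = meval PC (\<lambda>j. if j = v then 0 else PX j - PX v ^ w j)"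

definition to_poly :: "'n mpoly \<Rightarrow> 'n mpoly poly" where
  "to_poly = meval (\<lambda>c. [:PC c:]) (\<lambda>j. [:if j = v then 0 else PX j:] + Polynomial.monom 1 (w j))"

definition from_poly :: "'n mpoly poly \<Rightarrow> 'n mpoly" where
  "from_poly F = poly (map_poly sub_y F) (PX v)"

lemma const_hom: "comm_ring_hom (\<lambda>c. [:PC c :: 'n mpoly:])"
  by unfold_locales (simp_all add: one_pCons)

sublocale kill: comm_ring_hom "kill S" for S
  unfolding kill_def by (rule comm_ring_hom_meval[OF comm_ring_hom_PC])
sublocale sub_y: comm_ring_hom sub_y
  unfolding sub_y_def by (rule comm_ring_hom_meval[OF comm_ring_hom_PC])
sublocale to_poly: comm_ring_hom to_poly
  unfolding to_poly_def by (rule comm_ring_hom_meval[OF const_hom])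
sublocale msub_y: map_poly_comm_ring_hom sub_y ..

lemma from_poly_hom: "from_poly (F + G) = from_poly F + from_poly G"
  "from_poly (F * G) = from_poly F * from_poly G" "from_poly 1 = 1" "from_poly 0 = 0"
  by (simp_all add: from_poly_def msub_y.hom_add msub_y.hom_mult)

lemma kill_simps [simp]: "kill S (PC c) = PC c" "kill S (PX j) = (if j \<in> S \<or> j = v then 0 else PX j)"
  by (simp_all add: kill_def meval_PC meval_PX comm_ring_hom_PC)

lemma sub_y_simps [simp]: "sub_y (PC c) = PC c" "sub_y (PX j) = (if j = v then 0 else PX j - PX v ^ w j)"
  by (simp_all add: sub_y_def meval_PC meval_PX comm_ring_hom_PC)

lemma to_poly_simps [simp]: "to_poly (PC c) = [:PC c:]"
  "to_poly (PX j) = [:if j = v then 0 else PX j:] + Polynomial.monom 1 (w j)"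
  by (simp_all only: to_poly_def meval_PC[OF const_hom] meval_PX[OF const_hom])

lemma kill_kill: "S \<subseteq> S' \<Longrightarrow> kill S' (kill S p) = kill S' p"
  by (rule mpoly_hom_eqI[OF comm_ring_hom_comp[OF kill.comm_ring_hom_axioms kill.comm_ring_hom_axioms] kill.comm_ring_hom_axioms])
    (auto simp: kill.hom_zero)

text \<open>\<open>to_poly\<close> expands \<open>x_j\<close> as \<open>y_j + X ^ w_j\<close>, and
  \<open>from_poly\<close> puts back \<open>y_j = x_j - x_v ^ w_j\<close> and
  \<open>X = x_v\<close>. For \<open>x_v\<close> itself this is where \<open>w v = 1\<close>
  enters.\<close>

lemma from_to_poly: "from_poly (to_poly p) = p"
proof -
  have "comm_ring_hom from_poly"
    by unfold_locales (simp_all add: from_poly_hom)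
  from mpoly_hom_eqI[OF comm_ring_hom_comp[OF to_poly.comm_ring_hom_axioms this] comm_ring_hom_ident, of p]
  show ?thesis
    by (auto simp: from_poly_def msub_y.hom_add map_poly_monom poly_monom w_v sub_y.map_poly_pCons_hom)
qed

text \<open>The powers of \<open>X\<close> cancel in the image of \<open>x_j - x_v ^ w_j\<close>, so
  elements of the subalgebra become constants; \<open>kill {}\<close> records that
  \<open>sub_y\<close> forgets \<open>x_v\<close>.\<close>

lemma to_poly_sub_y: "to_poly (sub_y p) = [:kill {} p:]"
proof -
  have "comm_ring_hom (\<lambda>q :: 'n mpoly. [:q:])"
    by unfold_locales (simp_all add: one_pCons)
  from mpoly_hom_eqI[OF comm_ring_hom_comp[OF sub_y.comm_ring_hom_axioms to_poly.comm_ring_hom_axioms] comm_ring_hom_comp[OF kill.comm_ring_hom_axioms this], where p = p]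
  show ?thesis
    by (auto simp: to_poly.hom_minus to_poly.hom_power to_poly.hom_zero w_v monom_power)
qed

text \<open>A monomial \<open>m\<close> turns into a monic polynomial of degree
  \<open>weight w m\<close>. The weights of the keys are distinct, so the heaviest one alone decides
  the leading coefficient, and that is a constant.\<close>

lemma to_poly_monic:
  assumes inj: "inj_on (weight w) (pkeys a)" and a: "a \<noteq> 0"
  obtains c d P where "c \<noteq> 0" "monic_upto P d" "to_poly a = [:PC c:] * P" "from_poly P = PC (inverse c) * a"
proof -
  obtain k where k: "k \<in> pkeys a" "\<And>m. m \<in> pkeys a \<Longrightarrow> weight w m \<le> weight w k"
  proof -
    have "Max (weight w ` pkeys a) \<in> weight w ` pkeys a" using a by (intro Max_in) auto
    then obtain k where "k \<in> pkeys a" "Max (weight w ` pkeys a) = weight w k" by auto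
    then show ?thesis using that[of k] Max_ge[of "weight w ` pkeys a"] by force
  qed
  define c where "c = lkp a k"
  have c: "c \<noteq> 0" using k(1) by (simp add: c_def in_keys_iff)
  let ?G = "\<lambda>m. \<Prod>j\<in>UNIV. ([:if j = v then 0 else PX j:] + Polynomial.monom 1 (w j)) ^ lkp m j :: 'n mpoly poly"
  have G: "monic_upto (?G m) (weight w m)" for m
    unfolding weight_def
  proof (intro monic_upto_prod monic_upto_power)
    fix j
    have "degree ([:if j = v then 0 else PX j:] + Polynomial.monom 1 (w j) :: 'n mpoly poly) \<le> w j"
      by (intro degree_add_le) (auto simp: degree_monom_le)
    moreover have "poly.coeff ([:if j = v then 0 else PX j:] :: 'n mpoly poly) (w j) = 0"
      using w_pos[of j] by (intro coeff_eq_0) auto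
    ultimately show "monic_upto ([:if j = v then 0 else PX j:] + Polynomial.monom 1 (w j) :: 'n mpoly poly) (w j)"
      by (simp add: monic_upto_def)
  qed
  define P where "P = to_poly (PC (inverse c) * a)"
  have eq: "to_poly a = (\<Sum>m\<in>pkeys a. [:PC (lkp a m):] * ?G m)"
    by (simp add: to_poly_def meval_def)
  then have P: "P = (\<Sum>m\<in>pkeys a. [:PC (inverse c * lkp a m):] * ?G m)"
    unfolding P_def to_poly.hom_mult to_poly_simps eq sum_distrib_left
    by (intro sum.cong) (simp_all add: mult.commute)
  have "monic_upto P (weight w k)"
    unfolding monic_upto_def
  proof
    show "degree P \<le> weight w k"
      unfolding P
    proof (intro degree_sum_le)
      fix m assume "m \<in> pkeys a"
      have "degree ([:PC (inverse c * lkp a m):] * ?G m) \<le> degree (?G m)" using degree_smult_le by simp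
      also have "\<dots> \<le> weight w m" using G[of m] by (simp only: monic_upto_def)
      also have "\<dots> \<le> weight w k" using k(2) \<open>m \<in> pkeys a\<close> by blast
      finally show "degree ([:PC (inverse c * lkp a m):] * ?G m) \<le> weight w k" .
    qed simp
    have "poly.coeff P (weight w k) = (\<Sum>m\<in>pkeys a. if m = k then 1 else 0)"
      unfolding P coeff_sum
    proof (rule sum.cong[OF refl])
      fix m assume m: "m \<in> pkeys a"
      show "poly.coeff ([:PC (inverse c * lkp a m):] * ?G m) (weight w k) = (if m = k then 1 else 0)"
      proof (cases "m = k")
        case True
        have "poly.coeff (?G k) (weight w k) = 1" using G[of k] by (simp only: monic_upto_def)
        then show ?thesis using c by (simp add: True c_def[symmetric])
      next
        case False
        then have "weight w m < weight w k" using k m inj by (metis inj_onD le_neq_implies_less)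
        moreover have "degree (?G m) \<le> weight w m" using G[of m] by (simp only: monic_upto_def)
        ultimately have "poly.coeff (?G m) (weight w k) = 0"
          by (intro coeff_eq_0) (rule le_less_trans)
        then show ?thesis using False by simp
      qed
    qed
    then show "poly.coeff P (weight w k) = 1" using k(1) by (simp add: sum.delta)
  qed
  moreover have "to_poly a = [:PC c:] * P"
    using c by (simp add: P_def to_poly.hom_mult mult.assoc[symmetric] flip: PC_hom(4))
  ultimately show ?thesis using that[OF c, of P] by (simp add: P_def from_to_poly)
qed

text \<open>Modulo \<open>Q\<close> the ring is integral over the subalgebra. By the determinant
  trick the ideal \<open>E\<close> generated by \<open>Q\<close> and the kernel of
  \<open>kill S'\<close> meets the subalgebra only in that kernel, so a prime above \<open>E\<close>
  can avoid all other elements of the subalgebra.\<close>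

lemma lying_over:
  assumes Q: "cideal Q" and a: "monic_upto P d" "from_poly P \<in> Q"
    and Q0: "\<And>p. sub_y p \<in> Q \<Longrightarrow> kill S p = 0" and S: "S \<subseteq> S'"
  obtains Q' where "cprime Q'" "Q \<subseteq> Q'" "\<And>p. sub_y p \<in> Q' \<longleftrightarrow> kill S' p = 0"
proof -
  let ?x = "PX v :: 'n mpoly"
  let ?L = "\<lambda>n. \<Sum>i<d. sub_y (n i) * ?x ^ i"
  \<comment> \<open>Division by the monic \<open>P\<close>: modulo \<open>Q\<close> the first
    \<open>d\<close> powers of \<open>x_v\<close> span the ring over the subalgebra.\<close>
  have gen: "\<exists>n. p - ?L n \<in> Q" for p
  proof -
    obtain q r where qr: "to_poly p = P * q + r" "r = 0 \<or> degree r < d"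
      using monic_upto_division[OF a(1)] by blast
    have "p = from_poly P * from_poly q + from_poly r"
      using arg_cong[OF qr(1), of from_poly] by (simp add: from_to_poly from_poly_hom)
    moreover have "from_poly r = ?L (poly.coeff r)"
    proof (cases "r = 0")
      case False
      then have "degree (map_poly sub_y r) < d" using qr(2) degree_map_poly_le[of sub_y r] by simp
      then have "from_poly r = (\<Sum>i<d. poly.coeff (map_poly sub_y r) i * ?x ^ i)"
        unfolding from_poly_def poly_altdef
      proof (intro sum.mono_neutral_left ballI)
        fix i assume "i \<in> {..<d} - {..degree (map_poly sub_y r)}"
        then show "poly.coeff (map_poly sub_y r) i * ?x ^ i = 0" by (subst coeff_eq_0) auto
      qed auto
      then show ?thesis by (simp add: coeff_map_poly)
    qed (simp add: from_poly_hom)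
    ultimately have "p - ?L (poly.coeff r) = from_poly P * from_poly q" by simp
    then show ?thesis using cideal_mult_right[OF Q a(2), of "from_poly q"]
      by (intro exI[of _ "poly.coeff r"]) simp
  qed
  have d: "d > 0"
  proof (rule ccontr)
    assume "\<not> d > 0"
    then have "sub_y 1 \<in> Q" using gen[of 1] by simp
    then show False using Q0[of 1] by simp
  qed
  \<comment> \<open>The generated ideal is written in coordinates with respect to the powers of
    \<open>x_v\<close>, which is the form in which the determinant trick uses it.\<close>
  define E where "E = {p. \<exists>n. (\<forall>i. kill S' (n i) = 0) \<and> p - ?L n \<in> Q}"
  have L_add: "?L (\<lambda>i. n i + n' i) = ?L n + ?L n'" for n n'
    by (simp add: sub_y.hom_add distrib_right sum.distrib)
  have E: "cideal E"
  proof (rule cidealI)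
    show "0 \<in> E" using cideal_zero[OF Q] by (auto simp: E_def intro!: exI[of _ "\<lambda>_. 0"])
    fix p q assume "p \<in> E" "q \<in> E"
    then obtain n n' where n: "\<forall>i. kill S' (n i) = 0" "p - ?L n \<in> Q" "\<forall>i. kill S' (n' i) = 0" "q - ?L n' \<in> Q"
      by (auto simp: E_def)
    have "p + q - ?L (\<lambda>i. n i + n' i) = (p - ?L n) + (q - ?L n')" by (simp only: L_add) simp
    then have "p + q - ?L (\<lambda>i. n i + n' i) \<in> Q" using cideal_add[OF Q n(2) n(4)] by (simp only:)
    moreover have "\<forall>i. kill S' (n i + n' i) = 0" using n(1,3) by (simp add: kill.hom_add)
    ultimately show "p + q \<in> E" unfolding E_def by (intro CollectI exI[of _ "\<lambda>i. n i + n' i"] conjI)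
  next
    fix r p assume "p \<in> E"
    then obtain n where n: "\<forall>i. kill S' (n i) = 0" "p - ?L n \<in> Q" by (auto simp: E_def)
    have "\<forall>i. \<exists>n. r * ?x ^ i - ?L n \<in> Q" using gen by blast
    from choice[OF this] obtain g where g: "\<And>i. r * ?x ^ i - ?L (g i) \<in> Q" by blast
    define n' where "n' j = (\<Sum>i<d. n i * g i j)" for j
    have "r * p - ?L n' \<in> Q"
    proof -
      have "?L n' = (\<Sum>j<d. \<Sum>i<d. sub_y (n i) * (sub_y (g i j) * ?x ^ j))"
        by (simp add: n'_def sub_y.hom_sum sub_y.hom_mult sum_distrib_right mult.assoc)
      also have "\<dots> = (\<Sum>i<d. sub_y (n i) * ?L (g i))"
        by (subst sum.swap) (simp add: sum_distrib_left)
      finally have "r * p - ?L n' = r * (p - ?L n) + (\<Sum>i<d. sub_y (n i) * (r * ?x ^ i - ?L (g i)))"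
        by (simp add: right_diff_distrib sum_subtractf sum_distrib_left mult_ac)
      moreover have "(\<Sum>i<d. sub_y (n i) * (r * ?x ^ i - ?L (g i))) \<in> Q"
        by (intro cideal_sum[OF Q] cideal_mult[OF Q g])
      ultimately show ?thesis using cideal_add[OF Q cideal_mult[OF Q n(2), of r]] by simp
    qed
    moreover have "kill S' (n' j) = 0" for j
      by (simp add: n'_def kill.hom_sum kill.hom_mult n(1))
    ultimately show "r * p \<in> E" unfolding E_def by blast
  qed
  have Q_E: "Q \<subseteq> E" by (auto simp: E_def intro!: exI[of _ "\<lambda>_. 0"])
  have ker_E: "sub_y p \<in> E" if p: "kill S' p = 0" for p
  proof -
    have "?L (\<lambda>i. if i = 0 then p else 0) = (\<Sum>i<d. if i = 0 then sub_y p else 0)"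
      by (intro sum.cong) auto
    also have "\<dots> = sub_y p" using d by (simp add: sum.delta')
    finally show ?thesis
      using p cideal_zero[OF Q] unfolding E_def
      by (intro CollectI exI[of _ "\<lambda>i. if i = 0 then p else 0"]) auto
  qed
  have disj: "kill S' s = 0" if "sub_y s \<in> E" for s
  proof -
    have "\<forall>i. \<exists>n. (\<forall>j. kill S' (n j) = 0) \<and> sub_y s * ?x ^ i - ?L n \<in> Q"
      using cideal_mult_right[OF E that] by (simp add: E_def)
    from choice[OF this] obtain N where N: "\<And>i j. kill S' (N i j) = 0" "\<And>i. sub_y s * ?x ^ i - ?L (N i) \<in> Q"
      by blast
    \<comment> \<open>Each \<open>s * x_v ^ i\<close> is congruent to
      \<open>\<Sum>j. N i j * x_v ^ j\<close>, so the matrix \<open>s - N\<close> sends the vector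
      of powers of \<open>x_v\<close> into \<open>Q\<close>.\<close>
    define A where "A = mat d d (\<lambda>(i, j). (if i = j then s else 0) - N i j)"
    have A: "A \<in> carrier_mat d d" by (simp add: A_def)
    let ?B = "map_mat sub_y A"
    have B: "?B \<in> carrier_mat d d" using A by simp
    have row: "(\<Sum>j<d. ?B $$ (i, j) * ?x ^ j) \<in> Q" if i: "i < d" for i
    proof -
      have "(\<Sum>j<d. ?B $$ (i, j) * ?x ^ j) = (\<Sum>j<d. (if i = j then sub_y s * ?x ^ i else 0) - sub_y (N i j) * ?x ^ j)"
        using i by (intro sum.cong) (auto simp: A_def sub_y.hom_minus algebra_simps)
      also have "\<dots> = sub_y s * ?x ^ i - ?L (N i)" using i by (simp add: sum_subtractf sum.delta)
      finally show ?thesis using N(2) by simp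
    qed
    \<comment> \<open>Row \<open>0\<close> of the adjugate isolates the power
      \<open>x_v ^ 0 = 1\<close>; therefore the determinant itself lies in \<open>Q\<close>, and not
      only its products with powers of \<open>x_v\<close>.\<close>
    have "det ?B = (\<Sum>j<d. (\<Sum>i<d. adj_mat ?B $$ (0, i) * ?B $$ (i, j)) * ?x ^ j)"
    proof -
      have "(\<Sum>i<d. adj_mat ?B $$ (0, i) * ?B $$ (i, j)) = (if j = 0 then det ?B else 0)" if j: "j < d" for j
      proof -
        have "(adj_mat ?B * ?B) $$ (0, j) = (\<Sum>i<d. adj_mat ?B $$ (0, i) * ?B $$ (i, j))"
          using adj_mat(1)[OF B] B j d by (simp add: times_mat_def scalar_prod_def atLeast0LessThan)
        moreover have "(adj_mat ?B * ?B) $$ (0, j) = (if j = 0 then det ?B else 0)"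
          using j d by (auto simp: adj_mat(3)[OF B])
        ultimately show ?thesis by simp
      qed
      then have "(\<Sum>j<d. (\<Sum>i<d. adj_mat ?B $$ (0, i) * ?B $$ (i, j)) * ?x ^ j) = (\<Sum>j<d. if j = 0 then det ?B else 0)"
        by (intro sum.cong) auto
      then show ?thesis using d by (simp add: sum.delta')
    qed
    also have "\<dots> = (\<Sum>i<d. adj_mat ?B $$ (0, i) * (\<Sum>j<d. ?B $$ (i, j) * ?x ^ j))"
      unfolding sum_distrib_left sum_distrib_right by (subst sum.swap) (simp add: mult.assoc)
    also have "\<dots> \<in> Q"
    proof (rule cideal_sum[OF Q])
      fix i assume "i \<in> {..<d}"
      then show "adj_mat ?B $$ (0, i) * (\<Sum>j<d. ?B $$ (i, j) * ?x ^ j) \<in> Q"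
        by (intro cideal_mult[OF Q] row) simp
    qed
    finally have "sub_y (det A) \<in> Q" by (simp add: sub_y.hom_det)
    then have "kill S' (det A) = 0" using Q0[of "det A"] kill_kill[OF S, of "det A"] by simp
    \<comment> \<open>The entries of \<open>N\<close> are killed, so the determinant becomes the
      \<open>d\<close>-th power of \<open>kill S' s\<close>.\<close>
    moreover have "map_mat (kill S') A = kill S' s \<cdot>\<^sub>m 1\<^sub>m d"
      by (rule eq_matI) (auto simp: A_def kill.hom_minus N(1))
    ultimately have "kill S' s ^ d = 0"
      using kill.hom_det[of S' A] by (simp add: det_smult)
    then show ?thesis by (rule mpoly_power_eq_0D)
  qed
  let ?T = "sub_y ` {s. kill S' s \<noteq> 0}"
  have "1 \<in> ?T" by (rule image_eqI[of _ _ 1]) auto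
  moreover have "p * q \<in> ?T" if "p \<in> ?T" "q \<in> ?T" for p q
  proof -
    obtain s t where st: "p = sub_y s" "q = sub_y t" "kill S' s \<noteq> 0" "kill S' t \<noteq> 0" using \<open>p \<in> ?T\<close> \<open>q \<in> ?T\<close> by auto
    then show ?thesis using mpoly_no_zero_divisors[of "kill S' s" "kill S' t"]
      by (intro image_eqI[of _ _ "s * t"]) (auto simp: sub_y.hom_mult kill.hom_mult)
  qed
  moreover have "E \<inter> ?T = {}" using disj by auto
  ultimately obtain Q' where Q': "cprime Q'" "E \<subseteq> Q'" "Q' \<inter> ?T = {}"
    using krull_maximal_avoiding[OF E, of ?T] by metis
  show ?thesis
  proof (rule that[OF Q'(1)])
    show "Q \<subseteq> Q'" using Q_E Q'(2) by blast
    show "sub_y p \<in> Q' \<longleftrightarrow> kill S' p = 0" for p using Q'(2,3) ker_E[of p] by blast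
  qed
qed

end

text \<open>\<open>c\<close> has a nonzero remainder modulo the monic multiple of \<open>a\<close>.
  An element of the subalgebra in the colon ideal would multiply this remainder into a multiple of
  the monic polynomial while keeping the degree too small, so it is zero.\<close>

theorem colon_has_long_chain:
  fixes a c :: "'n::finite mpoly"
  assumes a: "a \<noteq> 0" and c: "\<not> a dvd c"
  shows "has_long_chain {p. a dvd p * c}"
proof -
  fix v :: 'n
  obtain w :: "'n \<Rightarrow> nat" where w: "inj_on (weight w) (pkeys a)" "\<And>j. w j \<ge> 1" "w v = 1"
    by (rule ex_weight[of "pkeys a" v]) auto
  interpret nagata v w by unfold_locales (use w in auto)
  obtain c0 d P where P: "c0 \<noteq> 0" "monic_upto P d" "to_poly a = [:PC c0:] * P" "from_poly P = PC (inverse c0) * a"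
    using to_poly_monic[OF w(1) a] by metis
  let ?J = "{p. a dvd p * c}"
  have J: "cideal ?J"
    by (rule cidealI) (auto simp: distrib_right mult.assoc)
  have PJ: "from_poly P \<in> ?J" by (simp add: P(4) mult.assoc)
  have J0: "kill {} p = 0" if p: "sub_y p \<in> ?J" for p
  proof -
    from p obtain g where "sub_y p * c = a * g" by auto
    then have "to_poly (sub_y p * c) = to_poly (a * g)" by simp
    then have 1: "[:kill {} p:] * to_poly c = P * ([:PC c0:] * to_poly g)"
      by (simp add: to_poly.hom_mult to_poly_sub_y P(3) mult_ac del: mult_pCons_left mult_pCons_right)
    obtain q r where qr: "to_poly c = P * q + r" "r = 0 \<or> degree r < d"
      using monic_upto_division[OF P(2)] by blast
    have "P * ([:PC c0:] * to_poly g - [:kill {} p:] * q) = [:kill {} p:] * r"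
      using 1 unfolding qr(1) by (simp add: algebra_simps del: mult_pCons_left mult_pCons_right)
    moreover have "[:kill {} p:] * r = 0 \<or> degree ([:kill {} p:] * r) < d"
      using qr(2) degree_smult_le[of "kill {} p" r] by auto
    ultimately have "[:kill {} p:] * r = 0"
      using monic_upto_mult_eq_0[OF P(2)] by (metis mult_zero_right)
    moreover have "r \<noteq> 0"
    proof
      assume "r = 0"
      then have "c = from_poly P * from_poly q"
        using arg_cong[OF qr(1), of from_poly] by (simp add: from_to_poly from_poly_hom)
      then show False using c by (simp add: P(4) mult_ac)
    qed
    ultimately have "kill {} p * lead_coeff r = 0" "lead_coeff r \<noteq> 0"
      by (simp_all add: poly_eq_iff)
    then show ?thesis using mpoly_no_zero_divisors by blast
  qed
  obtain e :: "'n \<Rightarrow> nat" where e: "bij_betw e UNIV {..<CARD('n)}" "e v = 0" by (rule ex_enum_from)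
  \<comment> \<open>\<open>e\<close> gives number \<open>0\<close> to \<open>v\<close> and the
    numbers \<open>1\<close> to \<open>n - 1\<close> to the other variables. Stage \<open>i\<close>
    kills those up to \<open>i\<close>, so the stages \<open>0\<close> to \<open>n - 1\<close>
    supply exactly \<open>n\<close> primes.\<close>
  define S where "S i = {j. 1 \<le> e j \<and> e j \<le> i}" for i
  define good where "good i Q \<longleftrightarrow> cprime Q \<and> ?J \<subseteq> Q \<and> (\<forall>p. sub_y p \<in> Q \<longleftrightarrow> kill (S i) p = 0)" for i Q
  have "\<exists>Q. good 0 Q"
    by (rule lying_over[OF J P(2) PJ J0, of "S 0"]) (auto simp: good_def)
  moreover have step: "\<exists>Q'. good (Suc i) Q' \<and> Q \<subseteq> Q'" if Q: "good i Q" for i Q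
  proof -
    have Q': "cideal Q" "from_poly P \<in> Q" "\<And>p. sub_y p \<in> Q \<Longrightarrow> kill (S i) p = 0"
      using Q PJ cprime_ideal[of Q] unfolding good_def by blast+
    obtain Q' where "cprime Q'" "Q \<subseteq> Q'" "\<And>p. sub_y p \<in> Q' \<longleftrightarrow> kill (S (Suc i)) p = 0"
      by (rule lying_over[OF Q'(1) P(2) Q'(2,3), of "S (Suc i)"]) (auto simp: S_def)
    then show ?thesis using Q by (auto simp: good_def)
  qed
  ultimately obtain Q where Q: "\<And>i. good i (Q i)" "\<And>i. Q i \<subseteq> Q (Suc i)"
    using dependent_nat_choice[of "\<lambda>i Q. good i Q" "\<lambda>i Q Q'. Q \<subseteq> Q'"] by metis
  have "Q i \<subset> Q (Suc i)" if i: "Suc i < CARD('n)" for i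
  proof -
    obtain j where j: "e j = Suc i" using i e(1) unfolding bij_betw_def by (metis imageE lessThan_iff)
    then have "j \<noteq> v" using e(2) by auto
    have "PX j \<noteq> (0 :: 'n mpoly)" by (metis PX_def lookup_single_eq lookup_zero one_neq_zero)
    then have "kill (S i) (PX j) \<noteq> 0" "kill (S (Suc i)) (PX j) = 0"
      using j \<open>j \<noteq> v\<close> by (auto simp: S_def)
    then have "sub_y (PX j) \<notin> Q i" "sub_y (PX j) \<in> Q (Suc i)" using Q(1)[of i] Q(1)[of "Suc i"] unfolding good_def by blast+
    then show ?thesis using Q(2)[of i] by blast
  qed
  then show ?thesis unfolding has_long_chain_def using Q(1) by (intro exI[of _ Q]) (auto simp: good_def)
qed

subsection \<open>Maximal minors\<close>

definition minors_in :: "'a::comm_ring_1 mat \<Rightarrow> 'a set \<Rightarrow> bool" where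
  "minors_in M Q \<longleftrightarrow> (\<forall>J. J \<subseteq> {..<dim_col M} \<and> card J = dim_row M \<longrightarrow> det (submatrix M UNIV J) \<in> Q)"

lemma submatrix_UNIV:
  assumes "M \<in> carrier_mat l k" "J \<subseteq> {..<k}" "card J = l"
  shows "submatrix M UNIV J = mat l l (\<lambda>(i, j). M $$ (i, pick J j))"
proof -
  have "{j. j < k \<and> j \<in> J} = J" using assms(2) by auto
  then show ?thesis using assms by (auto simp: submatrix_def pick_UNIV)
qed

text \<open>A repeated column makes the determinant zero; otherwise \<open>\<sigma>\<close> differs
  from the increasing enumeration \<open>pick J\<close> by a permutation, which costs a
  sign.\<close>

lemma det_select_columns_mem:
  fixes M :: "'a::comm_ring_1 mat"
  assumes M: "M \<in> carrier_mat l k" and Q: "cideal Q" and mi: "minors_in M Q"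
    and \<sigma>: "\<And>j. j < l \<Longrightarrow> \<sigma> j < k"
  shows "det (mat l l (\<lambda>(i, j). M $$ (i, \<sigma> j))) \<in> Q"
proof (cases "inj_on \<sigma> {..<l}")
  case False
  then obtain i j where ij: "i < l" "j < l" "i \<noteq> j" "\<sigma> i = \<sigma> j" by (auto simp: inj_on_def)
  have "det (mat l l (\<lambda>(i, j). M $$ (i, \<sigma> j))) = 0"
    by (rule det_identical_columns[OF _ ij(3,1,2)]) (use ij in \<open>auto intro!: eq_vecI\<close>)
  then show ?thesis using cideal_zero[OF Q] by simp
next
  case True
  define J where "J = \<sigma> ` {..<l}"
  have J: "J \<subseteq> {..<k}" "card J = l" "finite J" using True \<sigma> by (auto simp: J_def card_image)
  \<comment> \<open>The rank of \<open>\<sigma> j\<close> within \<open>J\<close>; beyond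
    \<open>l\<close> the identity, as \<open>permutes\<close> demands.\<close>
  define \<pi> where "\<pi> j = (if j < l then card {a\<in>J. a < \<sigma> j} else j)" for j
  have pick: "pick J (\<pi> j) = \<sigma> j" if "j < l" for j
    using that pick_card_in_set[of "\<sigma> j" J] by (simp add: \<pi>_def J_def)
  have lt: "\<pi> j < l" if "j < l" for j
  proof -
    have "{a\<in>J. a < \<sigma> j} \<subset> J" using that by (auto simp: J_def)
    then show ?thesis using psubset_card_mono[OF J(3)] J(2) that by (simp add: \<pi>_def)
  qed
  have "inj_on \<pi> {..<l}"
    using True pick by (intro inj_onI) (metis inj_onD lessThan_iff)
  then have "bij_betw \<pi> {..<l} {..<l}"
    using lt by (intro bij_betw_imageI endo_inj_surj) auto
  then have perm: "\<pi> permutes {0..<l}"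
    by (intro bij_imp_permutes) (auto simp: \<pi>_def atLeast0LessThan)
  let ?N = "submatrix M UNIV J"
  have N: "?N = mat l l (\<lambda>(i, j). M $$ (i, pick J j))" by (rule submatrix_UNIV[OF M J(1,2)])
  have "mat l l (\<lambda>(i, j). M $$ (i, \<sigma> j)) = (mat l l (\<lambda>(i, j). ?N\<^sup>T $$ (\<pi> i, j)))\<^sup>T"
    by (rule eq_matI) (auto simp: N lt pick)
  also have "det \<dots> = det (mat l l (\<lambda>(i, j). ?N\<^sup>T $$ (\<pi> i, j)))" by (rule det_transpose[of _ l]) simp
  also have "\<dots> = signof \<pi> * det ?N\<^sup>T" by (rule det_permute_rows[OF _ perm]) (simp add: N)
  also have "\<dots> = signof \<pi> * det ?N" using det_transpose[of ?N l] by (simp add: N)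
  also have "\<dots> \<in> Q" using mi J M by (intro cideal_mult[OF Q]) (auto simp: minors_in_def)
  finally show ?thesis .
qed

text \<open>Cramer's rule over the residue field of \<open>Q\<close>: take the largest \<open>r\<close> for which the first \<open>r\<close> rows have
  a nonvanishing \<open>r \<times> r\<close> minor and expand the \<open>(r + 1) \<times> (r + 1)\<close> minors along the last column.\<close>

lemma ex_left_kernel_mod_prime:
  fixes M :: "'a::comm_ring_1 mat"
  assumes M: "M \<in> carrier_mat l k" and Q: "cprime Q" and mi: "minors_in M Q"
  obtains c where "\<exists>i<l. c i \<notin> Q" "\<And>j. j < k \<Longrightarrow> (\<Sum>i<l. c i * M $$ (i, j)) \<in> Q"
proof -
  note Qi = cprime_ideal[OF Q]
  define B where "B r \<sigma> = mat r r (\<lambda>(i, j). M $$ (i, \<sigma> j))" for r and \<sigma> :: "nat \<Rightarrow> nat"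
  define T where "T r \<longleftrightarrow> (\<exists>\<sigma>. (\<forall>j<r. \<sigma> j < k) \<and> det (B r \<sigma>) \<notin> Q)" for r
  have "T 0" using cprime_one[OF Q] by (simp add: T_def B_def det_dim_zero)
  moreover have "\<not> T l" using det_select_columns_mem[OF M Qi mi] by (auto simp: T_def B_def)
  ultimately have "\<exists>r<l. T r \<and> \<not> T (Suc r)" using ex_least_nat_less[of "\<lambda>r. \<not> T r" l] by auto
  then obtain r \<sigma> where r: "r < l" "\<not> T (Suc r)" and \<sigma>: "\<forall>j<r. \<sigma> j < k" "det (B r \<sigma>) \<notin> Q"
    unfolding T_def by blast
  \<comment> \<open>Cofactors of the last column do not see that column, so the value of
    \<open>\<sigma>\<close> at \<open>r\<close> is irrelevant and the same \<open>c\<close> serves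
    every \<open>j\<close>.\<close>
  define c where "c i = (if i \<le> r then cofactor (B (Suc r) \<sigma>) i r else 0)" for i
  have "c r = det (B r \<sigma>)"
  proof -
    have "mat_delete (B (Suc r) \<sigma>) r r = B r \<sigma>"
      by (rule eq_matI) (auto simp: mat_delete_def B_def)
    then show ?thesis by (simp add: c_def cofactor_def mult_2[symmetric])
  qed
  then have "\<exists>i<l. c i \<notin> Q" using r(1) \<sigma>(2) by auto
  moreover have "(\<Sum>i<l. c i * M $$ (i, j)) \<in> Q" if j: "j < k" for j
  proof -
    let ?D = "B (Suc r) (\<sigma>(r := j))"
    have D: "?D \<in> carrier_mat (Suc r) (Suc r)" by (simp add: B_def)
    have cof: "cofactor ?D i r = c i" if "i \<le> r" for i
    proof -
      have "mat_delete ?D i r = mat_delete (B (Suc r) \<sigma>) i r"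
        by (rule eq_matI) (auto simp: mat_delete_def B_def)
      then show ?thesis using that by (simp add: c_def cofactor_def)
    qed
    have "(\<Sum>i<l. c i * M $$ (i, j)) = (\<Sum>i<Suc r. c i * M $$ (i, j))"
      using r(1) by (intro sum.mono_neutral_right) (auto simp: c_def)
    also have "\<dots> = (\<Sum>i<Suc r. ?D $$ (i, r) * cofactor ?D i r)"
    proof (rule sum.cong[OF refl])
      fix i assume "i \<in> {..<Suc r}"
      then have i: "i \<le> r" by simp
      then have "?D $$ (i, r) = M $$ (i, j)" by (simp add: B_def)
      then show "c i * M $$ (i, j) = ?D $$ (i, r) * cofactor ?D i r" by (simp add: cof[OF i] mult.commute)
    qed
    also have "\<dots> = det ?D" by (rule laplace_expansion_column[OF D, symmetric]) simp
    also have "\<dots> \<in> Q"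
    proof -
      have "\<forall>i<Suc r. (\<sigma>(r := j)) i < k" using \<sigma>(1) j by simp
      then show ?thesis using r(2) unfolding T_def by blast
    qed
    finally show ?thesis .
  qed
  ultimately show ?thesis using that by blast
qed

section \<open>Row rank and maximal minors at a point\<close>

lemma (in vec_space) rank_le_dim_row:
  assumes "A \<in> carrier_mat n nc"
  shows "rank A \<le> n"
proof -
  obtain S where S: "maximal S (\<lambda>T. T \<subseteq> set (cols A) \<and> lin_indpt T)" "finite S"
    using maximal_exists_superset[of "set (cols A)" "\<lambda>T. T \<subseteq> set (cols A) \<and> lin_indpt T" "{}"]
    by (auto simp: lin_dep_def)
  then have "S \<subseteq> set (cols A)" "lin_indpt S" by (auto simp: maximal_def)
  moreover have "set (cols A) \<subseteq> carrier_vec n" using cols_dim assms by blast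
  ultimately have "card S \<le> dim" by (intro li_le_dim(2)) auto
  then show ?thesis using rank_card_indpt[OF assms S(1)] by (simp add: dim_is_n)
qed

text \<open>At full rank the columns span the whole space, and then \<open>u\<close> would
  annihilate the unit vectors as well.\<close>

lemma (in vec_space) rank_less_if_left_kernel:
  assumes A: "A \<in> carrier_mat n nc" and u: "u \<in> carrier_vec n" "u \<noteq> 0\<^sub>v n"
    and 0: "\<And>j. j < nc \<Longrightarrow> scalar_prod u (col A j) = 0"
  shows "rank A < n"
proof (rule ccontr)
  assume "\<not> rank A < n"
  obtain S where S: "maximal S (\<lambda>T. T \<subseteq> set (cols A) \<and> lin_indpt T)" "finite S"
    using maximal_exists_superset[of "set (cols A)" "\<lambda>T. T \<subseteq> set (cols A) \<and> lin_indpt T" "{}"]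
    by (auto simp: lin_dep_def)
  then have Sc: "S \<subseteq> set (cols A)" "lin_indpt S" by (auto simp: maximal_def)
  have cs: "set (cols A) \<subseteq> carrier_vec n" using cols_dim A by blast
  have "card S \<ge> dim" using \<open>\<not> rank A < n\<close> rank_card_indpt[OF A S(1)] by (simp add: dim_is_n)
  then have "basis S" using S(2) Sc cs by (intro dim_li_is_basis) auto
  then have "span S = carrier_vec n" by (simp add: basis_def)
  moreover have "span S \<subseteq> {v \<in> carrier_vec n. scalar_prod u v = 0}"
  proof (rule span_is_subset)
    show "LinearCombinations.submodule class_ring {v \<in> carrier_vec n. scalar_prod u v = 0} V"
      using u(1) module_axioms
      by (auto simp: LinearCombinations.submodule_def module_vec_simps class_ring_simps scalar_prod_add_distrib[of u n])
    show "S \<subseteq> {v \<in> carrier_vec n. scalar_prod u v = 0}"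
      using Sc(1) cs 0 A by (auto simp: cols_def)
  qed
  ultimately have "scalar_prod u v = 0" if "v \<in> carrier_vec n" for v using that by blast
  then have "scalar_prod u (unit_vec n i) = 0" for i by simp
  then have "vec_index u i = 0" if "i < n" for i using u(1) that scalar_prod_right_unit[OF that, of u] by metis
  then have "u = 0\<^sub>v n" using u(1) by (intro eq_vecI) auto
  then show False using u(2) by simp
qed

text \<open>A nonvanishing minor bounds the rank from below. If all minors vanish at
  \<open>x\<close>, they lie in the prime of polynomials vanishing at \<open>x\<close>, and a left
  kernel vector modulo this prime, evaluated at \<open>x\<close>, is a nonzero null vector.\<close>

lemma full_row_rank_iff:
  fixes M :: "'n::finite mpoly mat"
  assumes M: "M \<in> carrier_mat l k"
  shows "full_row_rank (map_mat (\<lambda>p. peval p x) M) \<longleftrightarrow> \<not> minors_in M {p. peval p x = 0}"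
proof -
  let ?ev = "\<lambda>p. peval p x"
  let ?A = "map_mat ?ev M"
  have A: "?A \<in> carrier_mat l k" using M by simp
  have fr: "full_row_rank ?A \<longleftrightarrow> vec_space.rank l ?A = l" using A by (simp add: full_row_rank_def)
  have "vec_space.rank l ?A = l" if nm: "\<not> minors_in M {p. peval p x = 0}"
  proof -
    from nm obtain J where J: "J \<subseteq> {..<k}" "card J = l" "peval (det (submatrix M UNIV J)) x \<noteq> 0"
      using M by (auto simp: minors_in_def)
    have "submatrix ?A UNIV J = map_mat ?ev (submatrix M UNIV J)"
      unfolding submatrix_UNIV[OF M J(1,2)] submatrix_UNIV[OF A J(1,2)]
    proof (rule eq_matI)
      fix i j assume ij: "i < dim_row (map_mat ?ev (mat l l (\<lambda>(i, j). M $$ (i, pick J j))))"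
        "j < dim_col (map_mat ?ev (mat l l (\<lambda>(i, j). M $$ (i, pick J j))))"
      have "{a. a < k \<and> a \<in> J} = J" using J(1) by auto
      then have "pick J j < k" using pick_le[of j k J] ij J(2) by simp
      then show "mat l l (\<lambda>(i, j). ?A $$ (i, pick J j)) $$ (i, j) = map_mat ?ev (mat l l (\<lambda>(i, j). M $$ (i, pick J j))) $$ (i, j)"
        using ij M by simp
    qed auto
    then have "det (submatrix ?A UNIV J) \<noteq> 0" using J(3) by (simp add: peval.hom_det)
    from vec_space.rank_gt_minor[OF A this] have "card {j. j < k \<and> j \<in> J} \<le> vec_space.rank l ?A" .
    moreover have "{j. j < k \<and> j \<in> J} = J" using J(1) by auto
    ultimately show ?thesis using vec_space.rank_le_dim_row[OF A] J(2) by simp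
  qed
  moreover have "vec_space.rank l ?A < l" if mi: "minors_in M {p. peval p x = 0}"
  proof -
    let ?Q = "{p :: 'n mpoly. peval p x = 0}"
    have Q: "cprime ?Q" by (auto simp: cprime_def cideal_def peval.hom_add peval.hom_mult)
    obtain c where c: "\<exists>i<l. c i \<notin> ?Q" "\<And>j. j < k \<Longrightarrow> (\<Sum>i<l. c i * M $$ (i, j)) \<in> ?Q"
      by (rule ex_left_kernel_mod_prime[OF M Q mi]) blast
    let ?u = "vec l (\<lambda>i. peval (c i) x)"
    show ?thesis
    proof (rule vec_space.rank_less_if_left_kernel[OF A, of ?u])
      obtain i where i: "i < l" "peval (c i) x \<noteq> 0" using c(1) by auto
      then have "vec_index ?u i \<noteq> vec_index (0\<^sub>v l) i" by simp
      then show "?u \<noteq> 0\<^sub>v l" by metis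
      fix j assume "j < k"
      then show "scalar_prod ?u (col ?A j) = 0"
        using c(2)[of j] M by (simp add: scalar_prod_def atLeast0LessThan peval.hom_sum peval.hom_mult)
    qed simp
  qed
  ultimately show ?thesis using fr by auto
qed

lemma cideal_cancellation_ideal: "cideal (cancellation_ideal (M :: 'a::comm_ring_1 mat))"
  unfolding cancellation_ideal_def cideal_iff_ideal[symmetric]
  by (rule ring.genideal_ideal[OF class_ring.ring_axioms]) (simp add: class_ring_simps)

lemma cancellation_ideal_subset_iff:
  assumes K: "cideal K"
  shows "cancellation_ideal M \<subseteq> K \<longleftrightarrow> minors_in M K"
proof -
  let ?S = "{det (submatrix M UNIV J) | J. J \<subseteq> {..<dim_col M} \<and> card J = dim_row M}"
  have "cancellation_ideal M \<subseteq> K \<longleftrightarrow> ?S \<subseteq> K"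
    unfolding cancellation_ideal_def
    using ring.Idl_subset_ideal[OF class_ring.ring_axioms, of K ?S] K
    by (simp add: cideal_iff_ideal class_ring_simps)
  also have "\<dots> \<longleftrightarrow> minors_in M K" by (auto simp: minors_in_def)
  finally show ?thesis .
qed

lemma zero_set_cancellation_ideal:
  "x \<in> zero_set (cancellation_ideal M) \<longleftrightarrow> minors_in M {p. peval p x = 0}"
proof -
  have "cideal {p. peval p x = 0}" by (auto simp: cideal_def peval.hom_add peval.hom_mult)
  from cancellation_ideal_subset_iff[OF this, of M] show ?thesis by (auto simp: zero_set_def)
qed

subsection \<open>Torsion and the cancellation ideal\<close>

locale presentation =
  fixes M :: "'n::finite mpoly mat" and l k :: nat
  assumes M: "M \<in> carrier_mat l k" and ideal_nonzero: "cancellation_ideal M \<noteq> {0}"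
begin

text \<open>Coefficients are functions on all of \<open>nat\<close> of which only the first
  \<open>l\<close> values count, so uniqueness of coefficients can be claimed only below
  \<open>l\<close>.\<close>

definition comb :: "(nat \<Rightarrow> 'n mpoly) \<Rightarrow> 'n mpoly Matrix.vec" where
  "comb c = vec k (\<lambda>j. \<Sum>i<l. c i * M $$ (i, j))"

definition rel_module :: "'n mpoly Matrix.vec set" where "rel_module = range comb"

text \<open>The common middle term: torsion freeness of the quotient, absence of long chains and
  controllability are all compared with this condition.\<close>

definition saturated :: bool where
  "saturated \<longleftrightarrow> (\<forall>a v. a \<noteq> 0 \<and> v \<in> carrier_vec k \<and> a \<cdot>\<^sub>v v \<in> rel_module \<longrightarrow> v \<in> rel_module)"

lemma comb_carrier [simp]: "comb c \<in> carrier_vec k" by (simp add: comb_def)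

lemma comb_index: "j < k \<Longrightarrow> vec_index (comb c) j = (\<Sum>i<l. c i * M $$ (i, j))"
  by (simp add: comb_def)

text \<open>The entries of \<open>comb c\<close> at the columns in \<open>J\<close> form the row
  vector \<open>c B\<close> for the submatrix \<open>B\<close>; the adjugate of \<open>B\<close>
  recovers \<open>c\<close> up to the determinant.\<close>

lemma cramer:
  assumes J: "J \<subseteq> {..<k}" "card J = l" and i: "i < l"
  shows "c i * det (submatrix M UNIV J) =
    (\<Sum>j<l. vec_index (comb c) (pick J j) * adj_mat (submatrix M UNIV J) $$ (j, i))"
proof -
  let ?B = "submatrix M UNIV J"
  have B: "?B \<in> carrier_mat l l" by (simp add: submatrix_UNIV[OF M J])
  have "{a. a < k \<and> a \<in> J} = J" using J(1) by auto
  then have pk: "pick J j < k" if "j < l" for j using pick_le[of j k J] that J(2) by simp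
  have "(\<Sum>j<l. vec_index (comb c) (pick J j) * adj_mat ?B $$ (j, i)) =
    (\<Sum>j<l. \<Sum>i'<l. c i' * (?B $$ (i', j) * adj_mat ?B $$ (j, i)))"
    by (intro sum.cong) (auto simp: comb_index pk submatrix_UNIV[OF M J] sum_distrib_right mult.assoc)
  also have "\<dots> = (\<Sum>i'<l. c i' * (\<Sum>j<l. ?B $$ (i', j) * adj_mat ?B $$ (j, i)))"
    by (subst sum.swap) (simp add: sum_distrib_left)
  also have "\<dots> = (\<Sum>i'<l. if i' = i then c i' * det ?B else 0)"
  proof (rule sum.cong[OF refl])
    fix i' assume i': "i' \<in> {..<l}"
    have "(?B * adj_mat ?B) $$ (i', i) = (\<Sum>j<l. ?B $$ (i', j) * adj_mat ?B $$ (j, i))"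
      using adj_mat(1)[OF B] B i i' by (simp add: times_mat_def scalar_prod_def atLeast0LessThan)
    moreover have "(?B * adj_mat ?B) $$ (i', i) = (if i' = i then det ?B else 0)"
      using i i' by (auto simp: adj_mat(2)[OF B])
    ultimately have eq: "(\<Sum>j<l. ?B $$ (i', j) * adj_mat ?B $$ (j, i)) = (if i' = i then det ?B else 0)"
      by (rule trans[OF sym])
    show "c i' * (\<Sum>j<l. ?B $$ (i', j) * adj_mat ?B $$ (j, i)) = (if i' = i then c i' * det ?B else 0)"
      by (simp only: eq) simp
  qed
  also have "\<dots> = c i * det ?B" using i by (simp add: sum.delta)
  finally show ?thesis by simp
qed

lemma ex_minor:
  obtains J where "J \<subseteq> {..<k}" "card J = l" "det (submatrix M UNIV J) \<noteq> 0"
proof -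
  have "{0} \<subseteq> cancellation_ideal M" using cideal_zero[OF cideal_cancellation_ideal] by blast
  then have "\<not> cancellation_ideal M \<subseteq> {0}" using ideal_nonzero by blast
  then have "\<not> minors_in M {0}"
    using cancellation_ideal_subset_iff[of "{0}" M] by (simp add: cideal_def)
  then show ?thesis using that M by (auto simp: minors_in_def)
qed

lemma rows_le_cols: "l \<le> k"
proof -
  obtain J where "J \<subseteq> {..<k}" "card J = l" by (rule ex_minor)
  then show ?thesis using card_mono[of "{..<k}" J] by simp
qed

lemma comb_hom: "comb (\<lambda>i. c i + d i) = comb c + comb d" "comb (\<lambda>i. a * c i) = a \<cdot>\<^sub>v comb c"
  by (auto intro!: eq_vecI simp: comb_def algebra_simps sum.distrib sum_distrib_left)

lemma comb_inj:
  assumes "comb c = comb d" "i < l"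
  shows "c i = d i"
proof -
  obtain J where J: "J \<subseteq> {..<k}" "card J = l" "det (submatrix M UNIV J) \<noteq> 0" by (rule ex_minor)
  have "(c i - d i) * det (submatrix M UNIV J) = 0"
    using cramer[OF J(1,2) assms(2), of c] cramer[OF J(1,2) assms(2), of d] assms(1)
    by (simp add: left_diff_distrib)
  then show ?thesis using J(3) mpoly_no_zero_divisors by fastforce
qed

lemma not_saturated_imp_long_chain:
  assumes "\<not> saturated"
  shows "has_long_chain (cancellation_ideal M)"
proof -
  from assms obtain a v c where a: "a \<noteq> 0" and v: "v \<in> carrier_vec k" "v \<notin> rel_module" and c: "a \<cdot>\<^sub>v v = comb c"
    unfolding saturated_def rel_module_def by auto
  \<comment> \<open>Otherwise \<open>a\<close> could be cancelled, and \<open>v\<close> would itself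
    be a combination of the rows.\<close>
  have "\<exists>i<l. \<not> a dvd c i"
  proof (rule ccontr)
    assume "\<not> ?thesis"
    then have "\<forall>i. \<exists>d. i < l \<longrightarrow> c i = a * d" by auto
    then obtain d where d: "\<And>i. i < l \<Longrightarrow> c i = a * d i" by metis
    have "comb c = comb (\<lambda>i. a * d i)" by (auto simp: comb_def d intro!: eq_vecI sum.cong)
    then have eq: "a \<cdot>\<^sub>v v = a \<cdot>\<^sub>v comb d" using c by (simp add: comb_hom)
    have "v = comb d"
    proof (rule eq_vecI)
      fix j assume "j < dim_vec (comb d)"
      then have j: "j < k" by (simp add: comb_def)
      have "a * (vec_index v j - vec_index (comb d) j) = 0"
        using arg_cong[OF eq, of "\<lambda>u. vec_index u j"] j v(1) by (simp add: right_diff_distrib comb_def)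
      then show "vec_index v j = vec_index (comb d) j" using mpoly_no_zero_divisors a by fastforce
    qed (use v in \<open>auto simp: comb_def\<close>)
    then show False using v(2) by (auto simp: rel_module_def)
  qed
  then obtain i where i: "i < l" "\<not> a dvd c i" by blast
  let ?K = "{p. a dvd p * c i}"
  have K: "cideal ?K" by (rule cidealI) (auto simp: distrib_right mult.assoc)
  have "minors_in M ?K"
    unfolding minors_in_def
  proof (intro allI impI)
    fix J assume "J \<subseteq> {..<dim_col M} \<and> card J = dim_row M"
    then have J: "J \<subseteq> {..<k}" "card J = l" using M by auto
    have "{a. a < k \<and> a \<in> J} = J" using J(1) by auto
    then have pk: "pick J j < k" if "j < l" for j using pick_le[of j k J] that J(2) by simp
    \<comment> \<open>The entries of \<open>comb c\<close> are those of \<open>a v\<close>, so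
      Cramer's rule exhibits the product of \<open>c i\<close> with the minor as a multiple of
      \<open>a\<close>.\<close>
    have "c i * det (submatrix M UNIV J) =
      (\<Sum>j<l. vec_index (comb c) (pick J j) * adj_mat (submatrix M UNIV J) $$ (j, i))" by (rule cramer[OF J i(1)])
    also have "\<dots> = (\<Sum>j<l. a * (vec_index v (pick J j) * adj_mat (submatrix M UNIV J) $$ (j, i)))"
      using v(1) by (intro sum.cong) (auto simp: c[symmetric] pk mult.assoc)
    finally show "det (submatrix M UNIV J) \<in> ?K"
      by (simp add: mult.commute[of _ "c i"] flip: sum_distrib_left)
  qed
  then have "cancellation_ideal M \<subseteq> ?K" using cancellation_ideal_subset_iff[OF K] by blast
  then show ?thesis using colon_has_long_chain[OF a i(2)] unfolding has_long_chain_def by blast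
qed

text \<open>With \<open>{0}\<close> below and \<open>R\<close> strictly in between, the
  \<open>n\<close> primes would extend to a chain of \<open>n + 2\<close>. This does the work of the
  principal ideal theorem.\<close>

lemma primes_below:
  fixes Q :: "nat \<Rightarrow> 'n mpoly set"
  assumes Q: "\<And>i. i < CARD('n) \<Longrightarrow> cprime (Q i)" "\<And>i. Suc i < CARD('n) \<Longrightarrow> Q i \<subset> Q (Suc i)"
    and R: "cprime R" "R \<subseteq> Q 0" "R \<noteq> {0}"
  shows "R = Q 0"
proof (rule ccontr)
  assume ne: "R \<noteq> Q 0"
  define P where "P i = (if i = 0 then {0} else if i = 1 then R else Q (i - 2))" for i
  have "Suc (CARD('n)) \<le> CARD('n)"
  proof (rule prime_chain_le_card[of "Suc (CARD('n))" P])
    show "cprime (P i)" if "i \<le> Suc (CARD('n))" for i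
      using that Q(1)[of "i - 2"] R(1) cprime_zero by (auto simp: P_def)
    show "P i \<subset> P (Suc i)" if "i < Suc (CARD('n))" for i
    proof -
      consider "i = 0" | "i = 1" | j where "i = Suc (Suc j)" by (metis One_nat_def not0_implies_Suc)
      then show ?thesis
      proof cases
        case 1
        then show ?thesis using R(3) cideal_zero[OF cprime_ideal[OF R(1)]] by (auto simp: P_def)
      next
        case 2
        then show ?thesis using R(2) ne by (auto simp: P_def)
      next
        case 3
        then show ?thesis using Q(2)[of j] that by (auto simp: P_def)
      qed
    qed
  qed
  then show False by simp
qed

text \<open>A one-dimensional local domain has depth one: \<open>K\<close> stands for a principal ideal of the localisation,
  and \<open>t\<close> is a nonzero element of the socle of the quotient by it.\<close>

lemma ex_socle_element:
  fixes K :: "'a::comm_ring_1 set" and m :: nat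
  assumes K: "cideal K" "1 \<notin> K" and u: "\<And>j. j < m \<Longrightarrow> \<exists>N. u j ^ N \<in> K"
  shows "\<exists>t. t \<notin> K \<and> (\<forall>j<m. t * u j \<in> K)"
  using u
proof (induction m)
  case 0
  then show ?case using K(2) by auto
next
  case (Suc m)
  then obtain t where t: "t \<notin> K" "\<And>j. j < m \<Longrightarrow> t * u j \<in> K" by (metis less_Suc_eq)
  obtain N where "u m ^ N \<in> K" using Suc.prems by blast
  then have N: "t * u m ^ N \<in> K" by (rule cideal_mult[OF K(1)])
  then obtain e where e: "t * u m ^ e \<notin> K" "t * u m ^ Suc e \<in> K"
    using ex_least_nat_less[of "\<lambda>e. t * u m ^ e \<in> K" N] t(1) by auto
  have "t * u m ^ e * u j \<in> K" if "j < Suc m" for j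
  proof (cases "j = m")
    case True
    then show ?thesis using e(2) by (simp add: mult_ac)
  next
    case False
    then have "t * u j \<in> K" using t(2) that by simp
    then show ?thesis using cideal_mult_right[OF K(1), of _ "u m ^ e"] by (metis mult.commute mult.left_commute)
  qed
  then show ?case using e(1) by blast
qed

lemma saturated_imp_no_long_chain:
  assumes sat: saturated
  shows "\<not> has_long_chain (cancellation_ideal M)"
proof
  assume "has_long_chain (cancellation_ideal M)"
  then obtain Q where Q: "\<And>i. i < CARD('n) \<Longrightarrow> cprime (Q i)" "\<And>i. Suc i < CARD('n) \<Longrightarrow> Q i \<subset> Q (Suc i)"
    and IQ: "\<And>i. i < CARD('n) \<Longrightarrow> cancellation_ideal M \<subseteq> Q i"
    unfolding has_long_chain_def by blast
  define q where "q = Q 0"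
  have q: "cprime q" using Q(1)[of 0] by (simp add: q_def)
  note qi = cprime_ideal[OF q]
  have mi: "minors_in M q" using IQ[of 0] cancellation_ideal_subset_iff[OF qi, of M] by (simp add: q_def)
  obtain c where c: "\<exists>i<l. c i \<notin> q" "\<And>j. j < k \<Longrightarrow> (\<Sum>i<l. c i * M $$ (i, j)) \<in> q"
    by (rule ex_left_kernel_mod_prime[OF M q mi]) blast
  obtain J where J: "J \<subseteq> {..<k}" "card J = l" "det (submatrix M UNIV J) \<noteq> 0" by (rule ex_minor)
  define a where "a = det (submatrix M UNIV J)"
  have a: "a \<noteq> 0" "a \<in> q" using J mi M by (auto simp: a_def minors_in_def)
  \<comment> \<open>In the local ring at \<open>q\<close> the only prime containing \<open>a\<close>
    is the maximal one, so each \<open>u\<close> in \<open>q\<close> is nilpotent modulo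
    \<open>a\<close>. Otherwise a prime containing \<open>a\<close> and avoiding all
    \<open>s * u ^ N\<close> would lie strictly between \<open>{0}\<close> and
    \<open>q\<close>.\<close>
  have pow: "\<exists>s N. s \<notin> q \<and> a dvd s * u ^ N" if u: "u \<in> q" for u
  proof (rule ccontr)
    assume *: "\<not> ?thesis"
    let ?S = "{s * u ^ N | s N. s \<notin> q}"
    have A: "cideal {p. a dvd p}" by (rule cidealI) auto
    have S1: "1 \<in> ?S" using cprime_one[OF q] by (intro CollectI exI[of _ 1] exI[of _ 0]) simp
    have S_mult: "x * y \<in> ?S" if "x \<in> ?S" "y \<in> ?S" for x y
    proof -
      obtain s N t L where st: "x = s * u ^ N" "y = t * u ^ L" "s \<notin> q" "t \<notin> q" using \<open>x \<in> ?S\<close> \<open>y \<in> ?S\<close> by blast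
      have "x * y = (s * t) * u ^ (N + L)" by (simp add: st power_add mult_ac)
      then show ?thesis using st cprime_mult[OF q, of s t] by blast
    qed
    have disj: "{p. a dvd p} \<inter> ?S = {}" using * by auto
    obtain R where R: "cprime R" "{p. a dvd p} \<subseteq> R" "R \<inter> ?S = {}"
      by (rule krull_maximal_avoiding[OF A S1 S_mult disj]) assumption+
    have "R \<subseteq> q"
    proof
      fix s assume "s \<in> R"
      show "s \<in> q"
      proof (rule ccontr)
        assume "s \<notin> q"
        then have "s * u ^ 0 \<in> ?S" by blast
        then show False using R(3) \<open>s \<in> R\<close> by auto
      qed
    qed
    moreover have "R \<noteq> {0}"
    proof -
      have "a \<in> R" by (rule subsetD[OF R(2)]) simp
      then show ?thesis using a(1) by blast
    qed
    ultimately have "R = q" using primes_below[of Q R] Q R(1) by (simp add: q_def)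
    moreover have "1 * u ^ 1 \<in> ?S" using cprime_one[OF q] by blast
    ultimately show False using R(3) u by auto
  qed
  \<comment> \<open>The contraction of the ideal that \<open>a\<close> generates in the localisation
    at \<open>q\<close>.\<close>
  define K where "K = {p. \<exists>s. s \<notin> q \<and> a dvd s * p}"
  have K: "cideal K"
  proof (rule cidealI)
    show "0 \<in> K" using cprime_one[OF q] by (auto simp: K_def)
    fix x y assume "x \<in> K" "y \<in> K"
    then obtain s t where st: "s \<notin> q" "a dvd s * x" "t \<notin> q" "a dvd t * y" by (auto simp: K_def)
    have "(s * t) * (x + y) = t * (s * x) + s * (t * y)" by (simp add: algebra_simps)
    then have "a dvd (s * t) * (x + y)" using st by (simp add: dvd_mult)
    then show "x + y \<in> K" using cprime_mult[OF q, of s t] st unfolding K_def by blast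
  next
    fix r x assume "x \<in> K"
    then show "r * x \<in> K" by (auto simp: K_def mult.left_commute[of _ r])
  qed
  have K1: "1 \<notin> K"
  proof
    assume "1 \<in> K"
    then obtain s where "s \<notin> q" "a dvd s" by (auto simp: K_def)
    then show False using cideal_mult_right[OF qi a(2)] by (auto elim: dvdE)
  qed
  define u where "u j = (\<Sum>i<l. c i * M $$ (i, j))" for j
  have "\<exists>N. u j ^ N \<in> K" if "j < k" for j
    using pow[OF c(2)[OF that]] unfolding K_def u_def by blast
  then obtain t where t: "t \<notin> K" "\<And>j. j < k \<Longrightarrow> t * u j \<in> K"
    using ex_socle_element[OF K K1, of k u] by blast
  have "\<forall>j. \<exists>s. j < k \<longrightarrow> s \<notin> q \<and> a dvd s * (t * u j)" using t(2) by (auto simp: K_def)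
  then obtain s where s: "\<And>j. j < k \<Longrightarrow> s j \<notin> q" "\<And>j. j < k \<Longrightarrow> a dvd s j * (t * u j)" by metis
  \<comment> \<open>A common denominator outside \<open>q\<close> for all columns.\<close>
  define s0 where "s0 = (\<Prod>j<k. s j)"
  have s0: "s0 \<notin> q" using cprime_prod[OF q, of "{..<k}" s] s(1) by (auto simp: s0_def)
  have "\<exists>y. s0 * t * u j = a * y" if "j < k" for j
  proof -
    have "s0 * (t * u j) = (\<Prod>i\<in>{..<k} - {j}. s i) * (s j * (t * u j))"
      using that by (simp add: s0_def prod.remove[of "{..<k}" j] mult_ac)
    then have "a dvd s0 * (t * u j)" using s(2)[OF that] by simp
    then show ?thesis by (auto simp: mult.assoc elim: dvdE)
  qed
  then obtain y where y: "\<And>j. j < k \<Longrightarrow> s0 * t * u j = a * y j" by metis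
  have "a \<cdot>\<^sub>v vec k y = comb (\<lambda>i. s0 * t * c i)"
    by (rule eq_vecI) (auto simp: comb_index comb_hom comb_def y[symmetric] u_def sum_distrib_left mult.assoc)
  then have "vec k y \<in> rel_module"
    using sat a(1) unfolding saturated_def rel_module_def by (metis rangeI vec_carrier)
  then obtain d where "vec k y = comb d" by (auto simp: rel_module_def)
  \<comment> \<open>Saturation has divided the combination by \<open>a\<close>. Coefficients being
    unique, \<open>a\<close> divides every \<open>s0 * t * c i\<close>, and an index with
    \<open>c i\<close> outside \<open>q\<close> then puts \<open>t\<close> into
    \<open>K\<close>.\<close>
  then have "comb (\<lambda>i. a * d i) = comb (\<lambda>i. s0 * t * c i)"
    using \<open>a \<cdot>\<^sub>v vec k y = _\<close> by (simp add: comb_hom)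
  then have eq: "a * d i = s0 * t * c i" if "i < l" for i using comb_inj that by blast
  obtain i where i: "i < l" "c i \<notin> q" using c(1) by blast
  have "a dvd (s0 * c i) * t" using eq[OF i(1)] by (metis dvd_triv_left mult.assoc mult.commute)
  moreover have "s0 * c i \<notin> q" using cprime_mult[OF q] s0 i(2) by blast
  ultimately show False using t(1) by (auto simp: K_def)
qed

lemma saturated_iff: "saturated \<longleftrightarrow> \<not> has_long_chain (cancellation_ideal M)"
  using not_saturated_imp_long_chain saturated_imp_no_long_chain by blast

text \<open>\<open>R v\<close> is \<open>\<delta> v - comb (e v)\<close>, where \<open>e v\<close>
  holds the coefficients that Cramer's rule computes from the columns \<open>J\<close>. On
  combinations of the rows the two terms agree; where they agree, \<open>\<delta> v\<close> is a
  combination and saturation removes \<open>\<delta>\<close>.\<close>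

lemma saturated_imp_kernel:
  assumes sat: saturated
  obtains R where "\<And>v. v \<in> carrier_vec k \<Longrightarrow> v \<in> rel_module \<longleftrightarrow> (\<forall>i<k. (\<Sum>j<k. R i j * vec_index v j) = 0)"
proof -
  obtain J where J: "J \<subseteq> {..<k}" "card J = l" "det (submatrix M UNIV J) \<noteq> 0" by (rule ex_minor)
  define \<delta> where "\<delta> = det (submatrix M UNIV J)"
  have "{a. a < k \<and> a \<in> J} = J" using J(1) by auto
  then have pk: "pick J j < k" if "j < l" for j using pick_le[of j k J] that J(2) by simp
  let ?adj = "\<lambda>j i. adj_mat (submatrix M UNIV J) $$ (j, i)"
  define e where "e v i = (\<Sum>j<l. vec_index v (pick J j) * ?adj j i)" for v :: "'n mpoly Matrix.vec" and i
  define R where "R i j = (if i = j then \<delta> else 0) - (\<Sum>j'<l. \<Sum>i'<l. if pick J j' = j then ?adj j' i' * M $$ (i', i) else 0)" for i j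
  have R: "(\<Sum>j<k. R i j * vec_index v j) = \<delta> * vec_index v i - vec_index (comb (e v)) i" if i: "i < k" for v i
  proof -
    have "(\<Sum>j<k. R i j * vec_index v j) = (\<Sum>j<k. if i = j then \<delta> * vec_index v j else 0) -
      (\<Sum>j<k. \<Sum>j'<l. \<Sum>i'<l. if pick J j' = j then ?adj j' i' * M $$ (i', i) * vec_index v j else 0)"
      unfolding R_def left_diff_distrib sum_subtractf sum_distrib_right
      by (intro arg_cong2[where f = "(-)"] sum.cong) auto
    also have "(\<Sum>j<k. \<Sum>j'<l. \<Sum>i'<l. if pick J j' = j then ?adj j' i' * M $$ (i', i) * vec_index v j else 0) =
      (\<Sum>j'<l. \<Sum>i'<l. \<Sum>j<k. if pick J j' = j then ?adj j' i' * M $$ (i', i) * vec_index v j else 0)"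
      by (subst sum.swap, rule sum.cong[OF refl], rule sum.swap)
    also have "\<dots> = (\<Sum>j'<l. \<Sum>i'<l. ?adj j' i' * M $$ (i', i) * vec_index v (pick J j'))"
      by (intro sum.cong refl) (simp add: sum.delta pk)
    also have "\<dots> = (\<Sum>i'<l. \<Sum>j'<l. ?adj j' i' * M $$ (i', i) * vec_index v (pick J j'))" by (rule sum.swap)
    also have "\<dots> = vec_index (comb (e v)) i"
      using i by (simp add: comb_index e_def sum_distrib_left sum_distrib_right mult_ac)
    finally show ?thesis using i by (simp add: sum.delta)
  qed
  show ?thesis
  proof (rule that[of R])
    fix v :: "'n mpoly Matrix.vec" assume v: "v \<in> carrier_vec k"
    show "v \<in> rel_module \<longleftrightarrow> (\<forall>i<k. (\<Sum>j<k. R i j * vec_index v j) = 0)"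
    proof
      assume "v \<in> rel_module"
      then obtain c where c: "v = comb c" by (auto simp: rel_module_def)
      have "e v i = \<delta> * c i" if "i < l" for i
        using cramer[OF J(1,2) that, of c] by (simp add: e_def c \<delta>_def mult.commute)
      then have "comb (e v) = comb (\<lambda>i. \<delta> * c i)" by (auto simp: comb_def intro!: eq_vecI sum.cong)
      then have "comb (e v) = \<delta> \<cdot>\<^sub>v v" by (simp add: comb_hom c)
      then show "\<forall>i<k. (\<Sum>j<k. R i j * vec_index v j) = 0" using v by (simp add: R)
    next
      assume 0: "\<forall>i<k. (\<Sum>j<k. R i j * vec_index v j) = 0"
      have "\<delta> \<cdot>\<^sub>v v = comb (e v)"
      proof (rule eq_vecI)
        fix i assume "i < dim_vec (comb (e v))"
        then have i: "i < k" by (simp add: comb_def)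
        then show "vec_index (\<delta> \<cdot>\<^sub>v v) i = vec_index (comb (e v)) i" using 0 R[OF i, of v] v by simp
      qed (use v in \<open>auto simp: comb_def\<close>)
      then show "v \<in> rel_module"
        using sat J(3) v unfolding saturated_def rel_module_def \<delta>_def by (metis rangeI)
    qed
  qed
qed

end

subsection \<open>Partial derivatives\<close>

lemma partial_eq: "(f has_derivative D) (at x) \<Longrightarrow> partial j f x = D (axis j 1)"
  unfolding partial_def using frechet_derivative_at by metis

lemma line_has_vector_derivative:
  fixes f :: "real ^ 'n::finite \<Rightarrow> complex"
  assumes "f differentiable (at (y + t *\<^sub>R axis j 1))"
  shows "((\<lambda>s. f (y + s *\<^sub>R axis j 1)) has_vector_derivative partial j f (y + t *\<^sub>R axis j 1)) (at t)"
proof -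
  obtain D where D: "(f has_derivative D) (at (y + t *\<^sub>R axis j 1))" using assms by (auto simp: differentiable_def)
  have "((\<lambda>s. y + s *\<^sub>R axis j 1) has_derivative (\<lambda>s. s *\<^sub>R axis j 1)) (at t)"
    by (auto intro!: derivative_eq_intros)
  from has_derivative_compose[OF this D]
  have "((\<lambda>s. f (y + s *\<^sub>R axis j 1)) has_derivative (\<lambda>s. D (s *\<^sub>R axis j 1))) (at t)" .
  moreover have "D (s *\<^sub>R axis j 1) = s *\<^sub>R partial j f (y + t *\<^sub>R axis j 1)" for s
    using D by (simp add: partial_eq linear_scale has_derivative_linear)
  ultimately show ?thesis by (simp add: has_vector_derivative_def)
qed

lemma partial_eqI:
  assumes "f differentiable (at x)" "((\<lambda>s. f (x + s *\<^sub>R axis j 1)) has_vector_derivative d) (at 0)"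
  shows "partial j f x = d"
  using line_has_vector_derivative[of f x 0 j] assms by (auto intro: vector_derivative_unique_at)

lemma partial_add:
  assumes "f differentiable (at x)" "g differentiable (at x)"
  shows "partial j (\<lambda>x. f x + g x) x = partial j f x + partial j g x"
proof -
  obtain D E where D: "(f has_derivative D) (at x)" and E: "(g has_derivative E) (at x)"
    using assms by (auto simp: differentiable_def)
  show ?thesis using partial_eq[OF has_derivative_add[OF D E]] partial_eq[OF D] partial_eq[OF E] by simp
qed

lemma partial_mult:
  assumes "f differentiable (at x)" "g differentiable (at x)"
  shows "partial j (\<lambda>x. f x * g x) x = partial j f x * g x + f x * partial j g x"
proof -
  obtain D E where D: "(f has_derivative D) (at x)" and E: "(g has_derivative E) (at x)"
    using assms by (auto simp: differentiable_def)
  show ?thesis using partial_eq[OF has_derivative_mult[OF D E]] partial_eq[OF D] partial_eq[OF E] by simp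
qed

lemma partial_const [simp]: "partial j (\<lambda>x. c) = (\<lambda>x. 0)"
  using partial_eq[OF has_derivative_const] by fastforce

text \<open>\<open>frechet_derivative\<close> is a choice among all derivatives. Functions that
  agree near \<open>x\<close> have the same derivatives there, hence the same choice, whether or not
  they are differentiable.\<close>

lemma partial_cong_near:
  assumes "eventually (\<lambda>y. f y = g y) (nhds x)"
  shows "partial j f x = partial j g x"
proof -
  have "f x = g x" using assms by (rule eventually_nhds_x_imp_x)
  have fg: "eventually (\<lambda>y. f y = g y) (at x)" "eventually (\<lambda>y. g y = f y) (at x)"
    using assms by (auto simp: eventually_nhds_conv_at eq_commute)
  have "(f has_derivative D) (at x) \<longleftrightarrow> (g has_derivative D) (at x)" for D
    using has_derivative_transform_eventually[of f D x UNIV g, OF _ fg(1)]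
      has_derivative_transform_eventually[of g D x UNIV f, OF _ fg(2)] \<open>f x = g x\<close> by auto
  then show ?thesis by (simp add: partial_def frechet_derivative_def)
qed

text \<open>A graded form of \<open>smooth\<close>: closure under products is an induction on the
  order, because differentiating a product leaves a sum of products of lower order.\<close>

fun CN :: "nat \<Rightarrow> (real ^ 'n::finite \<Rightarrow> complex) \<Rightarrow> bool" where
  "CN 0 f \<longleftrightarrow> (\<forall>x. f differentiable (at x))"
| "CN (Suc N) f \<longleftrightarrow> (\<forall>x. f differentiable (at x)) \<and> (\<forall>j. CN N (partial j f))"

lemma CN_differentiable: "CN N f \<Longrightarrow> f differentiable (at x)"
  by (cases N) auto

lemma CN_Suc: "CN (Suc N) f \<Longrightarrow> CN N f"
  by (induction N arbitrary: f) auto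

lemma CN_add: "CN N f \<Longrightarrow> CN N g \<Longrightarrow> CN N (\<lambda>x. f x + g x)"
proof (induction N arbitrary: f g)
  case (Suc N)
  then have "partial j (\<lambda>x. f x + g x) = (\<lambda>x. partial j f x + partial j g x)" for j by (auto simp: partial_add)
  then show ?case using Suc by (auto intro: differentiable_add)
qed (auto intro: differentiable_add)

lemma CN_mult: "CN N f \<Longrightarrow> CN N g \<Longrightarrow> CN N (\<lambda>x. f x * g x)"
proof (induction N arbitrary: f g)
  case (Suc N)
  then have "partial j (\<lambda>x. f x * g x) = (\<lambda>x. partial j f x * g x + f x * partial j g x)" for j
    by (auto simp: partial_mult)
  moreover have "CN N f" "CN N g" using Suc.prems CN_Suc by blast+
  ultimately show ?case using Suc by (auto intro: differentiable_mult CN_add)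
qed (auto intro: differentiable_mult)

lemma CN_const: "CN N (\<lambda>x. c)"
  by (induction N arbitrary: c) auto

lemma smooth_iff_CN: "smooth f \<longleftrightarrow> (\<forall>N. CN N f)"
proof
  assume "smooth f"
  then have "CN N f" for N
  proof (induction N arbitrary: f)
    case 0
    then show ?case by (auto simp: smooth_def dest: spec[of _ "[]"])
  next
    case (Suc N)
    have "smooth (partial j f)" for j
      unfolding smooth_def
    proof (intro allI)
      fix js x
      show "fold partial js (partial j f) differentiable (at x)"
        using Suc.prems[unfolded smooth_def, rule_format, of "j # js" x] by simp
    qed
    then show ?case using Suc by (auto simp: smooth_def dest: spec[of _ "[]"])
  qed
  then show "\<forall>N. CN N f" by blast
next
  assume CN: "\<forall>N. CN N f"
  have "CN (length js) f \<Longrightarrow> fold partial js f differentiable (at x)" for js x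
    by (induction js arbitrary: f) auto
  then show "smooth f" using CN by (simp add: smooth_def)
qed

lemma smooth_differentiable: "smooth f \<Longrightarrow> f differentiable (at x)"
  using CN_differentiable smooth_iff_CN by blast

lemma smooth_partial: "smooth f \<Longrightarrow> smooth (partial j f)"
  unfolding smooth_iff_CN by (metis CN.simps(2))

lemma smooth_fold: "smooth f \<Longrightarrow> smooth (fold partial js f)"
  by (induction js arbitrary: f) (auto intro: smooth_partial)

lemma smooth_add: "smooth f \<Longrightarrow> smooth g \<Longrightarrow> smooth (\<lambda>x. f x + g x)"
  by (simp add: smooth_iff_CN CN_add)

lemma smooth_mult: "smooth f \<Longrightarrow> smooth g \<Longrightarrow> smooth (\<lambda>x. f x * g x)"
  by (simp add: smooth_iff_CN CN_mult)

lemma smooth_const: "smooth (\<lambda>x. c)"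
  by (simp add: smooth_iff_CN CN_const)

lemma smooth_cmult: "smooth f \<Longrightarrow> smooth (\<lambda>x. c * f x)"
  by (rule smooth_mult[OF smooth_const])

lemma smooth_diff: "smooth f \<Longrightarrow> smooth g \<Longrightarrow> smooth (\<lambda>x. f x - g x)"
  using smooth_add[of f "\<lambda>x. (- 1) * g x"] smooth_cmult[of g "- 1"] by simp

lemma smooth_prod: "(\<And>i. i \<in> S \<Longrightarrow> smooth (f i)) \<Longrightarrow> smooth (\<lambda>x. \<Prod>i\<in>S. f i x)"
  by (induction S rule: infinite_finite_induct) (auto intro: smooth_const smooth_mult)

lemma smooth_continuous: "smooth f \<Longrightarrow> continuous_on S f"
  by (meson smooth_differentiable differentiable_imp_continuous_within continuous_at_imp_continuous_on)

lemma partial_add_smooth: "smooth f \<Longrightarrow> smooth g \<Longrightarrow> partial j (\<lambda>x. f x + g x) = (\<lambda>x. partial j f x + partial j g x)"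
  by (auto simp: partial_add smooth_differentiable)

lemma partial_mult_smooth: "smooth f \<Longrightarrow> smooth g \<Longrightarrow> partial j (\<lambda>x. f x * g x) = (\<lambda>x. partial j f x * g x + f x * partial j g x)"
  by (auto simp: partial_mult smooth_differentiable)

lemma partial_cmult_smooth: "smooth f \<Longrightarrow> partial j (\<lambda>x. c * f x) = (\<lambda>x. c * partial j f x)"
  using partial_mult_smooth[OF smooth_const, of f j c] by simp

lemma partial_diff_smooth: "smooth f \<Longrightarrow> smooth g \<Longrightarrow> partial j (\<lambda>x. f x - g x) = (\<lambda>x. partial j f x - partial j g x)"
  using partial_add_smooth[of f "\<lambda>x. (- 1) * g x" j] smooth_cmult[of g "- 1"] partial_cmult_smooth[of g j "- 1"] by simp

lemma fold_partial_add: "smooth f \<Longrightarrow> smooth g \<Longrightarrow> fold partial js (\<lambda>x. f x + g x) = (\<lambda>x. fold partial js f x + fold partial js g x)"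
  by (induction js arbitrary: f g) (auto simp: partial_add_smooth smooth_partial)

lemma fold_partial_diff: "smooth f \<Longrightarrow> smooth g \<Longrightarrow> fold partial js (\<lambda>x. f x - g x) = (\<lambda>x. fold partial js f x - fold partial js g x)"
  by (induction js arbitrary: f g) (auto simp: partial_diff_smooth smooth_partial)

lemma fold_partial_cmult: "smooth f \<Longrightarrow> fold partial js (\<lambda>x. c * f x) = (\<lambda>x. c * fold partial js f x)"
  by (induction js arbitrary: f) (auto simp: partial_cmult_smooth smooth_partial)

lemma norm_line_diff_le:
  fixes f :: "real ^ 'n::finite \<Rightarrow> complex"
  assumes "\<And>s. s \<in> closed_segment a b \<Longrightarrow> f differentiable (at (y + s *\<^sub>R axis j 1))"
    and "\<And>s. s \<in> closed_segment a b \<Longrightarrow> norm (partial j f (y + s *\<^sub>R axis j 1)) \<le> B"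
  shows "norm (f (y + b *\<^sub>R axis j 1) - f (y + a *\<^sub>R axis j 1)) \<le> B * \<bar>b - a\<bar>"
proof -
  have "norm ((\<lambda>s. f (y + s *\<^sub>R axis j 1)) b - (\<lambda>s. f (y + s *\<^sub>R axis j 1)) a) \<le> B * norm (b - a)"
  proof (rule differentiable_bound[of "closed_segment a b" _ "\<lambda>s h. h *\<^sub>R partial j f (y + s *\<^sub>R axis j 1)"])
    fix s assume s: "s \<in> closed_segment a b"
    show "((\<lambda>s. f (y + s *\<^sub>R axis j 1)) has_derivative (\<lambda>h. h *\<^sub>R partial j f (y + s *\<^sub>R axis j 1))) (at s within closed_segment a b)"
      using line_has_vector_derivative[OF assms(1)[OF s]]
      by (auto simp: has_vector_derivative_def intro: has_derivative_at_withinI)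
    have "onorm (\<lambda>h. h *\<^sub>R partial j f (y + s *\<^sub>R axis j 1)) \<le> norm (partial j f (y + s *\<^sub>R axis j 1))"
      by (rule onorm_le) simp
    then show "onorm (\<lambda>h. h *\<^sub>R partial j f (y + s *\<^sub>R axis j 1)) \<le> B" using assms(2)[OF s] by linarith
  qed auto
  then show ?thesis by simp
qed

lemma norm_axis_one [simp]: "norm (axis j (1::real) :: real ^ 'n::finite) = 1"
  by (rule norm_axis_1)

text \<open>The mean value theorem needs real values, hence the functional \<open>L\<close>, which
  becomes \<open>Re\<close> and \<open>Im\<close> in the end.\<close>

lemma Re_line_MVT:
  fixes f :: "real ^ 'n::finite \<Rightarrow> complex"
  assumes f: "\<And>x. f differentiable (at x)" and h: "h > 0" and L: "bounded_linear L"
  obtains s where "0 < s" "s < h" "(L (f (y + h *\<^sub>R axis j 1)) - L (f y) :: real) = h * L (partial j f (y + s *\<^sub>R axis j 1))"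
proof -
  have "((\<lambda>s. L (f (y + s *\<^sub>R axis j 1))) has_real_derivative L (partial j f (y + s *\<^sub>R axis j 1))) (at s)" for s
    using bounded_linear.has_vector_derivative[OF L line_has_vector_derivative[OF f]]
    by (simp add: has_real_derivative_iff_has_vector_derivative)
  then show ?thesis
    using that MVT2[OF h, of "\<lambda>s. L (f (y + s *\<^sub>R axis j 1))" "\<lambda>s. L (partial j f (y + s *\<^sub>R axis j 1))"] by auto
qed

text \<open>The mean value theorem in direction \<open>i\<close>, applied to the difference in
  direction \<open>j\<close>, and then once more in direction \<open>j\<close>.\<close>

lemma second_difference:
  fixes f :: "real ^ 'n::finite \<Rightarrow> complex"
  assumes f: "smooth f" and h: "h > 0" and L: "bounded_linear L"
  shows "\<exists>z. dist z x \<le> 2 * h \<and> (L (f (x + h *\<^sub>R axis i 1 + h *\<^sub>R axis j 1)) - L (f (x + h *\<^sub>R axis i 1))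
    - L (f (x + h *\<^sub>R axis j 1)) + L (f x) :: real) = h * h * L (partial j (partial i f) z)"
proof -
  define g where "g y = f (y + h *\<^sub>R axis j 1) - f y" for y
  have g_deriv: "(g has_derivative (\<lambda>v. D1 v - D2 v)) (at y)"
    if "(f has_derivative D1) (at (y + h *\<^sub>R axis j 1))" "(f has_derivative D2) (at y)" for y D1 D2
  proof -
    have "((\<lambda>y. y + h *\<^sub>R axis j 1) has_derivative (\<lambda>v. v)) (at y)" by (auto intro!: derivative_eq_intros)
    from has_derivative_diff[OF has_derivative_compose[OF this that(1)] that(2)] show ?thesis by (simp add: g_def[abs_def])
  qed
  have g_diff: "g differentiable (at y)" for y
    using g_deriv smooth_differentiable[OF f] unfolding differentiable_def by blast
  have g_partial: "partial i g y = partial i f (y + h *\<^sub>R axis j 1) - partial i f y" for y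
  proof -
    obtain D1 D2 where D: "(f has_derivative D1) (at (y + h *\<^sub>R axis j 1))" "(f has_derivative D2) (at y)"
      using smooth_differentiable[OF f] unfolding differentiable_def by blast
    show ?thesis using partial_eq[OF g_deriv[OF D]] D by (simp add: partial_eq)
  qed
  obtain s where s: "0 < s" "s < h" "L (g (x + h *\<^sub>R axis i 1)) - L (g x) = h * L (partial i g (x + s *\<^sub>R axis i 1))"
    by (rule Re_line_MVT[OF g_diff h L])
  obtain t where t: "0 < t" "t < h" "L (partial i f (x + s *\<^sub>R axis i 1 + h *\<^sub>R axis j 1)) - L (partial i f (x + s *\<^sub>R axis i 1))
      = h * L (partial j (partial i f) (x + s *\<^sub>R axis i 1 + t *\<^sub>R axis j 1))"
    by (rule Re_line_MVT[OF smooth_differentiable[OF smooth_partial[OF f]] h L])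
  let ?z = "x + s *\<^sub>R axis i 1 + t *\<^sub>R axis j 1"
  have "dist ?z x = norm (s *\<^sub>R axis i (1::real) + t *\<^sub>R axis j 1)" by (simp add: dist_norm)
  also have "\<dots> \<le> norm (s *\<^sub>R axis i (1::real)) + norm (t *\<^sub>R axis j (1::real))" by (rule norm_triangle_ineq)
  also have "\<dots> \<le> 2 * h" using s t by (simp only: norm_scaleR norm_axis_one)
  finally have "dist ?z x \<le> 2 * h" .
  moreover have "L (f (x + h *\<^sub>R axis i 1 + h *\<^sub>R axis j 1)) - L (f (x + h *\<^sub>R axis i 1)) - L (f (x + h *\<^sub>R axis j 1)) + L (f x)
    = h * h * L (partial j (partial i f) ?z)"
    using s(3) t(3) by (simp add: g_def g_partial bounded_linear.linear[OF L, THEN linear_diff] algebra_simps)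
  ultimately show ?thesis by blast
qed

text \<open>The second difference is symmetric in \<open>i\<close> and \<open>j\<close>. Divided by
  \<open>h * h\<close> it is a value of either mixed derivative near \<open>x\<close>, and both are
  continuous.\<close>

lemma partial_commute:
  fixes f :: "real ^ 'n::finite \<Rightarrow> complex"
  assumes f: "smooth f"
  shows "partial i (partial j f) = partial j (partial i f)"
proof
  fix x
  have eq: "L (partial i (partial j f) x) = L (partial j (partial i f) x)" if L: "bounded_linear L" for L :: "complex \<Rightarrow> real"
  proof (rule ccontr)
    assume ne: "L (partial i (partial j f) x) \<noteq> L (partial j (partial i f) x)"
    define e where "e = \<bar>L (partial i (partial j f) x) - L (partial j (partial i f) x)\<bar> / 2"
    have e: "e > 0" using ne by (simp add: e_def)
    have cont: "isCont (\<lambda>z. L (partial a (partial b f) z)) x" for a b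
      using smooth_continuous[OF smooth_partial[OF smooth_partial[OF f, of b], of a], of UNIV]
      by (intro bounded_linear.isCont[OF L]) (simp add: continuous_on_eq_continuous_at)
    obtain d1 where d1: "d1 > 0" "\<And>z. dist z x < d1 \<Longrightarrow> dist (L (partial i (partial j f) z)) (L (partial i (partial j f) x)) < e"
      using cont[of i j] e unfolding continuous_at_eps_delta by blast
    obtain d2 where d2: "d2 > 0" "\<And>z. dist z x < d2 \<Longrightarrow> dist (L (partial j (partial i f) z)) (L (partial j (partial i f) x)) < e"
      using cont[of j i] e unfolding continuous_at_eps_delta by blast
    \<comment> \<open>The sample points lie within \<open>2 * h\<close>, which is half of the
      smaller radius.\<close>
    define h where "h = min d1 d2 / 4"
    have h: "h > 0" using d1(1) d2(1) by (simp add: h_def)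
    obtain z1 where z1: "dist z1 x \<le> 2 * h" "L (f (x + h *\<^sub>R axis i 1 + h *\<^sub>R axis j 1)) - L (f (x + h *\<^sub>R axis i 1))
      - L (f (x + h *\<^sub>R axis j 1)) + L (f x) = h * h * L (partial j (partial i f) z1)"
      using second_difference[OF f h L] by blast
    obtain z2 where z2: "dist z2 x \<le> 2 * h" "L (f (x + h *\<^sub>R axis j 1 + h *\<^sub>R axis i 1)) - L (f (x + h *\<^sub>R axis j 1))
      - L (f (x + h *\<^sub>R axis i 1)) + L (f x) = h * h * L (partial i (partial j f) z2)"
      using second_difference[OF f h L] by blast
    have sw: "x + h *\<^sub>R axis j 1 + h *\<^sub>R axis i 1 = x + h *\<^sub>R axis i 1 + h *\<^sub>R axis j 1"
      by (simp add: add_ac)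
    have "h * h * L (partial j (partial i f) z1) = h * h * L (partial i (partial j f) z2)"
      using z1(2) z2(2) unfolding sw by linarith
    then have "L (partial j (partial i f) z1) = L (partial i (partial j f) z2)" using h by simp
    moreover have z: "dist z1 x < d2" "dist z2 x < d1" using z1(1) z2(1) h d1(1) d2(1) by (auto simp: h_def)
    ultimately show False using d1(2)[OF z(2)] d2(2)[OF z(1)] unfolding dist_real_def e_def by (simp add: abs_real_def split: if_splits)
  qed
  show "partial i (partial j f) x = partial j (partial i f) x"
    using eq[OF bounded_linear_Re] eq[OF bounded_linear_Im] by (simp add: complex_eq_iff)
qed

lemma fold_partial_commute: "smooth f \<Longrightarrow> fold partial js (partial j f) = partial j (fold partial js f)"
proof (induction js arbitrary: f)
  case (Cons a js)
  then show ?case using partial_commute[of f a j] by (simp add: smooth_partial)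
qed simp

lemma fold_partial_remove1:
  "smooth f \<Longrightarrow> j \<in> set js \<Longrightarrow> fold partial js f = fold partial (remove1 j js) (partial j f)"
proof (induction js arbitrary: f)
  case (Cons a js)
  then show ?case using partial_commute[of f a j] by (auto simp: smooth_partial)
qed simp

subsection \<open>A smooth step function\<close>

text \<open>\<open>N\<close>-fold differentiability on the line. Order \<open>0\<close> asks for
  nothing, which explains the shift by one against \<open>CN\<close>; the derivative is quantified,
  so a closure property only has to exhibit one.\<close>

fun C1 :: "nat \<Rightarrow> (real \<Rightarrow> real) \<Rightarrow> bool" where
  "C1 0 g \<longleftrightarrow> True"
| "C1 (Suc N) g \<longleftrightarrow> (\<exists>g'. (\<forall>t. (g has_real_derivative g' t) (at t)) \<and> C1 N g')"

lemma C1_SucI: "(\<And>t. (g has_real_derivative g' t) (at t)) \<Longrightarrow> C1 N g' \<Longrightarrow> C1 (Suc N) g"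
  by auto

lemma C1_Suc: "C1 (Suc N) g \<Longrightarrow> C1 N g"
proof (induction N arbitrary: g)
  case (Suc N)
  then obtain g' where g': "\<forall>t. (g has_real_derivative g' t) (at t)" "C1 (Suc N) g'" by (subst (asm) C1.simps(2)) blast
  then show ?case using Suc.IH[of g'] by (auto simp del: C1.simps simp: C1.simps(2)[of N g])
qed simp

lemma C1_const: "C1 N (\<lambda>t. c)"
  by (induction N arbitrary: c) (auto intro!: exI[of _ "\<lambda>t. 0"])

lemma C1_add: "C1 N f \<Longrightarrow> C1 N g \<Longrightarrow> C1 N (\<lambda>t. f t + g t)"
proof (induction N arbitrary: f g)
  case (Suc N)
  then obtain f' g' where "\<forall>t. (f has_real_derivative f' t) (at t)" "C1 N f'"
    "\<forall>t. (g has_real_derivative g' t) (at t)" "C1 N g'" by auto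
  then show ?case using Suc.IH by (auto intro!: exI[of _ "\<lambda>t. f' t + g' t"] DERIV_add)
qed simp

lemma C1_mult: "C1 N f \<Longrightarrow> C1 N g \<Longrightarrow> C1 N (\<lambda>t. f t * g t)"
proof (induction N arbitrary: f g)
  case (Suc N)
  then obtain f' g' where 1: "\<forall>t. (f has_real_derivative f' t) (at t)" "C1 N f'"
    "\<forall>t. (g has_real_derivative g' t) (at t)" "C1 N g'" by auto
  have 2: "C1 N f" "C1 N g" using Suc.prems C1_Suc by blast+
  have "((\<lambda>t. f t * g t) has_real_derivative (f' t * g t + g' t * f t)) (at t)" for t
    using 1 by (intro DERIV_mult) auto
  moreover have "C1 N (\<lambda>t. f' t * g t + g' t * f t)" using Suc.IH 1 2 by (intro C1_add) auto
  ultimately show ?case by (rule C1_SucI)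
qed simp

lemma C1_inverse:
  assumes "\<And>t. g t \<noteq> 0"
  shows "C1 N g \<Longrightarrow> C1 N (\<lambda>t. inverse (g t))"
proof (induction N)
  case (Suc N)
  then obtain g' where 1: "\<forall>t. (g has_real_derivative g' t) (at t)" "C1 N g'" by auto
  have "C1 N (\<lambda>t. inverse (g t))" using Suc C1_Suc by blast
  then have "C1 N (\<lambda>t. (- 1) * (inverse (g t) * g' t * inverse (g t)))" using 1 by (intro C1_mult C1_const)
  moreover have "((\<lambda>t. inverse (g t)) has_real_derivative (- 1) * (inverse (g t) * g' t * inverse (g t))) (at t)" for t
    using DERIV_inverse'[of g "g' t" t UNIV] 1(1) assms[of t] by simp
  ultimately show ?case by (intro C1_SucI)
qed simp

lemma C1_affine: "C1 N g \<Longrightarrow> C1 N (\<lambda>t. g (a * t + b))"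
proof (induction N arbitrary: g)
  case (Suc N)
  then obtain g' where 1: "\<forall>t. (g has_real_derivative g' t) (at t)" "C1 N g'" by auto
  have "((\<lambda>t. g (a * t + b)) has_real_derivative g' (a * t + b) * a) (at t)" for t
    using 1(1) by (intro DERIV_chain2[of g]) (auto intro!: derivative_eq_intros)
  moreover have "C1 N (\<lambda>t. g' (a * t + b) * a)" using Suc.IH 1(2) by (intro C1_mult C1_const)
  ultimately show ?case by (rule C1_SucI)
qed simp

text \<open>The whole family \<open>p (1/t) * exp (- 1/t)\<close> is considered because
  differentiation stays inside it: in terms of \<open>u = 1/t\<close> it replaces \<open>p\<close>
  by \<open>u\<^sup>2 * (p - p')\<close>.\<close>

definition flat :: "real poly \<Rightarrow> real \<Rightarrow> real" where
  "flat p t = (if t > 0 then poly p (1 / t) * exp (- (1 / t)) else 0)"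

lemma poly_over_exp_tendsto_0: "((\<lambda>u. poly p u * exp (- u)) \<longlongrightarrow> (0::real)) at_top"
proof -
  have "((\<lambda>u. \<Sum>i\<le>degree p. poly.coeff p i * (u ^ i / exp u)) \<longlongrightarrow> (\<Sum>i\<le>degree p. poly.coeff p i * 0)) at_top"
    by (intro tendsto_sum tendsto_mult tendsto_const tendsto_power_div_exp_0)
  then show ?thesis by (simp add: poly_altdef sum_divide_distrib exp_minus divide_inverse sum_distrib_right mult.assoc)
qed

lemma flat_has_derivative:
  "(flat p has_real_derivative flat ([:0, 0, 1:] * (p - pderiv p)) t) (at t)"
proof (cases t "0 :: real" rule: linorder_cases)
  case less
  have "eventually (\<lambda>s. s < 0) (nhds t)" using less by (intro eventually_nhds_in_open[of "{..<0}", simplified]) auto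
  then have "eventually (\<lambda>s. flat p s = 0) (nhds t)" by (rule eventually_mono) (simp add: flat_def)
  then show ?thesis using less by (subst DERIV_cong_ev[OF refl _ refl, of _ "\<lambda>_. 0"]) (auto simp: flat_def)
next
  case greater
  have "eventually (\<lambda>s. s > 0) (nhds t)" using greater by (intro eventually_nhds_in_open[of "{0<..}", simplified]) auto
  then have ev: "eventually (\<lambda>s. flat p s = poly p (1 / s) * exp (- (1 / s))) (nhds t)"
    by (rule eventually_mono) (simp add: flat_def)
  have "((\<lambda>s. poly p (1 / s) * exp (- (1 / s))) has_real_derivative flat ([:0, 0, 1:] * (p - pderiv p)) t) (at t)"
    using greater by (auto intro!: derivative_eq_intros DERIV_chain2[OF poly_DERIV] simp: flat_def field_simps power2_eq_square)
  then show ?thesis by (subst DERIV_cong_ev[OF refl ev refl])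
next
  case equal
  \<comment> \<open>For positive \<open>h\<close> the difference quotient at \<open>0\<close> is
    again a polynomial in \<open>1/h\<close> times \<open>exp (- 1/h)\<close>, which tends to
    zero.\<close>
  have "((\<lambda>h. flat p h / h) \<longlongrightarrow> 0) (at 0)"
  proof (rule filterlim_split_at)
    have "eventually (\<lambda>h. flat p h / h = 0) (at_left 0)"
      by (auto simp: flat_def eventually_at_filter)
    then show "((\<lambda>h. flat p h / h) \<longlongrightarrow> 0) (at_left 0)" by (simp add: tendsto_eventually)
    have "filterlim (\<lambda>h::real. 1 / h) at_top (at_right 0)"
      using filterlim_inverse_at_top_right by (simp add: inverse_eq_divide)
    then have "((\<lambda>h. poly ([:0, 1:] * p) (1 / h) * exp (- (1 / h))) \<longlongrightarrow> (0::real)) (at_right 0)"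
      by (rule filterlim_compose[OF poly_over_exp_tendsto_0])
    moreover have "eventually (\<lambda>h. poly ([:0, 1:] * p) (1 / h) * exp (- (1 / h)) = flat p h / h) (at_right (0::real))"
      by (auto simp: flat_def eventually_at_filter)
    ultimately show "((\<lambda>h. flat p h / h) \<longlongrightarrow> 0) (at_right 0)" by (rule Lim_transform_eventually)
  qed
  then show ?thesis using equal by (simp add: DERIV_def flat_def)
qed

lemma C1_flat: "C1 N (flat p)"
  by (induction N arbitrary: p) (simp, rule C1_SucI[OF flat_has_derivative])

lemma ex_smooth_step:
  obtains h :: "real \<Rightarrow> real" where "\<And>N. C1 N h" "\<And>t. t \<le> 0 \<Longrightarrow> h t = 0" "\<And>t. t \<ge> 1 \<Longrightarrow> h t = 1"
proof -
  define f where "f = flat 1"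
  \<comment> \<open>\<open>t\<close> and \<open>1 - t\<close> are never both nonpositive, so the
    denominator does not vanish. The second argument is spelled as an affine function to fit
    \<open>C1_affine\<close>.\<close>
  define h where "h t = f t * inverse (f t + f (- 1 * t + 1))" for t
  have f0: "f t = 0" if "t \<le> 0" for t using that by (simp add: f_def flat_def)
  have f1: "f t > 0" if "t > 0" for t using that by (simp add: f_def flat_def)
  have f2: "f t \<ge> 0" for t using f0[of t] f1[of t] by (cases "t > 0") auto
  have "f t + f (- 1 * t + 1) > 0" for t
    using f1[of t] f1[of "1 - t"] f2[of t] f2[of "1 - t"] by (cases "t > 0") (auto intro: add_pos_nonneg add_nonneg_pos)
  then have "f t + f (- 1 * t + 1) \<noteq> 0" for t by (metis less_irrefl)
  then have "C1 N h" for N unfolding h_def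
    by (intro C1_mult C1_inverse C1_add C1_affine) (auto simp: f_def C1_flat)
  moreover have "h t = 0" if "t \<le> 0" for t using f0[OF that] by (simp add: h_def)
  moreover have "h t = 1" if "t \<ge> 1" for t using f0[of "1 - t"] f1[of t] that by (simp add: h_def)
  ultimately show ?thesis using that by blast
qed

lemma coordinate_has_derivative:
  fixes x :: "real ^ 'n::finite"
  assumes "(g has_real_derivative d) (at (vec_nth x i))"
  shows "((\<lambda>x. complex_of_real (g (vec_nth x i))) has_derivative (\<lambda>h. complex_of_real (d * vec_nth h i))) (at x)"
proof (rule has_derivative_of_real)
  have "((\<lambda>x. vec_nth x i) has_derivative (\<lambda>h. vec_nth h i)) (at x)"
    by (rule bounded_linear_imp_has_derivative[OF bounded_linear_vec_nth])
  from has_derivative_compose[OF this, of g] assms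
  show "((\<lambda>x. g (vec_nth x i)) has_derivative (\<lambda>h. d * vec_nth h i)) (at x)"
    by (simp add: has_field_derivative_def)
qed

lemma CN_coordinate: "C1 (Suc N) g \<Longrightarrow> CN N (\<lambda>x :: real ^ 'n::finite. complex_of_real (g (vec_nth x i)))"
proof (induction N arbitrary: g)
  case 0
  then show ?case using coordinate_has_derivative[of g] unfolding CN.simps C1.simps differentiable_def by blast
next
  case (Suc N)
  then obtain g' where g': "\<And>t. (g has_real_derivative g' t) (at t)" "C1 (Suc N) g'" by (subst (asm) C1.simps(2)) blast
  note D = coordinate_has_derivative[OF g'(1)]
  have "partial j (\<lambda>x :: real ^ 'n. complex_of_real (g (vec_nth x i))) = (\<lambda>x. (if i = j then 1 else 0) * complex_of_real (g' (vec_nth x i)))" for j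
    by (rule ext, subst partial_eq[OF D]) (simp add: axis_def)
  moreover have "CN N (\<lambda>x :: real ^ 'n. (if i = j then 1 else 0) * complex_of_real (g' (vec_nth x i)))" for j
    using Suc.IH[OF g'(2)] by (intro CN_mult CN_const)
  ultimately show ?case unfolding CN.simps using D unfolding differentiable_def by metis
qed

lemma smooth_coordinate: "(\<And>N. C1 N g) \<Longrightarrow> smooth (\<lambda>x :: real ^ 'n::finite. complex_of_real (g (vec_nth x i)))"
  unfolding smooth_iff_CN using CN_coordinate by blast

subsection \<open>Test functions\<close>

lemma supp_subsetI: "closed K \<Longrightarrow> (\<And>x. \<phi> x \<noteq> 0 \<Longrightarrow> x \<in> K) \<Longrightarrow> supp \<phi> \<subseteq> K"
  unfolding supp_def by (intro closure_minimal) auto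

lemma not_in_supp: "x \<notin> supp \<phi> \<Longrightarrow> \<phi> x = 0"
  unfolding supp_def using closure_subset[of "{x. \<phi> x \<noteq> 0}"] by auto

lemma closed_supp: "closed (supp \<phi>)"
  by (simp add: supp_def)

lemma partial_eq_0_outside:
  assumes "closed K" "\<And>x. x \<notin> K \<Longrightarrow> \<phi> x = 0" "x \<notin> K"
  shows "partial j \<phi> x = 0"
proof -
  have "eventually (\<lambda>y. y \<in> - K) (nhds x)" using assms by (intro eventually_nhds_in_open) auto
  then have "eventually (\<lambda>y. \<phi> y = 0) (nhds x)" by (rule eventually_mono) (simp add: assms(2))
  then have "partial j \<phi> x = partial j (\<lambda>_. 0) x" by (rule partial_cong_near)
  then show ?thesis by simp
qed

lemma supp_partial: "supp (partial j \<phi>) \<subseteq> supp \<phi>"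
proof (rule supp_subsetI[OF closed_supp])
  fix x assume "partial j \<phi> x \<noteq> 0"
  moreover have "partial j \<phi> x = 0" if "x \<notin> supp \<phi>"
    by (rule partial_eq_0_outside[OF closed_supp not_in_supp that])
  ultimately show "x \<in> supp \<phi>" by blast
qed

lemma supp_fold_partial: "supp (fold partial js \<phi>) \<subseteq> supp \<phi>"
proof (induction js arbitrary: \<phi>)
  case (Cons j js)
  show ?case using subset_trans[OF Cons[of "partial j \<phi>"] supp_partial] by simp
qed simp

lemma fold_partial_eq_0_outside: "x \<notin> supp \<phi> \<Longrightarrow> fold partial js \<phi> x = 0"
  using supp_fold_partial not_in_supp by blast

lemma test_functionI:
  assumes "smooth \<phi>" "compact K" "\<And>x. \<phi> x \<noteq> 0 \<Longrightarrow> x \<in> K"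
  shows "\<phi> \<in> test_functions"
proof -
  have "K \<inter> supp \<phi> = supp \<phi>" using supp_subsetI[OF compact_imp_closed[OF assms(2)] assms(3)] by blast
  then have "compact (supp \<phi>)" using compact_Int_closed[OF assms(2) closed_supp[of \<phi>]] by simp
  then show ?thesis using assms(1) by (simp add: test_functions_def)
qed

lemma test_functionD: "\<phi> \<in> test_functions \<Longrightarrow> smooth \<phi>" "\<phi> \<in> test_functions \<Longrightarrow> compact (supp \<phi>)"
  by (simp_all add: test_functions_def)

lemma test_partial: "\<phi> \<in> test_functions \<Longrightarrow> partial j \<phi> \<in> test_functions"
  using test_functionD[of \<phi>] supp_partial[of j \<phi>] not_in_supp[of _ "partial j \<phi>"]
  by (intro test_functionI[of _ "supp \<phi>"] smooth_partial) auto

lemma test_fold_partial: "\<phi> \<in> test_functions \<Longrightarrow> fold partial js \<phi> \<in> test_functions"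
  by (induction js arbitrary: \<phi>) (auto intro: test_partial)

lemma test_mult: "smooth \<psi> \<Longrightarrow> \<phi> \<in> test_functions \<Longrightarrow> (\<lambda>x. \<psi> x * \<phi> x) \<in> test_functions"
  using test_functionD[of \<phi>] not_in_supp[of _ \<phi>]
  by (intro test_functionI[of _ "supp \<phi>"] smooth_mult) auto

lemma supp_mult: "supp (\<lambda>x. \<psi> x * \<phi> x) \<subseteq> supp \<phi>"
  using not_in_supp[of _ \<phi>] by (intro supp_subsetI[OF closed_supp]) force

lemma test_cmult: "\<phi> \<in> test_functions \<Longrightarrow> (\<lambda>x. c * \<phi> x) \<in> test_functions"
  by (rule test_mult[OF smooth_const])

lemma test_add:
  assumes "\<phi> \<in> test_functions" "\<psi> \<in> test_functions"
  shows "(\<lambda>x. \<phi> x + \<psi> x) \<in> test_functions"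
proof (rule test_functionI[of _ "supp \<phi> \<union> supp \<psi>"])
  show "smooth (\<lambda>x. \<phi> x + \<psi> x)" "compact (supp \<phi> \<union> supp \<psi>)"
    using test_functionD[OF assms(1)] test_functionD[OF assms(2)] by (auto intro: smooth_add)
  show "x \<in> supp \<phi> \<union> supp \<psi>" if "\<phi> x + \<psi> x \<noteq> 0" for x
    using that not_in_supp[of x \<phi>] not_in_supp[of x \<psi>] by (cases "x \<in> supp \<phi>") auto
qed

lemma test_bounded:
  assumes "\<phi> \<in> test_functions"
  obtains B where "B \<ge> 0" "\<And>x. norm (\<phi> x) \<le> B"
proof -
  have "compact (\<phi> ` supp \<phi>)"
    using test_functionD[OF assms] by (intro compact_continuous_image smooth_continuous)
  then have "bounded (\<phi> ` supp \<phi>)" by (rule compact_imp_bounded)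
  then obtain B where B: "\<forall>y\<in>\<phi> ` supp \<phi>. norm y \<le> B" unfolding bounded_iff by (elim exE)
  have "norm (\<phi> x) \<le> max B 0" for x
  proof (cases "x \<in> supp \<phi>")
    case True
    then have "norm (\<phi> x) \<le> B" using B by simp
    then show ?thesis by simp
  qed (simp add: not_in_supp)
  then show ?thesis using that[of "max B 0"] by simp
qed

lemma finite_short_lists: "finite {js :: 'n::finite list. length js \<le> N}"
  using finite_lists_length_le[of "UNIV :: 'n set" N] by simp

lemma test_bounded_upto:
  fixes \<phi> :: "real ^ 'n::finite \<Rightarrow> complex"
  assumes "\<phi> \<in> test_functions"
  obtains B where "B \<ge> 0" "\<And>js x. length js \<le> N \<Longrightarrow> norm (fold partial js \<phi> x) \<le> B"
proof -
  have "\<forall>js. \<exists>B\<ge>0. \<forall>x. norm (fold partial js \<phi> x) \<le> B"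
  proof
    fix js
    obtain B where "B \<ge> 0" "\<And>x. norm (fold partial js \<phi> x) \<le> B"
      by (rule test_bounded[OF test_fold_partial[OF assms]]) blast
    then show "\<exists>B\<ge>0. \<forall>x. norm (fold partial js \<phi> x) \<le> B" by blast
  qed
  from choice[OF this] obtain b where "\<forall>js. b js \<ge> 0 \<and> (\<forall>x. norm (fold partial js \<phi> x) \<le> b js)" by (elim exE)
  then have b: "\<And>js. b js \<ge> 0" "\<And>js x. norm (fold partial js \<phi> x) \<le> b js" by simp_all
  let ?B = "\<Sum>js\<in>{js. length js \<le> N}. b js"
  have "norm (fold partial js \<phi> x) \<le> ?B" if "length js \<le> N" for js x
  proof (rule order_trans[OF b(2)], rule member_le_sum)
    show "finite {js :: 'n list. length js \<le> N}" by (rule finite_short_lists)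
  qed (use that b(1) in auto)
  then show ?thesis using that[of ?B] b(1) by (simp add: sum_nonneg)
qed

subsection \<open>Distributions\<close>

text \<open>A distribution without its continuity. The moment argument applies operators repeatedly
  and asks no more than this of the results.\<close>

definition linear_on_tests :: "'n::finite functional \<Rightarrow> bool" where
  "linear_on_tests T \<longleftrightarrow>
    (\<forall>\<phi>\<in>test_functions. \<forall>\<psi>\<in>test_functions. T (\<lambda>x. \<phi> x + \<psi> x) = T \<phi> + T \<psi>) \<and>
    (\<forall>c. \<forall>\<phi>\<in>test_functions. T (\<lambda>x. c * \<phi> x) = c * T \<phi>)"

lemma linear_on_testsD:
  assumes "linear_on_tests T"
  shows "\<phi> \<in> test_functions \<Longrightarrow> \<psi> \<in> test_functions \<Longrightarrow> T (\<lambda>x. \<phi> x + \<psi> x) = T \<phi> + T \<psi>"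
    and "\<phi> \<in> test_functions \<Longrightarrow> T (\<lambda>x. c * \<phi> x) = c * T \<phi>"
  using assms by (auto simp: linear_on_tests_def)

lemma linear_on_tests_diff:
  assumes "linear_on_tests T" "\<phi> \<in> test_functions" "\<psi> \<in> test_functions"
  shows "T (\<lambda>x. \<phi> x - \<psi> x) = T \<phi> - T \<psi>"
  using linear_on_testsD(1)[OF assms(1,2) test_cmult[OF assms(3), of "- 1"]] linear_on_testsD(2)[OF assms(1,3), of "- 1"]
  by simp

lemma distribution_linear: "T \<in> distributions \<Longrightarrow> linear_on_tests T"
  by (simp add: distributions_def linear_on_tests_def)

lemma distribution_outside: "T \<in> distributions \<Longrightarrow> \<phi> \<notin> test_functions \<Longrightarrow> T \<phi> = 0"
  by (simp add: distributions_def)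

lemma distribution_estimate: "T \<in> distributions \<Longrightarrow> compact K \<Longrightarrow>
    \<exists>N C. \<forall>\<phi>\<in>test_functions. supp \<phi> \<subseteq> K \<longrightarrow>
      norm (T \<phi>) \<le> C * (\<Sum>js | length js \<le> N. SUP x. norm (fold partial js \<phi> x))"
  by (simp add: distributions_def)

text \<open>The sum of suprema is traded for a single pointwise bound \<open>E\<close>, the form in
  which estimates arise later. The constant in the definition may be negative, hence its absolute
  value.\<close>

lemma distribution_bound:
  fixes T :: "'n::finite functional"
  assumes T: "T \<in> distributions" and K: "compact K"
  obtains N C where "C \<ge> 0" "\<And>\<phi> E. \<phi> \<in> test_functions \<Longrightarrow> supp \<phi> \<subseteq> K \<Longrightarrow>
    (\<And>js x. length js \<le> N \<Longrightarrow> norm (fold partial js \<phi> x) \<le> E) \<Longrightarrow> norm (T \<phi>) \<le> C * E"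
proof -
  from distribution_estimate[OF T K] obtain N C where "\<forall>\<phi>\<in>test_functions. supp \<phi> \<subseteq> K \<longrightarrow>
      norm (T \<phi>) \<le> C * (\<Sum>js | length js \<le> N. SUP x. norm (fold partial js \<phi> x))" by (elim exE)
  then have NC: "\<And>\<phi>. \<phi> \<in> test_functions \<Longrightarrow> supp \<phi> \<subseteq> K \<Longrightarrow>
      norm (T \<phi>) \<le> C * (\<Sum>js | length js \<le> N. SUP x. norm (fold partial js \<phi> x))" by simp
  let ?L = "{js :: 'n list. length js \<le> N}"
  have "norm (T \<phi>) \<le> (\<bar>C\<bar> * real (card ?L)) * E" if \<phi>: "\<phi> \<in> test_functions" "supp \<phi> \<subseteq> K"
    and E: "\<And>js x. length js \<le> N \<Longrightarrow> norm (fold partial js \<phi> x) \<le> E" for \<phi> E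
  proof -
    let ?s = "\<lambda>js. SUP x. norm (fold partial js \<phi> x)"
    have s_le: "?s js \<le> E" if "js \<in> ?L" for js using E that by (intro cSUP_least) auto
    have s_ge: "0 \<le> ?s js" if "js \<in> ?L" for js
    proof -
      have "bdd_above (range (\<lambda>x. norm (fold partial js \<phi> x)))" using E that by (intro bdd_aboveI2[of _ _ E]) auto
      then have "norm (fold partial js \<phi> 0) \<le> ?s js" by (intro cSUP_upper) auto
      then show ?thesis using norm_ge_zero order_trans by blast
    qed
    have "norm (T \<phi>) \<le> C * (\<Sum>js\<in>?L. ?s js)" using NC[OF \<phi>] .
    also have "\<dots> \<le> \<bar>C\<bar> * (\<Sum>js\<in>?L. ?s js)" using s_ge by (intro mult_right_mono sum_nonneg) auto
    also have "\<dots> \<le> \<bar>C\<bar> * (\<Sum>js\<in>?L. E)" using s_le by (intro mult_left_mono sum_mono) auto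
    finally show ?thesis by (simp add: mult_ac)
  qed
  then show ?thesis using that[of "\<bar>C\<bar> * real (card ?L)" N] by simp
qed

text \<open>The sums in \<open>Ker\<close> are formed in \<open>dist_module\<close>; to unfold them
  it has to be an abelian monoid, which requires closure of all distributions under
  addition.\<close>

lemma distributions_add:
  fixes S T :: "'n::finite functional"
  assumes S: "S \<in> distributions" and T: "T \<in> distributions"
  shows "(\<lambda>\<phi>. S \<phi> + T \<phi>) \<in> distributions"
proof -
  have "\<exists>N C. \<forall>\<phi>\<in>test_functions. supp \<phi> \<subseteq> K \<longrightarrow>
      norm (S \<phi> + T \<phi>) \<le> C * (\<Sum>js | length js \<le> N. SUP x. norm (fold partial js \<phi> x))" if K: "compact K" for K
  proof -
    from distribution_estimate[OF S K] obtain N1 C1 where "\<forall>\<phi>\<in>test_functions. supp \<phi> \<subseteq> K \<longrightarrow>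
        norm (S \<phi>) \<le> C1 * (\<Sum>js | length js \<le> N1. SUP x. norm (fold partial js \<phi> x))" by (elim exE)
    then have 1: "\<And>\<phi>. \<phi> \<in> test_functions \<Longrightarrow> supp \<phi> \<subseteq> K \<Longrightarrow>
        norm (S \<phi>) \<le> C1 * (\<Sum>js | length js \<le> N1. SUP x. norm (fold partial js \<phi> x))" by simp
    from distribution_estimate[OF T K] obtain N2 C2 where "\<forall>\<phi>\<in>test_functions. supp \<phi> \<subseteq> K \<longrightarrow>
        norm (T \<phi>) \<le> C2 * (\<Sum>js | length js \<le> N2. SUP x. norm (fold partial js \<phi> x))" by (elim exE)
    then have 2: "\<And>\<phi>. \<phi> \<in> test_functions \<Longrightarrow> supp \<phi> \<subseteq> K \<Longrightarrow>
        norm (T \<phi>) \<le> C2 * (\<Sum>js | length js \<le> N2. SUP x. norm (fold partial js \<phi> x))" by simp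
    let ?N = "max N1 N2"
    have "norm (S \<phi> + T \<phi>) \<le> (\<bar>C1\<bar> + \<bar>C2\<bar>) * (\<Sum>js | length js \<le> ?N. SUP x. norm (fold partial js \<phi> x))"
      if \<phi>: "\<phi> \<in> test_functions" "supp \<phi> \<subseteq> K" for \<phi>
    proof -
      let ?s = "\<lambda>js. SUP x. norm (fold partial js \<phi> x)"
      have s_ge: "0 \<le> ?s js" for js
      proof -
        obtain B where "\<And>x. norm (fold partial js \<phi> x) \<le> B"
          by (rule test_bounded[OF test_fold_partial[OF \<phi>(1)]]) blast
        then have "bdd_above (range (\<lambda>x. norm (fold partial js \<phi> x)))" by (intro bdd_aboveI2[of _ _ B]) auto
        then have "norm (fold partial js \<phi> 0) \<le> ?s js" by (intro cSUP_upper) auto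
        then show ?thesis using norm_ge_zero order_trans by blast
      qed
      have mono: "C * (\<Sum>js | length js \<le> M. ?s js) \<le> \<bar>C\<bar> * (\<Sum>js | length js \<le> ?N. ?s js)" if "M \<le> ?N" for C M
      proof -
        have "C * (\<Sum>js | length js \<le> M. ?s js) \<le> \<bar>C\<bar> * (\<Sum>js | length js \<le> M. ?s js)"
          by (intro mult_right_mono sum_nonneg s_ge) auto
        also have "\<dots> \<le> \<bar>C\<bar> * (\<Sum>js | length js \<le> ?N. ?s js)"
          using that by (intro mult_left_mono sum_mono2 finite_short_lists s_ge) auto
        finally show ?thesis .
      qed
      have "norm (S \<phi> + T \<phi>) \<le> norm (S \<phi>) + norm (T \<phi>)" by (rule norm_triangle_ineq)
      also have "\<dots> \<le> \<bar>C1\<bar> * (\<Sum>js | length js \<le> ?N. ?s js) + \<bar>C2\<bar> * (\<Sum>js | length js \<le> ?N. ?s js)"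
        using order_trans[OF 1[OF \<phi>] mono] order_trans[OF 2[OF \<phi>] mono] by (intro add_mono) auto
      finally show ?thesis by (simp add: distrib_right)
    qed
    then show ?thesis by (intro exI ballI impI)
  qed
  then show ?thesis
    using S T by (simp add: distributions_def algebra_simps)
qed

subsection \<open>Cubes and cut-off functions\<close>

definition cube :: "real \<Rightarrow> (real ^ 'n::finite) set" where
  "cube R = {x. \<forall>i. \<bar>vec_nth x i\<bar> \<le> R}"

lemma cube_eq_cbox: "cube R = cbox (vec_lambda (\<lambda>_. - R)) (vec_lambda (\<lambda>_. R))"
  by (auto simp: cube_def mem_box_cart abs_le_iff minus_le_iff)

lemma compact_cube: "compact (cube R)" and closed_cube: "closed (cube R)"
  unfolding cube_eq_cbox by (rule compact_cbox, rule closed_cbox)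

lemma bounded_subset_cube:
  fixes S :: "(real ^ 'n::finite) set"
  assumes "bounded S"
  obtains R where "R > 0" "S \<subseteq> cube R"
proof -
  obtain B where B: "B > 0" "\<forall>x\<in>S. norm x \<le> B" using assms bounded_pos by blast
  then have "S \<subseteq> cube B" using component_le_norm_cart order_trans by (fastforce simp: cube_def)
  then show ?thesis using that B by blast
qed

lemma ex_cutoff:
  fixes R :: real
  obtains \<chi> :: "real ^ 'n::finite \<Rightarrow> complex" where "smooth \<chi>" "\<And>x. x \<in> cube R \<Longrightarrow> \<chi> x = 1" "\<And>x. \<chi> x \<noteq> 0 \<Longrightarrow> x \<in> cube (R + 1)"
proof -
  obtain h where h: "\<And>N. C1 N h" "\<And>t. t \<le> 0 \<Longrightarrow> h t = 0" "\<And>t. t \<ge> 1 \<Longrightarrow> h t = 1"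
    by (rule ex_smooth_step) blast
  \<comment> \<open>Two opposite steps: both arguments are at least \<open>1\<close> when
    \<open>\<bar>t\<bar> \<le> R\<close>, and one is nonpositive beyond
    \<open>R + 1\<close>.\<close>
  define g where "g t = h (1 * t + (R + 1)) * h (- 1 * t + (R + 1))" for t
  have g: "C1 N g" for N unfolding g_def by (intro C1_mult C1_affine h(1))
  have g1: "g t = 1" if "\<bar>t\<bar> \<le> R" for t using that by (simp add: g_def h(3) abs_le_iff)
  have g0: "\<bar>t\<bar> \<le> R + 1" if "g t \<noteq> 0" for t
  proof (rule ccontr)
    assume "\<not> \<bar>t\<bar> \<le> R + 1"
    then have "t + (R + 1) \<le> 0 \<or> - t + (R + 1) \<le> 0" by linarith
    then show False using that h(2) by (auto simp: g_def)
  qed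
  define \<chi> where "\<chi> x = (\<Prod>i\<in>UNIV. complex_of_real (g (vec_nth x i)))" for x :: "real ^ 'n"
  have "smooth \<chi>" unfolding \<chi>_def by (intro smooth_prod smooth_coordinate g)
  moreover have "\<chi> x = 1" if "x \<in> cube R" for x using that by (simp add: \<chi>_def cube_def g1)
  moreover have "x \<in> cube (R + 1)" if "\<chi> x \<noteq> 0" for x using that g0 by (auto simp: \<chi>_def cube_def)
  ultimately show ?thesis using that by blast
qed

subsection \<open>Polynomial functions\<close>

definition pfun :: "'n::finite mpoly \<Rightarrow> real ^ 'n \<Rightarrow> complex" where
  "pfun p x = peval p (vec_lambda (\<lambda>i. complex_of_real (vec_nth x i)))"

lemma pfun_simps [simp]: "pfun (PC c) x = c" "pfun (PX j) x = complex_of_real (vec_nth x j)"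
  "pfun (p + q) x = pfun p x + pfun q x" "pfun (p * q) x = pfun p x * pfun q x"
  "pfun (p - q) x = pfun p x - pfun q x" "pfun 0 x = 0"
  by (simp_all add: pfun_def peval.hom_add peval.hom_mult peval.hom_minus)

lemma pfun_sum: "pfun (sum f S) x = (\<Sum>i\<in>S. pfun (f i) x)"
  by (simp add: pfun_def peval.hom_sum)

lemma C1_ident: "C1 N (\<lambda>t. t)"
  by (cases N) (simp, simp only:, rule C1_SucI[of _ "\<lambda>t. 1"], auto intro: C1_const)

lemma smooth_pfun: "smooth (pfun p)"
proof (induction p rule: mpoly_induct)
  case (const c)
  have "pfun (PC c) = (\<lambda>x. c)" by auto
  then show ?case by (simp add: smooth_const)
next
  case (var j)
  have "pfun (PX j) = (\<lambda>x. complex_of_real (vec_nth x j))" by auto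
  then show ?case using smooth_coordinate[OF C1_ident, of j] by simp
next
  case (add p q)
  have "pfun (p + q) = (\<lambda>x. pfun p x + pfun q x)" by auto
  then show ?case using smooth_add[OF add] by simp
next
  case (mult p q)
  have "pfun (p * q) = (\<lambda>x. pfun p x * pfun q x)" by auto
  then show ?case using smooth_mult[OF mult] by simp
qed

definition mono_fun :: "('n::finite \<Rightarrow>\<^sub>0 nat) \<Rightarrow> real ^ 'n \<Rightarrow> complex" where
  "mono_fun m = pfun (Poly_Mapping.single m 1)"

lemma mono_fun_altdef: "mono_fun m x = (\<Prod>i\<in>UNIV. complex_of_real (vec_nth x i) ^ lkp m i)"
  by (simp add: mono_fun_def pfun_def single_monomial peval.hom_prod peval.hom_power)

lemma smooth_mono_fun: "smooth (mono_fun m)"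
  by (simp add: mono_fun_def smooth_pfun)

lemma pfun_single: "pfun (Poly_Mapping.single m c) x = c * mono_fun m x"
  by (subst single_PC) (simp add: mono_fun_def)

lemma mono_fun_line:
  "mono_fun m (x + s *\<^sub>R axis j 1) =
    (complex_of_real (vec_nth x j) + complex_of_real s) ^ lkp m j * (\<Prod>i\<in>UNIV - {j}. complex_of_real (vec_nth x i) ^ lkp m i)"
proof -
  have "mono_fun m (x + s *\<^sub>R axis j 1) = (complex_of_real (vec_nth x j) + complex_of_real s) ^ lkp m j *
    (\<Prod>i\<in>UNIV - {j}. complex_of_real (vec_nth (x + s *\<^sub>R axis j 1) i) ^ lkp m i)"
    unfolding mono_fun_altdef by (subst prod.remove[of UNIV j]) (simp_all add: axis_def)
  also have "(\<Prod>i\<in>UNIV - {j}. complex_of_real (vec_nth (x + s *\<^sub>R axis j 1) i) ^ lkp m i) =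
    (\<Prod>i\<in>UNIV - {j}. complex_of_real (vec_nth x i) ^ lkp m i)"
    by (intro prod.cong) (auto simp: axis_def)
  finally show ?thesis .
qed

lemma partial_mono_fun_0:
  assumes "lkp m j = 0"
  shows "partial j (mono_fun m) x = 0"
proof (rule partial_eqI)
  show "mono_fun m differentiable (at x)" by (rule smooth_differentiable[OF smooth_mono_fun])
  show "((\<lambda>s. mono_fun m (x + s *\<^sub>R axis j 1)) has_vector_derivative 0) (at 0)"
    unfolding mono_fun_line using assms by simp
qed

lemma partial_mono_fun_Suc:
  "partial j (mono_fun (m + Poly_Mapping.single j 1)) x = of_nat (Suc (lkp m j)) * mono_fun m x"
proof (rule partial_eqI)
  let ?M = "m + Poly_Mapping.single j 1"
  show "mono_fun ?M differentiable (at x)" by (rule smooth_differentiable[OF smooth_mono_fun])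
  let ?a = "complex_of_real (vec_nth x j)"
  let ?c = "\<Prod>i\<in>UNIV - {j}. complex_of_real (vec_nth x i) ^ lkp m i"
  have c: "(\<Prod>i\<in>UNIV - {j}. complex_of_real (vec_nth x i) ^ lkp ?M i) = ?c"
    by (intro prod.cong) (auto simp: lookup_add lookup_single when_def)
  have line: "mono_fun ?M (x + s *\<^sub>R axis j 1) = (?a + complex_of_real s) ^ Suc (lkp m j) * ?c" for s
    unfolding mono_fun_line c by (simp add: lookup_add lookup_single)
  have "mono_fun m x = ?a ^ lkp m j * ?c"
    using mono_fun_line[of m x 0 j] by simp
  moreover have "((\<lambda>z. (?a + z) ^ Suc (lkp m j) * ?c) has_field_derivative of_nat (Suc (lkp m j)) * (?a ^ lkp m j * ?c)) (at (complex_of_real 0))"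
  proof -
    have "((\<lambda>z. ?a + z) has_field_derivative 1) (at (complex_of_real 0))" by (auto intro!: derivative_eq_intros)
    from DERIV_cmult_right[OF DERIV_power_Suc[OF this, of "lkp m j"], of ?c] show ?thesis by (simp add: mult_ac)
  qed
  ultimately show "((\<lambda>s. mono_fun ?M (x + s *\<^sub>R axis j 1)) has_vector_derivative of_nat (Suc (lkp m j)) * mono_fun m x) (at 0)"
    unfolding line using has_vector_derivative_real_field by fastforce
qed

lemma ex_antiderivative:
  fixes q :: "'n::finite mpoly"
  shows "\<exists>Q. partial j (pfun Q) = pfun q"
proof -
  have "\<exists>Q. partial j (pfun Q) = pfun (\<Sum>m\<in>S. Poly_Mapping.single m (c m))" for S and c :: "('n \<Rightarrow>\<^sub>0 nat) \<Rightarrow> complex"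
  proof (induction S rule: infinite_finite_induct)
    case (insert m S)
    then obtain Q where Q: "partial j (pfun Q) = pfun (\<Sum>m\<in>S. Poly_Mapping.single m (c m))" by blast
    let ?s = "Poly_Mapping.single (m + Poly_Mapping.single j 1) (c m / of_nat (Suc (lkp m j)))"
    have s: "pfun ?s = (\<lambda>x. (c m / of_nat (Suc (lkp m j))) * mono_fun (m + Poly_Mapping.single j 1) x)"
      by (rule ext) (rule pfun_single)
    have e1: "partial j (pfun ?s) = (\<lambda>x. c m * mono_fun m x)"
      unfolding s partial_cmult_smooth[OF smooth_mono_fun] partial_mono_fun_Suc by (rule ext) (simp del: of_nat_Suc)
    have e2: "pfun (?s + Q) = (\<lambda>x. pfun ?s x + pfun Q x)" by (rule ext) (rule pfun_simps)
    have "partial j (pfun (?s + Q)) = (\<lambda>x. c m * mono_fun m x + pfun (\<Sum>m\<in>S. Poly_Mapping.single m (c m)) x)"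
      unfolding e2 partial_add_smooth[OF smooth_pfun smooth_pfun] e1 Q ..
    also have "\<dots> = pfun (\<Sum>m\<in>insert m S. Poly_Mapping.single m (c m))"
      by (rule ext) (simp add: insert(1,2) pfun_single)
    finally have "partial j (pfun (?s + Q)) = pfun (\<Sum>m\<in>insert m S. Poly_Mapping.single m (c m))" .
    then show ?case by blast
  qed (auto intro!: exI[of _ "0"] simp: pfun_def)
  from this[of "lkp q" "pkeys q"] show ?thesis by (simp only: poly_mapping_sum_single[symmetric])
qed

lemma peval_meval: "peval (meval PC f p) y = peval p (vec_lambda (\<lambda>i. peval (f i) y))"
  by (rule mpoly_hom_eqI[OF comm_ring_hom_comp[OF comm_ring_hom_meval[OF comm_ring_hom_PC] peval.comm_ring_hom_axioms] peval.comm_ring_hom_axioms])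
    (simp_all add: meval_PC[OF comm_ring_hom_PC] meval_PX[OF comm_ring_hom_PC])

text \<open>Subtracting the restriction to the face, a polynomial in the other variables, does not
  change the derivative in direction \<open>j\<close>.\<close>

lemma ex_antiderivative_face:
  fixes q :: "'n::finite mpoly"
  obtains Q where "partial j (pfun Q) = pfun q" "\<And>x. vec_nth x j = a \<Longrightarrow> pfun Q x = 0"
proof -
  obtain Q0 :: "'n mpoly" where Q0: "partial j (pfun Q0) = pfun q" using ex_antiderivative by blast
  define P where "P = meval PC (\<lambda>i. if i = j then PC (complex_of_real a) else PX i) Q0"
  have P: "pfun P x = pfun Q0 (vec_lambda (\<lambda>i. if i = j then a else vec_nth x i))" for x
    unfolding P_def pfun_def peval_meval by (rule arg_cong[of _ _ "peval Q0"]) (auto simp: Finite_Cartesian_Product.vec_eq_iff)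
  have "partial j (pfun P) x = 0" for x
  proof (rule partial_eqI)
    show "pfun P differentiable (at x)" by (rule smooth_differentiable[OF smooth_pfun])
    have "pfun P (x + s *\<^sub>R axis j 1) = pfun P x" for s
      unfolding P by (rule arg_cong[of _ _ "pfun Q0"]) (auto simp: Finite_Cartesian_Product.vec_eq_iff axis_def)
    then show "((\<lambda>s. pfun P (x + s *\<^sub>R axis j 1)) has_vector_derivative 0) (at 0)" by simp
  qed
  moreover have "pfun (Q0 - P) = (\<lambda>x. pfun Q0 x - pfun P x)" by auto
  ultimately have "partial j (pfun (Q0 - P)) = pfun q"
    by (simp add: partial_diff_smooth[OF smooth_pfun smooth_pfun] Q0)
  moreover have "pfun (Q0 - P) x = 0" if "vec_nth x j = a" for x
  proof -
    have "vec_lambda (\<lambda>i. if i = j then a else vec_nth x i) = x" using that by (auto simp: Finite_Cartesian_Product.vec_eq_iff)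
    then show ?thesis by (simp add: P)
  qed
  ultimately show ?thesis using that by blast
qed

lemma real_polynomial_function_pfun:
  "real_polynomial_function f \<Longrightarrow> \<exists>p :: 'n::finite mpoly. \<forall>x :: real ^ 'n. complex_of_real (f x) = pfun p x"
proof (induction f rule: real_polynomial_function.induct)
  case (linear f)
  have eq: "f x = (\<Sum>i\<in>UNIV. vec_nth x i * f (axis i 1))" for x
  proof -
    have "f x = f (\<Sum>i\<in>UNIV. vec_nth x i *\<^sub>R axis i 1)"
      by (rule arg_cong[of _ _ f]) (simp add: Finite_Cartesian_Product.vec_eq_iff axis_def if_distrib cong: if_cong)
    then show ?thesis using bounded_linear.linear[OF linear] by (simp add: linear_sum linear_scale)
  qed
  show ?case
  proof (intro exI allI)
    fix x
    show "complex_of_real (f x) = pfun (\<Sum>i\<in>UNIV. PX i * PC (complex_of_real (f (axis i 1)))) x"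
      by (subst eq) (simp add: pfun_sum)
  qed
next
  case (const c)
  then show ?case by (intro exI[of _ "PC (complex_of_real c)"]) simp
next
  case (add f g)
  then obtain p q :: "'n mpoly" where "\<forall>x. complex_of_real (f x) = pfun p x" "\<forall>x. complex_of_real (g x) = pfun q x" by blast
  then show ?case by (intro exI[of _ "p + q"]) simp
next
  case (mult f g)
  then obtain p q :: "'n mpoly" where "\<forall>x. complex_of_real (f x) = pfun p x" "\<forall>x. complex_of_real (g x) = pfun q x" by blast
  then show ?case by (intro exI[of _ "p * q"]) simp
qed

lemma complex_weierstrass:
  fixes f :: "real ^ 'n::finite \<Rightarrow> complex"
  assumes "compact K" "continuous_on K f" "e > 0"
  shows "\<exists>p. \<forall>x\<in>K. norm (f x - pfun p x) \<le> e"
proof -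
  obtain g where g: "real_polynomial_function g" "\<And>x. x \<in> K \<Longrightarrow> \<bar>Re (f x) - g x\<bar> < e / 2"
    using Stone_Weierstrass_real_polynomial_function[OF assms(1), of "\<lambda>x. Re (f x)" "e / 2"] assms
    by (auto intro: continuous_on_Re)
  obtain h where h: "real_polynomial_function h" "\<And>x. x \<in> K \<Longrightarrow> \<bar>Im (f x) - h x\<bar> < e / 2"
    using Stone_Weierstrass_real_polynomial_function[OF assms(1), of "\<lambda>x. Im (f x)" "e / 2"] assms
    by (auto intro: continuous_on_Im)
  obtain p where p: "\<And>x. complex_of_real (g x) = pfun p x" using real_polynomial_function_pfun[OF g(1)] by blast
  obtain q where q: "\<And>x. complex_of_real (h x) = pfun q x" using real_polynomial_function_pfun[OF h(1)] by blast
  have "norm (f x - pfun (p + PC \<i> * q) x) \<le> e" if "x \<in> K" for x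
  proof -
    let ?z = "f x - pfun (p + PC \<i> * q) x"
    have "Re ?z = Re (f x) - g x" "Im ?z = Im (f x) - h x" by (simp_all flip: p q)
    then show ?thesis using cmod_le[of ?z] g(2)[OF that] h(2)[OF that] by linarith
  qed
  then show ?thesis by blast
qed

subsection \<open>Approximation by polynomials with all derivatives\<close>

text \<open>Lines in the other directions stay inside the face, so derivatives along them inherit
  the zero.\<close>

lemma fold_partial_face:
  "smooth g \<Longrightarrow> (\<And>x. vec_nth x j = a \<Longrightarrow> g x = 0) \<Longrightarrow> j \<notin> set ks \<Longrightarrow> vec_nth x j = a \<Longrightarrow> fold partial ks g x = 0"
proof (induction ks arbitrary: g x)
  case (Cons i ks)
  have "partial i g y = 0" if y: "vec_nth y j = a" for y
  proof (rule partial_eqI)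
    show "g differentiable (at y)" by (rule smooth_differentiable[OF Cons.prems(1)])
    have "g (y + s *\<^sub>R axis i 1) = 0" for s
      using Cons.prems(3) y by (intro Cons.prems(2)) (auto simp: axis_def)
    then show "((\<lambda>s. g (y + s *\<^sub>R axis i 1)) has_vector_derivative 0) (at 0)" by simp
  qed
  then show ?case using Cons.IH[OF smooth_partial[OF Cons.prems(1)], of i x] Cons.prems(3,4) by simp
qed simp

text \<open>The mean value estimate along the segment from the face \<open>x_j = - R\<close>; it
  stays in the cube and is at most \<open>2 * R\<close> long.\<close>

lemma norm_le_on_cube:
  fixes g :: "real ^ 'n::finite \<Rightarrow> complex"
  assumes g: "smooth g" "\<And>x. vec_nth x j = - R \<Longrightarrow> g x = 0"
    and e: "\<And>x. x \<in> cube R \<Longrightarrow> norm (partial j g x) \<le> e" and x: "x \<in> cube R"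
  shows "norm (g x) \<le> 2 * R * e"
proof -
  define b where "b = vec_nth x j + R"
  define y where "y = x - b *\<^sub>R axis j 1"
  have xj: "\<bar>vec_nth x j\<bar> \<le> R" using x by (simp add: cube_def)
  then have b: "0 \<le> b" "b \<le> 2 * R" by (auto simp: b_def)
  have e0: "0 \<le> e" using e[OF x] norm_ge_zero order_trans by blast
  have "norm (g (y + b *\<^sub>R axis j 1) - g (y + 0 *\<^sub>R axis j 1)) \<le> e * \<bar>b - 0\<bar>"
  proof (rule norm_line_diff_le)
    fix s assume "s \<in> closed_segment 0 b"
    then have s: "0 \<le> s" "s \<le> b" using b by (auto simp: closed_segment_eq_real_ivl)
    show "g differentiable (at (y + s *\<^sub>R axis j 1))" by (rule smooth_differentiable[OF g(1)])
    show "norm (partial j g (y + s *\<^sub>R axis j 1)) \<le> e"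
    proof (rule e)
      have "\<bar>vec_nth (y + s *\<^sub>R axis j 1) i\<bar> \<le> R" for i
      proof (cases "i = j")
        case True
        then have "vec_nth (y + s *\<^sub>R axis j 1) i = s - R" by (simp add: y_def b_def axis_def)
        then show ?thesis using s b xj by (auto simp: b_def)
      next
        case False
        then show ?thesis using x by (simp add: y_def axis_def cube_def)
      qed
      then show "y + s *\<^sub>R axis j 1 \<in> cube R" by (simp add: cube_def)
    qed
  qed
  moreover have "g (y + 0 *\<^sub>R axis j 1) = 0" by (rule g(2)) (simp add: y_def b_def axis_def)
  moreover have "y + b *\<^sub>R axis j 1 = x" by (simp add: y_def)
  ultimately have "norm (g x) \<le> e * b" using b by simp
  also have "\<dots> \<le> e * (2 * R)" using b e0 by (intro mult_left_mono)
  finally show ?thesis by (simp add: mult_ac)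
qed

text \<open>Induction on the derivatives to be controlled: approximate
  \<open>partial j \<phi>\<close> and integrate the approximant from the face
  \<open>x_j = - R\<close>, where \<open>\<phi>\<close> vanishes because \<open>R' < R\<close>.
  Derivatives that contain \<open>j\<close> are covered by the induction hypothesis, as partial
  derivatives commute; the others vanish on the face and are recovered from their derivative in
  direction \<open>j\<close>.\<close>

lemma smooth_weierstrass:
  fixes \<phi> :: "real ^ 'n::finite \<Rightarrow> complex"
  assumes R: "0 < R" "R' < R"
  shows "smooth \<phi> \<Longrightarrow> (\<And>x. x \<notin> cube R' \<Longrightarrow> \<phi> x = 0) \<Longrightarrow> e > 0 \<Longrightarrow>
    \<exists>Q. \<forall>ks. mset ks \<subseteq># mset J \<longrightarrow> (\<forall>x\<in>cube R. norm (fold partial ks (\<lambda>x. \<phi> x - pfun Q x) x) \<le> e)"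
proof (induction J arbitrary: \<phi> e)
  case Nil
  then show ?case using complex_weierstrass[OF compact_cube smooth_continuous[OF Nil(1)] Nil(3), of R] by simp
next
  case (Cons j J)
  \<comment> \<open>Integration across the cube loses a factor \<open>2 * R\<close>, while
    derivatives containing \<open>j\<close> need \<open>e' \<le> e\<close>.\<close>
  define e' where "e' = e / (1 + 2 * R)"
  have e': "e' > 0" "e' \<le> e" "2 * R * e' \<le> e"
    using Cons.prems(3) R by (auto simp: e'_def field_simps)
  have "partial j \<phi> x = 0" if "x \<notin> cube R'" for x
    by (rule partial_eq_0_outside[OF closed_cube Cons.prems(2) that])
  from Cons.IH[OF smooth_partial[OF Cons.prems(1)] this e'(1)]
  obtain q where q: "\<And>ks x. mset ks \<subseteq># mset J \<Longrightarrow> x \<in> cube R \<Longrightarrow> norm (fold partial ks (\<lambda>x. partial j \<phi> x - pfun q x) x) \<le> e'"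
    by blast
  obtain Q where Q: "partial j (pfun Q) = pfun q" "\<And>x. vec_nth x j = - R \<Longrightarrow> pfun Q x = 0"
    by (rule ex_antiderivative_face) blast
  define g where "g x = \<phi> x - pfun Q x" for x
  have g: "smooth g" unfolding g_def by (intro smooth_diff Cons.prems smooth_pfun)
  have pg: "partial j g = (\<lambda>x. partial j \<phi> x - pfun q x)"
    unfolding g_def by (simp add: partial_diff_smooth[OF Cons.prems(1) smooth_pfun] Q(1))
  have face: "g x = 0" if "vec_nth x j = - R" for x
  proof -
    have "\<not> \<bar>vec_nth x j\<bar> \<le> R'" using that R by simp
    then have "x \<notin> cube R'" by (auto simp: cube_def)
    then show ?thesis using Cons.prems(2) Q(2)[OF that] by (simp add: g_def)
  qed
  have "norm (fold partial ks g x) \<le> e" if ks: "mset ks \<subseteq># mset (j # J)" and x: "x \<in> cube R" for ks x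
  proof (cases "j \<in> set ks")
    case True
    have "mset (remove1 j ks) \<subseteq># mset J" using ks by (simp add: subset_eq_diff_conv)
    then show ?thesis
      using q[of "remove1 j ks" x] x e'(2) by (simp add: fold_partial_remove1[OF g True] pg)
  next
    case False
    have sub: "mset ks \<subseteq># mset J"
    proof (rule mset_subset_eqI)
      fix i
      have "j \<notin># mset ks" using False by simp
      then have 0: "count (mset ks) j = 0" by (simp only: not_in_iff)
      show "count (mset ks) i \<le> count (mset J) i"
      proof (cases "i = j")
        case True
        then show ?thesis by (simp only: 0)
      qed (use mset_subset_eq_count[OF ks, of i] in simp)
    qed
    have "norm (fold partial ks g x) \<le> 2 * R * e'"
    proof (rule norm_le_on_cube[OF smooth_fold[OF g] _ _ x])
      show "fold partial ks g y = 0" if "vec_nth y j = - R" for y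
        by (rule fold_partial_face[OF g face False that])
      show "norm (partial j (fold partial ks g) y) \<le> e'" if "y \<in> cube R" for y
        using q[OF sub that] by (simp add: fold_partial_commute[OF g, symmetric] pg)
    qed
    then show ?thesis using e'(3) by linarith
  qed
  then show ?case unfolding g_def by blast
qed

text \<open>Each derivative of the product doubles the number of terms. The bound on
  \<open>g\<close> is available only on \<open>K\<close>, but outside \<open>K\<close> every
  derivative of \<open>\<chi>\<close> is zero.\<close>

lemma leibniz_bound:
  fixes \<chi> g :: "real ^ 'n::finite \<Rightarrow> complex"
  assumes "smooth \<chi>" "smooth g" "B \<ge> 0" "E \<ge> 0" "length js \<le> n"
    and "\<And>ls x. length ls \<le> n \<Longrightarrow> norm (fold partial ls \<chi> x) \<le> B"
    and "\<And>ls x. length ls \<le> n \<Longrightarrow> x \<in> K \<Longrightarrow> norm (fold partial ls g x) \<le> E"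
    and "\<And>ls x. x \<notin> K \<Longrightarrow> fold partial ls \<chi> x = 0"
  shows "norm (fold partial js (\<lambda>x. \<chi> x * g x) x) \<le> 2 ^ length js * (B * E)"
  using assms
proof (induction js arbitrary: \<chi> g n)
  case Nil
  show ?case
  proof (cases "x \<in> K")
    case True
    then show ?thesis using Nil(6)[of "[]" x] Nil(7)[of "[]" x] Nil(3) by (simp add: norm_mult mult_mono)
  next
    case False
    then show ?thesis using Nil(8)[of x "[]"] Nil(3,4) by simp
  qed
next
  case (Cons j js)
  then obtain n' where n: "n = Suc n'" by (cases n) auto
  have len: "length js \<le> n'" using Cons.prems(5) n by simp
  note sm = Cons.prems(1,2)
  have 1: "norm (fold partial js (\<lambda>x. partial j \<chi> x * g x) x) \<le> 2 ^ length js * (B * E)"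
  proof (rule Cons.IH[OF smooth_partial[OF sm(1)] sm(2) Cons.prems(3,4) len])
    show "norm (fold partial ls (partial j \<chi>) x) \<le> B" if "length ls \<le> n'" for ls x
      using Cons.prems(6)[of "j # ls" x] that n by simp
    show "norm (fold partial ls g x) \<le> E" if "length ls \<le> n'" "x \<in> K" for ls x
      using Cons.prems(7)[of ls x] that n by simp
    show "fold partial ls (partial j \<chi>) x = 0" if "x \<notin> K" for ls x
      using Cons.prems(8)[of x "j # ls"] that by simp
  qed
  have 2: "norm (fold partial js (\<lambda>x. \<chi> x * partial j g x) x) \<le> 2 ^ length js * (B * E)"
  proof (rule Cons.IH[OF sm(1) smooth_partial[OF sm(2)] Cons.prems(3,4) len])
    show "norm (fold partial ls \<chi> x) \<le> B" if "length ls \<le> n'" for ls x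
      using Cons.prems(6)[of ls x] that n by simp
    show "norm (fold partial ls (partial j g) x) \<le> E" if "length ls \<le> n'" "x \<in> K" for ls x
      using Cons.prems(7)[of "j # ls" x] that n by simp
    show "fold partial ls \<chi> x = 0" if "x \<notin> K" for ls x
      using Cons.prems(8)[of x ls] that by simp
  qed
  have "fold partial (j # js) (\<lambda>x. \<chi> x * g x) x =
    fold partial js (\<lambda>x. partial j \<chi> x * g x) x + fold partial js (\<lambda>x. \<chi> x * partial j g x) x"
    by (simp add: partial_mult_smooth[OF sm] fold_partial_add[OF smooth_mult[OF smooth_partial[OF sm(1)] sm(2)] smooth_mult[OF sm(1) smooth_partial[OF sm(2)]]])
  then have "norm (fold partial (j # js) (\<lambda>x. \<chi> x * g x) x) \<le>
    norm (fold partial js (\<lambda>x. partial j \<chi> x * g x) x) + norm (fold partial js (\<lambda>x. \<chi> x * partial j g x) x)"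
    by (simp only: norm_triangle_ineq)
  also have "\<dots> \<le> 2 ^ length (j # js) * (B * E)" using 1 2 by simp
  finally show ?case .
qed

lemma ex_list_all_counts:
  obtains J :: "'n::finite list" where "\<And>ks. length ks \<le> N \<Longrightarrow> mset ks \<subseteq># mset J"
proof -
  obtain J :: "'n list" where J: "mset J = (\<Sum>j\<in>UNIV. replicate_mset N j)" using ex_mset by blast
  have "mset ks \<subseteq># mset J" if "length ks \<le> N" for ks
  proof (rule mset_subset_eqI)
    fix j
    have "count (mset ks) j \<le> length ks" by (metis count_le_length count_mset)
    also have "\<dots> \<le> N" by (rule that)
    also have "\<dots> = count (mset J) j" by (simp add: J count_sum)
    finally show "count (mset ks) j \<le> count (mset J) j" .
  qed
  then show ?thesis using that by blast
qed

definition vanishes_on :: "(real ^ 'n::finite) set \<Rightarrow> 'n functional \<Rightarrow> bool" where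
  "vanishes_on W T \<longleftrightarrow> (\<forall>\<phi>\<in>test_functions. supp \<phi> \<subseteq> W \<longrightarrow> T \<phi> = 0)"

lemma linear_on_tests_zero: "linear_on_tests T \<Longrightarrow> T (\<lambda>x. 0) = 0"
proof -
  assume T: "linear_on_tests T"
  have "(\<lambda>x. 0) \<in> test_functions" by (rule test_functionI[OF smooth_const, of "{}"]) auto
  from linear_on_testsD(2)[OF T this, of 0] show ?thesis by simp
qed

lemma linear_on_tests_sum:
  assumes T: "linear_on_tests T" and f: "\<And>i. i \<in> S \<Longrightarrow> f i \<in> test_functions" and S: "finite S"
  shows "(\<lambda>x. \<Sum>i\<in>S. f i x) \<in> test_functions \<and> T (\<lambda>x. \<Sum>i\<in>S. f i x) = (\<Sum>i\<in>S. T (f i))"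
  using S f
proof (induction S rule: finite_induct)
  case empty
  have "(\<lambda>x. 0) \<in> test_functions" by (rule test_functionI[OF smooth_const, of "{}"]) auto
  then show ?case using linear_on_tests_zero[OF T] by simp
next
  case (insert i S)
  then show ?case using test_add[of "f i" "\<lambda>x. \<Sum>i\<in>S. f i x"] linear_on_testsD(1)[OF T, of "f i" "\<lambda>x. \<Sum>i\<in>S. f i x"] by simp
qed

text \<open>\<open>T\<close> ignores changes away from \<open>cube R0\<close>, so
  \<open>\<phi>\<close> may be multiplied by \<open>\<chi>\<close>. The result is approximated by
  polynomials with all derivatives that the continuity estimate of \<open>T\<close> involves, and
  \<open>T\<close> vanishes on polynomials times \<open>\<chi>\<close>.\<close>

lemma distribution_zero_if_moments_zero:
  fixes T :: "'n::finite functional"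
  assumes T: "T \<in> distributions" and W: "vanishes_on W T" "\<And>x. x \<notin> cube R0 \<Longrightarrow> x \<in> W" and R0: "R0 > 0" "R0 < R1"
    and \<chi>: "smooth \<chi>" "\<And>x. x \<in> cube R1 \<Longrightarrow> \<chi> x = 1" "\<And>x. \<chi> x \<noteq> 0 \<Longrightarrow> x \<in> cube (R1 + 1)"
    and moments: "\<And>m. T (\<lambda>x. mono_fun m x * \<chi> x) = 0"
    and \<phi>: "\<phi> \<in> test_functions"
  shows "T \<phi> = 0"
proof -
  have \<chi>t: "\<chi> \<in> test_functions" by (rule test_functionI[OF \<chi>(1) compact_cube \<chi>(3)])
  note lin = distribution_linear[OF T]
  have tm: "(\<lambda>x. \<chi> x * \<psi> x) \<in> test_functions" if "\<psi> \<in> test_functions" for \<psi> by (rule test_mult[OF \<chi>(1) that])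
  \<comment> \<open>The support of \<open>(1 - \<chi>) * \<psi>\<close> is a closure; the gap
    between \<open>R0\<close> and \<open>R1\<close> keeps it inside \<open>W\<close>.\<close>
  have cut: "T \<psi> = T (\<lambda>x. \<chi> x * \<psi> x)" if \<psi>: "\<psi> \<in> test_functions" for \<psi>
  proof -
    have s: "smooth (\<lambda>x. 1 - \<chi> x)" by (intro smooth_diff smooth_const \<chi>)
    have t: "(\<lambda>x. (1 - \<chi> x) * \<psi> x) \<in> test_functions" by (rule test_mult[OF s \<psi>])
    have "supp (\<lambda>x. (1 - \<chi> x) * \<psi> x) \<subseteq> - {x. \<forall>i. \<bar>vec_nth x i\<bar> < R1}"
    proof (rule supp_subsetI)
      have "{x :: real ^ 'n. \<forall>i. \<bar>vec_nth x i\<bar> < R1} = (\<Inter>i. {x. \<bar>vec_nth x i\<bar> < R1})" by auto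
      moreover have "open (\<Inter>i\<in>UNIV. {x :: real ^ 'n. \<bar>vec_nth x i\<bar> < R1})"
        by (intro open_INT) (auto intro!: open_Collect_less continuous_intros)
      ultimately show "closed (- {x :: real ^ 'n. \<forall>i. \<bar>vec_nth x i\<bar> < R1})" by (simp add: closed_def)
      show "x \<in> - {x. \<forall>i. \<bar>vec_nth x i\<bar> < R1}" if "(1 - \<chi> x) * \<psi> x \<noteq> 0" for x
      proof
        assume "x \<in> {x. \<forall>i. \<bar>vec_nth x i\<bar> < R1}"
        then have "x \<in> cube R1" by (auto simp: cube_def less_imp_le)
        then show False using \<chi>(2) that by simp
      qed
    qed
    also have "\<dots> \<subseteq> W"
    proof
      fix x assume "x \<in> - {x :: real ^ 'n. \<forall>i. \<bar>vec_nth x i\<bar> < R1}"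
      then obtain i where "\<not> \<bar>vec_nth x i\<bar> < R1" by auto
      then have "\<not> \<bar>vec_nth x i\<bar> \<le> R0" using R0 by simp
      then have "x \<notin> cube R0" by (auto simp: cube_def)
      then show "x \<in> W" by (rule W(2))
    qed
    finally have "T (\<lambda>x. (1 - \<chi> x) * \<psi> x) = 0" using W(1) t by (simp add: vanishes_on_def)
    moreover have "T (\<lambda>x. (1 - \<chi> x) * \<psi> x + \<chi> x * \<psi> x) = T (\<lambda>x. (1 - \<chi> x) * \<psi> x) + T (\<lambda>x. \<chi> x * \<psi> x)"
      by (rule linear_on_testsD(1)[OF lin t tm[OF \<psi>]])
    ultimately show ?thesis by (simp add: algebra_simps)
  qed
  have poly0: "T (\<lambda>x. \<chi> x * pfun Q x) = 0" for Q
  proof -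
    have mt: "(\<lambda>x. mono_fun m x * \<chi> x) \<in> test_functions" for m by (rule test_mult[OF smooth_mono_fun \<chi>t])
    have "pfun Q x = (\<Sum>m\<in>pkeys Q. lkp Q m * mono_fun m x)" for x
      by (subst poly_mapping_sum_single) (simp only: pfun_sum pfun_single)
    then have eq: "(\<lambda>x. \<chi> x * pfun Q x) = (\<lambda>x. \<Sum>m\<in>pkeys Q. lkp Q m * (mono_fun m x * \<chi> x))"
      by (auto simp: sum_distrib_left mult_ac)
    have "T (\<lambda>x. \<chi> x * pfun Q x) = (\<Sum>m\<in>pkeys Q. T (\<lambda>x. lkp Q m * (mono_fun m x * \<chi> x)))"
      unfolding eq using linear_on_tests_sum[OF lin, of "pkeys Q" "\<lambda>m x. lkp Q m * (mono_fun m x * \<chi> x)"] test_cmult[OF mt] by simp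
    also have "\<dots> = 0" by (simp add: linear_on_testsD(2)[OF lin mt] moments)
    finally show ?thesis .
  qed
  have zero: "T (\<lambda>x. \<chi> x * \<psi> x) = 0" if \<psi>: "\<psi> \<in> test_functions" "\<And>x. x \<notin> cube (R1 + 1) \<Longrightarrow> \<psi> x = 0" for \<psi>
  proof -
    let ?K = "cube (R1 + 2) :: (real ^ 'n) set"
    obtain N C where C: "C \<ge> 0" "\<And>\<phi> E. \<phi> \<in> test_functions \<Longrightarrow> supp \<phi> \<subseteq> ?K \<Longrightarrow>
      (\<And>js x. length js \<le> N \<Longrightarrow> norm (fold partial js \<phi> x) \<le> E) \<Longrightarrow> norm (T \<phi>) \<le> C * E"
      by (rule distribution_bound[OF T compact_cube[of "R1 + 2"]]) blast
    obtain B where B: "B \<ge> 0" "\<And>js x. length js \<le> N \<Longrightarrow> norm (fold partial js \<chi> x) \<le> B"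
      by (rule test_bounded_upto[OF \<chi>t, of N]) blast
    obtain J :: "'n list" where J: "\<And>ks. length ks \<le> N \<Longrightarrow> mset ks \<subseteq># mset J"
      by (rule ex_list_all_counts[of N]) blast
    have sub: "supp \<chi> \<subseteq> ?K"
    proof (rule supp_subsetI[OF closed_cube])
      show "x \<in> ?K" if "\<chi> x \<noteq> 0" for x
      proof -
        have "\<bar>vec_nth x i\<bar> \<le> R1 + 2" for i
          using \<chi>(3)[OF that] by (simp add: cube_def order_trans[of _ "R1 + 1" "R1 + 2"])
        then show ?thesis by (simp add: cube_def)
      qed
    qed
    have est: "norm (T (\<lambda>x. \<chi> x * \<psi> x)) \<le> C * (2 ^ N * (B * e))" if e: "e > 0" for e
    proof -
      have "\<exists>Q. \<forall>ks. mset ks \<subseteq># mset J \<longrightarrow> (\<forall>x\<in>?K. norm (fold partial ks (\<lambda>x. \<psi> x - pfun Q x) x) \<le> e)"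
        using R0 by (intro smooth_weierstrass[of _ "R1 + 1"] test_functionD(1)[OF \<psi>(1)] \<psi>(2) e) auto
      then obtain Q where Q: "\<And>ks x. length ks \<le> N \<Longrightarrow> x \<in> ?K \<Longrightarrow> norm (fold partial ks (\<lambda>x. \<psi> x - pfun Q x) x) \<le> e"
        using J by blast
      let ?g = "\<lambda>x. \<psi> x - pfun Q x"
      have g: "smooth ?g" by (intro smooth_diff smooth_pfun test_functionD(1)[OF \<psi>(1)])
      have gt: "(\<lambda>x. ?g x * \<chi> x) \<in> test_functions" by (rule test_mult[OF g \<chi>t])
      have comm: "(\<lambda>x. ?g x * \<chi> x) = (\<lambda>x. \<chi> x * ?g x)" by (simp add: mult.commute)
      have qt: "(\<lambda>x. pfun Q x * \<chi> x) \<in> test_functions" by (rule test_mult[OF smooth_pfun \<chi>t])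
      have comm2: "(\<lambda>x. pfun Q x * \<chi> x) = (\<lambda>x. \<chi> x * pfun Q x)" by (simp add: mult.commute)
      have "norm (fold partial js (\<lambda>x. \<chi> x * ?g x) x) \<le> 2 ^ N * (B * e)" if js: "length js \<le> N" for js x
      proof -
        have "norm (fold partial js (\<lambda>x. \<chi> x * ?g x) x) \<le> 2 ^ length js * (B * e)"
        proof (rule leibniz_bound[OF \<chi>(1) g B(1) less_imp_le[OF e] js B(2) Q])
          show "fold partial ls \<chi> x = 0" if "x \<notin> ?K" for ls x
            using that sub by (intro fold_partial_eq_0_outside) auto
        qed
        also have "\<dots> \<le> 2 ^ N * (B * e)"
          using js B(1) e by (intro mult_right_mono power_increasing) auto
        finally show ?thesis .
      qed
      then have "norm (T (\<lambda>x. \<chi> x * ?g x)) \<le> C * (2 ^ N * (B * e))"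
        using C(2)[OF gt[unfolded comm]] supp_mult[of ?g \<chi>, unfolded comm] sub by (meson subset_trans)
      moreover have "T (\<lambda>x. \<chi> x * ?g x) = T (\<lambda>x. \<chi> x * \<psi> x) - T (\<lambda>x. \<chi> x * pfun Q x)"
        using linear_on_tests_diff[OF lin tm[OF \<psi>(1)] qt[unfolded comm2]] by (simp add: right_diff_distrib)
      ultimately show ?thesis by (simp add: poly0)
    qed
    have "norm (T (\<lambda>x. \<chi> x * \<psi> x)) \<le> 0 + \<epsilon>" if \<epsilon>: "\<epsilon> > 0" for \<epsilon>
    proof -
      \<comment> \<open>The added \<open>1\<close> keeps the divisor positive when \<open>C\<close>
        or \<open>B\<close> is zero.\<close>
      let ?D = "C * (2 ^ N * B) + 1"
      have D: "?D > 0" using C(1) B(1) by (intro add_nonneg_pos) auto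
      have "norm (T (\<lambda>x. \<chi> x * \<psi> x)) \<le> C * (2 ^ N * (B * (\<epsilon> / ?D)))" using est[of "\<epsilon> / ?D"] \<epsilon> D by simp
      also have "\<dots> = (C * (2 ^ N * B)) * (\<epsilon> / ?D)" by simp
      also have "\<dots> \<le> ?D * (\<epsilon> / ?D)" using \<epsilon> D by (intro mult_right_mono) auto
      also have "\<dots> = \<epsilon>" using D by simp
      finally show ?thesis by simp
    qed
    then have "norm (T (\<lambda>x. \<chi> x * \<psi> x)) \<le> 0" by (rule field_le_epsilon)
    then show ?thesis by simp
  qed
  \<comment> \<open>\<open>\<chi>\<close> is inserted twice: the inner factor confines the test
    function to a fixed cube, as the approximation requires, and the outer one cuts off the
    polynomials.\<close>
  have "T (\<lambda>x. \<chi> x * (\<chi> x * \<phi> x)) = 0"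
  proof (rule zero[OF tm[OF \<phi>]])
    show "\<chi> x * \<phi> x = 0" if "x \<notin> cube (R1 + 1)" for x using \<chi>(3)[of x] that by auto
  qed
  then show ?thesis using cut[OF \<phi>] cut[OF tm[OF \<phi>]] by simp
qed

subsection \<open>Compactly supported solutions of one equation\<close>

lemma dist_D_test: "\<phi> \<in> test_functions \<Longrightarrow> dist_D j T \<phi> = \<i> * T (partial j \<phi>)"
  by (simp add: dist_D_def field_simps)

lemma dist_D_linear: "linear_on_tests T \<Longrightarrow> linear_on_tests (dist_D j T)"
  unfolding linear_on_tests_def[of "dist_D j T"]
  by (simp add: dist_D_test test_add test_cmult test_partial linear_on_testsD partial_add_smooth partial_cmult_smooth
      test_functionD(1) distrib_left)

lemma dist_D_vanishes: "vanishes_on W T \<Longrightarrow> vanishes_on W (dist_D j T)"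
  unfolding vanishes_on_def
proof (intro ballI impI)
  fix \<phi> assume T: "\<forall>\<phi>\<in>test_functions. supp \<phi> \<subseteq> W \<longrightarrow> T \<phi> = 0" and \<phi>: "\<phi> \<in> test_functions" "supp \<phi> \<subseteq> W"
  have "supp (partial j \<phi>) \<subseteq> W" by (rule subset_trans[OF supp_partial \<phi>(2)])
  then have "T (partial j \<phi>) = 0" using T test_partial[OF \<phi>(1)] by blast
  then show "dist_D j T \<phi> = 0" by (simp add: dist_D_test[OF \<phi>(1)])
qed

text \<open>The moments are normalised so that \<open>D\<^sub>j\<close> acts on them as a shift, i.e. so that \<open>p(D)\<close> acts on the
  generating power series as multiplication by \<open>p\<close>.\<close>

definition moment_factor :: "('n::finite \<Rightarrow>\<^sub>0 nat) \<Rightarrow> complex" where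
  "moment_factor m = (\<Prod>j\<in>UNIV. (- \<i>) ^ lkp m j / fact (lkp m j))"

lemma moment_factor_nonzero: "moment_factor m \<noteq> 0"
  by (simp add: moment_factor_def)

text \<open>One more power of \<open>x_j\<close> contributes \<open>- \<i> / (m_j + 1)\<close>, the
  inverse of the factor \<open>\<i> * (m_j + 1)\<close> that \<open>D_j\<close> produces on the
  monomial.\<close>

lemma moment_factor_Suc:
  "moment_factor (m + Poly_Mapping.single j 1) * (\<i> * of_nat (Suc (lkp m j))) = moment_factor m"
proof -
  let ?M = "m + Poly_Mapping.single j 1"
  have "(\<Prod>i\<in>UNIV - {j}. (- \<i>) ^ lkp ?M i / fact (lkp ?M i)) = (\<Prod>i\<in>UNIV - {j}. (- \<i>) ^ lkp m i / fact (lkp m i))"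
    by (intro prod.cong) (auto simp: lookup_add lookup_single when_def)
  then have 1: "moment_factor ?M = (- \<i>) ^ Suc (lkp m j) / fact (Suc (lkp m j)) * (\<Prod>i\<in>UNIV - {j}. (- \<i>) ^ lkp m i / fact (lkp m i))"
    unfolding moment_factor_def by (subst prod.remove[of UNIV j]) (auto simp: lookup_add lookup_single)
  have 2: "moment_factor m = (- \<i>) ^ lkp m j / fact (lkp m j) * (\<Prod>i\<in>UNIV - {j}. (- \<i>) ^ lkp m i / fact (lkp m i))"
    unfolding moment_factor_def by (subst prod.remove[of UNIV j]) auto
  have "(- \<i>) ^ Suc k / fact (Suc k) * (\<i> * of_nat (Suc k)) = (- \<i>) ^ k / (fact k :: complex)" for k
  proof -
    have "(- \<i>) ^ Suc k / fact (Suc k) * (\<i> * of_nat (Suc k)) = (- \<i>) ^ k * (- \<i> * \<i>) * (of_nat (Suc k) / (of_nat (Suc k) * fact k))"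
      by (simp add: field_simps del: of_nat_Suc)
    also have "\<dots> = (- \<i>) ^ k / fact k" by (simp del: of_nat_Suc)
    finally show ?thesis .
  qed
  note k = this
  have "a * p * c = b * p" if "a * c = b" for a b c p :: complex
    using that by (simp only: mult.assoc mult.commute[of p]) (simp only: mult.assoc[symmetric])
  from this[OF k] show ?thesis unfolding 1 2 .
qed

text \<open>\<open>\<chi>\<close> plays the constant \<open>1\<close>: its derivatives are supported
  in \<open>W\<close>, where the functionals vanish, so differentiating \<open>\<chi>\<close> never
  contributes.\<close>

locale moment_setting =
  fixes W :: "(real ^ 'n::finite) set" and \<chi> :: "real ^ 'n \<Rightarrow> complex"
  assumes \<chi>: "\<chi> \<in> test_functions" and supp_partial_\<chi>: "supp (partial j \<chi>) \<subseteq> W"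
begin

definition good :: "'n functional \<Rightarrow> bool" where
  "good T \<longleftrightarrow> linear_on_tests T \<and> vanishes_on W T"

definition moment :: "'n functional \<Rightarrow> ('n \<Rightarrow>\<^sub>0 nat) \<Rightarrow> complex" where
  "moment T m = moment_factor m * T (\<lambda>x. mono_fun m x * \<chi> x)"

lemma good_dist_D: "good T \<Longrightarrow> good (dist_D j T)"
  by (simp add: good_def dist_D_linear dist_D_vanishes)

lemma good_dist_D_power: "good T \<Longrightarrow> good ((dist_D j ^^ r) T)"
  by (induction r) (auto intro: good_dist_D)

lemma dist_D_mono:
  assumes T: "good T"
  shows "dist_D j T (\<lambda>x. mono_fun m x * \<chi> x) = \<i> * T (\<lambda>x. partial j (mono_fun m) x * \<chi> x)"
proof -
  have \<chi>s: "smooth \<chi>" by (rule test_functionD(1)[OF \<chi>])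
  have t1: "(\<lambda>x. partial j (mono_fun m) x * \<chi> x) \<in> test_functions" by (rule test_mult[OF smooth_partial[OF smooth_mono_fun] \<chi>])
  have t2: "(\<lambda>x. mono_fun m x * partial j \<chi> x) \<in> test_functions" by (rule test_mult[OF smooth_mono_fun test_partial[OF \<chi>]])
  have "T (\<lambda>x. mono_fun m x * partial j \<chi> x) = 0"
    using T t2 subset_trans[OF supp_mult supp_partial_\<chi>] by (auto simp: good_def vanishes_on_def)
  then show ?thesis
    using T linear_on_testsD(1)[OF _ t1 t2, of T]
    by (simp add: dist_D_test[OF test_mult[OF smooth_mono_fun \<chi>]] partial_mult_smooth[OF smooth_mono_fun \<chi>s] good_def)
qed

lemma moment_D_Suc:
  assumes T: "good T"
  shows "moment (dist_D j T) (m + Poly_Mapping.single j 1) = moment T m"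
proof -
  have lin: "linear_on_tests T" using T by (simp add: good_def)
  have "dist_D j T (\<lambda>x. mono_fun (m + Poly_Mapping.single j 1) x * \<chi> x) =
    \<i> * T (\<lambda>x. of_nat (Suc (lkp m j)) * (mono_fun m x * \<chi> x))"
    unfolding dist_D_mono[OF T] partial_mono_fun_Suc by (simp only: mult.assoc)
  also have "\<dots> = (\<i> * of_nat (Suc (lkp m j))) * T (\<lambda>x. mono_fun m x * \<chi> x)"
    unfolding linear_on_testsD(2)[OF lin test_mult[OF smooth_mono_fun \<chi>]] by (simp only: mult.assoc)
  finally show ?thesis unfolding moment_def by (simp only: moment_factor_Suc[symmetric, of m j] mult.assoc)
qed

lemma moment_D_0:
  assumes T: "good T" and m: "lkp m j = 0"
  shows "moment (dist_D j T) m = 0"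
  using T linear_on_tests_zero[of T] by (simp add: moment_def dist_D_mono[OF T] partial_mono_fun_0[OF m] good_def)

lemma moment_D_power: "good T \<Longrightarrow> moment ((dist_D j ^^ r) T) (m + Poly_Mapping.single j r) = moment T m"
proof (induction r)
  case (Suc r)
  have "m + Poly_Mapping.single j (Suc r) = (m + Poly_Mapping.single j r) + Poly_Mapping.single j 1"
    by (simp add: add.assoc flip: single_add)
  then show ?case using Suc moment_D_Suc[OF good_dist_D_power[OF Suc.prems, where j = j and r = r], of j "m + Poly_Mapping.single j r"] by simp
qed simp

lemma moment_D_power_0: "good T \<Longrightarrow> lkp m j < r \<Longrightarrow> moment ((dist_D j ^^ r) T) m = 0"
proof (induction r arbitrary: m)
  case (Suc r)
  note g = good_dist_D_power[OF Suc.prems(1), where j = j and r = r]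
  show ?case
  proof (cases "lkp m j")
    case 0
    then show ?thesis using moment_D_0[OF g] by simp
  next
    case (Suc k)
    have "m = (m - Poly_Mapping.single j 1) + Poly_Mapping.single j 1"
      using Suc by (intro poly_mapping_eqI) (auto simp: lookup_add lookup_minus lookup_single when_def)
    then have "moment (dist_D j ((dist_D j ^^ r) T)) m = moment ((dist_D j ^^ r) T) (m - Poly_Mapping.single j 1)"
      using moment_D_Suc[OF g, of j "m - Poly_Mapping.single j 1"] by simp
    also have "\<dots> = 0"
      using Suc Suc.prems by (intro Suc.IH) (auto simp: lookup_minus lookup_single)
    finally show ?thesis by simp
  qed
qed simp

abbreviation Dk :: "('n \<Rightarrow>\<^sub>0 nat) \<Rightarrow> 'n list \<Rightarrow> 'n functional \<Rightarrow> 'n functional" where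
  "Dk k js \<equiv> fold (\<lambda>j. dist_D j ^^ lkp k j) js"

lemma lookup_sum_single: "lkp (\<Sum>j\<in>set js. Poly_Mapping.single j (lkp k j)) i = (if i \<in> set js then lkp k i else 0)"
  by (simp add: lookup_sum lookup_single when_def sum.delta)

text \<open>The sum over \<open>set js\<close> is the shift caused by the operators applied so far;
  for a full enumeration of the variables it is \<open>k\<close> itself.\<close>

lemma moment_fold:
  "distinct js \<Longrightarrow> good T \<Longrightarrow> moment (Dk k js T) (m + (\<Sum>j\<in>set js. Poly_Mapping.single j (lkp k j))) = moment T m"
proof (induction js arbitrary: T m)
  case (Cons j js)
  have "moment (Dk k js ((dist_D j ^^ lkp k j) T)) ((m + Poly_Mapping.single j (lkp k j)) + (\<Sum>j\<in>set js. Poly_Mapping.single j (lkp k j)))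
    = moment ((dist_D j ^^ lkp k j) T) (m + Poly_Mapping.single j (lkp k j))"
    using Cons.prems by (intro Cons.IH good_dist_D_power) auto
  then show ?case using Cons.prems by (simp add: add.assoc moment_D_power)
qed simp

lemma moment_fold_0:
  "distinct js \<Longrightarrow> good T \<Longrightarrow> \<exists>j\<in>set js. lkp m j < lkp k j \<Longrightarrow> moment (Dk k js T) m = 0"
proof (induction js arbitrary: T)
  case (Cons j js)
  note g = good_dist_D_power[OF Cons.prems(2), where j = j and r = "lkp k j"]
  show ?case
  proof (cases "\<exists>i\<in>set js. lkp m i < lkp k i")
    case True
    then show ?thesis using Cons.IH[OF _ g] Cons.prems by simp
  next
    case False
    then have j: "lkp m j < lkp k j" using Cons.prems by auto
    let ?s = "\<Sum>j\<in>set js. Poly_Mapping.single j (lkp k j)"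
    have "m = (m - ?s) + ?s"
      using False by (intro poly_mapping_eqI) (auto simp: lookup_add lookup_minus lookup_sum_single)
    then have "moment (Dk k js ((dist_D j ^^ lkp k j) T)) m = moment ((dist_D j ^^ lkp k j) T) (m - ?s)"
      using moment_fold[OF _ g, of js k "m - ?s"] Cons.prems by simp
    also have "\<dots> = 0"
      using j Cons.prems by (intro moment_D_power_0) (auto simp: lookup_minus lookup_sum_single)
    finally show ?thesis by simp
  qed
qed simp

end

lemma some_enum: "distinct (SOME js. distinct js \<and> set js = (UNIV :: 'n::finite set)) \<and>
    set (SOME js. distinct js \<and> set js = (UNIV :: 'n set)) = UNIV"
proof -
  have "\<exists>js. distinct js \<and> set js = (UNIV :: 'n set)" using finite_distinct_list[of "UNIV :: 'n set"] by auto
  then show ?thesis by (rule someI_ex)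
qed

context moment_setting
begin

lemma moment_monomial:
  assumes T: "good T"
  shows "moment (dist_D_monomial k T) (m + k) = moment T m"
    and "\<not> (\<forall>j. lkp k j \<le> lkp m j) \<Longrightarrow> moment (dist_D_monomial k T) m = 0"
proof -
  define js where "js = (SOME js. distinct js \<and> set js = (UNIV :: 'n set))"
  have js: "distinct js" "set js = UNIV" unfolding js_def using some_enum by auto
  have D: "dist_D_monomial k T = Dk k js T" by (simp add: dist_D_monomial_def js_def)
  have k: "(\<Sum>j\<in>set js. Poly_Mapping.single j (lkp k j)) = k"
    by (rule poly_mapping_eqI) (simp only: lookup_sum_single, simp add: js)
  show "moment (dist_D_monomial k T) (m + k) = moment T m"
    using moment_fold[OF js(1) T, of k m] by (simp only: D k)
  show "moment (dist_D_monomial k T) m = 0" if "\<not> (\<forall>j. lkp k j \<le> lkp m j)"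
    unfolding D using that js by (intro moment_fold_0 T) (auto simp: not_le)
qed

text \<open>The generating series is infinite, so the lightest terms are compared. At
  \<open>m0 + k0\<close> every key other than \<open>k0\<close> is heavier and would have to meet a
  moment lighter than \<open>m0\<close>, which is zero; the product of the two lightest coefficients
  remains.\<close>

lemma moments_zero:
  assumes T: "good T" and a: "a \<noteq> 0" and 0: "\<And>\<phi>. \<phi> \<in> test_functions \<Longrightarrow> dist_apply a T \<phi> = 0"
  shows "moment T m = 0"
proof (rule ccontr)
  assume "moment T m \<noteq> 0"
  obtain w :: "'n \<Rightarrow> nat" where w: "inj_on (weight w) (pkeys a)"
    by (rule ex_weight[of "pkeys a" undefined]) auto
  obtain m0 where m0: "moment T m0 \<noteq> 0" "\<And>m. moment T m \<noteq> 0 \<Longrightarrow> weight w m0 \<le> weight w m"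
    using ex_has_least_nat[of "\<lambda>m. moment T m \<noteq> 0" m "weight w"] \<open>moment T m \<noteq> 0\<close> by blast
  have "pkeys a \<noteq> {}" using a by simp
  then obtain k0 where k0: "k0 \<in> pkeys a" "\<And>k. k \<in> pkeys a \<Longrightarrow> weight w k0 \<le> weight w k"
    using ex_has_least_nat[of "\<lambda>k. k \<in> pkeys a" _ "weight w"] by blast
  have "moment (dist_apply a T) (m0 + k0) = (\<Sum>k\<in>pkeys a. lkp a k * moment (dist_D_monomial k T) (m0 + k0))"
    by (simp add: moment_def dist_apply_def sum_distrib_left mult_ac)
  also have "\<dots> = (\<Sum>k\<in>pkeys a. if k = k0 then lkp a k0 * moment T m0 else 0)"
  proof (rule sum.cong[OF refl])
    fix k assume k: "k \<in> pkeys a"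
    show "lkp a k * moment (dist_D_monomial k T) (m0 + k0) = (if k = k0 then lkp a k0 * moment T m0 else 0)"
    proof (cases "k = k0")
      case True
      then show ?thesis using moment_monomial(1)[OF T, of k0 m0] by simp
    next
      case False
      then have less: "weight w k0 < weight w k" using w k k0 by (metis inj_onD le_neq_implies_less)
      have "moment (dist_D_monomial k T) (m0 + k0) = 0"
      proof (cases "\<forall>j. lkp k j \<le> lkp (m0 + k0) j")
        case True
        then have m: "m0 + k0 = (m0 + k0 - k) + k"
          by (intro poly_mapping_eqI) (simp add: lookup_add lookup_minus)
        have "weight w (m0 + k0 - k) + weight w k = weight w m0 + weight w k0"
          using arg_cong[OF m, of "weight w"] by (simp add: weight_add)
        then have "\<not> weight w m0 \<le> weight w (m0 + k0 - k)" using less by linarith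
        then have "moment T (m0 + k0 - k) = 0" using m0(2) by blast
        then show ?thesis using moment_monomial(1)[OF T, of k "m0 + k0 - k"] m by simp
      next
        case False
        then show ?thesis by (rule moment_monomial(2)[OF T])
      qed
      then show ?thesis using False by simp
    qed
  qed
  also have "\<dots> = lkp a k0 * moment T m0" using k0(1) by (simp add: sum.delta)
  finally have "moment (dist_apply a T) (m0 + k0) \<noteq> 0" using k0(1) m0(1) by (simp add: in_keys_iff)
  moreover have "moment (dist_apply a T) (m0 + k0) = 0"
    by (simp add: moment_def 0[OF test_mult[OF smooth_mono_fun \<chi>]])
  ultimately show False by simp
qed

end

theorem compactly_supported_solution_zero:
  fixes T :: "'n::finite functional"
  assumes T: "T \<in> distributions" and V: "bounded V" "- V \<subseteq> W" and W: "vanishes_on W T"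
    and a: "a \<noteq> 0" "\<And>\<phi>. \<phi> \<in> test_functions \<Longrightarrow> dist_apply a T \<phi> = 0" and \<phi>: "\<phi> \<in> test_functions"
  shows "T \<phi> = 0"
proof -
  obtain R0 where R0: "R0 > 0" "V \<subseteq> cube R0" by (rule bounded_subset_cube[OF V(1)])
  obtain \<chi> :: "real ^ 'n \<Rightarrow> complex" where \<eta>: "smooth \<chi>" "\<And>x. x \<in> cube (R0 + 1) \<Longrightarrow> \<chi> x = 1" "\<And>x. \<chi> x \<noteq> 0 \<Longrightarrow> x \<in> cube (R0 + 1 + 1)"
    by (rule ex_cutoff[of "R0 + 1"]) blast
  have \<chi>t: "\<chi> \<in> test_functions" by (rule test_functionI[OF \<eta>(1) compact_cube \<eta>(3)])
  have outside: "x \<in> W" if "x \<notin> cube R0" for x using R0(2) V(2) that by blast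
  \<comment> \<open>\<open>\<chi>\<close> is constant on this open cube, so its derivatives are
    supported in the complement, which misses \<open>cube R0\<close>.\<close>
  let ?O = "{x :: real ^ 'n. \<forall>i. \<bar>vec_nth x i\<bar> < R0 + 1}"
  have O: "open ?O"
  proof -
    have "?O = (\<Inter>i. {x. \<bar>vec_nth x i\<bar> < R0 + 1})" by auto
    moreover have "open (\<Inter>i\<in>UNIV. {x :: real ^ 'n. \<bar>vec_nth x i\<bar> < R0 + 1})"
      by (intro open_INT) (auto intro!: open_Collect_less continuous_intros)
    ultimately show ?thesis by simp
  qed
  have "supp (partial j \<chi>) \<subseteq> W" for j
  proof -
    have "supp (partial j \<chi>) \<subseteq> - ?O"
    proof (rule supp_subsetI)
      show "closed (- ?O)" using O by (simp add: closed_def)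
      fix x assume "partial j \<chi> x \<noteq> 0"
      show "x \<in> - ?O"
      proof
        assume x: "x \<in> ?O"
        have "eventually (\<lambda>y. y \<in> ?O) (nhds x)" by (rule eventually_nhds_in_open[OF O x])
        then have "eventually (\<lambda>y. \<chi> y = 1) (nhds x)"
          by (rule eventually_mono) (auto intro!: \<eta>(2) simp: cube_def less_imp_le)
        then have "partial j \<chi> x = partial j (\<lambda>_. 1) x" by (rule partial_cong_near)
        then show False using \<open>partial j \<chi> x \<noteq> 0\<close> by simp
      qed
    qed
    also have "- ?O \<subseteq> W"
    proof
      fix x assume "x \<in> - ?O"
      then obtain i where "\<not> \<bar>vec_nth x i\<bar> < R0 + 1" by auto
      then have "\<not> \<bar>vec_nth x i\<bar> \<le> R0" by simp
      then have "x \<notin> cube R0" by (auto simp: cube_def)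
      then show "x \<in> W" by (rule outside)
    qed
    finally show ?thesis .
  qed
  then interpret moment_setting W \<chi> by unfold_locales (rule \<chi>t)
  have "moment T m = 0" for m
    using moments_zero[OF _ a] W distribution_linear[OF T] by (simp add: good_def)
  then have "T (\<lambda>x. mono_fun m x * \<chi> x) = 0" for m using moment_factor_nonzero[of m] unfolding moment_def by (metis mult_eq_0_iff)
  then show ?thesis
    using distribution_zero_if_moments_zero[OF T W outside R0(1) _ \<eta> _ \<phi>] by simp
qed

subsection \<open>Exponential solutions\<close>

lemma fold_ident: "(\<And>i x. i \<in> set js \<Longrightarrow> f i x = x) \<Longrightarrow> fold f js T = T"
  by (induction js) auto

lemma dist_apply_PC: "dist_apply (PC c) T = (\<lambda>\<phi>. c * T \<phi>)"
proof (cases "c = 0")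
  case False
  have "dist_D_monomial 0 T = T" unfolding dist_D_monomial_def by (rule fold_ident) simp
  then show ?thesis using False by (simp add: dist_apply_def PC_def)
qed (simp add: dist_apply_def)

lemma dist_apply_PX: "dist_apply (PX j) T = dist_D j T"
proof -
  define js where "js = (SOME js. distinct js \<and> set js = (UNIV :: 'a set))"
  have js: "distinct js" "set js = UNIV" unfolding js_def using some_enum by auto
  let ?f = "\<lambda>i. dist_D i ^^ lkp (Poly_Mapping.single j 1) i"
  obtain xs ys where s: "js = xs @ j # ys" using js(2) by (metis UNIV_I split_list)
  have f: "?f i U = U" if "i \<noteq> j" for i U using that by (simp add: lookup_single_not_eq)
  have "fold ?f xs U = U" for U using s js(1) by (intro fold_ident f) auto
  moreover have "fold ?f ys U = U" for U using s js(1) by (intro fold_ident f) auto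
  ultimately have "fold ?f js T = dist_D j T" by (simp add: s)
  then have "dist_D_monomial (Poly_Mapping.single j 1) T = dist_D j T" by (simp only: dist_D_monomial_def js_def)
  then show ?thesis by (simp add: dist_apply_def PX_def)
qed

section \<open>Translations of distributions\<close>

definition translate :: "'n::finite \<Rightarrow> real \<Rightarrow> (real ^ 'n \<Rightarrow> complex) \<Rightarrow> real ^ 'n \<Rightarrow> complex" where
  "translate j t \<phi> x = \<phi> (x - t *\<^sub>R axis j 1)"

lemma translate_has_derivative:
  "(\<phi> has_derivative D) (at (x - t *\<^sub>R axis j 1)) \<Longrightarrow> (translate j t \<phi> has_derivative D) (at x)"
proof -
  assume D: "(\<phi> has_derivative D) (at (x - t *\<^sub>R axis j 1))"
  have "((\<lambda>x. x - t *\<^sub>R axis j 1) has_derivative (\<lambda>v. v - 0)) (at x)"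
    by (intro has_derivative_diff has_derivative_ident has_derivative_const)
  from has_derivative_compose[OF this D] show ?thesis by (simp add: translate_def[abs_def])
qed

lemma partial_translate:
  assumes "\<And>x. \<phi> differentiable (at x)"
  shows "partial i (translate j t \<phi>) = translate j t (partial i \<phi>)"
proof
  fix x
  obtain D where "(\<phi> has_derivative D) (at (x - t *\<^sub>R axis j 1))" using assms unfolding differentiable_def by blast
  then show "partial i (translate j t \<phi>) x = translate j t (partial i \<phi>) x"
    using partial_eq[OF translate_has_derivative] by (simp add: translate_def partial_eq)
qed

lemma CN_translate: "CN N \<phi> \<Longrightarrow> CN N (translate j t \<phi>)"
proof (induction N arbitrary: \<phi>)
  case 0
  then show ?case using translate_has_derivative unfolding CN.simps differentiable_def by blast
next
  case (Suc N)
  then have "translate j t \<phi> differentiable (at x)" for x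
    using translate_has_derivative unfolding CN.simps differentiable_def by blast
  moreover have "CN N (partial i (translate j t \<phi>))" for i
    using Suc by (subst partial_translate) auto
  ultimately show ?case by simp
qed

lemma smooth_translate: "smooth \<phi> \<Longrightarrow> smooth (translate j t \<phi>)"
  by (simp add: smooth_iff_CN CN_translate)

lemma fold_partial_translate: "smooth \<phi> \<Longrightarrow> fold partial js (translate j t \<phi>) = translate j t (fold partial js \<phi>)"
  by (induction js arbitrary: \<phi>) (auto simp: partial_translate smooth_differentiable smooth_partial)

lemma test_translate:
  assumes "\<phi> \<in> test_functions"
  shows "translate j t \<phi> \<in> test_functions"
proof (rule test_functionI)
  show "smooth (translate j t \<phi>)" by (rule smooth_translate[OF test_functionD(1)[OF assms]])
  show "compact ((\<lambda>x. x + t *\<^sub>R axis j 1) ` supp \<phi>)"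
    using test_functionD(2)[OF assms] by (intro compact_continuous_image continuous_intros)
  show "x \<in> (\<lambda>x. x + t *\<^sub>R axis j 1) ` supp \<phi>" if "translate j t \<phi> x \<noteq> 0" for x
    using that not_in_supp[of "x - t *\<^sub>R axis j 1" \<phi>]
    by (intro image_eqI[of _ _ "x - t *\<^sub>R axis j 1"]) (auto simp: translate_def)
qed

lemma translate_translate: "translate j s (translate j t \<phi>) = translate j (s + t) \<phi>"
  by (auto simp: translate_def algebra_simps)

text \<open>Subtracting a multiple of the \<open>j\<close>-th coordinate makes the derivative vanish
  at \<open>x\<close>; two mean value estimates then give the quadratic bound, without the factor
  one half.\<close>

lemma norm_second_order_remainder:
  fixes g :: "real ^ 'n::finite \<Rightarrow> complex"
  assumes g: "smooth g" and M: "\<And>x. norm (partial j (partial j g) x) \<le> M"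
  shows "norm (g (x + b *\<^sub>R axis j 1) - g x - complex_of_real b * partial j g x) \<le> M * \<bar>b\<bar> * \<bar>b\<bar>"
proof -
  have M0: "M \<ge> 0" using M[of x] norm_ge_zero order_trans by blast
  define c where "c = partial j g x"
  define k where "k y = complex_of_real (vec_nth y j)" for y :: "real ^ 'n"
  have k: "smooth k" unfolding k_def using smooth_coordinate[OF C1_ident, of j] by simp
  have pk: "partial j k y = 1" for y
    by (simp add: k_def[abs_def] axis_def partial_eq[OF coordinate_has_derivative[OF DERIV_ident]])
  define h where "h y = g y - c * k y" for y
  have h: "smooth h" unfolding h_def by (intro smooth_diff smooth_cmult g k)
  have ph: "partial j h y = partial j g y - c" for y
    unfolding h_def by (simp add: partial_diff_smooth[OF g smooth_cmult[OF k]] partial_cmult_smooth[OF k] pk)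
  have "norm (h (x + b *\<^sub>R axis j 1) - h (x + 0 *\<^sub>R axis j 1)) \<le> (M * \<bar>b\<bar>) * \<bar>b - 0\<bar>"
  proof (rule norm_line_diff_le)
    fix s assume "s \<in> closed_segment 0 b"
    then have s: "\<bar>s\<bar> \<le> \<bar>b\<bar>" by (auto simp: closed_segment_eq_real_ivl split: if_splits)
    show "h differentiable (at (x + s *\<^sub>R axis j 1))" by (rule smooth_differentiable[OF h])
    have "norm (partial j g (x + s *\<^sub>R axis j 1) - partial j g (x + 0 *\<^sub>R axis j 1)) \<le> M * \<bar>s - 0\<bar>"
      by (rule norm_line_diff_le) (auto intro: smooth_differentiable smooth_partial g M)
    also have "\<dots> \<le> M * \<bar>b\<bar>" using s M0 by (intro mult_left_mono) auto
    finally show "norm (partial j h (x + s *\<^sub>R axis j 1)) \<le> M * \<bar>b\<bar>" by (simp add: ph c_def)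
  qed
  moreover have "h (x + b *\<^sub>R axis j 1) - h (x + 0 *\<^sub>R axis j 1) = g (x + b *\<^sub>R axis j 1) - g x - complex_of_real b * c"
    by (simp add: h_def k_def axis_def algebra_simps)
  ultimately show ?thesis by (simp add: c_def)
qed

text \<open>The quadratic remainder is uniform over all derivatives of order at most
  \<open>N\<close>, so the continuity estimate turns it into a quadratic remainder for the values of
  \<open>T\<close>.\<close>

lemma distribution_translate_derivative:
  fixes T :: "'n::finite functional"
  assumes T: "T \<in> distributions" and \<phi>: "\<phi> \<in> test_functions"
  shows "((\<lambda>t. T (translate j t \<phi>)) has_vector_derivative - T (partial j (translate j t \<phi>))) (at t)"
proof -
  define \<psi> where "\<psi> = translate j t \<phi>"
  have \<psi>: "\<psi> \<in> test_functions" unfolding \<psi>_def by (rule test_translate[OF \<phi>])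
  note \<psi>s = test_functionD(1)[OF \<psi>] and lin = distribution_linear[OF T]
  \<comment> \<open>The set swept by the support under translations of length at most
    \<open>1\<close>: one compact set for all remainders.\<close>
  define K where "K = (\<lambda>(x, s). x + s *\<^sub>R axis j (1::real)) ` (supp \<psi> \<times> {-1..1})"
  have K: "compact K" unfolding K_def
    by (intro compact_continuous_image compact_Times test_functionD(2)[OF \<psi>] compact_Icc)
       (auto intro!: continuous_intros simp: split_beta)
  obtain N C where C: "C \<ge> 0" "\<And>\<phi> E. \<phi> \<in> test_functions \<Longrightarrow> supp \<phi> \<subseteq> K \<Longrightarrow>
      (\<And>js x. length js \<le> N \<Longrightarrow> norm (fold partial js \<phi> x) \<le> E) \<Longrightarrow> norm (T \<phi>) \<le> C * E"
    by (rule distribution_bound[OF T K]) blast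
  \<comment> \<open>Two derivatives beyond \<open>N\<close>, for the second order remainder.\<close>
  obtain M where M: "M \<ge> 0" "\<And>js x. length js \<le> N + 2 \<Longrightarrow> norm (fold partial js \<psi> x) \<le> M"
    by (rule test_bounded_upto[OF \<psi>, of "N + 2"]) blast
  have est: "norm (T (translate j h \<psi>) - T \<psi> - h *\<^sub>R (- T (partial j \<psi>))) \<le> C * (M * \<bar>h\<bar> * \<bar>h\<bar>)" if h: "\<bar>h\<bar> \<le> 1" for h
  proof -
    define r where "r x = (translate j h \<psi> x - \<psi> x) + complex_of_real h * partial j \<psi> x" for x
    have tt: "translate j h \<psi> \<in> test_functions" by (rule test_translate[OF \<psi>])
    have tn: "(\<lambda>x. (- 1) * \<psi> x) \<in> test_functions" by (rule test_cmult[OF \<psi>])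
    have td: "(\<lambda>x. translate j h \<psi> x - \<psi> x) \<in> test_functions" using test_add[OF tt tn] by simp
    have tp: "(\<lambda>x. complex_of_real h * partial j \<psi> x) \<in> test_functions" by (rule test_cmult[OF test_partial[OF \<psi>]])
    have rt: "r \<in> test_functions" unfolding r_def by (rule test_add[OF td tp])
    have "T r = T (translate j h \<psi>) - T \<psi> + complex_of_real h * T (partial j \<psi>)"
      unfolding r_def linear_on_testsD(1)[OF lin td tp] linear_on_tests_diff[OF lin tt \<psi>] linear_on_testsD(2)[OF lin test_partial[OF \<psi>]] ..
    then have "T (translate j h \<psi>) - T \<psi> - h *\<^sub>R (- T (partial j \<psi>)) = T r" by (simp add: scaleR_conv_of_real)
    moreover have "norm (T r) \<le> C * (M * \<bar>h\<bar> * \<bar>h\<bar>)"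
    proof (rule C(2)[OF rt])
      show "supp r \<subseteq> K"
      proof (rule supp_subsetI[OF compact_imp_closed[OF K]])
        fix x assume "r x \<noteq> 0"
        then have "x - h *\<^sub>R axis j 1 \<in> supp \<psi> \<or> x \<in> supp \<psi>"
          using fold_partial_eq_0_outside[of x \<psi> "[j]"] not_in_supp[of x \<psi>] not_in_supp[of "x - h *\<^sub>R axis j 1" \<psi>]
          unfolding r_def translate_def by fastforce
        then show "x \<in> K"
        proof
          assume "x - h *\<^sub>R axis j 1 \<in> supp \<psi>"
          then show ?thesis unfolding K_def using h by (intro image_eqI[of _ _ "(x - h *\<^sub>R axis j 1, h)"]) auto
        next
          assume "x \<in> supp \<psi>"
          then show ?thesis unfolding K_def by (intro image_eqI[of _ _ "(x, 0)"]) auto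
        qed
      qed
      fix js :: "'n list" and x assume js: "length js \<le> N"
      let ?g = "fold partial js \<psi>"
      have g: "smooth ?g" by (rule smooth_fold[OF \<psi>s])
      have "fold partial js r x = translate j h ?g x - ?g x + complex_of_real h * partial j ?g x"
        unfolding r_def
        by (simp add: fold_partial_add fold_partial_diff fold_partial_cmult smooth_diff smooth_cmult smooth_translate smooth_partial \<psi>s
            fold_partial_translate fold_partial_commute)
      also have "\<dots> = ?g (x + (- h) *\<^sub>R axis j 1) - ?g x - complex_of_real (- h) * partial j ?g x"
        by (simp add: translate_def)
      also have "norm \<dots> \<le> M * \<bar>- h\<bar> * \<bar>- h\<bar>"
      proof (rule norm_second_order_remainder[OF g])
        show "norm (partial j (partial j ?g) x) \<le> M" for x
          using M(2)[of "js @ [j, j]" x] js by simp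
      qed
      finally show "norm (fold partial js r x) \<le> M * \<bar>h\<bar> * \<bar>h\<bar>" by simp
    qed
    ultimately show ?thesis by simp
  qed
  have "((\<lambda>s. T (translate j s \<phi>)) has_derivative (\<lambda>h. h *\<^sub>R (- T (partial j \<psi>)))) (at t within UNIV)"
  proof (rule has_derivativeI_sandwich[of 1 _ _ _ _ "\<lambda>s. C * M * \<bar>s - t\<bar>"])
    show "bounded_linear (\<lambda>h. h *\<^sub>R (- T (partial j \<psi>)))" by (rule bounded_linear_scaleR_left)
    have "((\<lambda>s. C * M * \<bar>s - t\<bar>) \<longlongrightarrow> C * M * \<bar>t - t\<bar>) (at t within UNIV)" by (intro tendsto_intros)
    then show "((\<lambda>s. C * M * \<bar>s - t\<bar>) \<longlongrightarrow> 0) (at t within UNIV)" by simp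
    fix s assume s: "s \<noteq> t" "dist s t < 1"
    have "translate j s \<phi> = translate j (s - t) \<psi>" by (simp add: \<psi>_def translate_translate)
    then have "norm (T (translate j s \<phi>) - T (translate j t \<phi>) - (s - t) *\<^sub>R (- T (partial j \<psi>))) \<le> C * (M * \<bar>s - t\<bar> * \<bar>s - t\<bar>)"
      using est[of "s - t"] s(2) by (simp add: \<psi>_def dist_real_def)
    then show "norm (T (translate j s \<phi>) - T (translate j t \<phi>) - (s - t) *\<^sub>R (- T (partial j \<psi>))) / norm (s - t) \<le> C * M * \<bar>s - t\<bar>"
      using s(1) by (simp add: pos_divide_le_eq mult_ac)
  qed simp
  then show ?thesis by (simp add: has_vector_derivative_def \<psi>_def)
qed

text \<open>As a function of the translation, the value of \<open>T\<close> solves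
  \<open>y' = \<i> * z * y\<close>. It is a multiple of an exponential, so a zero at one time forces
  a zero at time \<open>0\<close>.\<close>

lemma exponential_translate_zero:
  fixes T :: "'n::finite functional"
  assumes T: "T \<in> distributions" and z: "\<And>\<phi>. \<phi> \<in> test_functions \<Longrightarrow> dist_D j T \<phi> = z * T \<phi>"
    and \<phi>: "\<phi> \<in> test_functions" and t: "T (translate j t \<phi>) = 0"
  shows "T \<phi> = 0"
proof -
  let ?G = "\<lambda>s. T (translate j s \<phi>)"
  let ?E = "\<lambda>s :: real. exp (- (\<i> * z * complex_of_real s))"
  have D: "- T (partial j \<psi>) = \<i> * z * T \<psi>" if "\<psi> \<in> test_functions" for \<psi>
  proof -
    have "\<i> * T (partial j \<psi>) = z * T \<psi>" using z[OF that] dist_D_test[OF that, of j T] by simp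
    then have "\<i> * (\<i> * T (partial j \<psi>)) = \<i> * (z * T \<psi>)" by simp
    then show ?thesis by simp
  qed
  have "((\<lambda>s. ?E s * ?G s) has_vector_derivative 0) (at s within UNIV)" for s
  proof -
    have E: "(?E has_vector_derivative - (\<i> * z) * ?E s) (at s)"
      by (rule has_vector_derivative_real_field) (auto intro!: derivative_eq_intros)
    have G: "(?G has_vector_derivative \<i> * z * ?G s) (at s)"
      using distribution_translate_derivative[OF T \<phi>, of j s] by (simp add: D test_translate[OF \<phi>])
    from has_vector_derivative_mult[OF E G] show ?thesis by (simp add: algebra_simps)
  qed
  then obtain c where c: "\<And>s. ?E s * ?G s = c"
    by (rule has_vector_derivative_zero_constant[OF convex_UNIV]) auto
  have "c = 0" using c[of t] t by simp
  moreover have "translate j 0 \<phi> = \<phi>" by (simp add: translate_def[abs_def])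
  ultimately show ?thesis using c[of 0] by simp
qed

text \<open>\<open>T\<close> is never identified with a function. A test function is cut by smooth
  steps into slabs, one coordinate at a time; each slab can be translated into a box around
  \<open>p\<close> inside \<open>W\<close>, and zeros of \<open>T\<close> travel back along
  translations.\<close>

theorem exponential_vanishing_on_open:
  fixes T :: "'n::finite functional"
  assumes T: "T \<in> distributions" and z: "\<And>j \<phi>. \<phi> \<in> test_functions \<Longrightarrow> dist_D j T \<phi> = z j * T \<phi>"
    and W: "open W" "p \<in> W" "vanishes_on W T" and \<phi>: "\<phi> \<in> test_functions"
  shows "T \<phi> = 0"
proof -
  obtain r where r: "r > 0" "ball p r \<subseteq> W" using W(1,2) open_contains_ball by blast
  \<comment> \<open>Within the box the sum of the \<open>n\<close> coordinate distances is at most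
    \<open>r / 2\<close>, so the box lies in the ball.\<close>
  define \<delta> where "\<delta> = r / (2 * real CARD('n))"
  have \<delta>: "\<delta> > 0" using r by (simp add: \<delta>_def)
  have box: "x \<in> W" if "\<And>i. \<bar>vec_nth x i - vec_nth p i\<bar> \<le> \<delta>" for x
  proof -
    have "norm (x - p) \<le> (\<Sum>i\<in>UNIV. \<bar>vec_nth (x - p) i\<bar>)" by (rule norm_le_l1_cart)
    also have "\<dots> \<le> (\<Sum>i\<in>(UNIV :: 'n set). \<delta>)" using that by (intro sum_mono) simp
    also have "\<dots> = r / 2" by (simp add: \<delta>_def)
    also have "\<dots> < r" using r by simp
    finally show ?thesis using r(2) by (auto simp: dist_norm norm_minus_commute subset_iff)
  qed
  note lin = distribution_linear[OF T]
  obtain h where h: "\<And>N. C1 N h" "\<And>t. t \<le> 0 \<Longrightarrow> h t = 0" "\<And>t. t \<ge> 1 \<Longrightarrow> h t = 1"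
    by (rule ex_smooth_step) blast
  \<comment> \<open>Coordinates in \<open>S\<close> are free and the others confined to the box; the
    induction releases one coordinate at a time.\<close>
  define near where "near S \<phi> \<longleftrightarrow> (\<forall>x i. \<phi> x \<noteq> 0 \<longrightarrow> i \<notin> S \<longrightarrow> \<bar>vec_nth x i - vec_nth p i\<bar> \<le> \<delta>)" for S and \<phi> :: "real ^ 'n \<Rightarrow> complex"
  have claim: "finite S \<Longrightarrow> \<phi> \<in> test_functions \<Longrightarrow> near S \<phi> \<Longrightarrow> T \<phi> = 0" for S \<phi>
  proof (induction S arbitrary: \<phi> rule: finite_induct)
    case empty
    have "supp \<phi> \<subseteq> {x. \<forall>i. \<bar>vec_nth x i - vec_nth p i\<bar> \<le> \<delta>}"
    proof (rule supp_subsetI)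
      have "{x :: real ^ 'n. \<forall>i. \<bar>vec_nth x i - vec_nth p i\<bar> \<le> \<delta>} = (\<Inter>i. {x. \<bar>vec_nth x i - vec_nth p i\<bar> \<le> \<delta>})" by auto
      moreover have "closed (\<Inter>i. {x :: real ^ 'n. \<bar>vec_nth x i - vec_nth p i\<bar> \<le> \<delta>})"
        by (intro closed_INT) (auto intro!: closed_Collect_le continuous_intros)
      ultimately show "closed {x :: real ^ 'n. \<forall>i. \<bar>vec_nth x i - vec_nth p i\<bar> \<le> \<delta>}" by simp
    qed (use empty(2) in \<open>auto simp: near_def\<close>)
    then have "supp \<phi> \<subseteq> W" using box by blast
    then show ?case using W(3) empty(1) by (simp add: vanishes_on_def)
  next
    case (insert j S)
    have short: "T \<psi> = 0" if \<psi>: "\<psi> \<in> test_functions" "near (insert j S) \<psi>"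
      and a: "\<And>x. \<psi> x \<noteq> 0 \<Longrightarrow> a \<le> vec_nth x j \<and> vec_nth x j \<le> a + 2 * \<delta>" for a \<psi>
    proof -
      define t where "t = vec_nth p j - (a + \<delta>)"
      have "near S (translate j t \<psi>)"
        unfolding near_def
      proof (intro allI impI)
        fix x i assume x: "translate j t \<psi> x \<noteq> 0" and i: "i \<notin> S"
        let ?y = "x - t *\<^sub>R axis j 1"
        have y: "\<psi> ?y \<noteq> 0" using x by (simp add: translate_def)
        show "\<bar>vec_nth x i - vec_nth p i\<bar> \<le> \<delta>"
        proof (cases "i = j")
          case True
          have "vec_nth ?y j = vec_nth x j - t" by (simp add: axis_def)
          then show ?thesis using a[OF y] unfolding True t_def abs_le_iff by linarith
        next
          case False
          then have "vec_nth ?y i = vec_nth x i" by (simp add: axis_def)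
          then show ?thesis using \<psi>(2) y i False unfolding near_def by (metis insert_iff)
        qed
      qed
      then have "T (translate j t \<psi>) = 0" by (rule insert.IH[OF test_translate[OF \<psi>(1)]])
      then show ?thesis using exponential_translate_zero[OF T _ \<psi>(1), of j "z j" t] z by blast
    qed
    have long: "T \<psi> = 0" if \<psi>: "\<psi> \<in> test_functions" "near (insert j S) \<psi>"
      and a: "\<And>x. \<psi> x \<noteq> 0 \<Longrightarrow> a \<le> vec_nth x j \<and> vec_nth x j \<le> a + (real N + 2) * \<delta>" for a N \<psi>
      using \<psi> a
    proof (induction N arbitrary: \<psi>)
      case 0
      then show ?case using short[of \<psi> a] by simp
    next
      case (Suc N)
      \<comment> \<open>The top slab runs from \<open>b\<close> to \<open>b + 2 * \<delta>\<close>,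
        and \<open>\<eta>\<close> rises between \<open>b\<close> and \<open>b + \<delta>\<close>, so
        what is left ends at \<open>b + \<delta>\<close>, shorter by
        \<open>\<delta>\<close>.\<close>
      define b where "b = a + (real N + 1) * \<delta>"
      define \<eta> where "\<eta> x = complex_of_real (h ((1 / \<delta>) * vec_nth x j + (- b / \<delta>)))" for x :: "real ^ 'n"
      have \<eta>: "smooth \<eta>" unfolding \<eta>_def by (intro smooth_coordinate[of "\<lambda>t. h ((1 / \<delta>) * t + (- b / \<delta>))"] C1_affine h(1))
      have \<eta>0: "\<eta> x = 0" if "vec_nth x j \<le> b" for x
        unfolding \<eta>_def using that \<delta> by (subst h(2)) (auto simp: field_simps)
      have \<eta>1: "\<eta> x = 1" if "vec_nth x j \<ge> b + \<delta>" for x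
        unfolding \<eta>_def using that \<delta> by (subst h(3)) (auto simp: field_simps)
      have t1: "(\<lambda>x. \<eta> x * \<psi> x) \<in> test_functions" by (rule test_mult[OF \<eta> Suc.prems(1)])
      have t2: "(\<lambda>x. (1 - \<eta> x) * \<psi> x) \<in> test_functions"
        by (rule test_mult[OF smooth_diff[OF smooth_const \<eta>] Suc.prems(1)])
      have "T (\<lambda>x. \<eta> x * \<psi> x) = 0"
      proof (rule short[OF t1, of b])
        show "near (insert j S) (\<lambda>x. \<eta> x * \<psi> x)" using Suc.prems(2) by (simp add: near_def)
        fix x assume x: "\<eta> x * \<psi> x \<noteq> 0"
        then have "\<not> vec_nth x j \<le> b" using \<eta>0 by auto
        moreover have "vec_nth x j \<le> b + 2 * \<delta>" using Suc.prems(3)[of x] x by (simp add: b_def algebra_simps)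
        ultimately show "b \<le> vec_nth x j \<and> vec_nth x j \<le> b + 2 * \<delta>" by linarith
      qed
      moreover have "T (\<lambda>x. (1 - \<eta> x) * \<psi> x) = 0"
      proof (rule Suc.IH[OF t2])
        show "near (insert j S) (\<lambda>x. (1 - \<eta> x) * \<psi> x)" using Suc.prems(2) by (simp add: near_def)
        fix x assume x: "(1 - \<eta> x) * \<psi> x \<noteq> 0"
        then have "\<not> vec_nth x j \<ge> b + \<delta>" using \<eta>1 by auto
        moreover have "b + \<delta> = a + (real N + 2) * \<delta>" by (simp add: b_def algebra_simps)
        ultimately show "a \<le> vec_nth x j \<and> vec_nth x j \<le> a + (real N + 2) * \<delta>" using Suc.prems(3)[of x] x by simp
      qed
      moreover have "T (\<lambda>x. \<eta> x * \<psi> x + (1 - \<eta> x) * \<psi> x) = T (\<lambda>x. \<eta> x * \<psi> x) + T (\<lambda>x. (1 - \<eta> x) * \<psi> x)"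
        by (rule linear_on_testsD(1)[OF lin t1 t2])
      moreover have "(\<lambda>x. \<eta> x * \<psi> x + (1 - \<eta> x) * \<psi> x) = \<psi>" by (simp add: algebra_simps)
      ultimately show ?case by simp
    qed
    obtain R where R: "R > 0" "supp \<phi> \<subseteq> cube R"
      by (rule bounded_subset_cube[OF compact_imp_bounded[OF test_functionD(2)[OF insert.prems(1)]]])
    obtain N :: nat where N: "2 * R / \<delta> \<le> real N" using real_arch_simple by blast
    show ?case
    proof (rule long[OF insert.prems, of "- R" N])
      fix x assume "\<phi> x \<noteq> 0"
      then have "x \<in> cube R" using not_in_supp[of x \<phi>] R(2) by blast
      then have x: "- R \<le> vec_nth x j" "vec_nth x j \<le> R" by (auto simp: cube_def abs_le_iff minus_le_iff)
      have "2 * R \<le> real N * \<delta>" using N \<delta> by (simp add: field_simps)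
      then have "2 * R \<le> (real N + 2) * \<delta>" using \<delta> by (simp add: algebra_simps)
      then show "- R \<le> vec_nth x j \<and> vec_nth x j \<le> - R + (real N + 2) * \<delta>" using x by linarith
    qed
  qed
  show ?thesis by (rule claim[of UNIV]) (auto simp: near_def \<phi>)
qed

subsection \<open>Presentations of submodules\<close>

lemma submodule_closed:
  assumes "Module.submodule P class_ring (module_vec TYPE('a::comm_ring_1) k)"
  shows "P \<subseteq> carrier_vec k" "0\<^sub>v k \<in> P" "v \<in> P \<Longrightarrow> w \<in> P \<Longrightarrow> v + w \<in> P" "v \<in> P \<Longrightarrow> a \<cdot>\<^sub>v v \<in> P"
proof -
  have g: "subgroup P (add_monoid (module_vec TYPE('a) k))"
    and s: "\<And>a v. a \<in> carrier (class_ring :: 'a ring) \<Longrightarrow> v \<in> P \<Longrightarrow> a \<odot>\<^bsub>module_vec TYPE('a) k\<^esub> v \<in> P"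
    using assms by (auto simp: Module.submodule_def Module.submodule_axioms_def)
  show "P \<subseteq> carrier_vec k" using subgroup.subset[OF g] by (simp add: module_vec_simps)
  show "0\<^sub>v k \<in> P" using subgroup.one_closed[OF g] by (simp add: module_vec_simps)
  show "v \<in> P \<Longrightarrow> w \<in> P \<Longrightarrow> v + w \<in> P" using subgroup.m_closed[OF g] by (simp add: module_vec_simps)
  show "v \<in> P \<Longrightarrow> a \<cdot>\<^sub>v v \<in> P" using s by (simp add: module_vec_simps class_ring_simps)
qed

lemma module_class_vec: "Module.module class_ring (module_vec TYPE('a::comm_ring_1) k)"
proof -
  interpret vec_module "TYPE('a)" k .
  show ?thesis by (rule module_axioms)
qed

context presentation
begin

lemma comb_row: "i < l \<Longrightarrow> comb (\<lambda>j. if j = i then 1 else 0) = row M i"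
  using M by (intro eq_vecI) (auto simp: comb_def sum.delta if_distrib[of "\<lambda>x. x * _"] cong: if_cong)

lemma rel_module_eq_span:
  assumes P: "Module.submodule P class_ring (module_vec TYPE('n mpoly) k)"
    and span: "LinearCombinations.module.span class_ring (module_vec TYPE('n mpoly) k) (set (rows M)) = P"
  shows "rel_module = P"
proof
  note P = submodule_closed[OF P]
  have rows: "set (rows M) \<subseteq> carrier_vec k" using M by (auto simp: rows_def)
  interpret V: Module.module class_ring "module_vec TYPE('n mpoly) k" by (rule module_class_vec)
  have "set (rows M) \<subseteq> P"
    using V.in_own_span[of "set (rows M)"] rows unfolding span by (simp add: module_vec_simps)
  then have row: "row M i \<in> P" if "i < l" for i using M that by (auto simp: rows_def)
  have "vec k (\<lambda>j. \<Sum>i<m. c i * M $$ (i, j)) \<in> P" if "m \<le> l" for m c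
    using that
  proof (induction m)
    case 0
    have "vec k (\<lambda>j. 0) = (0\<^sub>v k :: 'n mpoly Matrix.vec)" by (intro eq_vecI) auto
    then show ?case using P(2) by simp
  next
    case (Suc m)
    have "vec k (\<lambda>j. \<Sum>i<Suc m. c i * M $$ (i, j)) = vec k (\<lambda>j. \<Sum>i<m. c i * M $$ (i, j)) + c m \<cdot>\<^sub>v row M m"
      using M Suc.prems by (intro eq_vecI) auto
    then show ?case using Suc P(3,4) row by simp
  qed
  then show "rel_module \<subseteq> P" by (auto simp: rel_module_def comb_def)
  have "LinearCombinations.submodule class_ring rel_module (module_vec TYPE('n mpoly) k)"
    unfolding LinearCombinations.submodule_def
  proof (intro conjI allI impI)
    show "Module.module class_ring (module_vec TYPE('n mpoly) k)" by (rule module_class_vec)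
    show "rel_module \<subseteq> carrier (module_vec TYPE('n mpoly) k)" by (auto simp: rel_module_def module_vec_simps)
    have "comb (\<lambda>i. 0) = 0\<^sub>v k" by (intro eq_vecI) (auto simp: comb_def)
    then have "0\<^sub>v k \<in> rel_module" unfolding rel_module_def by (metis rangeI)
    then show "\<zero>\<^bsub>module_vec TYPE('n mpoly) k\<^esub> \<in> rel_module" by (simp add: module_vec_simps)
    fix v w assume "v \<in> rel_module" "w \<in> rel_module"
    then show "v \<oplus>\<^bsub>module_vec TYPE('n mpoly) k\<^esub> w \<in> rel_module"
      by (auto simp: rel_module_def module_vec_simps simp flip: comb_hom)
  next
    fix c v assume "v \<in> rel_module"
    then show "c \<odot>\<^bsub>module_vec TYPE('n mpoly) k\<^esub> v \<in> rel_module"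
      by (auto simp: rel_module_def module_vec_simps simp flip: comb_hom)
  qed
  moreover have "set (rows M) \<subseteq> rel_module"
    using M comb_row by (auto simp: rows_def rel_module_def simp flip: comb_row)
  ultimately show "P \<subseteq> rel_module" unfolding span[symmetric] by (intro V.span_is_subset)
qed

end

section \<open>Torsion of the quotient on representatives\<close>

lemma coset_eq_iff:
  assumes P: "Module.submodule P class_ring (module_vec TYPE('a::comm_ring_1) k)" and v: "v \<in> carrier_vec k"
  shows "P +>\<^bsub>module_vec TYPE('a) k\<^esub> v = P \<longleftrightarrow> v \<in> P"
proof
  note Pc = submodule_closed[OF P]
  have c: "P +>\<^bsub>module_vec TYPE('a) k\<^esub> v = (\<lambda>p. p + v) ` P"
    by (auto simp: a_r_coset_def r_coset_def module_vec_simps)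
  show "v \<in> P" if "P +>\<^bsub>module_vec TYPE('a) k\<^esub> v = P"
  proof -
    have "0\<^sub>v k + v \<in> P" using that Pc(2) unfolding c by blast
    then show ?thesis using v by simp
  qed
  assume vP: "v \<in> P"
  have "p \<in> (\<lambda>p. p + v) ` P" if p: "p \<in> P" for p
  proof (rule image_eqI)
    have "p + (- 1) \<cdot>\<^sub>v v + v = p" using v Pc(1) p by (intro eq_vecI) auto
    then show "p = p + (- 1) \<cdot>\<^sub>v v + v" by simp
    show "p + (- 1) \<cdot>\<^sub>v v \<in> P" using Pc(3,4) p vP by blast
  qed
  then show "P +>\<^bsub>module_vec TYPE('a) k\<^esub> v = P" using Pc(3) vP unfolding c by auto
qed

text \<open>Scalars act on a coset by a union over all its representatives; \<open>P\<close> is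
  closed under scalars, so the members of the union coincide.\<close>

lemma torsion_free_quotient_iff:
  assumes P: "Module.submodule P class_ring (module_vec TYPE('a::comm_ring_1) k)"
  shows "torsion_free class_ring (quotient_module class_ring (module_vec TYPE('a) k) P) \<longleftrightarrow>
    (\<forall>a v. a \<noteq> 0 \<and> v \<in> carrier_vec k \<and> a \<cdot>\<^sub>v v \<in> P \<longrightarrow> v \<in> P)"
proof -
  let ?V = "module_vec TYPE('a) k" and ?Q = "quotient_module class_ring (module_vec TYPE('a) k) P"
  note Pc = submodule_closed[OF P]
  have carr: "carrier ?Q = (\<lambda>v. P +>\<^bsub>?V\<^esub> v) ` carrier_vec k"
    by (auto simp: quotient_module_def A_RCOSETS_def RCOSETS_def a_r_coset_def module_vec_simps)
  have coset: "P +>\<^bsub>?V\<^esub> v = (\<lambda>p. p + v) ` P" for v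
    by (auto simp: a_r_coset_def r_coset_def module_vec_simps)
  have smult: "a \<odot>\<^bsub>?Q\<^esub> (P +>\<^bsub>?V\<^esub> v) = P \<longleftrightarrow> a \<cdot>\<^sub>v v \<in> P" if v: "v \<in> carrier_vec k" for a v
  proof -
    have "P +>\<^bsub>?V\<^esub> (a \<cdot>\<^sub>v (p + v)) = P +>\<^bsub>?V\<^esub> (a \<cdot>\<^sub>v v)" if p: "p \<in> P" for p
    proof -
      have pc: "p \<in> carrier_vec k" using p Pc(1) by blast
      have ap: "a \<cdot>\<^sub>v p \<in> P" using Pc(4) p by blast
      have e: "q + a \<cdot>\<^sub>v (p + v) = (q + a \<cdot>\<^sub>v p) + a \<cdot>\<^sub>v v" if "q \<in> P" for q
        using that Pc(1) pc v by (intro eq_vecI) (auto simp: algebra_simps)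
      have e2: "q + a \<cdot>\<^sub>v v = (q + (- 1) \<cdot>\<^sub>v (a \<cdot>\<^sub>v p)) + a \<cdot>\<^sub>v (p + v)" if "q \<in> P" for q
        using that Pc(1) pc v by (intro eq_vecI) (auto simp: algebra_simps)
      show ?thesis unfolding coset
      proof (intro equalityI image_subsetI)
        fix q assume q: "q \<in> P"
        show "q + a \<cdot>\<^sub>v (p + v) \<in> (\<lambda>p. p + a \<cdot>\<^sub>v v) ` P"
          using e[OF q] Pc(3)[OF q ap] by blast
        show "q + a \<cdot>\<^sub>v v \<in> (\<lambda>pa. pa + a \<cdot>\<^sub>v (p + v)) ` P"
          using e2[OF q] Pc(3)[OF q Pc(4)[OF ap]] by blast
      qed
    qed
    then have "a \<odot>\<^bsub>?Q\<^esub> (P +>\<^bsub>?V\<^esub> v) = (\<Union>p\<in>P. P +>\<^bsub>?V\<^esub> (a \<cdot>\<^sub>v v))"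
      unfolding quotient_module_def by (simp add: coset[of v] module_vec_simps)
    also have "\<dots> = P +>\<^bsub>?V\<^esub> (a \<cdot>\<^sub>v v)" using Pc(2) by blast
    finally show ?thesis using coset_eq_iff[OF P, of "a \<cdot>\<^sub>v v"] v by simp
  qed
  have "torsion_free class_ring ?Q \<longleftrightarrow>
      (\<forall>a. \<forall>v\<in>carrier_vec k. a \<odot>\<^bsub>?Q\<^esub> (P +>\<^bsub>?V\<^esub> v) = P \<longrightarrow> a = 0 \<or> P +>\<^bsub>?V\<^esub> v = P)"
    unfolding torsion_free_def carr by (simp add: quotient_module_def class_ring_simps)
  also have "\<dots> \<longleftrightarrow> (\<forall>a. \<forall>v\<in>carrier_vec k. a \<cdot>\<^sub>v v \<in> P \<longrightarrow> a = 0 \<or> v \<in> P)"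
    using smult coset_eq_iff[OF P] by simp
  finally show ?thesis by blast
qed

subsection \<open>Differential operators and restriction of distributions\<close>

text \<open>\<open>eq_near\<close> with the neighbourhood exposed, so that finitely many
  neighbourhoods can be intersected.\<close>

definition agree_on :: "(real ^ 'n::finite) set \<Rightarrow> 'n functional \<Rightarrow> 'n functional \<Rightarrow> bool" where
  "agree_on W S T \<longleftrightarrow> (\<forall>\<phi>\<in>test_functions. supp \<phi> \<subseteq> W \<longrightarrow> S \<phi> = T \<phi>)"

lemma agree_on_dist_D:
  assumes "agree_on W S T"
  shows "agree_on W (dist_D j S) (dist_D j T)"
  unfolding agree_on_def
proof (intro ballI impI)
  fix \<phi> assume \<phi>: "\<phi> \<in> test_functions" "supp \<phi> \<subseteq> W"
  have "supp (partial j \<phi>) \<subseteq> W" by (rule subset_trans[OF supp_partial \<phi>(2)])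
  then have "S (partial j \<phi>) = T (partial j \<phi>)" using assms test_partial[OF \<phi>(1)] by (simp add: agree_on_def)
  then show "dist_D j S \<phi> = dist_D j T \<phi>" by (simp add: dist_D_test[OF \<phi>(1)])
qed

text \<open>Differential operators are local because derivatives do not enlarge supports.\<close>

lemma agree_on_dist_apply:
  assumes "agree_on W S T"
  shows "agree_on W (dist_apply p S) (dist_apply p T)"
proof -
  have pow: "agree_on W ((dist_D j ^^ r) S) ((dist_D j ^^ r) T)" if "agree_on W S T" for j r S T
    using that by (induction r) (auto intro: agree_on_dist_D)
  have "agree_on W (fold (\<lambda>j. dist_D j ^^ lkp m j) js S) (fold (\<lambda>j. dist_D j ^^ lkp m j) js T)"
    if "agree_on W S T" for js m S T
    using that by (induction js arbitrary: S T) (auto intro: pow)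
  then have "agree_on W (dist_D_monomial m S) (dist_D_monomial m T)" for m
    unfolding dist_D_monomial_def using assms by blast
  then show ?thesis by (simp add: agree_on_def dist_apply_def)
qed

lemma agree_on_subset: "agree_on W S T \<Longrightarrow> W' \<subseteq> W \<Longrightarrow> agree_on W' S T"
  by (auto simp: agree_on_def)

lemma eq_near_iff: "eq_near U S T \<longleftrightarrow> (\<exists>W. open W \<and> U \<subseteq> W \<and> agree_on W S T)"
  by (simp add: eq_near_def agree_on_def)

lemma eq_near_vec_iff: "eq_near_vec U f g \<longleftrightarrow>
    (\<exists>W. open W \<and> U \<subseteq> W \<and> dim_vec f = dim_vec g \<and> (\<forall>j<dim_vec f. agree_on W (vec_index f j) (vec_index g j)))"
  by (simp add: eq_near_vec_def agree_on_def)

subsection \<open>Behaviours\<close>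

text \<open>The module axioms for \<open>F\<close> already say that \<open>dist_apply\<close>
  respects sums and products of operators on \<open>F\<close>; these rules are read off from
  them.\<close>

locale behaviour =
  fixes F :: "'n::finite functional set"
  assumes sub: "F \<subseteq> distributions" and mod: "Module.module class_ring (dist_module\<lparr>carrier := F\<rparr>)"
begin

interpretation F: Module.module class_ring "dist_module\<lparr>carrier := F\<rparr>" by (rule mod)

lemma F_zero: "(\<lambda>\<phi>. 0) \<in> F"
  using F.M.zero_closed by (simp add: dist_module_def)

lemma F_add: "S \<in> F \<Longrightarrow> T \<in> F \<Longrightarrow> (\<lambda>\<phi>. S \<phi> + T \<phi>) \<in> F"
  using F.M.a_closed[of S T] by (simp add: dist_module_def)

lemma F_apply: "T \<in> F \<Longrightarrow> dist_apply p T \<in> F"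
  using F.smult_closed[of p T] by (simp add: dist_module_def class_ring_simps)

lemma F_sum: "(\<And>i. i < (m::nat) \<Longrightarrow> T i \<in> F) \<Longrightarrow> (\<lambda>\<phi>. \<Sum>i<m. T i \<phi>) \<in> F"
  by (induction m) (auto intro: F_zero F_add)

lemma apply_add_left: "T \<in> F \<Longrightarrow> dist_apply (p + q) T = (\<lambda>\<phi>. dist_apply p T \<phi> + dist_apply q T \<phi>)"
  using F.smult_l_distr[of p q T] by (simp add: dist_module_def class_ring_simps)

lemma apply_add_right: "S \<in> F \<Longrightarrow> T \<in> F \<Longrightarrow>
    dist_apply p (\<lambda>\<phi>. S \<phi> + T \<phi>) = (\<lambda>\<phi>. dist_apply p S \<phi> + dist_apply p T \<phi>)"
  using F.smult_r_distr[of p S T] by (simp add: dist_module_def class_ring_simps)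

lemma apply_mult: "T \<in> F \<Longrightarrow> dist_apply (p * q) T = dist_apply p (dist_apply q T)"
  using F.smult_assoc1[of p q T] by (simp add: dist_module_def class_ring_simps)

lemma apply_one: "T \<in> F \<Longrightarrow> dist_apply 1 T = T"
  using F.smult_one[of T] by (simp add: dist_module_def class_ring_simps)

lemma apply_0_left [simp]: "dist_apply 0 T = (\<lambda>\<phi>. 0)"
  by (simp add: dist_apply_def)

lemma apply_0_right [simp]: "dist_apply p (\<lambda>\<phi>. 0) = (\<lambda>\<phi>. 0 :: complex)" for p :: "'n mpoly"
  using F.smult_r_null[of p] by (simp add: dist_module_def class_ring_simps)

lemma apply_sum_right: "(\<And>i. i < (m::nat) \<Longrightarrow> T i \<in> F) \<Longrightarrow>
    dist_apply p (\<lambda>\<phi>. \<Sum>i<m. T i \<phi>) = (\<lambda>\<phi>. \<Sum>i<m. dist_apply p (T i) \<phi>)"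
  by (induction m) (simp_all add: apply_add_right F_sum)

text \<open>The row \<open>v(D)\<close> applied to the column \<open>f\<close>. The explicit length
  lets partial sums over fewer than all components be treated in inductions.\<close>

definition act :: "nat \<Rightarrow> 'n mpoly Matrix.vec \<Rightarrow> (nat \<Rightarrow> 'n functional) \<Rightarrow> 'n functional" where
  "act k v f = (\<lambda>\<phi>. \<Sum>j<k. dist_apply (vec_index v j) (f j) \<phi>)"

lemma act_closed: "(\<And>j. j < k \<Longrightarrow> f j \<in> F) \<Longrightarrow> act k v f \<in> F"
  unfolding act_def by (intro F_sum F_apply)

lemma act_add:
  "(\<And>j. j < k \<Longrightarrow> f j \<in> F) \<Longrightarrow> v \<in> carrier_vec k \<Longrightarrow> w \<in> carrier_vec k \<Longrightarrow>
    act k (v + w) f = (\<lambda>\<phi>. act k v f \<phi> + act k w f \<phi>)"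
  by (auto simp: act_def apply_add_left sum.distrib)

lemma act_smult:
  assumes "\<And>j. j < k \<Longrightarrow> f j \<in> F" "v \<in> carrier_vec k"
  shows "act k (a \<cdot>\<^sub>v v) f = dist_apply a (act k v f)"
proof -
  have "dist_apply a (act k v f) = (\<lambda>\<phi>. \<Sum>j<k. dist_apply a (dist_apply (vec_index v j) (f j)) \<phi>)"
    unfolding act_def using assms by (intro apply_sum_right F_apply)
  then show ?thesis using assms by (simp add: act_def apply_mult)
qed

lemma act_zero: "act k (0\<^sub>v k) f = (\<lambda>\<phi>. 0)"
  by (simp add: act_def)

lemma act_unit:
  assumes "\<And>j. j < k \<Longrightarrow> f j \<in> F" "i < k"
  shows "act k (unit_vec k i) f = f i"
proof -
  have "act k (unit_vec k i) f = (\<lambda>\<phi>. \<Sum>j<k. if j = i then f j \<phi> else 0)"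
    unfolding act_def using assms by (intro ext sum.cong) (auto simp: apply_one)
  then show ?thesis using assms(2) by (simp add: sum.delta)
qed

lemma act_agree_on: "(\<And>j. j < k \<Longrightarrow> agree_on W (f j) (g j)) \<Longrightarrow> agree_on W (act k v f) (act k v g)"
  using agree_on_dist_apply[of W] by (fastforce simp: agree_on_def act_def intro!: sum.cong)

lemma Ker_iff: "f \<in> Ker F k P \<longleftrightarrow> f \<in> carrier_vec k \<and> (\<forall>j<k. vec_index f j \<in> F) \<and>
    (\<forall>p\<in>P. act k p (vec_index f) = (\<lambda>\<phi>. 0))"
proof -
  have M: "abelian_monoid (dist_module :: ('n mpoly, 'n functional) module)"
    by (rule abelian_monoidI)
       (auto simp: dist_module_def distributions_add add.assoc add.commute intro: subsetD[OF sub F_zero])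
  have "(\<Oplus>\<^bsub>dist_module\<^esub> j\<in>{..<m}. vec_index p j \<odot>\<^bsub>dist_module\<^esub> vec_index f j) = act m p (vec_index f)"
    if "\<And>j. j < m \<Longrightarrow> vec_index f j \<in> F" for p m
    using that
  proof (induction m)
    case 0
    then show ?case using abelian_monoid.finsum_empty[OF M] by (simp add: act_def dist_module_def)
  next
    case (Suc m)
    have c: "dist_apply (vec_index p j) (vec_index f j) \<in> distributions" if "j < Suc m" for j
      using F_apply[OF Suc.prems[OF that]] sub by blast
    have "(\<Oplus>\<^bsub>dist_module\<^esub> j\<in>insert m {..<m}. vec_index p j \<odot>\<^bsub>dist_module\<^esub> vec_index f j) =
      (vec_index p m \<odot>\<^bsub>dist_module\<^esub> vec_index f m) \<oplus>\<^bsub>dist_module\<^esub>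
      (\<Oplus>\<^bsub>dist_module\<^esub> j\<in>{..<m}. vec_index p j \<odot>\<^bsub>dist_module\<^esub> vec_index f j)"
      by (rule abelian_monoid.finsum_insert[OF M]) (auto simp: dist_module_def intro!: c)
    then show ?case
      using Suc by (simp add: lessThan_Suc act_def dist_module_def add.commute)
  qed
  then have "(\<forall>j<k. vec_index f j \<in> F) \<Longrightarrow>
    (\<Oplus>\<^bsub>dist_module\<^esub> j\<in>{..<k}. vec_index p j \<odot>\<^bsub>dist_module\<^esub> vec_index f j) = act k p (vec_index f)" for p
    by blast
  then show ?thesis by (auto simp: Ker_def dist_module_def)
qed

end

section \<open>Image representations and controllability\<close>

lemma mult_mat_vec_smult:
  fixes A :: "'a::comm_ring_1 mat"
  assumes "A \<in> carrier_mat m k" "v \<in> carrier_vec k"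
  shows "A *\<^sub>v (a \<cdot>\<^sub>v v) = a \<cdot>\<^sub>v (A *\<^sub>v v)"
  using assms by (intro eq_vecI) (auto simp: scalar_prod_def sum_distrib_left mult_ac)

context behaviour
begin

interpretation F: Module.module class_ring "dist_module\<lparr>carrier := F\<rparr>" by (rule mod)

text \<open>The linear relation \<open>G\<close> is itself the test module to which injectivity is applied, embedded by
  its first projection.\<close>

lemma extend_linear_relation:
  assumes inj: "injective_module class_ring (dist_module\<lparr>carrier := F\<rparr>)"
    and G: "G \<subseteq> carrier_vec k \<times> F" "(0\<^sub>v k, \<lambda>\<phi>. 0) \<in> G"
      "\<And>v S w T. (v, S) \<in> G \<Longrightarrow> (w, T) \<in> G \<Longrightarrow> (v + w, \<lambda>\<phi>. S \<phi> + T \<phi>) \<in> G"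
      "\<And>a v S. (v, S) \<in> G \<Longrightarrow> (a \<cdot>\<^sub>v v, dist_apply a S) \<in> G"
    and single: "\<And>T. (0\<^sub>v k, T) \<in> G \<Longrightarrow> T = (\<lambda>\<phi>. 0)"
  obtains g where "\<And>i. i < k \<Longrightarrow> g i \<in> F" "\<And>v T. (v, T) \<in> G \<Longrightarrow> T = act k v g"
proof -
  define X :: "('n mpoly, 'n mpoly Matrix.vec \<times> 'n functional) module" where
    "X = \<lparr>carrier = G, mult = undefined, one = undefined, zero = (0\<^sub>v k, \<lambda>\<phi>. 0),
      add = (\<lambda>(v, S) (w, T). (v + w, \<lambda>\<phi>. S \<phi> + T \<phi>)), smult = (\<lambda>a (v, S). (a \<cdot>\<^sub>v v, dist_apply a S))\<rparr>"
  let ?V = "module_vec TYPE('n mpoly) k" and ?F = "dist_module\<lparr>carrier := F\<rparr>"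
  have GF: "v \<in> carrier_vec k" "S \<in> F" if "(v, S) \<in> G" for v S using G(1) that by auto
  have neg: "(- v, \<lambda>\<phi>. - S \<phi>) \<in> G" if "(v, S) \<in> G" for v S
  proof -
    have "dist_apply (- 1) S = (\<lambda>\<phi>. - S \<phi>)"
    proof
      fix \<phi>
      have "dist_apply (- 1 + 1) S \<phi> = dist_apply (- 1) S \<phi> + S \<phi>"
        using apply_add_left[OF GF(2)[OF that], of "- 1" 1] apply_one[OF GF(2)[OF that]] by simp
      then show "dist_apply (- 1) S \<phi> = - S \<phi>" by (simp add: eq_neg_iff_add_eq_0)
    qed
    moreover have "(- 1) \<cdot>\<^sub>v v = - v" by (intro eq_vecI) auto
    ultimately show ?thesis using G(4)[OF that, of "- 1"] by simp
  qed
  have cr: "cring (class_ring :: 'n mpoly ring)" by (rule Module.module.axioms(1)[OF mod])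
  have "abelian_group X"
  proof (rule abelian_groupI)
    fix x assume "x \<in> carrier X"
    then obtain v S where x: "x = (v, S)" "(v, S) \<in> G" by (cases x) (auto simp: X_def)
    then show "\<exists>y\<in>carrier X. y \<oplus>\<^bsub>X\<^esub> x = \<zero>\<^bsub>X\<^esub>"
      using neg[OF x(2)] GF[OF x(2)] by (intro bexI[of _ "(- v, \<lambda>\<phi>. - S \<phi>)"]) (auto simp: X_def)
  next
    fix x y z assume "x \<in> carrier X" "y \<in> carrier X" "z \<in> carrier X"
    then show "x \<oplus>\<^bsub>X\<^esub> y \<oplus>\<^bsub>X\<^esub> z = x \<oplus>\<^bsub>X\<^esub> (y \<oplus>\<^bsub>X\<^esub> z)"
      by (auto simp: X_def add.assoc split: prod.splits intro!: assoc_add_vec[of _ k] dest: GF(1))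
  next
    fix x y assume "x \<in> carrier X" "y \<in> carrier X"
    then show "x \<oplus>\<^bsub>X\<^esub> y = y \<oplus>\<^bsub>X\<^esub> x"
      by (auto simp: X_def add.commute split: prod.splits intro!: comm_add_vec[of _ k] dest: GF(1))
  qed (use G(2,3) GF in \<open>auto simp: X_def\<close>)
  then have X: "Module.module class_ring X"
  proof (rule moduleI[OF cr])
    fix a b :: "'n mpoly" and x assume "x \<in> carrier X"
    then obtain v S where x: "x = (v, S)" "(v, S) \<in> G" by (cases x) (auto simp: X_def)
    note vS = GF[OF x(2)]
    show "a \<odot>\<^bsub>X\<^esub> x \<in> carrier X" using x G(4) by (simp add: X_def)
    show "(a \<oplus>\<^bsub>class_ring\<^esub> b) \<odot>\<^bsub>X\<^esub> x = a \<odot>\<^bsub>X\<^esub> x \<oplus>\<^bsub>X\<^esub> b \<odot>\<^bsub>X\<^esub> x"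
      using vS by (simp add: X_def x class_ring_simps apply_add_left add_smult_distrib_vec)
    show "(a \<otimes>\<^bsub>class_ring\<^esub> b) \<odot>\<^bsub>X\<^esub> x = a \<odot>\<^bsub>X\<^esub> (b \<odot>\<^bsub>X\<^esub> x)"
      using vS by (simp add: X_def x class_ring_simps apply_mult smult_smult_assoc)
    show "\<one>\<^bsub>class_ring\<^esub> \<odot>\<^bsub>X\<^esub> x = x"
      using vS by (simp add: X_def x class_ring_simps apply_one)
    fix y assume "y \<in> carrier X"
    then obtain w T where y: "y = (w, T)" "(w, T) \<in> G" by (cases y) (auto simp: X_def)
    show "a \<odot>\<^bsub>X\<^esub> (x \<oplus>\<^bsub>X\<^esub> y) = a \<odot>\<^bsub>X\<^esub> x \<oplus>\<^bsub>X\<^esub> a \<odot>\<^bsub>X\<^esub> y"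
      using vS GF[OF y(2)] by (simp add: X_def x y apply_add_right smult_add_distrib_vec)
  qed
  have fst: "fst \<in> module_hom class_ring X ?V"
    by (rule module_homI) (auto simp: X_def module_vec_simps GF split: prod.splits)
  have snd: "snd \<in> module_hom class_ring X ?F"
    by (rule module_homI) (auto simp: X_def dist_module_def GF split: prod.splits)
  have inj_fst: "inj_on fst (carrier X)"
  proof (rule inj_onI)
    fix x y assume xy: "x \<in> carrier X" "y \<in> carrier X" "fst x = fst y"
    obtain v S T where e: "x = (v, S)" "y = (v, T)" using xy(3) by (cases x, cases y) auto
    have m: "(v, S) \<in> G" "(v, T) \<in> G" using xy e by (auto simp: X_def)
    have "(v + - v, \<lambda>\<phi>. S \<phi> + - T \<phi>) \<in> G" by (rule G(3)[OF m(1) neg[OF m(2)]])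
    then have "(\<lambda>\<phi>. S \<phi> + - T \<phi>) = (\<lambda>\<phi>. 0)" using single GF(1)[OF m(1)] by simp
    then have "S \<phi> = T \<phi>" for \<phi> by (metis add.right_inverse add_right_cancel)
    then show "x = y" using e by auto
  qed
  obtain h where h: "h \<in> module_hom class_ring ?V ?F" and ext: "\<And>x. x \<in> carrier X \<Longrightarrow> h (fst x) = snd x"
    using injective_module_extend[OF inj X module_class_vec fst inj_fst snd] by blast
  have h_closed: "h v \<in> F" if "v \<in> carrier_vec k" for v
    using module_homD(1)[OF h, of v] that by (simp add: module_vec_simps dist_module_def)
  have h_add: "h (v + w) = (\<lambda>\<phi>. h v \<phi> + h w \<phi>)" if "v \<in> carrier_vec k" "w \<in> carrier_vec k" for v w
    using module_homD(2)[OF h, of v w] that by (simp add: module_vec_simps dist_module_def)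
  have h_smult: "h (a \<cdot>\<^sub>v v) = dist_apply a (h v)" if "v \<in> carrier_vec k" for a v
    using module_homD(3)[OF h, of a v] that by (simp add: module_vec_simps dist_module_def class_ring_simps)
  have h0: "h (0\<^sub>v k) = (\<lambda>\<phi>. 0)" using ext[of "(0\<^sub>v k, \<lambda>\<phi>. 0)"] G(2) by (simp add: X_def)
  define g where "g i = h (unit_vec k i)" for i
  have part: "h (vec k (\<lambda>j. if j < m then vec_index v j else 0)) = (\<lambda>\<phi>. \<Sum>i<m. dist_apply (vec_index v i) (g i) \<phi>)"
    if "m \<le> k" for m v
    using that
  proof (induction m)
    case 0
    have "vec k (\<lambda>j. 0) = (0\<^sub>v k :: 'n mpoly Matrix.vec)" by (intro eq_vecI) auto
    then show ?case using h0 by simp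
  next
    case (Suc m)
    have "vec k (\<lambda>j. if j < Suc m then vec_index v j else 0) =
        vec k (\<lambda>j. if j < m then vec_index v j else 0) + vec_index v m \<cdot>\<^sub>v unit_vec k m"
      using Suc.prems by (intro eq_vecI) (auto simp: less_Suc_eq)
    then show ?case using Suc by (simp add: h_add h_smult g_def)
  qed
  have full: "h v = act k v g" if "v \<in> carrier_vec k" for v
  proof -
    have "vec k (\<lambda>j. if j < k then vec_index v j else 0) = v" using that by (intro eq_vecI) auto
    then show ?thesis using part[of k v] by (simp add: act_def)
  qed
  show ?thesis
  proof (rule that[of g])
    show "g i \<in> F" if "i < k" for i unfolding g_def by (rule h_closed) simp
    fix v T assume "(v, T) \<in> G"
    then show "T = act k v g" using ext[of "(v, T)"] full GF(1) by (simp add: X_def)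
  qed
qed

text \<open>Sending \<open>R v\<close> to \<open>v(D) f\<close> is well defined, since
  \<open>R v = 0\<close> places \<open>v\<close> in \<open>P\<close>, which annihilates
  \<open>f\<close>. Its extension to all vectors is given by some \<open>g\<close>, and
  \<open>f\<close> is the image of \<open>g\<close> under the transpose of
  \<open>R(D)\<close>.\<close>

lemma image_representation:
  assumes inj: "injective_module class_ring (dist_module\<lparr>carrier := F\<rparr>)"
    and R: "R \<in> carrier_mat k k" "\<And>v. v \<in> carrier_vec k \<Longrightarrow> v \<in> P \<longleftrightarrow> R *\<^sub>v v = 0\<^sub>v k"
    and f: "f \<in> Ker F k P"
  shows "\<exists>g. (\<forall>i<k. g i \<in> F) \<and> (\<forall>v\<in>carrier_vec k. act k v (vec_index f) = act k (R *\<^sub>v v) g)"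
proof -
  have fF: "\<And>j. j < k \<Longrightarrow> vec_index f j \<in> F" and fP: "\<And>p. p \<in> P \<Longrightarrow> act k p (vec_index f) = (\<lambda>\<phi>. 0)"
    using f by (auto simp: Ker_iff)
  define G where "G = (\<lambda>v. (R *\<^sub>v v, act k v (vec_index f))) ` carrier_vec k"
  obtain g where g: "\<And>i. i < k \<Longrightarrow> g i \<in> F" "\<And>v T. (v, T) \<in> G \<Longrightarrow> T = act k v g"
  proof (rule extend_linear_relation[OF inj, of G k])
    show "G \<subseteq> carrier_vec k \<times> F" unfolding G_def using R(1) act_closed[OF fF] by auto
    have "R *\<^sub>v 0\<^sub>v k = 0\<^sub>v k" using R(1) by (intro eq_vecI) auto
    then show "(0\<^sub>v k, \<lambda>\<phi>. 0) \<in> G" unfolding G_def using act_zero[of k "vec_index f"] by (intro image_eqI[of _ _ "0\<^sub>v k"]) auto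
  next
    fix v S w T assume "(v, S) \<in> G" "(w, T) \<in> G"
    then obtain x y where "x \<in> carrier_vec k" "y \<in> carrier_vec k" "v = R *\<^sub>v x" "w = R *\<^sub>v y"
      "S = act k x (vec_index f)" "T = act k y (vec_index f)" by (auto simp: G_def)
    then show "(v + w, \<lambda>\<phi>. S \<phi> + T \<phi>) \<in> G" unfolding G_def
      by (intro image_eqI[of _ _ "x + y"]) (auto simp: act_add[OF fF] mult_add_distrib_mat_vec[OF R(1)])
  next
    fix a v S assume "(v, S) \<in> G"
    then obtain x where "x \<in> carrier_vec k" "v = R *\<^sub>v x" "S = act k x (vec_index f)" by (auto simp: G_def)
    then show "(a \<cdot>\<^sub>v v, dist_apply a S) \<in> G" unfolding G_def
      by (intro image_eqI[of _ _ "a \<cdot>\<^sub>v x"]) (auto simp: act_smult[OF fF] mult_mat_vec_smult[OF R(1)])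
  next
    fix T assume "(0\<^sub>v k, T) \<in> G"
    then obtain x where x: "x \<in> carrier_vec k" "R *\<^sub>v x = 0\<^sub>v k" "T = act k x (vec_index f)" by (auto simp: G_def)
    then show "T = (\<lambda>\<phi>. 0)" using fP R(2) by blast
  qed blast
  have "act k v (vec_index f) = act k (R *\<^sub>v v) g" if "v \<in> carrier_vec k" for v
    using that by (intro g(2)) (auto simp: G_def)
  then show ?thesis using g(1) by (intro exI[of _ g]) simp
qed

theorem controllable_if_kernel:
  assumes inj: "injective_module class_ring (dist_module\<lparr>carrier := F\<rparr>)"
    and P: "P \<subseteq> carrier_vec k"
    and R: "R \<in> carrier_mat k k" "\<And>v. v \<in> carrier_vec k \<Longrightarrow> v \<in> P \<longleftrightarrow> R *\<^sub>v v = 0\<^sub>v k"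
  shows "controllable F k P"
  unfolding controllable_def
proof (intro allI impI ballI)
  fix U1 U2 f1 f2 assume adm: "admissible F U1 U2" and f: "f1 \<in> Ker F k P" "f2 \<in> Ker F k P"
  from image_representation[OF inj R f(1)]
  obtain g1 where g1: "(\<forall>i<k. g1 i \<in> F) \<and> (\<forall>v\<in>carrier_vec k. act k v (vec_index f1) = act k (R *\<^sub>v v) g1)" ..
  from image_representation[OF inj R f(2)]
  obtain g2 where g2: "(\<forall>i<k. g2 i \<in> F) \<and> (\<forall>v\<in>carrier_vec k. act k v (vec_index f2) = act k (R *\<^sub>v v) g2)" ..
  have "\<forall>i. \<exists>h. i < k \<longrightarrow> h \<in> F \<and> eq_near U1 h (g1 i) \<and> eq_near U2 h (g2 i)"
    using adm g1 g2 unfolding admissible_def by blast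
  from choice[OF this] obtain g where g: "\<And>i. i < k \<Longrightarrow> g i \<in> F \<and> eq_near U1 (g i) (g1 i) \<and> eq_near U2 (g i) (g2 i)"
    by blast
  have gF: "\<And>i. i < k \<Longrightarrow> g i \<in> F" using g by blast
  \<comment> \<open>The transpose of \<open>R(D)\<close> applied to the patched \<open>g\<close>;
    every \<open>p\<close> in \<open>P\<close> annihilates it because
    \<open>R p = 0\<close>.\<close>
  define f where "f = vec k (\<lambda>j. act k (R *\<^sub>v unit_vec k j) g)"
  have fF: "\<And>j. j < k \<Longrightarrow> vec_index f j \<in> F" unfolding f_def by (simp add: act_closed[OF gF])
  have f_act: "act k v (vec_index f) = act k (R *\<^sub>v v) g" if v: "v \<in> carrier_vec k" for v
  proof -
    have part: "act m v (vec_index f) = act k (R *\<^sub>v vec k (\<lambda>j. if j < m then vec_index v j else 0)) g" if "m \<le> k" for m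
      using that
    proof (induction m)
      case 0
      have "R *\<^sub>v vec k (\<lambda>j. 0) = 0\<^sub>v k" using R(1) by (intro eq_vecI) (auto simp: scalar_prod_def)
      then show ?case by (simp add: act_zero) (simp add: act_def)
    next
      case (Suc m)
      have e: "vec k (\<lambda>j. if j < Suc m then vec_index v j else 0) =
          vec k (\<lambda>j. if j < m then vec_index v j else 0) + vec_index v m \<cdot>\<^sub>v unit_vec k m"
        using Suc.prems by (intro eq_vecI) (auto simp: less_Suc_eq)
      have "act k (R *\<^sub>v vec k (\<lambda>j. if j < Suc m then vec_index v j else 0)) g =
          (\<lambda>\<phi>. act k (R *\<^sub>v vec k (\<lambda>j. if j < m then vec_index v j else 0)) g \<phi> +
            dist_apply (vec_index v m) (act k (R *\<^sub>v unit_vec k m) g) \<phi>)"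
        using R(1) unfolding e
        by (simp add: mult_add_distrib_mat_vec[OF R(1)] mult_mat_vec_smult[OF R(1)] act_add[OF gF] act_smult[OF gF])
      moreover have "act (Suc m) v (vec_index f) =
          (\<lambda>\<phi>. act m v (vec_index f) \<phi> + dist_apply (vec_index v m) (vec_index f m) \<phi>)"
        by (simp add: act_def)
      moreover have "vec_index f m = act k (R *\<^sub>v unit_vec k m) g" using Suc.prems by (simp add: f_def)
      ultimately show ?case using Suc by simp
    qed
    have "vec k (\<lambda>j. if j < k then vec_index v j else 0) = v" using v by (intro eq_vecI) auto
    then show ?thesis using part[OF order_refl] by (simp only:)
  qed
  have "f \<in> Ker F k P"
    unfolding Ker_iff
  proof (intro conjI allI impI ballI)
    show "f \<in> carrier_vec k" by (simp add: f_def)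
    fix p assume "p \<in> P"
    then show "act k p (vec_index f) = (\<lambda>\<phi>. 0)" using f_act[of p] R(2)[of p] P act_zero by auto
  qed (rule fF)
  moreover have "eq_near_vec U f f'"
    if near: "\<And>i. i < k \<Longrightarrow> eq_near U (g i) (g' i)" and f': "f' \<in> Ker F k P"
      and g': "\<And>v. v \<in> carrier_vec k \<Longrightarrow> act k v (vec_index f') = act k (R *\<^sub>v v) g'" for U f' g'
  proof -
    have "\<forall>i. \<exists>W. i < k \<longrightarrow> open W \<and> U \<subseteq> W \<and> agree_on W (g i) (g' i)"
      using near unfolding eq_near_iff by blast
    from choice[OF this] obtain W where W: "\<And>i. i < k \<Longrightarrow> open (W i) \<and> U \<subseteq> W i \<and> agree_on (W i) (g i) (g' i)" by blast
    have f'F: "\<And>j. j < k \<Longrightarrow> vec_index f' j \<in> F" and f'c: "f' \<in> carrier_vec k" using f' by (auto simp: Ker_iff)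
    \<comment> \<open>\<open>eq_near_vec\<close> asks for one neighbourhood for all components; a
      finite intersection is still open.\<close>
    let ?W = "\<Inter>i\<in>{..<k}. W i"
    have ag: "agree_on ?W (g i) (g' i)" if "i < k" for i
    proof (rule agree_on_subset)
      show "agree_on (W i) (g i) (g' i)" using W[OF that] by blast
      show "?W \<subseteq> W i" using that by blast
    qed
    have "agree_on ?W (vec_index f j) (vec_index f' j)" if j: "j < k" for j
    proof -
      have "vec_index f' j = act k (R *\<^sub>v unit_vec k j) g'"
        using act_unit[OF f'F j] g'[OF unit_vec_carrier[of k j]] by (simp only:)
      moreover have "vec_index f j = act k (R *\<^sub>v unit_vec k j) g" using j by (simp add: f_def)
      moreover have "agree_on ?W (act k (R *\<^sub>v unit_vec k j) g) (act k (R *\<^sub>v unit_vec k j) g')"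
        by (rule act_agree_on[OF ag])
      ultimately show ?thesis by (simp only:)
    qed
    moreover have "open ?W" using W by (intro open_INT) auto
    moreover have "U \<subseteq> ?W" using W by auto
    moreover have "dim_vec f = k" "dim_vec f' = k" using f'c by (auto simp: f_def)
    ultimately show ?thesis unfolding eq_near_vec_iff by (intro exI[of _ ?W]) simp
  qed
  ultimately show "\<exists>f\<in>Ker F k P. eq_near_vec U1 f f1 \<and> eq_near_vec U2 f f2"
    using g f g1 g2 by blast
qed

text \<open>The test module is the field of complex numbers with \<open>p\<close> acting as its
  value at \<open>z\<close>; a nonzero homomorphism from it into \<open>F\<close> hits a joint
  eigenvector of all operators.\<close>

lemma exponential_in_cogenerator:
  assumes cogen: "injective_cogenerator class_ring (dist_module\<lparr>carrier := F\<rparr>)"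
  obtains u where "u \<in> F" "u \<noteq> (\<lambda>\<phi>. 0)" "\<And>p. dist_apply p u = (\<lambda>\<phi>. peval p z * u \<phi>)"
proof -
  define X :: "('n mpoly, complex) module" where
    "X = \<lparr>carrier = UNIV, mult = undefined, one = undefined, zero = 0, add = (+), smult = (\<lambda>p c. peval p z * c)\<rparr>"
  have cr: "cring (class_ring :: 'n mpoly ring)" by (rule Module.module.axioms(1)[OF mod])
  have "abelian_group X"
  proof (rule abelian_groupI)
    fix x show "\<exists>y\<in>carrier X. y \<oplus>\<^bsub>X\<^esub> x = \<zero>\<^bsub>X\<^esub>" by (intro bexI[of _ "- x"]) (auto simp: X_def)
  qed (auto simp: X_def)
  then have X: "Module.module class_ring X"
    by (rule moduleI[OF cr]) (auto simp: X_def class_ring_simps peval.hom_add peval.hom_mult algebra_simps)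
  have "carrier X \<noteq> {\<zero>\<^bsub>X\<^esub>}"
  proof
    assume "carrier X = {\<zero>\<^bsub>X\<^esub>}"
    then have "(1 :: complex) \<in> {0}" by (simp add: X_def)
    then show False by simp
  qed
  from injective_cogenerator_hom[OF cogen X this] obtain \<theta> c where
    \<theta>: "\<theta> \<in> module_hom class_ring X (dist_module\<lparr>carrier := F\<rparr>)" and c: "\<theta> c \<noteq> (\<lambda>\<phi>. 0)"
    by (auto simp: dist_module_def)
  have u: "\<theta> c \<in> F" using module_homD(1)[OF \<theta>, of c] by (simp add: X_def dist_module_def)
  have D: "dist_apply p (\<theta> c) = \<theta> (peval p z * c)" for p
    using module_homD(3)[OF \<theta>, of p c] by (simp add: X_def dist_module_def class_ring_simps)
  \<comment> \<open>On the test module \<open>p\<close> acts as the constant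
    \<open>peval p z\<close>, and constants act on distributions by scaling.\<close>
  have "dist_apply p (\<theta> c) = (\<lambda>\<phi>. peval p z * \<theta> c \<phi>)" for p
    using D[of p] D[of "PC (peval p z)"] by (simp add: peval_PC dist_apply_PC)
  then show ?thesis using that u c by blast
qed

theorem saturated_if_controllable:
  assumes cogen: "injective_cogenerator class_ring (dist_module\<lparr>carrier := F\<rparr>)"
    and cutoff: "cutoff_assumption F" and contr: "controllable F k P"
    and P: "Module.submodule P class_ring (module_vec TYPE('n mpoly) k)"
    and a: "a \<noteq> 0" and v: "v \<in> carrier_vec k" and av: "a \<cdot>\<^sub>v v \<in> P"
  shows "v \<in> P"
proof (rule ccontr)
  assume "v \<notin> P"
  note Pc = submodule_closed[OF P]
  have inj: "injective_module class_ring (dist_module\<lparr>carrier := F\<rparr>)"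
    using cogen by (simp add: injective_cogenerator_def)
  \<comment> \<open>The annihilator of the class of \<open>v\<close>, proper because
    \<open>v\<close> is not in \<open>P\<close>. A common zero \<open>z\<close> of it makes the
    relation \<open>G\<close> single-valued: every \<open>b\<close> in \<open>J\<close> annihilates
    the exponential \<open>u\<close>.\<close>
  define J where "J = {b. b \<cdot>\<^sub>v v \<in> P}"
  have J: "cideal J"
  proof (rule cidealI)
    have "0 \<cdot>\<^sub>v v = 0\<^sub>v k" using v by (intro eq_vecI) auto
    then show "0 \<in> J" using Pc(2) by (simp add: J_def)
    show "b + c \<in> J" if "b \<in> J" "c \<in> J" for b c
      using that Pc(3) by (simp add: J_def add_smult_distrib_vec)
    show "r * b \<in> J" if "b \<in> J" for r b
      using that Pc(4)[of "b \<cdot>\<^sub>v v" r] by (simp add: J_def smult_smult_assoc)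
  qed
  have "J \<inter> {1} = {}" using \<open>v \<notin> P\<close> by (simp add: J_def)
  then obtain Q where Q: "cprime Q" "J \<subseteq> Q"
    by (rule krull_maximal_avoiding[OF J, of "{1}", rotated 2]) auto
  obtain z where z: "\<And>p. p \<in> Q \<Longrightarrow> peval p z = 0"
    by (rule nullstellensatz[OF Q(1) cprime_one[OF Q(1)]]) blast
  obtain u where u: "u \<in> F" "u \<noteq> (\<lambda>\<phi>. 0)" "\<And>p. dist_apply p u = (\<lambda>\<phi>. peval p z * u \<phi>)"
    by (rule exponential_in_cogenerator[OF cogen]) blast
  \<comment> \<open>The graph of the homomorphism on \<open>P + A v\<close> that sends
    \<open>P\<close> to \<open>0\<close> and \<open>v\<close> to \<open>u\<close>; its extension is
    a trajectory \<open>f\<close> with \<open>v(D) f = u\<close>.\<close>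
  define G where "G = {(p + b \<cdot>\<^sub>v v, dist_apply b u) | p b. p \<in> P}"
  obtain f where f: "\<And>i. i < k \<Longrightarrow> f i \<in> F" "\<And>w T. (w, T) \<in> G \<Longrightarrow> T = act k w f"
  proof (rule extend_linear_relation[OF inj, of G k])
    show "G \<subseteq> carrier_vec k \<times> F" unfolding G_def using Pc(1) v F_apply[OF u(1)] by auto
    have "0\<^sub>v k = 0\<^sub>v k + 0 \<cdot>\<^sub>v v" using v by (intro eq_vecI) auto
    then show "(0\<^sub>v k, \<lambda>\<phi>. 0) \<in> G" unfolding G_def using Pc(2) apply_0_left[of u] by (metis (mono_tags, lifting) mem_Collect_eq)
  next
    fix x S y T assume "(x, S) \<in> G" "(y, T) \<in> G"
    then obtain p b q c where e: "p \<in> P" "q \<in> P" "x = p + b \<cdot>\<^sub>v v" "y = q + c \<cdot>\<^sub>v v"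
      "S = dist_apply b u" "T = dist_apply c u" by (auto simp: G_def)
    have "x + y = (p + q) + (b + c) \<cdot>\<^sub>v v" using e Pc(1) v by (intro eq_vecI) (auto simp: algebra_simps)
    then show "(x + y, \<lambda>\<phi>. S \<phi> + T \<phi>) \<in> G"
      using Pc(3)[OF e(1,2)] apply_add_left[OF u(1), of b c] e(5,6) unfolding G_def mem_Collect_eq
      by (intro exI[of _ "p + q"] exI[of _ "b + c"]) simp
  next
    fix c x S assume "(x, S) \<in> G"
    then obtain p b where e: "p \<in> P" "x = p + b \<cdot>\<^sub>v v" "S = dist_apply b u" by (auto simp: G_def)
    have "c \<cdot>\<^sub>v x = (c \<cdot>\<^sub>v p) + (c * b) \<cdot>\<^sub>v v" using e Pc(1) v by (intro eq_vecI) (auto simp: algebra_simps)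
    then show "(c \<cdot>\<^sub>v x, dist_apply c S) \<in> G"
      using Pc(4)[OF e(1), of c] apply_mult[OF u(1), of c b] e(3) unfolding G_def mem_Collect_eq
      by (intro exI[of _ "c \<cdot>\<^sub>v p"] exI[of _ "c * b"]) simp
  next
    fix T assume "(0\<^sub>v k, T) \<in> G"
    then obtain p b where e: "p \<in> P" "p + b \<cdot>\<^sub>v v = 0\<^sub>v k" "T = dist_apply b u" by (auto simp: G_def)
    have "b \<cdot>\<^sub>v v = (- 1) \<cdot>\<^sub>v p"
    proof (intro eq_vecI)
      fix i assume "i < dim_vec ((- 1) \<cdot>\<^sub>v p)"
      then have "i < k" using e(1) Pc(1) by auto
      then have "vec_index (p + b \<cdot>\<^sub>v v) i = 0" using e(2) by simp
      then show "vec_index (b \<cdot>\<^sub>v v) i = vec_index ((- 1) \<cdot>\<^sub>v p) i"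
        using \<open>i < k\<close> v e(1) Pc(1) by (auto simp: eq_neg_iff_add_eq_0 add.commute)
    qed (use v e(1) Pc(1) in auto)
    then have "b \<in> J" using Pc(4)[OF e(1), of "- 1"] by (simp add: J_def)
    then have "peval b z = 0" using z Q(2) by blast
    then show "T = (\<lambda>\<phi>. 0)" using e(3) u(3)[of b] by simp
  qed blast
  define f1 where "f1 = vec k f"
  have act_f1: "act k w (vec_index f1) = act k w f" for w by (simp add: act_def f1_def)
  have "f1 \<in> Ker F k P"
    unfolding Ker_iff
  proof (intro conjI allI impI ballI)
    fix p assume p: "p \<in> P"
    have "p = p + 0 \<cdot>\<^sub>v v" using p Pc(1) v by (intro eq_vecI) auto
    then have "(p, dist_apply 0 u) \<in> G" using p unfolding G_def by blast
    then show "act k p (vec_index f1) = (\<lambda>\<phi>. 0)" using f(2) by (simp add: act_f1)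
  qed (auto simp: f1_def f(1))
  moreover define f0 where "f0 = vec k (\<lambda>j. (\<lambda>\<phi> :: real ^ 'n \<Rightarrow> complex. 0 :: complex))"
  have f0: "f0 \<in> Ker F k P" by (auto simp: Ker_iff f0_def F_zero act_def)
  \<comment> \<open>The unit ball plays the bounded set \<open>V\<close>; controllability then joins
    \<open>f1\<close> near \<open>U\<close> to the zero trajectory outside the ball.\<close>
  have "bounded (ball (0 :: real ^ 'n) 1)" "interior (ball (0 :: real ^ 'n) 1) \<noteq> {}" by auto
  then obtain U where U: "U \<noteq> {}" "admissible F U (- ball 0 1)" using cutoff unfolding cutoff_assumption_def by blast
  ultimately obtain f' where f': "f' \<in> Ker F k P" "eq_near_vec U f' f1" "eq_near_vec (- ball 0 1) f' f0"
    using contr f0 unfolding controllable_def by blast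
  have f'F: "\<And>j. j < k \<Longrightarrow> vec_index f' j \<in> F" and f'k: "dim_vec f' = k" and f'P: "\<And>p. p \<in> P \<Longrightarrow> act k p (vec_index f') = (\<lambda>\<phi>. 0)"
    using f'(1) by (auto simp: Ker_iff)
  \<comment> \<open>It satisfies \<open>a(D) w = 0\<close> because \<open>a v\<close> lies in
    \<open>P\<close>, vanishes near the complement of the ball by locality, and equals
    \<open>u\<close> near \<open>U\<close>.\<close>
  define w where "w = act k v (vec_index f')"
  have wF: "w \<in> F" unfolding w_def by (rule act_closed[OF f'F])
  obtain W2 where W2: "- ball 0 1 \<subseteq> W2" "\<And>j. j < k \<Longrightarrow> agree_on W2 (vec_index f' j) (vec_index f0 j)"
    using f'(3) f'k unfolding eq_near_vec_iff by auto
  have "agree_on W2 w (act k v (vec_index f0))" unfolding w_def by (rule act_agree_on[OF W2(2)])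
  moreover have "act k v (vec_index f0) = (\<lambda>\<phi>. 0)" by (simp add: act_def f0_def)
  ultimately have w0: "vanishes_on W2 w" by (simp add: vanishes_on_def agree_on_def)
  have "dist_apply a w = (\<lambda>\<phi>. 0)"
    using f'P[OF av] act_smult[OF f'F v, where a = a] by (simp add: w_def)
  then have w_zero: "w \<phi> = 0" if "\<phi> \<in> test_functions" for \<phi>
    using compactly_supported_solution_zero[OF subsetD[OF sub wF] _ W2(1) w0 a _ that] by simp
  obtain W1 where W1: "open W1" "U \<subseteq> W1" "\<And>j. j < k \<Longrightarrow> agree_on W1 (vec_index f' j) (vec_index f1 j)"
    using f'(2) f'k unfolding eq_near_vec_iff by auto
  have "agree_on W1 w (act k v (vec_index f1))" unfolding w_def by (rule act_agree_on[OF W1(3)])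
  moreover have "act k v (vec_index f1) = u"
  proof -
    have "v = 0\<^sub>v k + 1 \<cdot>\<^sub>v v" using v by (intro eq_vecI) auto
    then have "(v, dist_apply 1 u) \<in> G" using Pc(2) unfolding G_def by blast
    then show ?thesis using f(2) apply_one[OF u(1)] by (simp add: act_f1)
  qed
  ultimately have u0: "vanishes_on W1 u" using w_zero by (simp add: vanishes_on_def agree_on_def)
  obtain x where x: "x \<in> W1" using U(1) W1(2) by blast
  have ud: "u \<in> distributions" using u(1) sub by blast
  have zu: "dist_D j u \<phi> = vec_nth z j * u \<phi>" for j \<phi>
    using u(3)[of "PX j"] by (simp add: dist_apply_PX peval_PX)
  have "u \<phi> = 0" for \<phi>
  proof (cases "\<phi> \<in> test_functions")
    case True
    show ?thesis by (rule exponential_vanishing_on_open[OF ud zu W1(1) x u0 True])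
  qed (rule distribution_outside[OF ud])
  then show False using u(2) by auto
qed

end

section \<open>Saturation as the link between rank, dimension and controllability\<close>

lemma behaviourI:
  assumes "Module.submodule F class_ring dist_module" "injective_module class_ring (dist_module\<lparr>carrier := F\<rparr>)"
  shows "behaviour F"
proof (rule behaviour.intro)
  have "subgroup F (add_monoid (dist_module :: ('a mpoly, 'a functional) module))"
    using assms(1) by (simp add: Module.submodule_def)
  from subgroup.subset[OF this] show "F \<subseteq> distributions" by (simp add: dist_module_def)
  show "Module.module class_ring (dist_module\<lparr>carrier := F\<rparr>)" using assms(2) by (simp add: injective_module_def)
qed

theorem theorem3p2:
  fixes P :: "'n::finite mpoly Matrix.vec set" and PD :: "'n mpoly mat" and k l :: nat
  assumes P: "Module.submodule P class_ring (module_vec TYPE('n mpoly) k)"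
    and l: "l = min_generators class_ring (module_vec TYPE('n mpoly) k) P"
    and PD: "PD \<in> carrier_mat l k"
    and PD_generates:
      "LinearCombinations.module.span class_ring (module_vec TYPE('n mpoly) k) (set (rows PD)) = P"
    and nonzero: "cancellation_ideal PD \<noteq> {0}"
  shows "l \<le> k \<and>
    (torsion_free class_ring (quotient_module class_ring (module_vec TYPE('n mpoly) k) P) \<longleftrightarrow>
      (\<exists>V :: (complex ^ 'n) set. algebraic_variety V \<and> variety_dim V \<le> ereal (real CARD('n) - 2) \<and>
        (\<forall>x. x \<notin> V \<longrightarrow> full_row_rank (map_mat (\<lambda>p. peval p x) PD)))) \<and>
    (torsion_free class_ring (quotient_module class_ring (module_vec TYPE('n mpoly) k) P) \<longleftrightarrow>
      krull_dim (class_ring Quot cancellation_ideal PD) \<le> ereal (real CARD('n) - 2)) \<and>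
    (\<forall>F :: 'n functional set.
      Module.submodule F class_ring dist_module \<and> cutoff_assumption F \<longrightarrow>
      (injective_module class_ring (dist_module\<lparr>carrier := F\<rparr>) \<longrightarrow>
        variety_dim (zero_set (cancellation_ideal PD)) \<le> ereal (real CARD('n) - 2) \<longrightarrow>
        controllable F k P) \<and>
      (injective_cogenerator class_ring (dist_module\<lparr>carrier := F\<rparr>) \<longrightarrow>
        controllable F k P \<longrightarrow>
        variety_dim (zero_set (cancellation_ideal PD)) \<le> ereal (real CARD('n) - 2)))"
proof -
  interpret presentation PD l k using PD nonzero by unfold_locales
  let ?I = "cancellation_ideal PD" and ?d = "ereal (real CARD('n) - 2)"
  let ?tf = "torsion_free class_ring (quotient_module class_ring (module_vec TYPE('n mpoly) k) P)"
  have rel: "rel_module = P" by (rule rel_module_eq_span[OF P PD_generates])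
  have sat: "saturated \<longleftrightarrow> (\<forall>a v. a \<noteq> 0 \<and> v \<in> carrier_vec k \<and> a \<cdot>\<^sub>v v \<in> P \<longrightarrow> v \<in> P)"
    by (simp add: saturated_def rel)
  have dim: "variety_dim (zero_set ?I) \<le> ?d \<longleftrightarrow> saturated"
    by (simp add: variety_dim_le_iff saturated_iff)
  have tf: "?tf \<longleftrightarrow> saturated" unfolding torsion_free_quotient_iff[OF P] sat ..
  have rank: "full_row_rank (map_mat (\<lambda>p. peval p x) PD) \<longleftrightarrow> x \<notin> zero_set ?I" for x
    by (simp add: full_row_rank_iff[OF PD] zero_set_cancellation_ideal)
  have "?tf \<longleftrightarrow> (\<exists>V :: (complex ^ 'n) set. algebraic_variety V \<and> variety_dim V \<le> ?d \<and>
        (\<forall>x. x \<notin> V \<longrightarrow> full_row_rank (map_mat (\<lambda>p. peval p x) PD)))"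
  proof
    assume ?tf
    then have "variety_dim (zero_set ?I) \<le> ?d" by (simp add: dim tf)
    then show "\<exists>V :: (complex ^ 'n) set. algebraic_variety V \<and> variety_dim V \<le> ?d \<and>
        (\<forall>x. x \<notin> V \<longrightarrow> full_row_rank (map_mat (\<lambda>p. peval p x) PD))"
      by (intro exI[of _ "zero_set ?I"]) (auto simp: algebraic_variety_def rank)
  next
    assume "\<exists>V :: (complex ^ 'n) set. algebraic_variety V \<and> variety_dim V \<le> ?d \<and>
        (\<forall>x. x \<notin> V \<longrightarrow> full_row_rank (map_mat (\<lambda>p. peval p x) PD))"
    \<comment> \<open>Full rank off \<open>V\<close> says precisely that the cancellation variety
      lies in \<open>V\<close>, and dimension is monotone.\<close>
    then obtain V :: "(complex ^ 'n) set" where V: "variety_dim V \<le> ?d" "zero_set ?I \<subseteq> V" by (auto simp: rank)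
    have "variety_dim (zero_set ?I) \<le> ?d" using variety_dim_mono[OF V(2)] V(1) by (rule order_trans)
    then show ?tf by (simp add: dim tf)
  qed
  moreover have "?tf \<longleftrightarrow> krull_dim (class_ring Quot ?I) \<le> ?d"
    using krull_dim_le_iff[of ?I] by (simp add: tf saturated_iff cideal_cancellation_ideal)
  moreover have "controllable F k P"
    if F: "Module.submodule F class_ring dist_module" "injective_module class_ring (dist_module\<lparr>carrier := F\<rparr>)"
      and d: "variety_dim (zero_set ?I) \<le> ?d" for F :: "'n functional set"
  proof -
    interpret behaviour F by (rule behaviourI[OF F])
    obtain R where R: "\<And>v. v \<in> carrier_vec k \<Longrightarrow> v \<in> rel_module \<longleftrightarrow> (\<forall>i<k. (\<Sum>j<k. R i j * vec_index v j) = 0)"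
      by (rule saturated_imp_kernel) (use d dim in blast)+
    show ?thesis
    proof (rule controllable_if_kernel[OF F(2) submodule_closed(1)[OF P]])
      show "mat k k (\<lambda>(i, j). R i j) \<in> carrier_mat k k" by simp
      fix v :: "'n mpoly Matrix.vec" assume v: "v \<in> carrier_vec k"
      then have "vec_index (mat k k (\<lambda>(i, j). R i j) *\<^sub>v v) i = (\<Sum>j<k. R i j * vec_index v j)" if "i < k" for i
        using that by (auto simp: scalar_prod_def lessThan_atLeast0 intro!: sum.cong)
      then have "mat k k (\<lambda>(i, j). R i j) *\<^sub>v v = 0\<^sub>v k \<longleftrightarrow> (\<forall>i<k. (\<Sum>j<k. R i j * vec_index v j) = 0)"
        unfolding vec_eq_iff by auto
      then show "v \<in> P \<longleftrightarrow> mat k k (\<lambda>(i, j). R i j) *\<^sub>v v = 0\<^sub>v k" using R[OF v] rel by simp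
    qed
  qed
  moreover have "variety_dim (zero_set ?I) \<le> ?d"
    if F: "Module.submodule F class_ring dist_module" "cutoff_assumption F"
      and cogen: "injective_cogenerator class_ring (dist_module\<lparr>carrier := F\<rparr>)"
      and contr: "controllable F k P" for F :: "'n functional set"
  proof -
    have "injective_module class_ring (dist_module\<lparr>carrier := F\<rparr>)" using cogen by (simp add: injective_cogenerator_def)
    then interpret behaviour F by (rule behaviourI[OF F(1)])
    show ?thesis
      unfolding dim sat using saturated_if_controllable[OF cogen F(2) contr P] by blast
  qed
  ultimately show ?thesis using rows_le_cols by blast
qed

end
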